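(* The group $\widetilde{\Delta}$, the universal central extension of $\Delta$, is torsion-free, finitely presented, super-perfect, has no non-trivial finite quotients, and $H_3(\widetilde{\Delta},\mathbb{Q})$ is infinite dimensional over $\mathbb{Q}$.
   Context: The group $\Delta$ is constructed as follows. Let $A$ be either the Higman group $$\langle a,b,c,d \mid bab^{-1}=a^2,\ cbc^{-1}=b^2,\ dcd^{-1}=c^2,\ ada^{-1}=d^2\rangle$$ or, for some integer $p\ge 3$, the group $$\langle a_1,a_2,b_1,b_2 \mid a_1^{-1}a_2^{p}a_1a_2^{-p-1},\ b_1^{-1}b_2^{p}b_1b_2^{-p-1},\ a_1^{-1}[b_2,b_1^{-1}b_2b_1],\ b_1^{-1}[a_2,a_1^{-1}a_2a_1]\rangle .$$ It is known that $A$ is finitely presented, acyclic ($H_i(A,\mathbb{Z})=0$ for all $i\ge1$), has no non-trivial finite quotients, is torsion-free with a 2-dimensional classifying space $K(A,1)$, and contains a free group $F$ of rank 2; fix such an $F<A$. Let $S<F\times F$ be the kernel of a homomorphism $F\times F\to\mathbb{Z}$ whose restriction to each of the two factors is surjective (the first Stallings–Bieri group). Let $\Delta=(A\times A)\ast_S(A\times A)$ be the double of $A\times A$ along $S<F\times F<A\times A$, i.e. the amalgamated free product of two copies of $A\times A$ identified along $S$. The group $\Delta$ is perfect; $\widetilde{\Delta}$ denotes its universal central extension, which fits into a central extension $1\to H_2(\Delta,\mathbb{Z})\to\widetilde{\Delta}\to\Delta\to1$. A group $G$ is super-perfect if $H_1(G,\mathbb{Z})=H_2(G,\mathbb{Z})=0$.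 *)

theory Defs
  imports "HOL-Algebra.Elementary_Groups" "HOL-Library.Poly_Mapping" "Jordan_Normal_Form.VS_Connect"
begin

section \<open>Group presentations\<close>

text \<open>A letter \<open>(x, True)\<close> stands for the generator \<open>x\<close> and \<open>(x, False)\<close> for its inverse.\<close>

type_synonym 'x gword = "('x \<times> bool) list"

definition gwords :: "'x set \<Rightarrow> 'x gword set" where
  "gwords X = lists (X \<times> UNIV)"

definition gen :: "'x \<Rightarrow> 'x gword" where
  "gen x = [(x, True)]"

definition winv :: "'x gword \<Rightarrow> 'x gword" where
  "winv w = rev (map (\<lambda>(x, e). (x, \<not> e)) w)"

definition wpow :: "'x gword \<Rightarrow> nat \<Rightarrow> 'x gword" where
  "wpow w n = concat (replicate n w)"

definition wcomm :: "'x gword \<Rightarrow> 'x gword \<Rightarrow> 'x gword" where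
  "wcomm u v = u @ v @ winv u @ winv v"

text \<open>The relator expressing the relation \<open>u = v\<close>.\<close>

definition relator :: "'x gword \<Rightarrow> 'x gword \<Rightarrow> 'x gword" where
  "relator u v = u @ winv v"

inductive pres_eq :: "'x set \<Rightarrow> 'x gword set \<Rightarrow> 'x gword \<Rightarrow> 'x gword \<Rightarrow> bool"
  for X :: "'x set" and R :: "'x gword set" where
  refl: "w \<in> gwords X \<Longrightarrow> pres_eq X R w w"
| sym: "pres_eq X R u v \<Longrightarrow> pres_eq X R v u"
| trans: "pres_eq X R u v \<Longrightarrow> pres_eq X R v w \<Longrightarrow> pres_eq X R u w"
| cancel: "u \<in> gwords X \<Longrightarrow> v \<in> gwords X \<Longrightarrow> x \<in> X \<Longrightarrow>
    pres_eq X R (u @ [(x, e), (x, \<not> e)] @ v) (u @ v)"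
| rel: "u \<in> gwords X \<Longrightarrow> v \<in> gwords X \<Longrightarrow> r \<in> R \<Longrightarrow> r \<in> gwords X \<Longrightarrow>
    pres_eq X R (u @ r @ v) (u @ v)"

definition pres_class :: "'x set \<Rightarrow> 'x gword set \<Rightarrow> 'x gword \<Rightarrow> 'x gword set" where
  "pres_class X R w = {v. pres_eq X R w v}"

text \<open>The group \<open>\<langle>X | R\<rangle>\<close>.\<close>

definition presented_group :: "'x set \<Rightarrow> 'x gword set \<Rightarrow> 'x gword set monoid" where
  "presented_group X R =
    \<lparr>carrier = pres_class X R ` gwords X,
     monoid.mult = (\<lambda>P Q. {w. \<exists>u\<in>P. \<exists>v\<in>Q. pres_eq X R (u @ v) w}),
     one = pres_class X R []\<rparr>"

definition free_group :: "'x set \<Rightarrow> 'x gword set monoid" where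
  "free_group X = presented_group X {}"

definition finitely_presented :: "('g, 'm) monoid_scheme \<Rightarrow> bool" where
  "finitely_presented G \<longleftrightarrow>
    (\<exists>(n::nat) R. finite R \<and> R \<subseteq> gwords {..<n} \<and> G \<cong> presented_group {..<n} R)"

text \<open>The amalgamated free product of \<open>G\<close> and \<open>H\<close> along maps \<open>\<phi>: C \<rightarrow> G\<close> and \<open>\<psi>: C \<rightarrow> H\<close>: the
  generators are the elements of the two factors, and the relators are the two multiplication tables
  together with \<open>\<phi> c = \<psi> c\<close>.\<close>

definition amalgamated_product ::
    "('g, 'm) monoid_scheme \<Rightarrow> ('h, 'n) monoid_scheme \<Rightarrow> 'c set \<Rightarrow> ('c \<Rightarrow> 'g) \<Rightarrow> ('c \<Rightarrow> 'h)
      \<Rightarrow> ('g + 'h) gword set monoid" where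
  "amalgamated_product G H C \<phi> \<psi> =
    presented_group (carrier G <+> carrier H)
      ({relator (gen (Inl x) @ gen (Inl y)) (gen (Inl (x \<otimes>\<^bsub>G\<^esub> y))) | x y.
          x \<in> carrier G \<and> y \<in> carrier G}
     \<union> {relator (gen (Inr x) @ gen (Inr y)) (gen (Inr (x \<otimes>\<^bsub>H\<^esub> y))) | x y.
          x \<in> carrier H \<and> y \<in> carrier H}
     \<union> {relator (gen (Inl (\<phi> c))) (gen (Inr (\<psi> c))) | c. c \<in> C})"

definition double :: "('g, 'm) monoid_scheme \<Rightarrow> 'g set \<Rightarrow> ('g + 'g) gword set monoid" where
  "double G S = amalgamated_product G G S (\<lambda>s. s) (\<lambda>s. s)"

text \<open>The generators \<open>a, b, c, d\<close> are numbered \<open>0, 1, 2, 3\<close>.\<close>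

definition higman_group :: "nat gword set monoid" where
  "higman_group =
    (let a = gen 0; b = gen 1; c = gen 2; d = gen 3 in
     presented_group {..<4}
      {relator (b @ a @ winv b) (wpow a 2),
       relator (c @ b @ winv c) (wpow b 2),
       relator (d @ c @ winv d) (wpow c 2),
       relator (a @ d @ winv a) (wpow d 2)})"

text \<open>The generators \<open>a\<^sub>1, a\<^sub>2, b\<^sub>1, b\<^sub>2\<close> are numbered \<open>0, 1, 2, 3\<close>. The automorphism of the free group
  inverting \<open>a\<^sub>2\<close> and \<open>b\<^sub>2\<close> shows that the convention chosen for commutators does not affect the
  isomorphism type.\<close>

definition four_generator_group :: "nat \<Rightarrow> nat gword set monoid" where
  "four_generator_group p =
    (let a1 = gen 0; a2 = gen 1; b1 = gen 2; b2 = gen 3 in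
     presented_group {..<4}
      {winv a1 @ wpow a2 p @ a1 @ wpow (winv a2) (p + 1),
       winv b1 @ wpow b2 p @ b1 @ wpow (winv b2) (p + 1),
       winv a1 @ wcomm b2 (winv b1 @ b2 @ b1),
       winv b1 @ wcomm a2 (winv a1 @ a2 @ a1)})"


section \<open>Group homology with trivial coefficients\<close>

text \<open>Chains are the inhomogeneous bar complex: the degree \<open>n\<close> part is the free \<open>'r\<close>-module on the
  lists of length \<open>n\<close> over the group.\<close>

definition bar_chains :: "('g, 'm) monoid_scheme \<Rightarrow> nat \<Rightarrow> ('g list \<Rightarrow>\<^sub>0 'r::comm_ring_1) set" where
  "bar_chains G n = {c. Poly_Mapping.keys c \<subseteq> {gs \<in> lists (carrier G). length gs = n}}"

definition bar_face :: "('g, 'm) monoid_scheme \<Rightarrow> nat \<Rightarrow> 'g list \<Rightarrow> 'g list" where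
  "bar_face G i gs =
    (if i = 0 then tl gs
     else if i = length gs then butlast gs
     else take (i - 1) gs @ [gs ! (i - 1) \<otimes>\<^bsub>G\<^esub> gs ! i] @ drop (i + 1) gs)"

definition bar_boundary ::
    "('g, 'm) monoid_scheme \<Rightarrow> ('g list \<Rightarrow>\<^sub>0 'r::comm_ring_1) \<Rightarrow> ('g list \<Rightarrow>\<^sub>0 'r)" where
  "bar_boundary G c =
    (\<Sum>gs\<in>Poly_Mapping.keys c. if gs = [] then 0
       else \<Sum>i\<le>length gs.
         Poly_Mapping.single (bar_face G i gs) ((- 1) ^ i * Poly_Mapping.lookup c gs))"

definition bar_cycles :: "('g, 'm) monoid_scheme \<Rightarrow> nat \<Rightarrow> ('g list \<Rightarrow>\<^sub>0 'r::comm_ring_1) set" where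
  "bar_cycles G n = {c \<in> bar_chains G n. bar_boundary G c = 0}"

definition bar_boundaries :: "('g, 'm) monoid_scheme \<Rightarrow> nat \<Rightarrow> ('g list \<Rightarrow>\<^sub>0 'r::comm_ring_1) set" where
  "bar_boundaries G n = bar_boundary G ` bar_chains G (n + 1)"

text \<open>\<open>H\<^sub>n(G; 'r)\<close> as a module over \<open>class_ring :: 'r ring\<close>. The fields \<open>mult\<close> and \<open>one\<close> of the record
  type of modules carry no meaning. Adding the boundaries in \<open>smult\<close> is needed when \<open>r\<close> is not a
  unit, since then \<open>r\<close> times a coset need not be a full coset.\<close>

definition group_homology ::
    "('g, 'm) monoid_scheme \<Rightarrow> nat \<Rightarrow> ('r::comm_ring_1, ('g list \<Rightarrow>\<^sub>0 'r) set) module" where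
  "group_homology G n =
    \<lparr>carrier = {{z + b | b. b \<in> bar_boundaries G n} | z. z \<in> bar_cycles G n},
     monoid.mult = undefined,
     one = undefined,
     zero = bar_boundaries G n,
     add = (\<lambda>P Q. {x + y | x y. x \<in> P \<and> y \<in> Q}),
     smult = (\<lambda>r P. {Poly_Mapping.map ((*) r) x + b | x b. x \<in> P \<and> b \<in> bar_boundaries G n})\<rparr>"

definition super_perfect :: "('g, 'm) monoid_scheme \<Rightarrow> bool" where
  "super_perfect G \<longleftrightarrow>
    (\<forall>n\<in>{1, 2}. carrier (group_homology G n :: (int, _) module)
       = {\<zero>\<^bsub>(group_homology G n :: (int, _) module)\<^esub>})"


section \<open>Group properties\<close>

definition torsion_free :: "('g, 'm) monoid_scheme \<Rightarrow> bool" where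
  "torsion_free G \<longleftrightarrow>
    (\<forall>x\<in>carrier G. \<forall>n::nat. n > 0 \<longrightarrow> x [^]\<^bsub>G\<^esub> n = \<one>\<^bsub>G\<^esub> \<longrightarrow> x = \<one>\<^bsub>G\<^esub>)"

definition no_nontrivial_finite_quotients :: "('g, 'm) monoid_scheme \<Rightarrow> bool" where
  "no_nontrivial_finite_quotients G \<longleftrightarrow>
    (\<forall>N. N \<lhd> G \<longrightarrow> finite (carrier (G Mod N)) \<longrightarrow> trivial_group (G Mod N))"

definition central_extension ::
    "('e, 'm) monoid_scheme \<Rightarrow> ('q, 'n) monoid_scheme \<Rightarrow> ('e \<Rightarrow> 'q) \<Rightarrow> bool" where
  "central_extension E Q \<pi> \<longleftrightarrow> group E \<and> group Q \<and> \<pi> \<in> epi E Q \<and>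
    (\<forall>k\<in>kernel E Q \<pi>. \<forall>x\<in>carrier E. k \<otimes>\<^bsub>E\<^esub> x = x \<otimes>\<^bsub>E\<^esub> k)"

text \<open>The universal property is tested against all central extensions whose total group has its
  elements in the type \<open>'u\<close>. For countable \<open>Q\<close> every infinite \<open>'u\<close> gives the same notion: each
  countable group has a copy in \<open>'u\<close>, the universal central extension of \<open>Q\<close> is countable, and
  the central extensions with countable total group suffice to characterise it. Restriction to
  \<open>extensional (carrier E)\<close> makes uniqueness mean uniqueness on the carrier.\<close>

definition universal_central_extension ::
    "'u itself \<Rightarrow> ('e, 'm) monoid_scheme \<Rightarrow> ('q, 'n) monoid_scheme \<Rightarrow> ('e \<Rightarrow> 'q) \<Rightarrow> bool" where
  "universal_central_extension U E Q \<pi> \<longleftrightarrow> central_extension E Q \<pi> \<and>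
    (\<forall>(H :: 'u monoid) \<rho>. central_extension H Q \<rho> \<longrightarrow>
      (\<exists>!f. f \<in> hom E H \<and> f \<in> extensional (carrier E) \<and> (\<forall>x\<in>carrier E. \<rho> (f x) = \<pi> x)))"


section \<open>Presented groups are groups\<close>

lemma gwords_append: "u @ v \<in> gwords X \<longleftrightarrow> u \<in> gwords X \<and> v \<in> gwords X"
  by (auto simp: gwords_def)

lemma pres_eq_gwords: "pres_eq X R u v \<Longrightarrow> u \<in> gwords X \<and> v \<in> gwords X"
  by (induction rule: pres_eq.induct) (auto simp: gwords_def)

lemma pres_eq_context:
  assumes "pres_eq X R u v" "p \<in> gwords X" "q \<in> gwords X"
  shows "pres_eq X R (p @ u @ q) (p @ v @ q)"
  using assms
proof (induction rule: pres_eq.induct)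
  case (refl w)
  then show ?case by (intro pres_eq.refl) (auto simp: gwords_append)
next
  case (sym u v)
  then show ?case by (blast intro: pres_eq.sym)
next
  case (trans u v w)
  then show ?case by (blast intro: pres_eq.trans)
next
  case (cancel u v x e)
  then have "p @ u \<in> gwords X" "v @ q \<in> gwords X" by (auto simp: gwords_append)
  from pres_eq.cancel[OF this \<open>x \<in> X\<close>, of R e] show ?case by simp
next
  case (rel u v r)
  then have "p @ u \<in> gwords X" "v @ q \<in> gwords X" by (auto simp: gwords_append)
  from pres_eq.rel[OF this, of r R] rel show ?case by simp
qed

lemma pres_eq_append:
  assumes "pres_eq X R u u'" "pres_eq X R v v'"
  shows "pres_eq X R (u @ v) (u' @ v')"
proof -
  have nil: "[] \<in> gwords X" by (simp add: gwords_def)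
  have "pres_eq X R (u @ v) (u' @ v)"
    using pres_eq_context[OF assms(1) nil, of v] pres_eq_gwords[OF assms(2)] by simp
  moreover have "pres_eq X R (u' @ v) (u' @ v')"
    using pres_eq_context[OF assms(2) _ nil, of u'] pres_eq_gwords[OF assms(1)] by simp
  ultimately show ?thesis by (rule pres_eq.trans)
qed

lemma pres_eq_winv:
  assumes "w \<in> gwords X"
  shows "pres_eq X R (winv w @ w) []"
  using assms
proof (induction w)
  case Nil
  then show ?case by (auto simp: winv_def gwords_def intro: pres_eq.refl)
next
  case (Cons a w)
  obtain x e where a: "a = (x, e)" by force
  from Cons a have w: "w \<in> gwords X" "x \<in> X" "winv w \<in> gwords X"
    by (auto simp: gwords_def winv_def)
  have "winv (a # w) @ a # w = winv w @ [(x, \<not> e), (x, \<not> \<not> e)] @ w"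
    by (simp add: winv_def a)
  then show ?case using pres_eq.cancel[OF w(3,1,2), of R "\<not> e"] Cons.IH[OF w(1)]
    by (metis pres_eq.trans)
qed

lemma pres_class_eq_iff:
  "u \<in> gwords X \<Longrightarrow> pres_class X R u = pres_class X R v \<longleftrightarrow> pres_eq X R v u"
  unfolding pres_class_def by (blast intro: pres_eq.intros)

lemma mult_pres_class:
  assumes "u \<in> gwords X" "v \<in> gwords X"
  shows "pres_class X R u \<otimes>\<^bsub>presented_group X R\<^esub> pres_class X R v = pres_class X R (u @ v)"
  using assms unfolding presented_group_def pres_class_def
  by (auto intro: pres_eq.intros pres_eq_append pres_eq.trans[OF pres_eq_append])

lemma group_presented_group: "group (presented_group X R)"
proof -
  have car: "carrier (presented_group X R) = pres_class X R ` gwords X"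
    and one: "\<one>\<^bsub>presented_group X R\<^esub> = pres_class X R []"
    by (simp_all add: presented_group_def)
  have nil: "[] \<in> gwords X" by (simp add: gwords_def)
  show ?thesis
  proof (rule groupI, goal_cases)
    case (5 x)
    then obtain w where w: "w \<in> gwords X" "x = pres_class X R w"
      by (auto simp: car)
    then have w': "winv w \<in> gwords X"
      by (auto simp: gwords_def winv_def)
    have "pres_class X R (winv w) \<otimes>\<^bsub>presented_group X R\<^esub> x = \<one>\<^bsub>presented_group X R\<^esub>"
      using w w' pres_eq_winv[of w X R]
      by (simp add: mult_pres_class one pres_class_eq_iff gwords_append pres_eq.sym)
    then show ?case using w' by (auto simp: car)
  qed (auto simp: car one mult_pres_class gwords_append nil)
qed



section \<open>Homology with field coefficients is a vector space\<close>

lemma length_bar_face: "gs \<noteq> [] \<Longrightarrow> i \<le> length gs \<Longrightarrow> length (bar_face G i gs) = length gs - 1"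
  by (auto simp: bar_face_def)

lemma nth_bar_face:
  assumes "i \<le> length gs" "k < length gs - 1"
  shows "bar_face G i gs ! k =
    (if k + 1 < i then gs ! k else if k + 1 = i then gs ! k \<otimes>\<^bsub>G\<^esub> gs ! (k + 1) else gs ! (k + 1))"
proof -
  have kk: "Suc k < length gs" using assms(2) by simp
  consider "i = 0" | "i = length gs" "i \<noteq> 0" | "0 < i" "i < length gs" "k + 1 < i"
    | "0 < i" "i < length gs" "k + 1 = i" | "0 < i" "i < length gs" "i < k + 1"
    using assms(1) by linarith
  then show ?thesis
  proof cases
    case 1 then show ?thesis using assms kk by (simp add: bar_face_def nth_tl)
  next
    case 2 then show ?thesis using assms kk by (simp add: bar_face_def nth_butlast)
  next
    case 3 then have "k < i - 1" by simp
    with 3 show ?thesis using assms kk by (simp add: bar_face_def nth_append)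
  next
    case 4
    then have i: "i = Suc k" by simp
    show ?thesis using 4 assms kk unfolding i by (simp add: bar_face_def nth_append)
  next
    case 5
    then obtain m d where "i = Suc m" "k = Suc m + d"
      by (metis add_Suc add_diff_inverse_nat less_Suc_eq_le not_less Suc_eq_plus1 gr0_implies_Suc)
    with 5 show ?thesis using assms kk by (simp add: bar_face_def nth_append min_def Suc_diff_le)
  qed
qed

lemma set_bar_face:
  assumes "group G" "set gs \<subseteq> carrier G" "i \<le> length gs"
  shows "set (bar_face G i gs) \<subseteq> carrier G"
proof -
  interpret group G by fact
  show ?thesis
  proof (cases "gs = []")
    case False
    show ?thesis
    proof
      fix x assume "x \<in> set (bar_face G i gs)"
      then obtain k where k: "k < length gs - 1" "x = bar_face G i gs ! k"
        using False assms by (metis in_set_conv_nth length_bar_face)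
      have "gs ! k \<in> carrier G" "gs ! (k+1) \<in> carrier G" using k assms by (auto simp: subset_iff)
      then show "x \<in> carrier G" using k assms by (auto simp: nth_bar_face simp del: One_nat_def)
    qed
  qed (use assms in \<open>auto simp: bar_face_def\<close>)
qed

lemma bar_face_bar_face:
  assumes "group G" "set gs \<subseteq> carrier G" "length gs \<ge> 2" "j < i" "i \<le> length gs"
  shows "bar_face G j (bar_face G i gs) = bar_face G (i - 1) (bar_face G j gs)"
proof -
  interpret group G by fact
  have ne: "gs \<noteq> []" using assms by auto
  have l: "length (bar_face G i gs) = length gs - 1" "length (bar_face G j gs) = length gs - 1"
    using assms length_bar_face[OF ne, of i G] length_bar_face[OF ne, of j G] by linarith+
  then have ne': "bar_face G i gs \<noteq> []" "bar_face G j gs \<noteq> []" using assms by auto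
  have c: "gs ! k \<in> carrier G" if "k < length gs" for k using assms that by auto
  show ?thesis
  proof (rule nth_equalityI)
    show "length (bar_face G j (bar_face G i gs)) = length (bar_face G (i - 1) (bar_face G j gs))"
      using l ne' assms by (simp add: length_bar_face)
    fix k assume "k < length (bar_face G j (bar_face G i gs))"
    then have k: "k < length gs - 2" using l ne' assms by (simp add: length_bar_face)
    then have "k < length gs" "k+1 < length gs" "k+2 < length gs" by auto
    with c have cc: "gs ! k \<in> carrier G" "gs ! (k+1) \<in> carrier G" "gs ! (k+2) \<in> carrier G" by auto
    show "bar_face G j (bar_face G i gs) ! k = bar_face G (i - 1) (bar_face G j gs) ! k"
    proof -
      have L: "bar_face G j (bar_face G i gs) ! k =
          (if k + 1 < j then bar_face G i gs ! k
           else if k + 1 = j then bar_face G i gs ! k \<otimes>\<^bsub>G\<^esub> bar_face G i gs ! (k + 1)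
           else bar_face G i gs ! (k + 1))"
        and R: "bar_face G (i - 1) (bar_face G j gs) ! k =
          (if k + 1 < i - 1 then bar_face G j gs ! k
           else if k + 1 = i - 1 then bar_face G j gs ! k \<otimes>\<^bsub>G\<^esub> bar_face G j gs ! (k + 1)
           else bar_face G j gs ! (k + 1))"
        using k l assms(4,5) by (intro nth_bar_face; simp)+
      have I: "bar_face G h gs ! k = (if k + 1 < h then gs ! k
             else if k + 1 = h then gs ! k \<otimes>\<^bsub>G\<^esub> gs ! (k + 1) else gs ! (k + 1))"
           "bar_face G h gs ! (k + 1) = (if k + 2 < h then gs ! (k + 1)
             else if k + 2 = h then gs ! (k + 1) \<otimes>\<^bsub>G\<^esub> gs ! (k + 2) else gs ! (k + 2))"
        if "h \<le> length gs" for h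
        using k that by (simp_all add: nth_bar_face numeral_2_eq_2)
      have i: "i \<le> length gs" "j \<le> length gs" using assms(4,5) by auto
      obtain m where m: "i = Suc m" "j \<le> m" using assms(4) by (cases i) auto
      consider "k + 1 < j" "k + 1 < m" "k + 1 < i" | "k + 1 = j" "m = j" | "k + 1 = j" "k + 1 < m"
        | "j < k + 1" "k + 1 < m" | "j < k + 1" "k + 1 = m" | "j < k + 1" "m < k + 1"
        using m by linarith
      then show ?thesis
        unfolding L R I[OF i(1)] I[OF i(2)] unfolding m(1) by cases (use cc in \<open>simp_all add: m_assoc\<close>)
    qed
  qed
qed

definition bar_term ::
    "('g, 'm) monoid_scheme \<Rightarrow> 'g list \<Rightarrow> 'r::comm_ring_1 \<Rightarrow> ('g list \<Rightarrow>\<^sub>0 'r)" where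
  "bar_term G gs a = (if gs = [] then 0 else \<Sum>i\<le>length gs.
         Poly_Mapping.single (bar_face G i gs) ((- 1) ^ i * a))"

lemma bar_term_add: "bar_term G gs (a + b) = bar_term G gs a + bar_term G gs b"
  by (simp add: bar_term_def single_add distrib_left sum.distrib)

lemma bar_term_0 [simp]: "bar_term G gs 0 = 0"
  by (simp add: bar_term_def)

lemma bar_boundary_superset:
  assumes "finite K" "Poly_Mapping.keys c \<subseteq> K"
  shows "bar_boundary G c = (\<Sum>gs\<in>K. bar_term G gs (Poly_Mapping.lookup c gs))"
  unfolding bar_boundary_def bar_term_def[symmetric]
  by (rule sum.mono_neutral_left) (use assms in \<open>auto simp: in_keys_iff\<close>)

lemma bar_boundary_add: "bar_boundary G (c + d) = bar_boundary G c + bar_boundary G d"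
proof -
  let ?K = "Poly_Mapping.keys c \<union> Poly_Mapping.keys d"
  have k: "finite ?K" "Poly_Mapping.keys (c + d) \<subseteq> ?K" by (auto simp: Poly_Mapping.keys_add)
  show ?thesis
    by (subst (1 2 3) bar_boundary_superset[OF k(1)])
       (use k in \<open>auto simp: lookup_add bar_term_add sum.distrib\<close>)
qed

lemma bar_boundary_0 [simp]: "bar_boundary G 0 = 0"
  by (simp add: bar_boundary_def)

lemma bar_boundary_sum: "bar_boundary G (sum f I) = (\<Sum>i\<in>I. bar_boundary G (f i))"
  by (induction I rule: infinite_finite_induct) (auto simp: bar_boundary_add)

lemma bar_boundary_single: "bar_boundary G (Poly_Mapping.single gs a) = bar_term G gs a"
  by (subst bar_boundary_superset[of "{gs}"]) (auto simp: )

lemma bar_boundary_boundary: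
  fixes c :: "'g list \<Rightarrow>\<^sub>0 'b::comm_ring_1"
  assumes "group G" "c \<in> bar_chains G n"
  shows "bar_boundary G (bar_boundary G c) = 0"
proof -
  have "bar_boundary G (bar_term G gs a) = 0" if gs: "set gs \<subseteq> carrier G" for gs and a :: 'b
  proof (cases "length gs \<ge> 2")
    case False
    then consider "gs = []" | g where "gs = [g]"
      by (cases gs; cases "tl gs") auto
    then show ?thesis
    proof cases
      case 2
      have "{..length gs} = {0, 1}" using 2 by auto
      then show ?thesis using 2
        by (simp add: bar_term_def bar_face_def bar_boundary_add bar_boundary_single)
    qed (simp add: bar_term_def)
  next
    case True
    define n where "n = length gs"
    have n: "n \<ge> 2" using True n_def by simp
    let ?t = "\<lambda>i j. Poly_Mapping.single (bar_face G j (bar_face G i gs)) ((- 1) ^ (i + j) * a)"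
    have "bar_boundary G (bar_term G gs a) = (\<Sum>i\<le>n. \<Sum>j\<le>n-1. ?t i j)"
    proof -
      have "bar_face G i gs \<noteq> [] \<and> length (bar_face G i gs) = n - 1" if "i \<le> n" for i
      proof -
        have "gs \<noteq> []" using True by auto
        from length_bar_face[OF this, of i G] that show ?thesis using True n_def by auto
      qed
      moreover have "gs \<noteq> []" using True by auto
      ultimately show ?thesis
        unfolding bar_term_def
        by (simp add: bar_boundary_sum bar_boundary_single)
           (auto simp: n_def[symmetric] bar_term_def power_add mult_ac intro!: sum.cong)
    qed
    also have "\<dots> = (\<Sum>(i,j)\<in>{..n}\<times>{..n-1}. ?t i j)"
      by (simp add: sum.cartesian_product)
    also have "\<dots> = (\<Sum>(i,j)\<in>{(i,j). j < i \<and> i \<le> n}. ?t i j)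
        + (\<Sum>(i,j)\<in>{(i,j). i \<le> j \<and> j \<le> n-1}. ?t i j)"
    proof -
      have e: "{..n}\<times>{..n-1} = {(i,j). j < i \<and> i \<le> n} \<union> {(i,j). i \<le> j \<and> j \<le> n-1}"
        using n by auto
      have "finite ({(i,j). j < i \<and> i \<le> n} \<union> {(i,j). i \<le> j \<and> j \<le> n-1})"
        unfolding e[symmetric] by simp
      then show ?thesis unfolding e by (intro sum.union_disjoint) auto
    qed
    also have "(\<Sum>(i,j)\<in>{(i,j). j < i \<and> i \<le> n}. ?t i j)
        = (\<Sum>(i,j)\<in>{(i,j). i \<le> j \<and> j \<le> n-1}. - ?t i j)"
    proof (rule sum.reindex_bij_witness[of _ "\<lambda>(i,j). (j+1,i)" "\<lambda>(i,j). (j,i-1)"])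
      fix ij assume ij: "ij \<in> {(i,j). j < i \<and> i \<le> n}"
      then obtain i j where "ij = (i,j)" and ij: "j < i" "i \<le> n" by auto
      moreover have "bar_face G j (bar_face G i gs) = bar_face G (i - 1) (bar_face G j gs)"
        using bar_face_bar_face[OF assms(1) gs True] ij n_def by auto
      moreover have "(- 1) ^ (i + j) = - ((- 1 :: 'b) ^ (j + (i - 1)))"
        using ij by (cases i) (auto simp: add.commute)
      ultimately show "(case (case ij of (i,j) \<Rightarrow> (j,i-1)) of (i,j) \<Rightarrow> - ?t i j)
        = (case ij of (i,j) \<Rightarrow> ?t i j)" by (simp add: single_uminus)
    qed (use n in auto)
    finally show ?thesis by (simp add: sum_negf case_prod_unfold)
  qed
  moreover have "bar_boundary G c = (\<Sum>gs\<in>Poly_Mapping.keys c. bar_term G gs (Poly_Mapping.lookup c gs))"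
    by (rule bar_boundary_superset) auto
  ultimately show ?thesis using assms(2)
    by (simp add: bar_boundary_sum bar_chains_def) (rule sum.neutral, auto simp: subset_iff)
qed


abbreviation scl where "scl r \<equiv> Poly_Mapping.map ((*) (r :: 'r::comm_ring_1))"

lemma lookup_scl [simp]: "Poly_Mapping.lookup (scl r c) k = r * Poly_Mapping.lookup c k"
  by (simp add: Poly_Mapping.map.rep_eq when_def)

lemma scl_simps: "scl r (c + d) = scl r c + scl r d" "scl (r + s) c = scl r c + scl s c"
  "scl (r * s) c = scl r (scl s c)" "scl 1 c = c" "scl r 0 = 0" "scl (-1) c = - c"
  by (auto intro!: poly_mapping_eqI simp: lookup_add algebra_simps)

lemma bar_term_scl: "bar_term G gs (r * a) = scl r (bar_term G gs a)"
proof -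
  have "scl r (sum f I) = (\<Sum>i\<in>I. scl r (f i))" for f :: "nat \<Rightarrow> 'a list \<Rightarrow>\<^sub>0 'b" and I
    by (induction I rule: infinite_finite_induct) (auto simp: scl_simps)
  moreover have "scl r (Poly_Mapping.single x y) = Poly_Mapping.single x (r * y)" for x :: "'a list" and y
    by (auto intro!: poly_mapping_eqI simp: lookup_single when_def)
  ultimately show ?thesis by (simp add: bar_term_def mult_ac scl_simps)
qed

lemma bar_boundary_scl: "bar_boundary G (scl r c) = scl r (bar_boundary G c)"
proof -
  have e: "scl r (sum f I) = (\<Sum>i\<in>I. scl r (f i))" for f :: "'a list \<Rightarrow> 'a list \<Rightarrow>\<^sub>0 'b" and I
    by (induction I rule: infinite_finite_induct) (auto simp: scl_simps)
  have "Poly_Mapping.keys (scl r c) \<subseteq> Poly_Mapping.keys c" by (auto simp: in_keys_iff)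
  then show ?thesis
    by (subst (1 2) bar_boundary_superset[of "Poly_Mapping.keys c"]) (auto simp: bar_term_scl e)
qed

lemma bar_chains_closed: "0 \<in> bar_chains G n" "c \<in> bar_chains G n \<Longrightarrow> d \<in> bar_chains G n \<Longrightarrow> c + d \<in> bar_chains G n"
   "c \<in> bar_chains G n \<Longrightarrow> scl r c \<in> bar_chains G n"
proof -
  show "0 \<in> bar_chains G n" by (simp add: bar_chains_def)
  show "c + d \<in> bar_chains G n" if "c \<in> bar_chains G n" "d \<in> bar_chains G n"
    using that Poly_Mapping.keys_add[of c d] unfolding bar_chains_def by blast
  have "Poly_Mapping.keys (scl r c) \<subseteq> Poly_Mapping.keys c" by (auto simp: in_keys_iff)
  then show "scl r c \<in> bar_chains G n" if "c \<in> bar_chains G n"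
    using that unfolding bar_chains_def by blast
qed

lemma bar_term_chain:
  fixes G :: "('a, 'm) monoid_scheme" and a :: "'c::comm_ring_1"
  assumes "group G" "length gs = Suc n" "set gs \<subseteq> carrier G"
  shows "bar_term G gs a \<in> bar_chains G n"
proof -
  have sm: "sum f I \<in> bar_chains G n" if "\<And>i. i \<in> I \<Longrightarrow> f i \<in> bar_chains G n" for f :: "nat \<Rightarrow> 'a list \<Rightarrow>\<^sub>0 'c" and I
    using that by (induction I rule: infinite_finite_induct) (auto intro: bar_chains_closed)
  moreover have sg: "Poly_Mapping.single (bar_face G i gs) b \<in> bar_chains G n" if "i \<le> length gs" for i and b :: 'c
  proof -
    have "gs \<noteq> []" using assms by auto
    from length_bar_face[OF this that, of G] set_bar_face[OF assms(1,3) that] assms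
    show ?thesis by (auto simp: bar_chains_def)
  qed
  moreover have "gs \<noteq> []" using assms by auto
  ultimately show ?thesis unfolding bar_term_def by (simp del: One_nat_def) (rule sm, rule sg, simp)
qed

lemma bar_boundary_chain:
  fixes G :: "('a, 'm) monoid_scheme" and c :: "'a list \<Rightarrow>\<^sub>0 'c::comm_ring_1"
  assumes "group G" "c \<in> bar_chains G (Suc n)"
  shows "bar_boundary G c \<in> bar_chains G n"
proof -
  have s: "sum f I \<in> bar_chains G n" if "\<And>i. i \<in> I \<Longrightarrow> f i \<in> bar_chains G n" for f :: "'a list \<Rightarrow> 'a list \<Rightarrow>\<^sub>0 'c" and I
    using that by (induction I rule: infinite_finite_induct) (auto intro: bar_chains_closed)
  show ?thesis
  proof (subst bar_boundary_superset[of "Poly_Mapping.keys c"])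
    show "(\<Sum>gs\<in>Poly_Mapping.keys c. bar_term G gs (Poly_Mapping.lookup c gs)) \<in> bar_chains G n"
    proof (rule s)
      fix gs assume "gs \<in> Poly_Mapping.keys c"
      then have "length gs = Suc n" "set gs \<subseteq> carrier G" using assms(2) by (auto simp: bar_chains_def)
      then show "bar_term G gs (Poly_Mapping.lookup c gs) \<in> bar_chains G n"
        by (rule bar_term_chain[OF assms(1)])
    qed
  qed auto
qed

lemma module_group_homology:
  fixes G :: "('g, 'm) monoid_scheme"
  assumes "group G"
  shows "module (class_ring :: 'r::comm_ring_1 ring) (group_homology G n)"
proof -
  define B :: "('g list \<Rightarrow>\<^sub>0 'r) set" where "B = bar_boundaries G n"
  define Z :: "('g list \<Rightarrow>\<^sub>0 'r) set" where "Z = bar_cycles G n"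
  define C where "C z = {z + b | b. b \<in> B}" for z
  let ?H = "group_homology G n :: ('r, _) module"
  have Z: "0 \<in> Z" "\<And>x y. x \<in> Z \<Longrightarrow> y \<in> Z \<Longrightarrow> x + y \<in> Z" "\<And>r x. x \<in> Z \<Longrightarrow> scl r x \<in> Z"
    by (auto simp: Z_def bar_cycles_def bar_chains_closed bar_boundary_add bar_boundary_scl scl_simps)
  have B: "0 \<in> B" "\<And>x y. x \<in> B \<Longrightarrow> y \<in> B \<Longrightarrow> x + y \<in> B" "\<And>r x. x \<in> B \<Longrightarrow> scl r x \<in> B"
  proof -
    have B': "x \<in> B \<longleftrightarrow> (\<exists>c\<in>bar_chains G (n + 1). x = bar_boundary G c)" for x
      by (auto simp: B_def bar_boundaries_def)
    show "0 \<in> B" unfolding B' by (rule bexI[of _ 0]) (simp_all add: bar_chains_closed)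
    show "x + y \<in> B" if "x \<in> B" "y \<in> B" for x y
    proof -
      from that obtain c d where "c \<in> bar_chains G (n + 1)" "d \<in> bar_chains G (n + 1)"
        "x = bar_boundary G c" "y = bar_boundary G d" unfolding B' by blast
      then show ?thesis unfolding B'
        by (intro bexI[of _ "c + d"]) (simp_all add: bar_boundary_add bar_chains_closed)
    qed
    show "scl r x \<in> B" if "x \<in> B" for r x
    proof -
      from that obtain c where "c \<in> bar_chains G (n + 1)" "x = bar_boundary G c" unfolding B' by blast
      then show ?thesis unfolding B'
        by (intro bexI[of _ "scl r c"]) (simp_all add: bar_boundary_scl bar_chains_closed)
    qed
  qed
  have "B \<subseteq> Z"
    unfolding B_def Z_def bar_boundaries_def bar_cycles_def
    using bar_boundary_boundary[OF assms] bar_boundary_chain[OF assms] by auto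
  have Bm: "- x \<in> B" if "x \<in> B" for x using B(3)[OF that, of "-1"] by (simp add: scl_simps)
  have car: "carrier ?H = C ` Z" and zero: "\<zero>\<^bsub>?H\<^esub> = C 0"
    by (auto simp: group_homology_def C_def B_def Z_def)
  have add: "C x \<oplus>\<^bsub>?H\<^esub> C y = C (x + y)" for x y
  proof -
    have "{u + v | u v. u \<in> C x \<and> v \<in> C y} = C (x + y)"
    proof (intro Set.set_eqI iffI)
      fix w assume "w \<in> {u + v | u v. u \<in> C x \<and> v \<in> C y}"
      then obtain b b' where "b \<in> B" "b' \<in> B" "w = (x + b) + (y + b')"
        unfolding C_def by blast
      then have "b + b' \<in> B" "w = x + y + (b + b')" by (simp_all add: add_ac B(2))
      then show "w \<in> C (x + y)" unfolding C_def by blast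
    next
      fix w assume "w \<in> C (x + y)"
      then obtain c where "c \<in> B" "w = x + y + c" unfolding C_def by blast
      then have "x + c \<in> C x" "y + 0 \<in> C y" "w = (x + c) + (y + 0)"
        using B(1) unfolding C_def by (blast, blast, simp add: add.assoc add.left_commute)
      then show "w \<in> {u + v | u v. u \<in> C x \<and> v \<in> C y}" by blast
    qed
    then show ?thesis by (simp add: group_homology_def)
  qed
  have scl: "r \<odot>\<^bsub>?H\<^esub> C x = C (scl r x)" for r x
  proof -
    have "{scl r u + v | u v. u \<in> C x \<and> v \<in> B} = C (scl r x)"
    proof (intro Set.set_eqI iffI)
      fix w assume "w \<in> {scl r u + v | u v. u \<in> C x \<and> v \<in> B}"
      then obtain b b' where b: "b \<in> B" "b' \<in> B" "w = scl r (x + b) + b'"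
        unfolding C_def by blast
      have "scl r b + b' \<in> B" by (rule B(2)[OF B(3)[OF b(1)] b(2)])
      moreover have "w = scl r x + (scl r b + b')" using b by (simp add: scl_simps add_ac)
      ultimately show "w \<in> C (scl r x)" unfolding C_def by blast
    next
      fix w assume "w \<in> C (scl r x)"
      then obtain c where "c \<in> B" "w = scl r x + c" unfolding C_def by blast
      moreover have "x + 0 \<in> C x" using B(1) unfolding C_def by blast
      then have "x \<in> C x" by simp
      ultimately show "w \<in> {scl r u + v | u v. u \<in> C x \<and> v \<in> B}" by blast
    qed
    then show ?thesis by (simp add: group_homology_def B_def)
  qed
  have "- x \<in> Z" if "x \<in> Z" for x using Z(3)[OF that, of "-1"] by (simp add: scl_simps)
  then have inv: "\<exists>y\<in>Z. y + x = 0" if "x \<in> Z" for x using that by force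
  have ab: "abelian_group ?H"
  proof (rule abelian_groupI)
    fix x assume "x \<in> carrier ?H"
    then show "\<exists>y\<in>carrier ?H. y \<oplus>\<^bsub>?H\<^esub> x = \<zero>\<^bsub>?H\<^esub>"
    proof -
      from \<open>x \<in> carrier ?H\<close> obtain z where z: "z \<in> Z" "x = C z" unfolding car by blast
      with inv obtain y where "y \<in> Z" "y + z = 0" by blast
      with z show ?thesis by (intro bexI[of _ "C y"]) (simp_all add: car add zero)
    qed
  qed (auto simp: car add zero Z add_ac)
  have "cring (class_ring :: 'r ring)" by (rule class_cring.is_cring)
  then show ?thesis
    by (rule moduleI[OF _ ab]) (auto simp: car scl add Z scl_simps)
qed

lemma vectorspace_group_homology:
  fixes G :: "('g, 'm) monoid_scheme"
  assumes "group G"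
  shows "vectorspace (class_ring :: 'r::field ring) (group_homology G n)"
  by (simp add: vectorspace_def module_group_homology[OF assms] class_field.field_axioms)

end

theory Submission
  imports Defs "HOL-Library.Countable_Set" "HOL-Number_Theory.Number_Theory" "HOL-Algebra.Multiplicative_Group"
begin

text \<open>The universal central extension of \<open>\<Delta>\<close> is an explicit amalgam \<open>E0\<close> of two copies of
  \<open>A \<times> A \<times> \<int>\<^sup>3\<close> over \<open>S \<times> \<int>\<^sup>3\<close>, where one gluing map is twisted by a surjection \<open>\<tau> : S \<rightarrow> \<int>\<^sup>3\<close>.
  Homomorphisms from the perfect group \<open>A\<close> lift through central extensions since its relators can be
  corrected, the two lifts to \<open>A \<times> A\<close> differ on \<open>S\<close> by a homomorphism that factors through \<open>\<tau>\<close>, and so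
  every homomorphism from \<open>E0\<close> lifts through central extensions; this gives the universal property and
  \<open>H\<^sub>2 = 0\<close>. An amalgam acts on the cosets of the amalgamated subgroup, and a derivation into the dual of
  this permutation module replaces the Bass--Serre tree: it yields torsion-freeness of \<open>A\<close> and \<open>E0\<close>.
  Combined with the Fox derivatives of the two free factors, transported to \<open>\<Delta>\<close> along a retraction
  \<open>\<Delta> \<rightarrow> S\<close>, it also yields a 3-cocycle with values in the Laurent polynomials over the rationals.
  The commutator of \<open>x1\<^sup>n\<close> and \<open>y1\<close> bounds in both copies of \<open>A \<times> A\<close>; the products of the two bounding
  chains with the class of \<open>y2\<close> differ by a 3-cycle on which the cocycle is \<open>t\<^sup>n - 1\<close>, and these
  values lie in no finite-dimensional space.\<close>

text \<open>Mayer-Vietoris explains the shape of the model. The group \<open>A \<times> A\<close> is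
  acyclic, so the second homology of \<Delta> is the first homology of S, which is free abelian of
  rank three; this is the origin of \<open>Z3\<close> and \<tau>. One degree up, the third homology
  of \<Delta> sees the second homology of S, where the tori spanned by y2 and the conjugates of y1
  by x1^n are independent. None of these exact sequences is used: each consequence is replaced by an
  explicit homomorphism, permutation or chain. Two obstacles shape the argument. Injectivity and
  freeness are obtained without normal forms, from permutations of countable sets found by extending
  partial equivariant bijections. Moreover the universal property is tested only on groups over
  \<open>'u\<close>, whereas E lives in an unrelated type and is not known to be countable
  beforehand, so E can be compared with the model only through countable quotients. Commutators
  serve to build the cycles because \<tau> kills them: both embeddings of such an element in E
  coincide, and the two bounding chains get the same boundary.\<close>

abbreviation (input) mult_in ("(_ \<otimes>\<^sub>_/ _)" [70, 1000, 71] 70) where "x \<otimes>\<^sub>G y \<equiv> monoid.mult G x y"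
abbreviation (input) pow_in ("(_ [^]\<^sub>_/ _)" [76, 1000, 75] 75) where "x [^]\<^sub>G n \<equiv> Group.pow G x n"
abbreviation (input) one_in ("\<one>\<^sub>_" [1000] 1000) where "\<one>\<^sub>G \<equiv> monoid.one G"

section \<open>Words and presentations\<close>

primrec weval :: "('h, 'm) monoid_scheme \<Rightarrow> ('x \<Rightarrow> 'h) \<Rightarrow> 'x gword \<Rightarrow> 'h" where
  "weval H h [] = \<one>\<^sub>H"
| "weval H h (a # w) = (if snd a then h (fst a) else inv\<^bsub>H\<^esub> (h (fst a))) \<otimes>\<^sub>H weval H h w"

lemma gwords_Nil [simp]: "[] \<in> gwords X"
  and gwords_Cons [simp]: "a # w \<in> gwords X \<longleftrightarrow> fst a \<in> X \<and> w \<in> gwords X"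
  and gwords_app [simp]: "u @ v \<in> gwords X \<longleftrightarrow> u \<in> gwords X \<and> v \<in> gwords X"
  and gwords_gen [simp]: "gen x \<in> gwords X \<longleftrightarrow> x \<in> X"
  and gwords_winv [simp]: "winv w \<in> gwords X \<longleftrightarrow> w \<in> gwords X"
  by ((force simp: gwords_def)?, (simp add: gwords_def mem_Times_iff), (simp add: gwords_def), (simp add: gwords_def gen_def mem_Times_iff), (force simp: gwords_def winv_def in_lists_conv_set mem_Times_iff split_def))

lemma gwords_wpow [simp]: "w \<in> gwords X \<Longrightarrow> wpow w n \<in> gwords X"
  by (induction n) (auto simp: wpow_def)

lemma gwords_wcomm [simp]: "u \<in> gwords X \<Longrightarrow> v \<in> gwords X \<Longrightarrow> wcomm u v \<in> gwords X"
  by (simp add: wcomm_def)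

context group begin

lemma inv_cancel_left [simp]: "x \<in> carrier G \<Longrightarrow> y \<in> carrier G \<Longrightarrow> inv x \<otimes> (x \<otimes> y) = y"
  and inv_cancel_left' [simp]: "x \<in> carrier G \<Longrightarrow> y \<in> carrier G \<Longrightarrow> x \<otimes> (inv x \<otimes> y) = y"
  by (simp_all add: m_assoc[symmetric])

lemma weval_closed [simp]: "h ` X \<subseteq> carrier G \<Longrightarrow> w \<in> gwords X \<Longrightarrow> weval G h w \<in> carrier G"
  by (induction w) auto

lemma weval_append: "h ` X \<subseteq> carrier G \<Longrightarrow> u \<in> gwords X \<Longrightarrow> v \<in> gwords X \<Longrightarrow>
    weval G h (u @ v) = weval G h u \<otimes> weval G h v"
proof (induction u)
  case (Cons a u)
  have "(if snd a then h (fst a) else inv h (fst a)) \<in> carrier G" using Cons by auto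
  then show ?case using Cons weval_closed[of h X u] weval_closed[of h X v] by (simp add: m_assoc)
qed simp

lemma weval_gen: "h x \<in> carrier G \<Longrightarrow> weval G h (gen x) = h x"
  by (simp add: gen_def)

lemma weval_winv: "h ` X \<subseteq> carrier G \<Longrightarrow> w \<in> gwords X \<Longrightarrow> weval G h (winv w) = inv (weval G h w)"
proof (induction w)
  case (Cons a w)
  have "winv (a # w) = winv w @ [(fst a, \<not> snd a)]" by (simp add: winv_def split_def)
  moreover have "(if snd a then h (fst a) else inv h (fst a)) \<in> carrier G" using Cons by auto
  moreover have "h (fst a) \<in> carrier G" using Cons by auto
  ultimately show ?case using Cons weval_closed[of h X w]
    by (simp add: weval_append[where X = X] inv_mult_group)
qed (simp add: winv_def)

lemma weval_wpow: "h ` X \<subseteq> carrier G \<Longrightarrow> w \<in> gwords X \<Longrightarrow> weval G h (wpow w n) = weval G h w [^] n"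
proof (induction n)
  case (Suc n)
  have "wpow w (Suc n) = w @ wpow w n" by (simp add: wpow_def)
  then show ?case using Suc weval_closed[of h X w]
    by (simp only: weval_append[where X = X] nat_pow_Suc2 gwords_wpow)
qed (simp add: wpow_def)

lemma weval_relator: "h ` X \<subseteq> carrier G \<Longrightarrow> u \<in> gwords X \<Longrightarrow> v \<in> gwords X \<Longrightarrow>
    weval G h (relator u v) = \<one> \<longleftrightarrow> weval G h u = weval G h v"
  by (simp add: relator_def weval_append[where X = X] weval_winv[where X = X] inv_solve_right')

lemma weval_wcomm: "h ` X \<subseteq> carrier G \<Longrightarrow> u \<in> gwords X \<Longrightarrow> v \<in> gwords X \<Longrightarrow>
    weval G h (wcomm u v) = weval G h u \<otimes> weval G h v \<otimes> inv (weval G h u) \<otimes> inv (weval G h v)"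
  by (simp add: wcomm_def weval_append[where X = X] weval_winv[where X = X] m_assoc)

end

lemma weval_hom:
  assumes "group G" "group H" "f \<in> hom G H" "h ` X \<subseteq> carrier G" "w \<in> gwords X"
  shows "f (weval G h w) = weval H (f \<circ> h) w"
proof -
  interpret group_hom G H f using assms by (intro group_hom.intro group_hom_axioms.intro)
  show ?thesis using assms(4,5)
  proof (induction w)
    case (Cons a w)
    have "h (fst a) \<in> carrier G" using Cons by auto
    then show ?case using Cons G.weval_closed[of h X w] by auto
  qed simp
qed

lemma weval_cong: "w \<in> gwords X \<Longrightarrow> (\<And>x. x \<in> X \<Longrightarrow> f x = g x) \<Longrightarrow> weval H f w = weval H g w"
  by (induction w) auto

definition pgen :: "'x set \<Rightarrow> 'x gword set \<Rightarrow> 'x \<Rightarrow> 'x gword set" where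
  "pgen X R x = pres_class X R (gen x)"

lemma carrier_presented_group: "carrier (presented_group X R) = pres_class X R ` gwords X"
  and one_presented_group: "\<one>\<^bsub>presented_group X R\<^esub> = pres_class X R []"
  by (simp_all add: presented_group_def)

lemma pgen_closed: "x \<in> X \<Longrightarrow> pgen X R x \<in> carrier (presented_group X R)"
  by (simp add: pgen_def carrier_presented_group)

lemma weval_pgen: "w \<in> gwords X \<Longrightarrow> weval (presented_group X R) (pgen X R) w = pres_class X R w"
proof (induction w)
  case (Cons a w)
  interpret group "presented_group X R" by (rule group_presented_group)
  let ?P = "presented_group X R"
  obtain x e where a: "a = (x, e)" by force
  have x: "x \<in> X" "w \<in> gwords X" using Cons a by auto
  have "inv\<^bsub>?P\<^esub> (pgen X R x) = pres_class X R [(x, False)]"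
  proof (rule inv_equality)
    have "pres_class X R [(x, False)] \<otimes>\<^sub>?P pgen X R x = pres_class X R [(x, False), (x, True)]"
      using x by (simp add: pgen_def mult_pres_class) (simp add: gen_def)
    also have "\<dots> = pres_class X R []"
      using pres_eq.cancel[of "[]" X "[]" x R False] x
      by (simp add: pres_class_eq_iff pres_eq.sym)
    finally show "pres_class X R [(x, False)] \<otimes>\<^sub>?P pgen X R x = \<one>\<^sub>?P"
      by (simp add: one_presented_group)
    show "pgen X R x \<in> carrier ?P" by (simp add: x pgen_closed)
    show "pres_class X R [(x, False)] \<in> carrier ?P" using x by (simp add: carrier_presented_group)
  qed
  then have "(if snd a then pgen X R (fst a) else inv\<^bsub>?P\<^esub> (pgen X R (fst a))) = pres_class X R [a]"
    by (simp add: a pgen_def gen_def)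
  then have "weval ?P (pgen X R) (a # w) = pres_class X R [a] \<otimes>\<^sub>?P pres_class X R w"
    using Cons by (simp only: weval.simps gwords_Cons simp_thms)
  then show ?case using x a by (simp add: mult_pres_class)
qed (simp add: one_presented_group)

lemma pgen_relation:
  assumes "r \<in> R" "r \<in> gwords X"
  shows "weval (presented_group X R) (pgen X R) r = \<one>\<^bsub>presented_group X R\<^esub>"
  using pres_eq.rel[of "[]" X "[]" r R] assms
  by (simp add: weval_pgen one_presented_group pres_class_eq_iff pres_eq.sym)

lemma von_dyck:
  assumes H: "group H" and h: "h ` X \<subseteq> carrier H"
    and rel: "\<And>r. r \<in> R \<Longrightarrow> r \<in> gwords X \<Longrightarrow> weval H h r = \<one>\<^sub>H"
  shows "\<exists>f \<in> hom (presented_group X R) H. \<forall>x \<in> X. f (pgen X R x) = h x"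
proof -
  interpret H: group H by (rule H)
  have eq: "weval H h u = weval H h v" if "pres_eq X R u v" for u v
    using that
  proof (induction rule: pres_eq.induct)
    case (cancel u v x e)
    then have "h x \<in> carrier H" using h by auto
    with cancel show ?case using h by (cases e) (simp_all add: H.weval_append[OF h])
  next
    case (rel u v r)
    then show ?case using assms(3)[of r] H.weval_closed[OF h] by (simp add: H.weval_append[OF h])
  qed auto
  \<comment> \<open>Elements of a presented group are sets of equivalent words; by \<open>eq\<close>
    the value is the same for whichever member is picked.\<close>
  define f where "f P = weval H h (SOME w. w \<in> P)" for P
  have f: "f (pres_class X R w) = weval H h w" if "w \<in> gwords X" for w
  proof -
    have "w \<in> pres_class X R w" using that by (simp add: pres_class_def pres_eq.refl)
    then have "(SOME v. v \<in> pres_class X R w) \<in> pres_class X R w" by (rule someI)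
    then show ?thesis unfolding f_def by (metis eq pres_class_def mem_Collect_eq)
  qed
  have "f \<in> hom (presented_group X R) H"
    by (rule homI) (use H.weval_closed[OF h] in \<open>auto simp: carrier_presented_group f mult_pres_class H.weval_append[OF h]\<close>)
  moreover have "f (pgen X R x) = h x" if "x \<in> X" for x
    using that h by (auto simp: pgen_def f H.weval_gen image_subset_iff)
  ultimately show ?thesis by blast
qed

lemma pgen_relator:
  assumes "relator u v \<in> R" "u \<in> gwords X" "v \<in> gwords X"
  shows "weval (presented_group X R) (pgen X R) u = weval (presented_group X R) (pgen X R) v"
proof -
  interpret group "presented_group X R" by (rule group_presented_group)
  have h: "pgen X R ` X \<subseteq> carrier (presented_group X R)" by (auto simp: pgen_closed)
  have "relator u v \<in> gwords X" using assms by (simp add: relator_def)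
  from pgen_relation[OF assms(1) this] show ?thesis
    by (simp add: weval_relator[OF h assms(2,3)])
qed

text \<open>Generation is tested by subgroups rather than by words, so that equalizers, preimages
  and zero sets of derivations settle all elements at once.\<close>

definition generates :: "('g, 'm) monoid_scheme \<Rightarrow> 'g set \<Rightarrow> bool" where
  "generates G B \<longleftrightarrow> B \<subseteq> carrier G \<and> (\<forall>N. subgroup N G \<longrightarrow> B \<subseteq> N \<longrightarrow> N = carrier G)"

lemma generatesD: "generates G B \<Longrightarrow> subgroup N G \<Longrightarrow> B \<subseteq> N \<Longrightarrow> x \<in> carrier G \<Longrightarrow> x \<in> N"
  by (auto simp: generates_def)

lemma generates_presented_group: "generates (presented_group X R) (pgen X R ` X)"
  unfolding generates_def
proof (intro conjI allI impI)
  interpret group "presented_group X R" by (rule group_presented_group)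
  let ?P = "presented_group X R"
  show "pgen X R ` X \<subseteq> carrier ?P" by (auto simp: pgen_closed)
  fix N assume N: "subgroup N ?P" "pgen X R ` X \<subseteq> N"
  have "weval ?P (pgen X R) w \<in> N" if "w \<in> gwords X" for w
    using that
  proof (induction w)
    case Nil
    show ?case using subgroup.one_closed[OF N(1)] by simp
  next
    case (Cons a w)
    then show ?case using N(2) subgroup.m_inv_closed[OF N(1)]
      by (auto intro!: subgroup.m_closed[OF N(1)])
  qed
  then have "carrier ?P \<subseteq> N" by (auto simp: carrier_presented_group weval_pgen)
  then show "N = carrier ?P" using subgroup.subset[OF N(1)] by blast
qed

lemma group_homI: "group G \<Longrightarrow> group H \<Longrightarrow> f \<in> hom G H \<Longrightarrow> group_hom G H f"
  by (intro group_hom.intro group_hom_axioms.intro)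

lemma equalizer_subgroup:
  assumes "group G" "group H" "f \<in> hom G H" "g \<in> hom G H"
  shows "subgroup {x \<in> carrier G. f x = g x} G"
proof -
  interpret f: group_hom G H f by (rule group_homI[OF assms(1,2,3)])
  interpret g: group_hom G H g by (rule group_homI[OF assms(1,2,4)])
  have "\<one>\<^sub>G \<in> {x \<in> carrier G. f x = g x}" by simp
  then show ?thesis by (intro group.subgroupI[OF assms(1)]) (blast, blast, simp_all)
qed

lemma hom_eq_on_generators:
  assumes "generates G B" "group G" "group H" "f \<in> hom G H" "g \<in> hom G H"
    and "\<And>b. b \<in> B \<Longrightarrow> f b = g b" "x \<in> carrier G"
  shows "f x = g x"
proof -
  have "x \<in> {x \<in> carrier G. f x = g x}"
    by (rule generatesD[OF assms(1) equalizer_subgroup[OF assms(2-5)] _ assms(7)])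
       (use assms(1,6) in \<open>auto simp: generates_def\<close>)
  then show ?thesis by simp
qed

text \<open>The step is an equivalence and not an implication. This makes the set of right factors
  that preserve \<open>P\<close> closed under inverses, so that only multiplication by generators
  has to be examined.\<close>

lemma generates_induct:
  fixes G (structure)
  assumes "generates G B" "group G" "P \<one>\<^sub>G" "x \<in> carrier G"
    and step: "\<And>g b. g \<in> carrier G \<Longrightarrow> b \<in> B \<Longrightarrow> P (g \<otimes>\<^sub>G b) \<longleftrightarrow> P g"
  shows "P x"
proof -
  interpret group G by (rule assms(2))
  let ?N = "{n \<in> carrier G. \<forall>g\<in>carrier G. P (g \<otimes>\<^sub>G n) \<longleftrightarrow> P g}"
  have "subgroup ?N G"
  proof (rule subgroupI)
    fix a assume a: "a \<in> ?N"
    then have ac: "a \<in> carrier G" and A: "\<forall>g\<in>carrier G. P (g \<otimes> a) \<longleftrightarrow> P g"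
      by - (erule CollectE, elim conjE, assumption)+
    have "P (g \<otimes> inv a) \<longleftrightarrow> P g" if g: "g \<in> carrier G" for g
    proof -
      have "P (g \<otimes> inv a \<otimes> a) \<longleftrightarrow> P (g \<otimes> inv a)" using bspec[OF A m_closed[OF g inv_closed[OF ac]]] .
      then show ?thesis using g ac by (simp add: m_assoc)
    qed
    then show "inv a \<in> ?N" by (intro CollectI conjI ballI inv_closed ac)
  next
    fix a b assume ab: "a \<in> ?N" "b \<in> ?N"
    then have c: "a \<in> carrier G" "b \<in> carrier G" and A: "\<forall>g\<in>carrier G. P (g \<otimes> a) \<longleftrightarrow> P g"
        "\<forall>g\<in>carrier G. P (g \<otimes> b) \<longleftrightarrow> P g"
      by - (erule CollectE, elim conjE, assumption)+
    have "P (g \<otimes> (a \<otimes> b)) \<longleftrightarrow> P g" if g: "g \<in> carrier G" for g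
    proof -
      have "P (g \<otimes> a \<otimes> b) \<longleftrightarrow> P g"
        using bspec[OF A(2) m_closed[OF g c(1)]] bspec[OF A(1) g] by simp
      then show ?thesis using g c by (simp add: m_assoc)
    qed
    then show "a \<otimes> b \<in> ?N" by (intro CollectI conjI ballI m_closed c)
  next
    have "\<one> \<in> ?N" by simp
    then show "?N \<noteq> {}" by blast
  qed (rule Collect_restrict)
  moreover have "B \<subseteq> ?N" using assms(1) step by (auto simp: generates_def)
  ultimately have "x \<in> ?N" using assms(4) by (rule generatesD[OF assms(1)])
  then have "P (\<one> \<otimes> x) \<longleftrightarrow> P \<one>" by blast
  then show ?thesis using assms(3,4) by simp
qed

lemma countable_presented_group: "countable X \<Longrightarrow> countable (carrier (presented_group X R))"
  by (auto simp: carrier_presented_group gwords_def)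

section \<open>Amalgamated products\<close>

definition amal_rels where
  "amal_rels G H C \<phi> \<psi> = {relator (gen (Inl x) @ gen (Inl y)) (gen (Inl (x \<otimes>\<^sub>G y))) | x y.
          x \<in> carrier G \<and> y \<in> carrier G}
     \<union> {relator (gen (Inr x) @ gen (Inr y)) (gen (Inr (x \<otimes>\<^sub>H y))) | x y.
          x \<in> carrier H \<and> y \<in> carrier H}
     \<union> {relator (gen (Inl (\<phi> c))) (gen (Inr (\<psi> c))) | c. c \<in> C}"

definition am1 where "am1 G H C \<phi> \<psi> g = pgen (carrier G <+> carrier H) (amal_rels G H C \<phi> \<psi>) (Inl g)"
definition am2 where "am2 G H C \<phi> \<psi> h = pgen (carrier G <+> carrier H) (amal_rels G H C \<phi> \<psi>) (Inr h)"

lemma amalgamated_product_eq: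
  "amalgamated_product G H C \<phi> \<psi> = presented_group (carrier G <+> carrier H) (amal_rels G H C \<phi> \<psi>)"
  by (simp add: amalgamated_product_def amal_rels_def)

lemma group_amalgamated_product: "group (amalgamated_product G H C \<phi> \<psi>)"
  by (simp add: amalgamated_product_eq group_presented_group)

locale amalgam = G: group G + H: group H
  for G :: "('g, 'm) monoid_scheme" and H :: "('h, 'n) monoid_scheme"
    and C :: "'c set" and \<phi> :: "'c \<Rightarrow> 'g" and \<psi> :: "'c \<Rightarrow> 'h" +
  assumes phi: "\<phi> ` C \<subseteq> carrier G" and psi: "\<psi> ` C \<subseteq> carrier H"
begin

abbreviation "P \<equiv> amalgamated_product G H C \<phi> \<psi>"
abbreviation "i1 \<equiv> am1 G H C \<phi> \<psi>"
abbreviation "i2 \<equiv> am2 G H C \<phi> \<psi>"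

sublocale P: group P by (rule group_amalgamated_product)

lemma i1_hom: "i1 \<in> hom G P"
proof (rule homI)
  fix x y assume xy: "x \<in> carrier G" "y \<in> carrier G"
  let ?X = "carrier G <+> carrier H" let ?R = "amal_rels G H C \<phi> \<psi>"
  have h: "pgen ?X ?R ` ?X \<subseteq> carrier P" unfolding amalgamated_product_eq by (auto intro!: pgen_closed)
  have "relator (gen (Inl x) @ gen (Inl y)) (gen (Inl (x \<otimes>\<^sub>G y))) \<in> ?R"
    using xy by (auto simp: amal_rels_def)
  from pgen_relator[OF this, of ?X] xy show "i1 (x \<otimes>\<^sub>G y) = i1 x \<otimes>\<^sub>P i1 y"
    using h by (simp add: P.weval_append[OF h] InlI InrI P.weval_gen image_subset_iff am1_def am2_def
      flip: amalgamated_product_eq)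
qed (auto simp: am1_def am2_def amalgamated_product_eq intro!: pgen_closed)

lemma i2_hom: "i2 \<in> hom H P"
proof (rule homI)
  fix x y assume xy: "x \<in> carrier H" "y \<in> carrier H"
  let ?X = "carrier G <+> carrier H" let ?R = "amal_rels G H C \<phi> \<psi>"
  have h: "pgen ?X ?R ` ?X \<subseteq> carrier P" unfolding amalgamated_product_eq by (auto intro!: pgen_closed)
  have "relator (gen (Inr x) @ gen (Inr y)) (gen (Inr (x \<otimes>\<^sub>H y))) \<in> ?R"
    using xy by (auto simp: amal_rels_def)
  from pgen_relator[OF this, of ?X] xy show "i2 (x \<otimes>\<^sub>H y) = i2 x \<otimes>\<^sub>P i2 y"
    using h by (simp add: P.weval_append[OF h] InlI InrI P.weval_gen image_subset_iff am1_def am2_def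
      flip: amalgamated_product_eq)
qed (auto simp: am1_def am2_def amalgamated_product_eq intro!: pgen_closed)

lemma i1_i2: "c \<in> C \<Longrightarrow> i1 (\<phi> c) = i2 (\<psi> c)"
proof -
  assume c: "c \<in> C"
  let ?X = "carrier G <+> carrier H" let ?R = "amal_rels G H C \<phi> \<psi>"
  have h: "pgen ?X ?R ` ?X \<subseteq> carrier P" unfolding amalgamated_product_eq by (auto intro!: pgen_closed)
  have "relator (gen (Inl (\<phi> c))) (gen (Inr (\<psi> c))) \<in> ?R"
    using c by (auto simp: amal_rels_def)
  from pgen_relator[OF this, of ?X] c phi psi h show ?thesis
    by (simp add: InlI InrI P.weval_gen image_subset_iff am1_def am2_def flip: amalgamated_product_eq)
qed

lemma generates_P: "generates P (i1 ` carrier G \<union> i2 ` carrier H)"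
proof -
  have "pgen (carrier G <+> carrier H) (amal_rels G H C \<phi> \<psi>) ` (carrier G <+> carrier H)
      = i1 ` carrier G \<union> i2 ` carrier H"
    by (auto simp: am1_def am2_def image_iff)
  with generates_presented_group[of "carrier G <+> carrier H" "amal_rels G H C \<phi> \<psi>"] show ?thesis
    by (simp add: amalgamated_product_eq)
qed

lemma universal:
  assumes K: "group K" "f \<in> hom G K" "g \<in> hom H K" "\<And>c. c \<in> C \<Longrightarrow> f (\<phi> c) = g (\<psi> c)"
  obtains F where "F \<in> hom P K" "\<And>x. x \<in> carrier G \<Longrightarrow> F (i1 x) = f x"
    "\<And>y. y \<in> carrier H \<Longrightarrow> F (i2 y) = g y"
proof -
  interpret K: group K by fact
  interpret f: group_hom G K f by (rule group_homI[OF G.group_axioms K(1,2)])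
  interpret g: group_hom H K g by (rule group_homI[OF H.group_axioms K(1,3)])
  let ?X = "carrier G <+> carrier H"
  let ?h = "case_sum f g"
  have h: "?h ` ?X \<subseteq> carrier K" by auto
  have r: "weval K ?h r = \<one>\<^sub>K" if "r \<in> amal_rels G H C \<phi> \<psi>" "r \<in> gwords ?X" for r
  proof -
    have ev: "weval K ?h (gen z) = ?h z" if "z \<in> ?X" for z
      using that h by (intro K.weval_gen) blast
    have app: "weval K ?h (u @ v) = weval K ?h u \<otimes>\<^sub>K weval K ?h v" if "u \<in> gwords ?X" "v \<in> gwords ?X" for u v
      by (rule K.weval_append[OF h that])
    show ?thesis
      using that(1) unfolding amal_rels_def
    proof (elim UnE CollectE exE conjE)
      fix x y assume "r = relator (gen (Inl x) @ gen (Inl y)) (gen (Inl (x \<otimes>\<^sub>G y)))"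
        "x \<in> carrier G" "y \<in> carrier G"
      then show ?thesis by (simp add: K.weval_relator[OF h] app ev InlI)
    next
      fix x y assume "r = relator (gen (Inr x) @ gen (Inr y)) (gen (Inr (x \<otimes>\<^sub>H y)))"
        "x \<in> carrier H" "y \<in> carrier H"
      then show ?thesis by (simp add: K.weval_relator[OF h] app ev InrI)
    next
      fix c assume c: "r = relator (gen (Inl (\<phi> c))) (gen (Inr (\<psi> c)))" "c \<in> C"
      then have "Inl (\<phi> c) \<in> ?X" "Inr (\<psi> c) \<in> ?X" using phi psi by auto
      with c K(4)[of c] show ?thesis by (simp only: K.weval_relator[OF h] gwords_gen ev sum.case)
    qed
  qed
  have "\<exists>F\<in>hom P K. \<forall>x\<in>?X. F (pgen ?X (amal_rels G H C \<phi> \<psi>) x) = ?h x"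
    unfolding amalgamated_product_eq by (rule von_dyck[OF K(1) h r])
  then obtain F where F: "F \<in> hom P K" "\<forall>x\<in>?X. F (pgen ?X (amal_rels G H C \<phi> \<psi>) x) = ?h x"
    by (elim bexE)
  show ?thesis
    using bspec[OF F(2) InlI] bspec[OF F(2) InrI] by (intro that[OF F(1)]) (simp_all only: am1_def am2_def sum.case)
qed

lemma countable_P: "countable (carrier G) \<Longrightarrow> countable (carrier H) \<Longrightarrow> countable (carrier P)"
  unfolding amalgamated_product_eq by (rule countable_presented_group) (auto simp: Plus_def)

end

section \<open>Permutation representations\<close>

definition perms :: "('a \<Rightarrow> 'a) monoid" where
  "perms = \<lparr>carrier = {f. bij f}, monoid.mult = (\<circ>), one = id\<rparr>"

lemma perms_simps [simp]: "carrier perms = {f. bij f}" "monoid.mult perms = (\<circ>)" "one perms = id"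
  by (simp_all add: perms_def)

lemma group_perms: "group perms"
proof (rule groupI)
  fix f :: "'a \<Rightarrow> 'a" assume "f \<in> carrier perms"
  then show "\<exists>g\<in>carrier perms. g \<otimes>\<^sub>perms f = \<one>\<^sub>perms"
    by (intro bexI[of _ "inv_into UNIV f"]) (auto simp: bij_imp_bij_inv bij_is_inj)
qed (auto simp: bij_comp comp_assoc)

definition action :: "('g, 'm) monoid_scheme \<Rightarrow> 'x set \<Rightarrow> ('g \<Rightarrow> 'x \<Rightarrow> 'x) \<Rightarrow> bool" where
  "action G X a \<longleftrightarrow> (\<forall>g\<in>carrier G. \<forall>x\<in>X. a g x \<in> X)
    \<and> (\<forall>g\<in>carrier G. \<forall>h\<in>carrier G. \<forall>x\<in>X. a (g \<otimes>\<^sub>G h) x = a g (a h x))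
    \<and> (\<forall>x\<in>X. a \<one>\<^sub>G x = x)"

definition free_action :: "('g, 'm) monoid_scheme \<Rightarrow> 'x set \<Rightarrow> ('g \<Rightarrow> 'x \<Rightarrow> 'x) \<Rightarrow> bool" where
  "free_action G X a \<longleftrightarrow> action G X a \<and> (\<forall>g\<in>carrier G. \<forall>x\<in>X. a g x = x \<longrightarrow> g = \<one>\<^sub>G)"

lemma actionD:
  assumes "action G X a" "x \<in> X" "g \<in> carrier G"
  shows "a g x \<in> X" "h \<in> carrier G \<Longrightarrow> a (g \<otimes>\<^sub>G h) x = a g (a h x)" "a \<one>\<^sub>G x = x"
  using assms by (auto simp: action_def)

lemma action_inv:
  fixes G (structure)
  assumes "group G" "action G X a" "x \<in> X" "g \<in> carrier G"
  shows "a (inv\<^bsub>G\<^esub> g) (a g x) = x" "a g (a (inv\<^bsub>G\<^esub> g) x) = x"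
proof -
  interpret group G by fact
  show "a (inv g) (a g x) = x" "a g (a (inv g) x) = x"
    using actionD[OF assms(2,3)] assms(4) by (metis inv_closed l_inv r_inv)+
qed

text \<open>\<open>perms\<close> consists of bijections of a whole type, whereas the actions below
  live on subsets of one; points outside the subset stay where they are.\<close>

definition extend_id :: "'x set \<Rightarrow> ('x \<Rightarrow> 'x) \<Rightarrow> 'x \<Rightarrow> 'x" where
  "extend_id X f x = (if x \<in> X then f x else x)"

lemma bij_extend_id: "bij_betw f X X \<Longrightarrow> bij (extend_id X f)"
proof -
  assume "bij_betw f X X"
  then have "bij_betw (extend_id X f) X X"
    by (rule bij_betw_cong[THEN iffD1, rotated]) (simp add: extend_id_def)
  moreover have "bij_betw (extend_id X f) (- X) (- X)"
    by (rule bij_betw_cong[THEN iffD1, rotated, OF bij_betw_id[unfolded id_def]]) (simp add: extend_id_def)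
  ultimately have "bij_betw (extend_id X f) (X \<union> - X) (X \<union> - X)"
    by (rule bij_betw_combine) simp
  then show ?thesis by simp
qed

lemma action_bij:
  fixes G (structure)
  assumes "group G" "action G X a" "g \<in> carrier G"
  shows "bij_betw (a g) X X"
proof (rule bij_betw_byWitness[where f' = "a (inv\<^bsub>G\<^esub> g)"])
  interpret group G by fact
  show "\<forall>x\<in>X. a (inv g) (a g x) = x" "\<forall>x\<in>X. a g (a (inv g) x) = x"
    using action_inv[OF assms(1,2)] assms(3) by auto
  show "a g ` X \<subseteq> X" "a (inv g) ` X \<subseteq> X" using actionD(1)[OF assms(2)] assms(3) by auto
qed

lemma action_hom:
  assumes "group G" "action G X a"
  shows "(\<lambda>g. extend_id X (a g)) \<in> hom G perms"
  using action_bij[OF assms] actionD[OF assms(2)]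
  by (intro homI) (auto simp: bij_extend_id fun_eq_iff extend_id_def)

section \<open>Extending equivariant bijections\<close>

text \<open>Every orbit meets \<open>B\<close> in at most one point, so for a free action the values
  of an equivariant map on \<open>B\<close> may be prescribed at will.\<close>

definition separated :: "('g, 'm) monoid_scheme \<Rightarrow> 'x set \<Rightarrow> ('g \<Rightarrow> 'x \<Rightarrow> 'x) \<Rightarrow> 'x set \<Rightarrow> bool" where
  "separated G X a B \<longleftrightarrow> B \<subseteq> X \<and> (\<forall>g\<in>carrier G. \<forall>x\<in>B. a g x \<in> B \<longrightarrow> a g x = x)"

text \<open>The points \<open>p m\<close> lie in distinct orbits, all of which miss
  \<open>B\<close>. This reserve makes the orbits left over infinite in number, so that two
  countable actions can be matched outside the prescribed part.\<close>

definition spare_orbits :: "('g, 'm) monoid_scheme \<Rightarrow> 'x set \<Rightarrow> ('g \<Rightarrow> 'x \<Rightarrow> 'x) \<Rightarrow> 'x set \<Rightarrow> (nat \<Rightarrow> 'x) \<Rightarrow> bool" where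
  "spare_orbits G X a B p \<longleftrightarrow> range p \<subseteq> X \<and>
    (\<forall>g\<in>carrier G. \<forall>m. a g (p m) \<notin> B \<and> (\<forall>n. a g (p m) = p n \<longrightarrow> m = n))"

text \<open>One point is chosen in every orbit, and it is taken from \<open>B\<close> whenever the
  orbit meets \<open>B\<close>. Freeness makes the coordinates of a point with respect to the chosen
  ones unique.\<close>

lemma transversal:
  fixes G (structure)
  assumes G: "group G" and a: "free_action G X a" and B: "separated G X a B"
  obtains I where "B \<subseteq> I" "I \<subseteq> X" "bij_betw (\<lambda>(g, i). a g i) (carrier G \<times> I) X"
proof -
  interpret group G by fact
  have act: "action G X a" using a by (simp add: free_action_def)
  note A = actionD[OF act]
  define orb where "orb x = (\<lambda>g. a g x) ` carrier G" for x
  have orb_sub: "orb x \<subseteq> X" if "x \<in> X" for x using A(1) that by (auto simp: orb_def)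
  have orb_self: "x \<in> orb x" if "x \<in> X" for x
    using A(3)[OF that one_closed] unfolding orb_def by (metis imageI one_closed)
  have orb_eq: "orb y = orb x" if "x \<in> X" "y \<in> orb x" for x y
  proof -
    from that obtain g where g: "g \<in> carrier G" "y = a g x" by (auto simp: orb_def)
    show ?thesis
    proof
      show "orb y \<subseteq> orb x"
      proof
        fix z assume "z \<in> orb y"
        then obtain h where h: "h \<in> carrier G" "z = a h y" unfolding orb_def by (rule imageE)
        then have "z = a (h \<otimes> g) x" using A(2)[OF \<open>x \<in> X\<close> h(1) g(1)] g by simp
        then show "z \<in> orb x" unfolding orb_def using m_closed[OF h(1) g(1)] by (rule image_eqI)
      qed
      show "orb x \<subseteq> orb y"
      proof
        fix z assume "z \<in> orb x"
        then obtain h where h: "h \<in> carrier G" "z = a h x" unfolding orb_def by (rule imageE)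
        have c: "h \<otimes> inv g \<in> carrier G" using h g by simp
        have "z = a (h \<otimes> inv g) y" using A(2)[OF \<open>x \<in> X\<close> c g(1)] g h by (simp add: m_assoc)
        then show "z \<in> orb y" unfolding orb_def using c by (rule image_eqI)
      qed
    qed
  qed
  define rep where "rep x = (if orb x \<inter> B \<noteq> {} then SOME b. b \<in> orb x \<inter> B else SOME y. y \<in> orb x)" for x
  have rep_orb: "rep x \<in> orb x" if "x \<in> X" for x
  proof (cases "orb x \<inter> B = {}")
    case True
    have "(SOME y. y \<in> orb x) \<in> orb x" using orb_self[OF that] by (rule someI)
    then show ?thesis using True by (simp add: rep_def)
  next
    case False
    then have "(SOME b. b \<in> orb x \<inter> B) \<in> orb x \<inter> B" by (rule some_in_eq[THEN iffD2])
    then show ?thesis using False by (simp add: rep_def)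
  qed
  have rep_B: "rep b = b" if "b \<in> B" for b
  proof -
    have bX: "b \<in> X" using that B by (auto simp: separated_def)
    have "orb b \<inter> B = {b}"
      using orb_self[OF bX] that B by (auto simp: separated_def orb_def)
    then show ?thesis by (simp add: rep_def)
  qed
  have rep_rep: "rep y = rep x" if "x \<in> X" "y \<in> orb x" for x y
    using orb_eq[OF that] by (simp add: rep_def)
  define I where "I = rep ` X"
  have IX: "I \<subseteq> X" using rep_orb orb_sub by (auto simp: I_def)
  have rep_I: "rep i = i" if "i \<in> I" for i
    using that rep_rep rep_orb by (auto simp: I_def)
  show thesis
  proof
    show "B \<subseteq> I"
    proof
      fix b assume b: "b \<in> B"
      then have "b \<in> X" using B by (auto simp: separated_def)
      then show "b \<in> I" using rep_B[OF b] unfolding I_def by (metis imageI)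
    qed
    show "I \<subseteq> X" by fact
    show "bij_betw (\<lambda>(g, i). a g i) (carrier G \<times> I) X"
    proof (rule bij_betwI')
      fix p q assume "p \<in> carrier G \<times> I" "q \<in> carrier G \<times> I"
      then obtain g i h j where p: "p = (g, i)" "q = (h, j)" "g \<in> carrier G" "h \<in> carrier G" "i \<in> I" "j \<in> I" by blast
      show "((\<lambda>(g, i). a g i) p = (\<lambda>(g, i). a g i) q) = (p = q)"
      proof
        assume "(\<lambda>(g, i). a g i) p = (\<lambda>(g, i). a g i) q"
        then have e: "a g i = a h j" by (simp add: p)
        have ij: "i \<in> X" "j \<in> X" using p IX by auto
        have "rep (a g i) = i" "rep (a h j) = j"
          using rep_rep[OF ij(1), of "a g i"] rep_rep[OF ij(2), of "a h j"] p rep_I by (auto simp: orb_def)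
        then have "i = j" using e by simp
        moreover have "a (inv h \<otimes> g) i = i"
          using A(2)[OF ij(1), of "inv h" g] action_inv(1)[OF G act ij(2) p(4)] p e \<open>i = j\<close> by simp
        then have "inv h \<otimes> g = \<one>" using a ij(1) m_closed[OF inv_closed[OF p(4)] p(3)]
          unfolding free_action_def by blast
        then have "g = h" using p by (metis inv_closed inv_inv inv_equality)
        ultimately show "p = q" using p by simp
      qed simp
    next
      fix p assume "p \<in> carrier G \<times> I" then show "(\<lambda>(g, i). a g i) p \<in> X" using A(1) IX by auto
    next
      fix x assume x: "x \<in> X"
      from rep_orb[OF x] obtain g where g: "g \<in> carrier G" "rep x = a g x" by (auto simp: orb_def)
      have "x = a (inv g) (rep x)" using action_inv(1)[OF G act x g(1)] g(2) by simp
      then show "\<exists>p\<in>carrier G \<times> I. x = (\<lambda>(g, i). a g i) p"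
        using g(1) imageI[OF x, of rep] by (intro bexI[of _ "(inv g, rep x)"]) (auto simp: I_def)
    qed
  qed
qed

text \<open>The representatives of the orbits of the spare points are translates of these points;
  hence they are pairwise distinct and none of them lies in \<open>B\<close>.\<close>

lemma infinite_transversal:
  fixes G (structure)
  assumes G: "group G" and a: "free_action G X a" and p: "spare_orbits G X a B p"
    and I: "I \<subseteq> X" "bij_betw (\<lambda>(g, i). a g i) (carrier G \<times> I) X"
  shows "infinite (I - B)"
proof -
  interpret group G by fact
  have act: "action G X a" using a by (simp add: free_action_def)
  have "\<exists>g i. g \<in> carrier G \<and> i \<in> I \<and> a g i = p n" for n
  proof -
    have "p n \<in> (\<lambda>(g, i). a g i) ` (carrier G \<times> I)"
      using p I(2) by (auto simp: spare_orbits_def bij_betw_def)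
    then obtain gi where "gi \<in> carrier G \<times> I" "p n = (\<lambda>(g, i). a g i) gi" by (rule imageE)
    then show ?thesis by (intro exI[of _ "fst gi"] exI[of _ "snd gi"]) (simp add: mem_Times_iff split_def)
  qed
  then obtain g i where gi: "\<And>n. g n \<in> carrier G" "\<And>n. i n \<in> I" "\<And>n. a (g n) (i n) = p n" by metis
  have e: "a (inv (g n)) (p n) = i n" for n
    using action_inv(1)[OF G act _ gi(1)] gi I(1) by (metis subsetD)
  have "inj i"
  proof (rule injI)
    fix m n assume mn: "i m = i n"
    have pm: "p m \<in> X" using p by (auto simp: spare_orbits_def)
    have "a (g n \<otimes> inv (g m)) (p m) = p n"
      using actionD(2)[OF act pm, of "g n" "inv (g m)"] gi(1) e mn gi(3) by simp
    then show "m = n" using p gi(1) unfolding spare_orbits_def by (meson inv_closed m_closed)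
  qed
  moreover have "range i \<subseteq> I - B"
    using e p gi unfolding spare_orbits_def by (metis DiffI image_subsetI inv_closed)
  ultimately show ?thesis by (meson infinite_UNIV_nat infinite_iff_countable_subset)
qed

text \<open>The substitute for normal forms: it produces permutations with prescribed relations and
  prescribed values. Transversals through \<open>B\<close> and \<open>D\<close> have countably
  infinite remainders, any bijection of the remainders completes \<beta>, and equivariance extends
  the result from the transversal to all points.\<close>

lemma equivariant_extension:
  fixes G (structure)
  assumes G: "group G" and a: "free_action G X a" and b: "free_action G Y b"
    and cnt: "countable X" "countable Y"
    and B: "separated G X a B" "spare_orbits G X a B p"
    and D: "separated G Y b D" "spare_orbits G Y b D q"
    and bet: "bij_betw \<beta> B D"
  obtains \<theta> where "bij_betw \<theta> X Y" "\<And>g x. g \<in> carrier G \<Longrightarrow> x \<in> X \<Longrightarrow> \<theta> (a g x) = b g (\<theta> x)"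
    "\<And>x. x \<in> B \<Longrightarrow> \<theta> x = \<beta> x"
proof -
  interpret group G by fact
  have act: "action G X a" "action G Y b" using a b by (simp_all add: free_action_def)
  obtain I where I: "B \<subseteq> I" "I \<subseteq> X" "bij_betw (\<lambda>(g, i). a g i) (carrier G \<times> I) X"
    using transversal[OF G a B(1)] .
  obtain J where J: "D \<subseteq> J" "J \<subseteq> Y" "bij_betw (\<lambda>(g, i). b g i) (carrier G \<times> J) Y"
    using transversal[OF G b D(1)] .
  have "countable (I - B)" "countable (J - D)"
    using cnt I(2) J(2) by (meson countable_subset Diff_subset subset_trans)+
  with infinite_transversal[OF G a B(2) I(2,3)] infinite_transversal[OF G b D(2) J(2,3)]
  have "bij_betw (to_nat_on (I - B)) (I - B) UNIV" "bij_betw (from_nat_into (J - D)) UNIV (J - D)"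
    by (auto intro: to_nat_on_infinite bij_betw_from_nat_into)
  from bij_betw_trans[OF this] obtain \<gamma> where \<gamma>: "bij_betw \<gamma> (I - B) (J - D)" by blast
  define \<beta>' where "\<beta>' i = (if i \<in> B then \<beta> i else \<gamma> i)" for i
  have "bij_betw \<beta>' B D" using bet by (rule bij_betw_cong[THEN iffD1, rotated]) (simp add: \<beta>'_def)
  moreover have "bij_betw \<beta>' (I - B) (J - D)"
    using \<gamma> by (rule bij_betw_cong[THEN iffD1, rotated]) (simp add: \<beta>'_def)
  ultimately have "bij_betw \<beta>' (B \<union> (I - B)) (D \<union> (J - D))" by (rule bij_betw_combine) auto
  then have bb: "bij_betw \<beta>' I J" using I(1) J(1) by (simp add: Un_absorb1)
  let ?u = "\<lambda>(g, i). a g i" let ?v = "\<lambda>(g, i). b g i"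
  let ?w = "map_prod id \<beta>'"
  have w: "bij_betw ?w (carrier G \<times> I) (carrier G \<times> J)"
    by (rule bij_betw_map_prod[OF bij_betw_id bb])
  define \<theta> where "\<theta> = ?v \<circ> ?w \<circ> inv_into (carrier G \<times> I) ?u"
  have "bij_betw \<theta> X Y"
    unfolding \<theta>_def by (intro bij_betw_trans[OF bij_betw_inv_into[OF I(3)]] bij_betw_trans[OF w J(3)])
  moreover have th: "\<theta> (a g i) = b g (\<beta>' i)" if "g \<in> carrier G" "i \<in> I" for g i
  proof -
    have "inv_into (carrier G \<times> I) ?u (?u (g, i)) = (g, i)"
      using I(3) that by (intro inv_into_f_f) (auto simp: bij_betw_def)
    then show ?thesis by (simp add: \<theta>_def)
  qed
  moreover have "\<theta> (a g x) = b g (\<theta> x)" if "g \<in> carrier G" "x \<in> X" for g x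
  proof -
    have "x \<in> ?u ` (carrier G \<times> I)" using that I(3) by (simp add: bij_betw_def)
    then obtain hi where "hi \<in> carrier G \<times> I" "x = ?u hi" by (rule imageE)
    then obtain h i where hi: "h \<in> carrier G" "i \<in> I" "x = a h i" by (cases hi) auto
    have iX: "i \<in> X" "\<beta>' i \<in> Y" using hi I(2) J(2) bb by (auto simp: bij_betw_def)
    have "a g x = a (g \<otimes> h) i" using actionD(2)[OF act(1) iX(1)] that hi by simp
    then show ?thesis using th hi that actionD(2)[OF act(2) iX(2)] by simp
  qed
  moreover have "\<theta> x = \<beta> x" if "x \<in> B" for x
  proof -
    have x: "x \<in> I" "x \<in> X" "\<beta>' x \<in> Y" using that I J(2) bb by (auto simp: bij_betw_def)
    have "\<theta> x = \<beta>' x" using th[OF one_closed x(1)] actionD(3)[OF act(1) x(2) one_closed] actionD(3)[OF act(2) x(3) one_closed] by simp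
    then show ?thesis using that by (simp add: \<beta>'_def)
  qed
  ultimately show thesis using that by blast
qed

section \<open>Derivations into dual permutation modules\<close>

definition total_action :: "('p, 'm) monoid_scheme \<Rightarrow> ('p \<Rightarrow> 'x \<Rightarrow> 'x) \<Rightarrow> bool" where
  "total_action P act \<longleftrightarrow> (\<forall>p\<in>carrier P. \<forall>q\<in>carrier P. \<forall>x. act (p \<otimes>\<^sub>P q) x = act p (act q x))
    \<and> (\<forall>x. act \<one>\<^sub>P x = x)"

definition additive_functional :: "(('x \<Rightarrow> 'r::ab_group_add) \<Rightarrow> 'r) \<Rightarrow> bool" where
  "additive_functional m \<longleftrightarrow> (\<forall>k k'. m (\<lambda>x. k x + k' x) = m k + m k')"

text \<open>A crossed homomorphism into functionals on functions. A point \<open>x\<close> of the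
  permutation module is represented by evaluation at \<open>x\<close>, so that \<open>T g k\<close>
  is the pairing of a combination of points with a function \<open>k\<close>.\<close>

definition derivation ::
    "('p, 'm) monoid_scheme \<Rightarrow> ('p \<Rightarrow> 'x \<Rightarrow> 'x) \<Rightarrow> ('p \<Rightarrow> ('x \<Rightarrow> 'r::ab_group_add) \<Rightarrow> 'r) \<Rightarrow> bool" where
  "derivation P act T \<longleftrightarrow> (\<forall>g\<in>carrier P. additive_functional (T g)) \<and>
    (\<forall>g\<in>carrier P. \<forall>h\<in>carrier P. \<forall>k. T (g \<otimes>\<^sub>P h) k = T g k + T h (\<lambda>x. k (act g x)))"

text \<open>The semidirect product of the functionals with \<open>P\<close>. Derivations are its
  homomorphic sections, which is why presentations and universal properties can construct
  them.\<close>

definition derivation_group ::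
    "('p, 'm) monoid_scheme \<Rightarrow> ('p \<Rightarrow> 'x \<Rightarrow> 'x) \<Rightarrow> ((('x \<Rightarrow> 'r::ab_group_add) \<Rightarrow> 'r) \<times> 'p) monoid" where
  "derivation_group P act = \<lparr>carrier = {(m, p). additive_functional m \<and> p \<in> carrier P},
    monoid.mult = (\<lambda>(m, p) (m', p'). (\<lambda>k. m k + m' (\<lambda>x. k (act p x)), p \<otimes>\<^sub>P p')),
    one = (\<lambda>k. 0, \<one>\<^sub>P)\<rparr>"

lemma derivation_group_simps [simp]:
  "(m, p) \<in> carrier (derivation_group P act) \<longleftrightarrow> additive_functional m \<and> p \<in> carrier P"
  "(m, p) \<otimes>\<^bsub>derivation_group P act\<^esub> (m', p') = (\<lambda>k. m k + m' (\<lambda>x. k (act p x)), p \<otimes>\<^sub>P p')"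
  "\<one>\<^bsub>derivation_group P act\<^esub> = (\<lambda>k. 0, \<one>\<^sub>P)"
  by (simp_all add: derivation_group_def)

lemma group_derivation_group:
  fixes P (structure)
  assumes "group P" "total_action P act"
  shows "group (derivation_group P act :: ((('x \<Rightarrow> 'r::ab_group_add) \<Rightarrow> 'r) \<times> 'p) monoid)"
proof -
  interpret group P by fact
  let ?D = "derivation_group P act :: ((('x \<Rightarrow> 'r) \<Rightarrow> 'r) \<times> 'p) monoid"
  have act: "act (p \<otimes>\<^sub>P q) x = act p (act q x)" "act \<one>\<^sub>P x = x" if "p \<in> carrier P" "q \<in> carrier P" for p q x
    using assms(2) that by (auto simp: total_action_def)
  show ?thesis
  proof (rule groupI)
    show "x \<otimes>\<^sub>?D y \<in> carrier ?D" if "x \<in> carrier ?D" "y \<in> carrier ?D" for x y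
      using that by (cases x; cases y) (simp add: additive_functional_def add_ac)
    show "x \<otimes>\<^sub>?D y \<otimes>\<^sub>?D z = x \<otimes>\<^sub>?D (y \<otimes>\<^sub>?D z)"
      if "x \<in> carrier ?D" "y \<in> carrier ?D" "z \<in> carrier ?D" for x y z
      using that by (cases x; cases y; cases z) (simp add: act m_assoc add.assoc)
    show "\<one>\<^sub>?D \<otimes>\<^sub>?D x = x" if "x \<in> carrier ?D" for x
      using that act(2)[OF one_closed one_closed] by (cases x) simp
    show "\<exists>y\<in>carrier ?D. y \<otimes>\<^sub>?D x = \<one>\<^sub>?D" if "x \<in> carrier ?D" for x
    proof -
      obtain m p where x: "x = (m, p)" "additive_functional m" "p \<in> carrier P" using \<open>x \<in> carrier ?D\<close> by (cases x) auto
      show ?thesis using x by (intro bexI[of _ "(\<lambda>k. - m (\<lambda>x. k (act (inv p) x)), inv p)"]) (auto simp: additive_functional_def)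
    qed
  qed (simp add: additive_functional_def)
qed

lemma derivation_from_hom:
  assumes "F \<in> hom P (derivation_group P act)" "\<And>p. p \<in> carrier P \<Longrightarrow> snd (F p) = p"
  shows "derivation P act (\<lambda>p. fst (F p))"
  unfolding derivation_def
proof (intro conjI ballI allI)
  have F: "F p = (fst (F p), p)" if "p \<in> carrier P" for p using assms(2)[OF that] by (metis prod.collapse)
  fix p assume p: "p \<in> carrier P"
  then have "F p \<in> carrier (derivation_group P act)" using assms(1) by (auto simp: hom_def)
  then show "additive_functional (fst (F p))" using F[OF p] by (metis derivation_group_simps(1))
  fix q k assume q: "q \<in> carrier P"
  have "F (p \<otimes>\<^sub>P q) = (fst (F p), p) \<otimes>\<^bsub>derivation_group P act\<^esub> (fst (F q), q)"
    using assms(1) p q F[OF p] F[OF q] by (simp add: hom_def)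
  then show "fst (F (p \<otimes>\<^sub>P q)) k = fst (F p) k + fst (F q) (\<lambda>x. k (act p x))" by simp
qed

lemma snd_derivation_hom: "snd \<in> hom (derivation_group P act) P"
  by (rule homI) auto

text \<open>Fox calculus in general form: values on generators extend once all relators are trivial
  in the semidirect product. The second coordinate of the resulting homomorphism fixes the
  generators and is therefore the identity.\<close>

lemma presentation_derivation:
  fixes \<delta> :: "'x \<Rightarrow> ('y \<Rightarrow> 'r::ab_group_add) \<Rightarrow> 'r"
  assumes act: "total_action (presented_group X R) act"
    and \<delta>: "\<And>x. x \<in> X \<Longrightarrow> additive_functional (\<delta> x)"
    and rel: "\<And>r. r \<in> R \<Longrightarrow> r \<in> gwords X \<Longrightarrow>
      weval (derivation_group (presented_group X R) act) (\<lambda>x. (\<delta> x, pgen X R x)) r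
        = \<one>\<^bsub>derivation_group (presented_group X R) act\<^esub>"
  obtains T where "derivation (presented_group X R) act T" "\<And>x. x \<in> X \<Longrightarrow> T (pgen X R x) = \<delta> x"
proof -
  let ?P = "presented_group X R"
  let ?D = "derivation_group ?P act :: ((('y \<Rightarrow> 'r) \<Rightarrow> 'r) \<times> 'x gword set) monoid"
  interpret P: group ?P by (rule group_presented_group)
  have D: "group ?D" by (rule group_derivation_group[OF P.group_axioms act])
  have "\<exists>f\<in>hom ?P ?D. \<forall>x\<in>X. f (pgen X R x) = (\<delta> x, pgen X R x)"
    by (rule von_dyck[OF D _ rel]) (auto simp: \<delta> pgen_closed)
  then obtain F where F: "F \<in> hom ?P ?D" "\<forall>x\<in>X. F (pgen X R x) = (\<delta> x, pgen X R x)" by blast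
  have "(snd \<circ> F) p = id p" if "p \<in> carrier ?P" for p
  proof (rule hom_eq_on_generators[where f = "snd \<circ> F" and g = id, OF generates_presented_group P.group_axioms P.group_axioms])
    show "snd \<circ> F \<in> hom ?P ?P" by (rule hom_compose[OF F(1) snd_derivation_hom])
    show "id \<in> hom ?P ?P" by (rule homI) auto
  qed (use F(2) that in auto)
  then have "derivation ?P act (\<lambda>p. fst (F p))" by (intro derivation_from_hom[OF F(1)]) simp
  then show thesis by (rule that) (simp add: F(2))
qed

lemma derivation_one:
  assumes "group P" "total_action P act" "derivation P act T"
  shows "T \<one>\<^sub>P k = 0"
proof -
  interpret group P by (rule assms(1))
  have "T (\<one>\<^sub>P \<otimes>\<^sub>P \<one>\<^sub>P) k = T \<one>\<^sub>P k + T \<one>\<^sub>P (\<lambda>x. k (act \<one>\<^sub>P x))"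
    using assms(3) one_closed unfolding derivation_def by blast
  then show ?thesis using assms(2) by (simp add: total_action_def)
qed

section \<open>Left cosets\<close>

definition lcosets :: "('p, 'm) monoid_scheme \<Rightarrow> 'p set \<Rightarrow> 'p set set" where
  "lcosets P C = (\<lambda>x. x <#\<^bsub>P\<^esub> C) ` carrier P"

text \<open>The functions paired with a derivation are defined on all sets, so the action on cosets
  is made total by letting it fix every other set.\<close>

definition lact :: "('p, 'm) monoid_scheme \<Rightarrow> 'p set \<Rightarrow> 'p \<Rightarrow> 'p set \<Rightarrow> 'p set" where
  "lact P C p X = (if X \<in> lcosets P C then p <#\<^bsub>P\<^esub> X else X)"

context group begin

lemma lact_coset: "subgroup C G \<Longrightarrow> p \<in> carrier G \<Longrightarrow> x \<in> carrier G \<Longrightarrow> lact G C p (x <# C) = (p \<otimes> x) <# C"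
  by (simp add: lact_def lcosets_def lcos_m_assoc subgroup.subset)

lemma total_action_lact: "subgroup C G \<Longrightarrow> total_action G (lact G C)"
  unfolding total_action_def
proof (intro conjI ballI allI)
  assume C: "subgroup C G"
  fix p q X assume pq: "p \<in> carrier G" "q \<in> carrier G"
  show "lact G C (p \<otimes> q) X = lact G C p (lact G C q X)"
  proof (cases "X \<in> lcosets G C")
    case True
    then obtain x where "x \<in> carrier G" "X = x <# C" by (auto simp: lcosets_def)
    then show ?thesis using C pq by (simp add: lact_coset m_assoc)
  qed (simp add: lact_def)
next
  assume C: "subgroup C G"
  fix X show "lact G C \<one> X = X"
  proof (cases "X \<in> lcosets G C")
    case True
    then obtain x where "x \<in> carrier G" "X = x <# C" by (auto simp: lcosets_def)
    then show ?thesis using C by (simp add: lact_coset)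
  qed (simp add: lact_def)
qed

lemma lcos_eq_iff:
  assumes C: "subgroup C G" and "x \<in> carrier G" "y \<in> carrier G"
  shows "x <# C = y <# C \<longleftrightarrow> (\<exists>c\<in>C. y = x \<otimes> c)"
proof
  assume "x <# C = y <# C"
  moreover have "y \<in> y <# C" using subgroup.one_closed[OF C] assms by (force simp: l_coset_def)
  ultimately show "\<exists>c\<in>C. y = x \<otimes> c" by (auto simp: l_coset_def)
next
  assume "\<exists>c\<in>C. y = x \<otimes> c"
  then obtain c where c: "c \<in> C" "y = x \<otimes> c" by blast
  have cc: "c \<in> carrier G" using subgroup.mem_carrier[OF C c(1)] .
  have "y <# C = x <# (c <# C)" using c assms cc by (simp add: lcos_m_assoc subgroup.subset[OF C])
  moreover have "c <# C = C"
  proof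
    show "c <# C \<subseteq> C" using c subgroup.m_closed[OF C] by (auto simp: l_coset_def)
    show "C \<subseteq> c <# C"
    proof
      fix d assume d: "d \<in> C"
      then have "inv c \<otimes> d \<in> C" using c subgroup.m_closed[OF C] subgroup.m_inv_closed[OF C] by blast
      moreover have "d = c \<otimes> (inv c \<otimes> d)" using d cc subgroup.mem_carrier[OF C] by simp
      ultimately show "d \<in> c <# C" unfolding l_coset_def by blast
    qed
  qed
  ultimately show "x <# C = y <# C" by simp
qed

end

text \<open>A faithful action instead of normal forms. \<open>G\<close> acts on countably many
  copies of itself, and so does \<open>H\<close>. Both are free sets for the amalgamated group with
  countably infinitely many orbits; an equivariant bijection identifies them, after which the two
  actions agree on that group and combine to an action of the amalgam.\<close>

lemma (in amalgam) inclusions_injective: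
  fixes Cg :: "('c, 'k) monoid_scheme"
  assumes Cg: "group Cg" "C = carrier Cg" "\<phi> \<in> hom Cg G" "inj_on \<phi> C" "\<psi> \<in> hom Cg H" "inj_on \<psi> C"
    and cnt: "countable (carrier G)" "countable (carrier H)"
  shows "inj_on i1 (carrier G)" "inj_on i2 (carrier H)"
proof -
  interpret Cg: group Cg by fact
  interpret phi: group_hom Cg G \<phi> by (rule group_homI[OF Cg(1) G.group_axioms Cg(3)])
  interpret psi: group_hom Cg H \<psi> by (rule group_homI[OF Cg(1) H.group_axioms Cg(5)])
  let ?X = "carrier G \<times> (UNIV :: nat set)" let ?Y = "carrier H \<times> (UNIV :: nat set)"
  define a where "a c = (\<lambda>(x, n::nat). (\<phi> c \<otimes>\<^sub>G x, n))" for c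
  define b where "b c = (\<lambda>(x, n::nat). (\<psi> c \<otimes>\<^sub>H x, n))" for c
  have fa: "free_action Cg ?X a"
    using Cg(2,4) phi.hom_one unfolding free_action_def action_def a_def
    by (auto simp: G.m_assoc inj_on_def simp del: phi.hom_one; metis Cg.one_closed phi.hom_one)
  have fb: "free_action Cg ?Y b"
    using Cg(2,6) psi.hom_one unfolding free_action_def action_def b_def
    by (auto simp: H.m_assoc inj_on_def simp del: psi.hom_one; metis Cg.one_closed psi.hom_one)
  \<comment> \<open>No value is prescribed here; the second coordinate alone provides the spare
    orbits.\<close>
  obtain \<theta> where th: "bij_betw \<theta> ?X ?Y" "\<And>c x. c \<in> carrier Cg \<Longrightarrow> x \<in> ?X \<Longrightarrow> \<theta> (a c x) = b c (\<theta> x)"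
  proof (rule equivariant_extension[OF Cg(1) fa fb, where B = "{}" and D = "{}" and \<beta> = undefined
        and p = "\<lambda>n. (\<one>\<^sub>G, n)" and q = "\<lambda>n. (\<one>\<^sub>H, n)"])
    show "countable ?X" "countable ?Y" using cnt by auto
    show "bij_betw undefined {} {}" by (simp add: bij_betw_def)
  qed (auto simp: separated_def spare_orbits_def a_def b_def)
  define \<theta>' where "\<theta>' = inv_into ?X \<theta>"
  have inv: "\<And>x. x \<in> ?X \<Longrightarrow> \<theta>' (\<theta> x) = x" "\<And>y. y \<in> ?Y \<Longrightarrow> \<theta> (\<theta>' y) = y"
    "\<And>x. x \<in> ?X \<Longrightarrow> \<theta> x \<in> ?Y" "\<And>y. y \<in> ?Y \<Longrightarrow> \<theta>' y \<in> ?X"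
    using th(1) bij_betw_inv_into[OF th(1)] unfolding \<theta>'_def
    by (auto simp: bij_betw_inv_into_left bij_betw_inv_into_right bij_betw_apply)
  define ag where "ag g = (\<lambda>(x, n::nat). (g \<otimes>\<^sub>G x, n))" for g
  define ah0 where "ah0 h = (\<lambda>(x, n::nat). (h \<otimes>\<^sub>H x, n))" for h
  \<comment> \<open>Left multiplication by \<open>H\<close>, carried over to the set on which
    \<open>G\<close> acts.\<close>
  define ah where "ah h x = \<theta>' (ah0 h (\<theta> x))" for h x
  have ag: "action G ?X ag" by (auto simp: action_def ag_def G.m_assoc)
  have ah0: "action H ?Y ah0" by (auto simp: action_def ah0_def H.m_assoc)
  have ah: "action H ?X ah"
    unfolding action_def
  proof (intro conjI ballI)
    fix x assume x: "x \<in> ?X"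
    note A = actionD[OF ah0 inv(3)[OF x]]
    show "ah \<one>\<^sub>H x = x" unfolding ah_def using A(3)[OF H.one_closed] inv(1)[OF x] by simp
    fix h assume h: "h \<in> carrier H"
    show "ah h x \<in> ?X" unfolding ah_def by (rule inv(4)[OF A(1)[OF h]])
    fix g assume g: "g \<in> carrier H"
    show "ah (g \<otimes>\<^sub>H h) x = ah g (ah h x)"
      unfolding ah_def using A(2)[OF g h] inv(2)[OF A(1)[OF h]] by simp
  qed
  let ?f = "\<lambda>g. extend_id ?X (ag g)" let ?g = "\<lambda>h. extend_id ?X (ah h)"
  have eq: "?f (\<phi> c) = ?g (\<psi> c)" if "c \<in> C" for c
  proof
    fix x
    have "ag (\<phi> c) x = ah (\<psi> c) x" if x: "x \<in> ?X"
    proof -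
      have "c \<in> carrier Cg" using \<open>c \<in> C\<close> Cg(2) by simp
      moreover have "action Cg ?X a" using fa by (simp only: free_action_def)
      ultimately have "a c x = \<theta>' (b c (\<theta> x))" using inv(1)[OF actionD(1)[OF _ x], of Cg a c] th(2)[OF _ x, of c] by simp
      then show ?thesis by (simp add: ah_def a_def b_def ag_def ah0_def)
    qed
    then show "?f (\<phi> c) x = ?g (\<psi> c) x" by (simp add: extend_id_def)
  qed
  obtain F where F: "F \<in> hom P perms" "\<And>x. x \<in> carrier G \<Longrightarrow> F (i1 x) = ?f x"
    "\<And>y. y \<in> carrier H \<Longrightarrow> F (i2 y) = ?g y"
    using universal[OF group_perms action_hom[OF G.group_axioms ag] action_hom[OF H.group_axioms ah] eq] by blast
  show "inj_on i1 (carrier G)"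
  proof (rule inj_onI)
    fix x y assume xy: "x \<in> carrier G" "y \<in> carrier G" "i1 x = i1 y"
    then have "?f x (\<one>\<^sub>G, 0) = ?f y (\<one>\<^sub>G, 0)" using F(2)[of x] F(2)[of y] by simp
    then show "x = y" using xy by (simp add: extend_id_def ag_def)
  qed
  show "inj_on i2 (carrier H)"
  proof (rule inj_onI)
    fix x y assume xy: "x \<in> carrier H" "y \<in> carrier H" "i2 x = i2 y"
    let ?e = "(\<one>\<^sub>H, 0::nat)"
    have e: "?e \<in> ?Y" by simp
    have "?g x (\<theta>' ?e) = ?g y (\<theta>' ?e)" using F(3)[of x] F(3)[of y] xy by simp
    then have "\<theta>' (ah0 x ?e) = \<theta>' (ah0 y ?e)" using inv(4)[OF e] inv(2)[OF e] by (simp add: extend_id_def ah_def)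
    moreover have "ah0 x ?e \<in> ?Y" "ah0 y ?e \<in> ?Y" using xy by (auto simp: ah0_def)
    ultimately have "ah0 x ?e = ah0 y ?e" using inv(2) by metis
    then show "x = y" using xy by (simp add: ah0_def)
  qed
qed


text \<open>In the Bass-Serre tree \<open>T p\<close> is the signed sum of the edges on the path
  from the vertex of \<open>G\<close> to its translate by \<open>p\<close>. Elements of
  \<open>G\<close> fix that vertex; for \<open>h\<close> in \<open>H\<close> the path runs along the
  base edge and returns along its translate by \<open>h\<close>. The tree itself never has to be
  constructed.\<close>

lemma (in amalgam) amalgam_derivation:
  assumes C: "subgroup (i1 ` \<phi> ` C) P"
  obtains T :: "_ \<Rightarrow> (_ \<Rightarrow> 'r::ab_group_add) \<Rightarrow> 'r" where "derivation P (lact P (i1 ` \<phi> ` C)) T"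
    "\<And>g k. g \<in> carrier G \<Longrightarrow> T (i1 g) k = 0"
    "\<And>h k. h \<in> carrier H \<Longrightarrow> T (i2 h) k = k (i1 ` \<phi> ` C) - k (i2 h <#\<^bsub>P\<^esub> (i1 ` \<phi> ` C))"
proof -
  let ?C = "i1 ` \<phi> ` C" let ?act = "lact P ?C"
  let ?D = "derivation_group P ?act :: (((_ \<Rightarrow> 'r) \<Rightarrow> 'r) \<times> _) monoid"
  have act: "total_action P ?act" by (rule P.total_action_lact[OF C])
  have D: "group ?D" by (rule group_derivation_group[OF P.group_axioms act])
  have i1c: "i1 g \<in> carrier P" if "g \<in> carrier G" for g using hom_in_carrier[OF i1_hom that] .
  have i2c: "i2 g \<in> carrier P" if "g \<in> carrier H" for g using hom_in_carrier[OF i2_hom that] .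
  have base: "?act p ?C = p <#\<^bsub>P\<^esub> ?C" if "p \<in> carrier P" for p
    using P.lact_coset[OF C that P.one_closed] that subgroup.subset[OF C] by (simp add: P.lcos_mult_one)
  have mult: "?act p (q <#\<^bsub>P\<^esub> ?C) = (p \<otimes>\<^sub>P q) <#\<^bsub>P\<^esub> ?C" if "p \<in> carrier P" "q \<in> carrier P" for p q
    by (rule P.lact_coset[OF C that])
  let ?f = "\<lambda>g. (\<lambda>k::_ \<Rightarrow> 'r. 0::'r, i1 g)"
  let ?g = "\<lambda>h. (\<lambda>k::_ \<Rightarrow> 'r. k ?C - k (i2 h <#\<^bsub>P\<^esub> ?C), i2 h)"
  have f: "?f \<in> hom G ?D"
    by (rule homI) (simp_all add: i1c additive_functional_def hom_mult[OF i1_hom])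
  have g: "?g \<in> hom H ?D"
    by (rule homI) (simp_all add: i2c additive_functional_def hom_mult[OF i2_hom] base mult)
  \<comment> \<open>The inner derivation on \<open>H\<close> vanishes on the amalgamated subgroup,
    whose elements fix the base coset.\<close>
  have eq: "?f (\<phi> c) = ?g (\<psi> c)" if "c \<in> C" for c
  proof -
    have "i1 (\<phi> c) \<in> ?C" using that by blast
    then have "i1 (\<phi> c) <#\<^bsub>P\<^esub> ?C = \<one>\<^sub>P <#\<^bsub>P\<^esub> ?C"
      using P.lcos_eq_iff[OF C P.one_closed, of "i1 (\<phi> c)"] subgroup.mem_carrier[OF C] by fastforce
    then show ?thesis using i1_i2[OF that] subgroup.subset[OF C] by (simp add: P.lcos_mult_one)
  qed
  obtain F where F: "F \<in> hom P ?D" "\<And>x. x \<in> carrier G \<Longrightarrow> F (i1 x) = ?f x"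
    "\<And>y. y \<in> carrier H \<Longrightarrow> F (i2 y) = ?g y"
    using universal[OF D f g eq] by blast
  have "(snd \<circ> F) p = id p" if "p \<in> carrier P" for p
  proof (rule hom_eq_on_generators[where f = "snd \<circ> F" and g = id, OF generates_P P.group_axioms P.group_axioms])
    show "snd \<circ> F \<in> hom P P" by (rule hom_compose[OF F(1) snd_derivation_hom])
    show "id \<in> hom P P" by (rule homI) auto
  qed (use F(2,3) that in auto)
  then have "derivation P ?act (\<lambda>p. fst (F p))" by (intro derivation_from_hom[OF F(1)]) simp
  then show thesis by (rule that) (simp_all add: F(2,3))
qed

section \<open>Torsion in amalgamated products and HNN extensions\<close>

lemma torsion_free_primeI:
  fixes G (structure)
  assumes "group G" and p: "\<And>x p. x \<in> carrier G \<Longrightarrow> prime (p::nat) \<Longrightarrow> x [^] p = \<one> \<Longrightarrow> x = \<one>"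
  shows "torsion_free G"
  unfolding torsion_free_def
proof (intro ballI allI impI)
  interpret group G by fact
  fix x and n :: nat assume "x \<in> carrier G" "n > 0" "x [^] n = \<one>"
  then show "x = \<one>"
  proof (induction n arbitrary: x rule: less_induct)
    case (less n)
    show ?case
    proof (cases "n = 1")
      case False
      then obtain q where q: "prime q" "q dvd n" using prime_factor_nat by blast
      then obtain m where m: "n = m * q" by (metis dvd_mult_div_cancel mult.commute)
      have "(x [^] m) [^] q = \<one>" using less.prems m by (simp add: nat_pow_pow)
      then have "x [^] m = \<one>" using p[of "x [^] m" q] q less.prems by simp
      moreover have "m < n" "m > 0" using m less.prems(2) prime_gt_1_nat[OF q(1)] by auto
      ultimately show ?thesis using less.IH[of m x] less.prems(1) by simp
    qed (use less in simp)
  qed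
qed

text \<open>An element of prime order \<open>n\<close> without fixed points permutes the cosets of \<open>V\<close> in cycles of
  length \<open>n\<close>; \<open>\<kappa>\<close> numbers the positions in each cycle.\<close>

lemma (in group) cycle_positions:
  assumes g: "g \<in> carrier G" "prime (n::nat)" "g [^] n = \<one>"
    and V: "subgroup V G" and conj: "\<And>x. x \<in> carrier G \<Longrightarrow> inv x \<otimes> g \<otimes> x \<notin> V"
  obtains \<kappa> :: "'a \<Rightarrow> int" where
    "\<And>x v. x \<in> carrier G \<Longrightarrow> v \<in> V \<Longrightarrow> \<kappa> (x \<otimes> v) = \<kappa> x"
    "\<And>x. x \<in> carrier G \<Longrightarrow> [\<kappa> (g \<otimes> x) = \<kappa> x + 1] (mod int n)"
proof -
  note Vc = subgroup.mem_carrier[OF V]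
  \<comment> \<open>If \<open>n\<close> does not divide \<open>i\<close>, then \<open>g\<close> is a
    power of \<open>g [^] i\<close>, and a conjugate of the latter in \<open>V\<close> would put the
    same conjugate of \<open>g\<close> into \<open>V\<close>.\<close>
  have nconj: "int n dvd i" if "x \<in> carrier G" "inv x \<otimes> g [^] i \<otimes> x \<in> V" for x and i :: int
  proof (rule ccontr)
    assume "\<not> int n dvd i"
    then have "coprime i (int n)"
      using g(2) by (metis coprime_commute prime_imp_coprime prime_nat_int_transfer)
    then obtain u v where uv: "u * i + v * int n = 1"
      by (metis bezout_int coprime_imp_gcd_eq_1)
    have gn: "g [^] (int n) = \<one>" using g(3) by (simp add: int_pow_int)
    have "g = g [^] (u * i + v * int n)" using uv g by simp
    also have "\<dots> = (g [^] i) [^] u \<otimes> (g [^] int n) [^] v"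
      using g(1) by (simp only: int_pow_mult int_pow_pow mult.commute)
    finally have e: "g = (g [^] i) [^] u" using gn g(1) by (simp add: int_pow_one)
    interpret c: group_hom G G "\<lambda>y. inv x \<otimes> y \<otimes> x"
      by (rule group_homI[OF group_axioms group_axioms]) (use \<open>x \<in> carrier G\<close> in \<open>auto intro!: homI simp: m_assoc\<close>)
    have pwi: "(inv x \<otimes> y \<otimes> x) [^] (m::int) = inv x \<otimes> y [^] m \<otimes> x" if "y \<in> carrier G" for y m
      using c.hom_int_pow[OF that, of m] by simp
    have "(inv x \<otimes> g [^] i \<otimes> x) [^] u \<in> V"
      using that(2) subgroup.m_closed[OF V] subgroup.m_inv_closed[OF V] subgroup.one_closed[OF V]
      by (metis V subgroup_int_pow_closed)
    then have "inv x \<otimes> g \<otimes> x \<in> V" using e pwi[of "g [^] i" u] g by simp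
    then show False using conj that(1) by blast
  qed
  \<comment> \<open>Double cosets of the powers of \<open>g\<close> and of \<open>V\<close>. With a
    representative \<rho> in each, \<kappa> is the exponent of \<open>g\<close> in the expression of
    \<open>x\<close> through \<rho>; \<open>nconj\<close> makes it unique modulo
    \<open>n\<close>.\<close>
  define dc where "dc x = {g [^] (i::int) \<otimes> x \<otimes> v | i v. v \<in> V}" for x
  have dc_self: "x \<in> dc x" if "x \<in> carrier G" for x
    unfolding dc_def using that subgroup.one_closed[OF V] by (intro CollectI exI[of _ "0::int"] exI[of _ \<one>]) simp
  have dc_sub: "dc y \<subseteq> dc x" if "x \<in> carrier G" "y \<in> dc x" for x y
  proof
    fix z assume "z \<in> dc y"
    then obtain j w where z: "z = g [^] (j::int) \<otimes> y \<otimes> w" "w \<in> V" unfolding dc_def by blast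
    obtain i v where y: "y = g [^] (i::int) \<otimes> x \<otimes> v" "v \<in> V" using \<open>y \<in> dc x\<close> unfolding dc_def by blast
    have "z = g [^] (j + i) \<otimes> x \<otimes> (v \<otimes> w)"
      using z y that(1) g(1) Vc by (simp add: int_pow_mult m_assoc)
    then show "z \<in> dc x" unfolding dc_def using z y subgroup.m_closed[OF V] by blast
  qed
  have dc_sym: "x \<in> dc y" if "x \<in> carrier G" "y \<in> dc x" for x y
  proof -
    obtain i v where y: "y = g [^] (i::int) \<otimes> x \<otimes> v" "v \<in> V" using \<open>y \<in> dc x\<close> unfolding dc_def by blast
    have "x = g [^] (- i) \<otimes> y \<otimes> inv v"
      using y that(1) g(1) Vc[OF y(2)] by (simp add: int_pow_neg m_assoc)
    then show ?thesis unfolding dc_def using y subgroup.m_inv_closed[OF V] by blast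
  qed
  have dcc: "dc x \<subseteq> carrier G" if "x \<in> carrier G" for x using that g(1) Vc by (auto simp: dc_def)
  have dc_eq: "dc y = dc x" if "x \<in> carrier G" "y \<in> dc x" for x y
    using dc_sub dc_sym that dcc by (meson subset_antisym subsetD)
  define \<rho> where "\<rho> x = (SOME y. y \<in> dc x)" for x
  have rho: "\<rho> x \<in> dc x" if "x \<in> carrier G" for x
    unfolding \<rho>_def using dc_self[OF that] by (rule someI)
  define E where "E x = {i::int. \<exists>v\<in>V. x = g [^] i \<otimes> \<rho> x \<otimes> v}" for x
  define \<kappa> where "\<kappa> x = (SOME i. i \<in> E x)" for x
  have E_ne: "E x \<noteq> {}" if "x \<in> carrier G" for x
    using dc_sym[OF that rho[OF that]] by (auto simp: E_def dc_def)
  have kE: "\<kappa> x \<in> E x" if "x \<in> carrier G" for x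
    unfolding \<kappa>_def using E_ne[OF that] by (rule some_in_eq[THEN iffD2])
  have E_cong: "[i = j] (mod int n)" if x: "x \<in> carrier G" "i \<in> E x" "j \<in> E x" for x i j
  proof -
    obtain v w where vw: "v \<in> V" "w \<in> V" "x = g [^] i \<otimes> \<rho> x \<otimes> v" "x = g [^] j \<otimes> \<rho> x \<otimes> w"
      using x by (auto simp: E_def)
    have r: "\<rho> x \<in> carrier G" using rho[OF x(1)] dcc[OF x(1)] by blast
    have "g [^] i \<otimes> \<rho> x \<otimes> v = g [^] j \<otimes> \<rho> x \<otimes> w" using vw by simp
    then have "inv (\<rho> x) \<otimes> inv (g [^] j) \<otimes> (g [^] i \<otimes> \<rho> x \<otimes> v) \<otimes> inv v = inv (\<rho> x) \<otimes> inv (g [^] j) \<otimes> (g [^] j \<otimes> \<rho> x \<otimes> w) \<otimes> inv v"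
      by simp
    then have "inv (\<rho> x) \<otimes> (inv (g [^] j) \<otimes> g [^] i) \<otimes> \<rho> x = w \<otimes> inv v"
      using r g(1) Vc[OF vw(1)] Vc[OF vw(2)] by (simp add: m_assoc)
    moreover have "inv (g [^] j) \<otimes> g [^] i = g [^] (i - j)"
      using g(1) by (metis add.commute add_uminus_conv_diff int_pow_mult int_pow_neg)
    ultimately have "inv (\<rho> x) \<otimes> g [^] (i - j) \<otimes> \<rho> x \<in> V"
      using vw subgroup.m_closed[OF V] subgroup.m_inv_closed[OF V] by simp
    then show ?thesis using nconj[OF r] by (simp add: cong_iff_dvd_diff)
  qed
  show thesis
  proof
    fix x v assume x: "x \<in> carrier G" and v: "v \<in> V"
    have "x \<otimes> v \<in> dc x"
      unfolding dc_def using x v by (intro CollectI exI[of _ "0::int"] exI[of _ v]) simp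
    then have r: "\<rho> (x \<otimes> v) = \<rho> x" using dc_eq[OF x] by (simp add: \<rho>_def)
    have rc: "\<rho> x \<in> carrier G" using rho[OF x] dcc[OF x] by blast
    \<comment> \<open>The sets of admissible exponents coincide, so the choice operator gives equal
      positions, not merely congruent ones.\<close>
    have "i \<in> E (x \<otimes> v) \<longleftrightarrow> i \<in> E x" for i
    proof
      assume "i \<in> E (x \<otimes> v)"
      then obtain w where w: "w \<in> V" "x \<otimes> v = g [^] i \<otimes> \<rho> x \<otimes> w" by (auto simp: E_def r)
      then have "x = g [^] i \<otimes> \<rho> x \<otimes> (w \<otimes> inv v)"
        using x Vc[OF v] Vc[OF w(1)] rc g(1) by (metis inv_solve_right m_assoc m_closed int_pow_closed inv_closed)
      then show "i \<in> E x" unfolding E_def using w v subgroup.m_closed[OF V] subgroup.m_inv_closed[OF V] by blast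
    next
      assume "i \<in> E x"
      then obtain w where w: "w \<in> V" "x = g [^] i \<otimes> \<rho> x \<otimes> w" by (auto simp: E_def)
      then have "x \<otimes> v = g [^] i \<otimes> \<rho> x \<otimes> (w \<otimes> v)"
        using x Vc[OF v] Vc[OF w(1)] rc g(1) by (metis m_assoc m_closed int_pow_closed)
      then show "i \<in> E (x \<otimes> v)" unfolding E_def r using w v subgroup.m_closed[OF V] by blast
    qed
    then show "\<kappa> (x \<otimes> v) = \<kappa> x" by (simp add: \<kappa>_def)
  next
    fix x assume x: "x \<in> carrier G"
    have gx: "g \<otimes> x \<in> dc x"
      unfolding dc_def using x g subgroup.one_closed[OF V] by (intro CollectI exI[of _ "1::int"] exI[of _ \<one>]) simp
    then have r: "\<rho> (g \<otimes> x) = \<rho> x" using dc_eq[OF x] by (simp add: \<rho>_def)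
    have rc: "\<rho> x \<in> carrier G" using rho[OF x] dcc[OF x] by blast
    from kE[OF x] obtain v where v: "v \<in> V" "x = g [^] \<kappa> x \<otimes> \<rho> x \<otimes> v" by (auto simp: E_def)
    have "g \<otimes> x = g \<otimes> (g [^] \<kappa> x \<otimes> \<rho> x \<otimes> v)" using v(2) by simp
    also have "\<dots> = g [^] (1 + \<kappa> x) \<otimes> \<rho> x \<otimes> v"
      using x rc Vc[OF v(1)] g(1) by (simp only: int_pow_mult int_pow_1 m_assoc m_closed int_pow_closed)
    finally have "\<kappa> x + 1 \<in> E (g \<otimes> x)" unfolding E_def r using v(1) by (auto simp: add.commute)
    then show "[\<kappa> (g \<otimes> x) = \<kappa> x + 1] (mod int n)" using E_cong[OF _ kE] x g by simp
  qed
qed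

text \<open>On an invariant \<open>k\<close> the values along the powers of \<open>g\<close> add up,
  so \<open>n\<close> times the integer \<open>T g k\<close> is zero and \<open>T g k\<close>
  vanishes. The positions \<kappa> demand that it be 1 modulo \<open>n\<close>.\<close>

lemma torsion_contradiction:
  fixes P (structure) and k :: "'x \<Rightarrow> int"
  assumes P: "group P" "total_action P act" "derivation P act T"
    and g: "g \<in> carrier P" "prime (n::nat)" "g [^] n = \<one>" and k: "\<And>x. k (act g x) = k x"
    and \<kappa>: "[T g k = \<kappa> g - \<kappa> \<one>] (mod int n)" "[\<kappa> g = \<kappa> \<one> + 1] (mod int n)"
  shows False
proof -
  interpret group P by fact
  have "T (g [^] j) k = int j * T g k" for j :: nat
  proof (induction j)
    case (Suc j)
    have "T (g [^] Suc j) k = T (g \<otimes> g [^] j) k" using g(1) by (simp only: nat_pow_Suc2)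
    also have "\<dots> = T g k + T (g [^] j) (\<lambda>x. k (act g x))" using P(3) g(1) by (simp add: derivation_def)
    finally show ?case using Suc by (simp add: k algebra_simps)
  qed (use derivation_one[OF P] in simp)
  from this[of n] have "int n * T g k = 0" using derivation_one[OF P] g(3) by simp
  then have "T g k = 0" using g(2) by (simp add: prime_gt_0_nat)
  then have "[0 = \<kappa> g - \<kappa> \<one>] (mod int n)" using \<kappa>(1) by simp
  moreover have "[\<kappa> g - \<kappa> \<one> = 1] (mod int n)"
    using cong_diff[OF \<kappa>(2) cong_refl, of "\<kappa> \<one>"] by simp
  ultimately have "[0 = 1] (mod int n)" by (rule cong_trans)
  then show False using prime_gt_1_nat[OF g(2)] by (auto simp: cong_def)
qed

text \<open>Read contrapositively, this supplies the fixed-point freeness that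
  \<open>cycle_positions\<close> asks for: a nontrivial element of prime order is not conjugate into
  a torsion-free vertex group.\<close>

lemma torsion_conjugate:
  fixes G (structure)
  assumes G: "group G" and inj: "inj_on h (carrier G)" "h \<in> hom G P" "group P" and tf: "torsion_free G"
    and g: "g \<in> carrier P" "prime (n::nat)" "g [^]\<^sub>P n = \<one>\<^sub>P"
    and x: "x \<in> carrier P" "inv\<^bsub>P\<^esub> x \<otimes>\<^sub>P g \<otimes>\<^sub>P x \<in> h ` carrier G"
  shows "g = \<one>\<^sub>P"
proof -
  interpret P: group P by fact
  interpret h: group_hom G P h by (rule group_homI[OF G inj(3,2)])
  obtain y where y: "y \<in> carrier G" "inv\<^bsub>P\<^esub> x \<otimes>\<^sub>P g \<otimes>\<^sub>P x = h y" using x(2) by blast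
  have "(inv\<^bsub>P\<^esub> x \<otimes>\<^sub>P g \<otimes>\<^sub>P x) [^]\<^sub>P (m::nat) = inv\<^bsub>P\<^esub> x \<otimes>\<^sub>P g [^]\<^sub>P m \<otimes>\<^sub>P x" for m
    by (induction m) (use g x in \<open>simp_all add: P.m_assoc\<close>)
  from this[of n] have "h y [^]\<^sub>P n = \<one>\<^sub>P" using g x y by simp
  then have "h (y [^] n) = h \<one>" using y(1) h.hom_nat_pow[of y n] by simp
  then have "y [^] n = \<one>" by (rule inj_onD[OF inj(1)]) (use y(1) G in \<open>simp_all add: group.is_monoid monoid.nat_pow_closed\<close>)
  then have "y = \<one>" using tf y(1) g(2) prime_gt_0_nat unfolding torsion_free_def by blast
  then have e: "inv\<^bsub>P\<^esub> x \<otimes>\<^sub>P g \<otimes>\<^sub>P x = \<one>\<^sub>P" using y by simp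
  have "g = x \<otimes>\<^sub>P (inv\<^bsub>P\<^esub> x \<otimes>\<^sub>P g \<otimes>\<^sub>P x) \<otimes>\<^sub>P inv\<^bsub>P\<^esub> x" using g x by (simp add: P.m_assoc)
  then show ?thesis using e x by simp
qed

definition coset_fun :: "('p, 'm) monoid_scheme \<Rightarrow> 'p set \<Rightarrow> ('p \<Rightarrow> int) \<Rightarrow> 'p set \<Rightarrow> int" where
  "coset_fun P C f X = (if X \<in> lcosets P C then f (SOME x. x \<in> carrier P \<and> X = x <#\<^bsub>P\<^esub> C) else 0)"

lemma (in group) coset_fun:
  assumes C: "subgroup C G" and f: "\<And>x c. x \<in> carrier G \<Longrightarrow> c \<in> C \<Longrightarrow> f (x \<otimes> c) = f x" and x: "x \<in> carrier G"
  shows "coset_fun G C f (x <# C) = f x"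
proof -
  let ?y = "SOME y. y \<in> carrier G \<and> x <# C = y <# C"
  have "?y \<in> carrier G \<and> x <# C = ?y <# C" by (rule someI[of _ x]) (simp add: x)
  then have "f ?y = f x" using lcos_eq_iff[OF C x, of ?y] f[OF x] by auto
  then show ?thesis using x by (auto simp: coset_fun_def lcosets_def)
qed

lemma (in group) coset_fun_lact:
  assumes C: "subgroup C G" and f: "\<And>x c. x \<in> carrier G \<Longrightarrow> c \<in> C \<Longrightarrow> f (x \<otimes> c) = f x"
    and g: "g \<in> carrier G" "\<And>x. x \<in> carrier G \<Longrightarrow> f (g \<otimes> x) = f x"
  shows "coset_fun G C f (lact G C g X) = coset_fun G C f X"
proof (cases "X \<in> lcosets G C")
  case True
  then obtain x where x: "x \<in> carrier G" "X = x <# C" by (auto simp: lcosets_def)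
  then show ?thesis using lact_coset[OF C g(1) x(1)] coset_fun[OF C f x(1)] coset_fun[OF C f, of "g \<otimes> x"] g by simp
qed (simp add: lact_def)

text \<open>An element of prime order would move every vertex of the tree. The positions
  \<open>\<kappa>1\<close> and \<open>\<kappa>2\<close> are potentials on the two kinds of vertices,
  each raised by one modulo the order. Their difference is therefore an invariant function on edges,
  while its sum along the path from 1 to \<open>g\<close> is the gain of
  \<open>\<kappa>1\<close>.\<close>

theorem (in amalgam) torsion_free_amalgam:
  assumes C: "subgroup (i1 ` \<phi> ` C) P" and inj: "inj_on i1 (carrier G)" "inj_on i2 (carrier H)"
    and tf: "torsion_free G" "torsion_free H"
  shows "torsion_free P"
proof (rule torsion_free_primeI[OF P.group_axioms], rule ccontr)
  fix g and n :: nat assume g: "g \<in> carrier P" "prime n" "g [^]\<^sub>P n = \<one>\<^sub>P" "g \<noteq> \<one>\<^sub>P"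
  interpret h1: group_hom G P i1 by (rule group_homI[OF G.group_axioms P.group_axioms i1_hom])
  interpret h2: group_hom H P i2 by (rule group_homI[OF H.group_axioms P.group_axioms i2_hom])
  let ?C = "i1 ` \<phi> ` C"
  have C1: "?C \<subseteq> i1 ` carrier G" using phi by blast
  have C2: "?C \<subseteq> i2 ` carrier H" using psi i1_i2 by (auto simp: image_subset_iff)
  have V: "subgroup (i1 ` carrier G) P" "subgroup (i2 ` carrier H) P"
    by (rule h1.img_is_subgroup h2.img_is_subgroup)+
  obtain \<kappa>1 :: "_ \<Rightarrow> int" where k1: "\<And>x v. x \<in> carrier P \<Longrightarrow> v \<in> i1 ` carrier G \<Longrightarrow> \<kappa>1 (x \<otimes>\<^sub>P v) = \<kappa>1 x"
    "\<And>x. x \<in> carrier P \<Longrightarrow> [\<kappa>1 (g \<otimes>\<^sub>P x) = \<kappa>1 x + 1] (mod int n)"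
    using P.cycle_positions[OF g(1-3) V(1)] torsion_conjugate[OF G.group_axioms inj(1) i1_hom P.group_axioms tf(1) g(1-3)] g(4)
    by metis
  obtain \<kappa>2 :: "_ \<Rightarrow> int" where k2: "\<And>x v. x \<in> carrier P \<Longrightarrow> v \<in> i2 ` carrier H \<Longrightarrow> \<kappa>2 (x \<otimes>\<^sub>P v) = \<kappa>2 x"
    "\<And>x. x \<in> carrier P \<Longrightarrow> [\<kappa>2 (g \<otimes>\<^sub>P x) = \<kappa>2 x + 1] (mod int n)"
    using P.cycle_positions[OF g(1-3) V(2)] torsion_conjugate[OF H.group_axioms inj(2) i2_hom P.group_axioms tf(2) g(1-3)] g(4)
    by metis
  let ?act = "lact P ?C"
  obtain T :: "_ \<Rightarrow> (_ \<Rightarrow> int) \<Rightarrow> int" where T: "derivation P ?act T"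
    "\<And>g k. g \<in> carrier G \<Longrightarrow> T (i1 g) k = 0"
    "\<And>h k. h \<in> carrier H \<Longrightarrow> T (i2 h) k = k ?C - k (i2 h <#\<^bsub>P\<^esub> ?C)"
    using amalgam_derivation[OF C, where 'r = int] by blast
  \<comment> \<open>Reducing modulo \<open>n\<close> turns the congruence between the values at
    \<open>x\<close> and at its translate by \<open>g\<close> into an equality, so that
    \<open>k\<close> becomes strictly invariant.\<close>
  define f where "f x = (\<kappa>2 x - \<kappa>1 x) mod int n" for x
  define k where "k = coset_fun P ?C f"
  have f: "f (x \<otimes>\<^sub>P c) = f x" if "x \<in> carrier P" "c \<in> ?C" for x c
    using k1(1)[OF that(1)] k2(1)[OF that(1)] that(2) C1 C2 by (simp add: f_def subset_iff)
  have fg: "f (g \<otimes>\<^sub>P x) = f x" if "x \<in> carrier P" for x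
    using cong_diff[OF k2(2)[OF that] k1(2)[OF that]] by (simp add: f_def cong_def)
  have kx: "k (x <#\<^bsub>P\<^esub> ?C) = f x" if "x \<in> carrier P" for x
    unfolding k_def by (rule P.coset_fun[OF C f that])
  have kinv: "k (?act g X) = k X" for X
    unfolding k_def by (rule P.coset_fun_lact[OF C f g(1) fg])
  have deriv: "T (p \<otimes>\<^sub>P q) k' = T p k' + T q (\<lambda>X. k' (?act p X))" if "p \<in> carrier P" "q \<in> carrier P" for p q k'
    using T(1) that by (simp add: derivation_def)
  have act: "total_action P ?act" by (rule P.total_action_lact[OF C])
  have Tk: "[T p k = \<kappa>1 p - \<kappa>1 \<one>\<^sub>P] (mod int n)" if "p \<in> carrier P" for p
  proof (rule generates_induct[OF generates_P P.group_axioms _ that])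
    show "[T \<one>\<^sub>P k = \<kappa>1 \<one>\<^sub>P - \<kappa>1 \<one>\<^sub>P] (mod int n)"
      using derivation_one[OF P.group_axioms act T(1)] by simp
    fix p b assume p: "p \<in> carrier P" and b: "b \<in> i1 ` carrier G \<union> i2 ` carrier H"
    \<comment> \<open>The path sum telescopes. A factor from \<open>G\<close> changes neither term;
      a factor from \<open>H\<close> leaves \<open>\<kappa>2\<close> fixed, so only the increment of
      \<open>\<kappa>1\<close> survives.\<close>
    have "[T (p \<otimes>\<^sub>P b) k - \<kappa>1 (p \<otimes>\<^sub>P b) = T p k - \<kappa>1 p] (mod int n)"
      using b
    proof
      assume "b \<in> i1 ` carrier G"
      then show ?thesis using deriv[OF p] T(2) k1(1)[OF p] by auto
    next
      assume "b \<in> i2 ` carrier H"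
      then obtain h where h: "h \<in> carrier H" "b = i2 h" by blast
      have C0: "?C = \<one>\<^sub>P <#\<^bsub>P\<^esub> ?C" using subgroup.subset[OF C] by (simp add: P.lcos_mult_one)
      have 1: "?act p ?C = p <#\<^bsub>P\<^esub> ?C" using P.lact_coset[OF C p P.one_closed] C0 p by simp
      have 2: "?act p (i2 h <#\<^bsub>P\<^esub> ?C) = (p \<otimes>\<^sub>P i2 h) <#\<^bsub>P\<^esub> ?C" using P.lact_coset[OF C p, of "i2 h"] h by simp
      have "T (p \<otimes>\<^sub>P b) k = T p k + (f p - f (p \<otimes>\<^sub>P b))"
        using deriv[OF p, of b k] T(3)[OF h(1)] h p by (simp add: 1 2 kx)
      moreover have "\<kappa>2 (p \<otimes>\<^sub>P b) = \<kappa>2 p" using k2(1)[OF p, of b] h by blast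
      moreover have "[f p - f (p \<otimes>\<^sub>P b) = (\<kappa>2 p - \<kappa>1 p) - (\<kappa>2 (p \<otimes>\<^sub>P b) - \<kappa>1 (p \<otimes>\<^sub>P b))] (mod int n)"
        unfolding f_def by (intro cong_diff) (simp_all add: cong_def)
      ultimately have "[T (p \<otimes>\<^sub>P b) k = T p k + (\<kappa>1 (p \<otimes>\<^sub>P b) - \<kappa>1 p)] (mod int n)"
        using cong_add[OF cong_refl, of _ _ "int n" "T p k"] by fastforce
      from cong_diff[OF this cong_refl[of "\<kappa>1 (p \<otimes>\<^sub>P b)" "int n"]] show ?thesis by simp
    qed
    from cong_add[OF this cong_refl[of "\<kappa>1 \<one>\<^sub>P" "int n"]]
    have "[T (p \<otimes>\<^sub>P b) k - (\<kappa>1 (p \<otimes>\<^sub>P b) - \<kappa>1 \<one>\<^sub>P) = T p k - (\<kappa>1 p - \<kappa>1 \<one>\<^sub>P)] (mod int n)"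
      by (simp only: diff_diff_eq2 diff_add_eq)
    from cong_dvd_iff[of _ _ "int n", OF this] show "[T (p \<otimes>\<^sub>P b) k = \<kappa>1 (p \<otimes>\<^sub>P b) - \<kappa>1 \<one>\<^sub>P] (mod int n) \<longleftrightarrow> [T p k = \<kappa>1 p - \<kappa>1 \<one>\<^sub>P] (mod int n)"
      by (simp only: cong_iff_dvd_diff)
  qed
  show False
    using torsion_contradiction[where \<kappa> = \<kappa>1 and k = k, OF P.group_axioms act T(1) g(1-3) kinv Tk[OF g(1)]] k1(2)[OF P.one_closed] g(1) by simp
qed

text \<open>The same argument with a single kind of vertex, the cosets of \<open>V\<close>. The
  coset \<open>t <# C\<close> plays the edge from \<open>V\<close> to its translate by
  \<open>t\<close>, so \<open>T\<close> is again a path sum; its existence carries what a normal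
  form theorem would otherwise give.\<close>

theorem torsion_free_HNN:
  fixes P (structure) and T :: "'p \<Rightarrow> ('p set \<Rightarrow> int) \<Rightarrow> int"
  assumes P: "group P" and V: "subgroup V P" and tf: "torsion_free (P\<lparr>carrier := V\<rparr>)"
    and t: "t \<in> carrier P" and C: "subgroup C P" "C \<subseteq> V" "\<And>c. c \<in> C \<Longrightarrow> t \<otimes> c \<otimes> inv t \<in> V"
    and gen: "generates P (insert t V)"
    and T: "derivation P (lact P C) T" "\<And>v k. v \<in> V \<Longrightarrow> T v k = 0" "\<And>k. T t k = k (t <# C)"
  shows "torsion_free P"
proof (rule torsion_free_primeI[OF P], rule ccontr)
  interpret group P by fact
  note Vc = subgroup.mem_carrier[OF V]
  fix g and n :: nat assume g: "g \<in> carrier P" "prime n" "g [^] n = \<one>" "g \<noteq> \<one>"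
  interpret V: group "P\<lparr>carrier := V\<rparr>" by (rule subgroup_imp_group[OF V])
  have "inj_on id (carrier (P\<lparr>carrier := V\<rparr>))" "id \<in> hom (P\<lparr>carrier := V\<rparr>) P"
    using Vc by (auto simp: hom_def)
  from torsion_conjugate[OF V.group_axioms this P tf g(1-3)] g(4)
  have nc: "\<And>x. x \<in> carrier P \<Longrightarrow> inv x \<otimes> g \<otimes> x \<notin> V" by auto
  obtain \<kappa> :: "_ \<Rightarrow> int" where \<kappa>: "\<And>x v. x \<in> carrier P \<Longrightarrow> v \<in> V \<Longrightarrow> \<kappa> (x \<otimes> v) = \<kappa> x"
    "\<And>x. x \<in> carrier P \<Longrightarrow> [\<kappa> (g \<otimes> x) = \<kappa> x + 1] (mod int n)"
    using cycle_positions[OF g(1-3) V nc] by blast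
  let ?act = "lact P C"
  \<comment> \<open>The edge at \<open>x\<close> ends in the vertex of \<open>x\<close> and starts
    in that of \<open>x \<otimes> inv t\<close>. The start depends only on the coset of
    \<open>C\<close> because \<open>t\<close> conjugates \<open>C\<close> into
    \<open>V\<close>.\<close>
  define f where "f x = (\<kappa> x - \<kappa> (x \<otimes> inv t)) mod int n" for x
  define k where "k = coset_fun P C f"
  have f: "f (x \<otimes> c) = f x" if "x \<in> carrier P" "c \<in> C" for x c
  proof -
    have c: "c \<in> carrier P" "c \<in> V" using that C(2) Vc by auto
    have "x \<otimes> c \<otimes> inv t = (x \<otimes> inv t) \<otimes> (t \<otimes> c \<otimes> inv t)"
      using that(1) c t by (simp add: m_assoc)
    then have "\<kappa> (x \<otimes> c \<otimes> inv t) = \<kappa> (x \<otimes> inv t)" using \<kappa>(1)[OF _ C(3)[OF that(2)], of "x \<otimes> inv t"] that(1) t by simp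
    then show ?thesis using \<kappa>(1)[OF that(1) c(2)] by (simp add: f_def)
  qed
  have fg: "f (g \<otimes> x) = f x" if "x \<in> carrier P" for x
    using cong_diff[OF \<kappa>(2)[OF that] \<kappa>(2)[of "x \<otimes> inv t"]] that t g(1) by (simp add: f_def cong_def m_assoc)
  have kx: "k (x <# C) = f x" if "x \<in> carrier P" for x
    unfolding k_def by (rule coset_fun[OF C(1) f that])
  have kinv: "k (?act g X) = k X" for X
    unfolding k_def by (rule coset_fun_lact[OF C(1) f g(1) fg])
  have deriv: "T (p \<otimes> q) k' = T p k' + T q (\<lambda>X. k' (?act p X))" if "p \<in> carrier P" "q \<in> carrier P" for p q k'
    using T(1) that by (simp add: derivation_def)
  have act: "total_action P ?act" by (rule total_action_lact[OF C(1)])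
  have Tk: "[T p k = \<kappa> p - \<kappa> \<one>] (mod int n)" if "p \<in> carrier P" for p
  proof (rule generates_induct[OF gen P _ that])
    show "[T \<one> k = \<kappa> \<one> - \<kappa> \<one>] (mod int n)"
      using derivation_one[OF P act T(1)] by simp
    fix p b assume p: "p \<in> carrier P" and b: "b \<in> insert t V"
    have "[T (p \<otimes> b) k - \<kappa> (p \<otimes> b) = T p k - \<kappa> p] (mod int n)"
    proof (cases "b \<in> V")
      case True
      then show ?thesis using deriv[OF p Vc] T(2) \<kappa>(1)[OF p] by auto
    next
      case False
      then have bt: "b = t" using b by simp
      have "T (p \<otimes> b) k = T p k + f (p \<otimes> b)"
        using deriv[OF p t] T(3) lact_coset[OF C(1) p t] kx[of "p \<otimes> t"] p t bt by simp
      moreover have "[f (p \<otimes> b) = \<kappa> (p \<otimes> b) - \<kappa> p] (mod int n)"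
        using p t bt by (simp add: f_def cong_def m_assoc)
      ultimately have "[T (p \<otimes> b) k = T p k + (\<kappa> (p \<otimes> b) - \<kappa> p)] (mod int n)"
        using cong_add[OF cong_refl, of _ _ "int n" "T p k"] by fastforce
      from cong_diff[OF this cong_refl[of "\<kappa> (p \<otimes> b)" "int n"]] show ?thesis by simp
    qed
    from cong_add[OF this cong_refl[of "\<kappa> \<one>" "int n"]]
    have "[T (p \<otimes> b) k - (\<kappa> (p \<otimes> b) - \<kappa> \<one>) = T p k - (\<kappa> p - \<kappa> \<one>)] (mod int n)"
      by (simp only: diff_diff_eq2 diff_add_eq)
    from cong_dvd_iff[of _ _ "int n", OF this] show "[T (p \<otimes> b) k = \<kappa> (p \<otimes> b) - \<kappa> \<one>] (mod int n) \<longleftrightarrow> [T p k = \<kappa> p - \<kappa> \<one>] (mod int n)"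
      by (simp only: cong_iff_dvd_diff)
  qed
  show False
    using torsion_contradiction[where \<kappa> = \<kappa> and k = k, OF P act T(1) g(1-3) kinv Tk[OF g(1)]] \<kappa>(2)[OF one_closed] g(1) by simp
qed

section \<open>Baumslag--Solitar groups\<close>

lemma torsion_free_inj:
  assumes "group G" "group H" "f \<in> hom G H" "inj_on f (carrier G)" "torsion_free H"
  shows "torsion_free G"
  unfolding torsion_free_def
proof (intro ballI allI impI)
  interpret group_hom G H f by (rule group_homI[OF assms(1-3)])
  fix x and n :: nat assume x: "x \<in> carrier G" "n > 0" "x [^]\<^sub>G n = \<one>\<^sub>G"
  have "f x [^]\<^sub>H n = \<one>\<^sub>H" using x hom_nat_pow[of x n] by simp
  then have "f x = f \<one>\<^sub>G" using assms(5) x unfolding torsion_free_def by simp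
  then show "x = \<one>\<^sub>G" by (rule inj_onD[OF assms(4)]) (use x in auto)
qed

lemma inj_on_homI:
  assumes "group G" "group H" "f \<in> hom G H" "\<And>x. x \<in> carrier G \<Longrightarrow> f x = \<one>\<^sub>H \<Longrightarrow> x = \<one>\<^sub>G"
  shows "inj_on f (carrier G)"
proof -
  interpret group_hom G H f by (rule group_homI[OF assms(1-3)])
  show ?thesis
  proof (rule inj_onI)
    fix x y assume xy: "x \<in> carrier G" "y \<in> carrier G" "f x = f y"
    then have "f (x \<otimes>\<^sub>G inv\<^bsub>G\<^esub> y) = \<one>\<^sub>H" by simp
    then have "x \<otimes>\<^sub>G inv\<^bsub>G\<^esub> y = \<one>\<^sub>G" by (rule assms(4)[rotated]) (use xy in simp)
    then show "x = y" using xy by (metis G.inv_closed G.inv_inv G.inv_equality)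
  qed
qed

definition cyclic :: "('g, 'm) monoid_scheme \<Rightarrow> 'g \<Rightarrow> 'g set" where
  "cyclic G a = range (\<lambda>i::int. a [^]\<^sub>G i)"

lemma (in group) subgroup_cyclic: "a \<in> carrier G \<Longrightarrow> subgroup (cyclic G a) G"
proof (rule subgroupI)
  assume a: "a \<in> carrier G"
  show "cyclic G a \<subseteq> carrier G" using a by (auto simp: cyclic_def)
  show "cyclic G a \<noteq> {}" by (simp add: cyclic_def)
  show "inv x \<in> cyclic G a" if "x \<in> cyclic G a" for x
    using that a by (auto simp: cyclic_def simp flip: int_pow_neg)
  show "x \<otimes> y \<in> cyclic G a" if "x \<in> cyclic G a" "y \<in> cyclic G a" for x y
    using that a by (auto simp: cyclic_def simp flip: int_pow_mult)
qed

lemma (in group) cyclic_self: "a \<in> carrier G \<Longrightarrow> a \<in> cyclic G a"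
  unfolding cyclic_def by (rule image_eqI[of _ _ 1]) auto

lemma (in group) int_pow_eq_one:
  assumes "a \<in> carrier G" "\<And>n::nat. a [^] n = \<one> \<Longrightarrow> n = 0" "a [^] (i::int) = \<one>"
  shows "i = 0"
proof (cases i rule: int_cases2)
  case (nonneg n) then show ?thesis using assms by (simp add: int_pow_int)
next
  case (nonpos n)
  then have "inv (a [^] n) = \<one>" using assms(1,3) by (simp add: int_pow_neg int_pow_int)
  then have "a [^] n = \<one>" using assms(1) by simp
  then show ?thesis using assms(2) nonpos by simp
qed

lemma derivation_zero_subgroup:
  assumes "group P" "total_action P act" "derivation P act T"
  shows "subgroup {p \<in> carrier P. \<forall>k. T p k = 0} P"
proof -
  interpret group P by (rule assms(1))
  have d: "T (g \<otimes>\<^sub>P h) k = T g k + T h (\<lambda>x. k (act g x))" if "g \<in> carrier P" "h \<in> carrier P" for g h k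
    using assms(3) that by (simp add: derivation_def)
  have "\<one>\<^sub>P \<in> {p \<in> carrier P. \<forall>k. T p k = 0}" using derivation_one[OF assms] by simp
  then show ?thesis
  proof (intro subgroupI)
    fix a assume a: "a \<in> {p \<in> carrier P. \<forall>k. T p k = 0}"
    then have ac: "a \<in> carrier P" by simp
    have "T (inv\<^bsub>P\<^esub> a) k = 0" for k
      using d[OF inv_closed[OF ac] ac, of k] a derivation_one[OF assms] ac by simp
    then show "inv\<^bsub>P\<^esub> a \<in> {p \<in> carrier P. \<forall>k. T p k = 0}" using ac by simp
  qed (auto simp: d)
qed

definition bs_rel :: "nat \<Rightarrow> nat \<Rightarrow> nat gword set" where
  "bs_rel m n = {relator (gen 1 @ wpow (gen 0) m @ winv (gen 1)) (wpow (gen 0) n)}"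

definition bs :: "nat \<Rightarrow> nat \<Rightarrow> nat gword set monoid" where
  "bs m n = presented_group {..<2} (bs_rel m n)"

definition bs_a where "bs_a m n = pgen {..<2} (bs_rel m n) 0"
definition bs_t where "bs_t m n = pgen {..<2} (bs_rel m n) 1"

lemma group_bs: "group (bs m n)"
  by (simp add: bs_def group_presented_group)

lemma bs_closed: "bs_a m n \<in> carrier (bs m n)" "bs_t m n \<in> carrier (bs m n)"
  by (simp_all add: bs_def bs_a_def bs_t_def pgen_closed)

lemma generates_bs: "generates (bs m n) {bs_a m n, bs_t m n}"
proof -
  have "{..<2::nat} = {0, 1}" by auto
  then show ?thesis using generates_presented_group[of "{..<2}" "bs_rel m n"]
    by (simp add: bs_def bs_a_def bs_t_def)
qed

lemma bs_relation:
  "bs_t m n \<otimes>\<^bsub>bs m n\<^esub> bs_a m n [^]\<^bsub>bs m n\<^esub> m \<otimes>\<^bsub>bs m n\<^esub> inv\<^bsub>bs m n\<^esub> (bs_t m n) = bs_a m n [^]\<^bsub>bs m n\<^esub> n"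
proof -
  interpret group "bs m n" by (rule group_bs)
  have h: "pgen {..<2} (bs_rel m n) ` {..<2} \<subseteq> carrier (bs m n)" by (auto simp: bs_def pgen_closed)
  have c: "pgen {..<2} (bs_rel m n) 0 \<in> carrier (bs m n)" "pgen {..<2} (bs_rel m n) 1 \<in> carrier (bs m n)"
    using bs_closed by (simp_all add: bs_a_def bs_t_def)
  have "weval (bs m n) (pgen {..<2} (bs_rel m n)) (gen 1 @ wpow (gen 0) m @ winv (gen 1))
      = weval (bs m n) (pgen {..<2} (bs_rel m n)) (wpow (gen 0) n)"
    unfolding bs_def by (rule pgen_relator) (simp_all add: bs_rel_def)
  then show ?thesis
    using c by (simp add: weval_append[OF h] weval_winv[OF h] weval_wpow[OF h] weval_gen bs_a_def bs_t_def m_assoc)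
qed

lemma bs_hom:
  fixes H (structure)
  assumes H: "group H" "x \<in> carrier H" "y \<in> carrier H" "y \<otimes> x [^] m \<otimes> inv y = x [^] n"
  obtains f where "f \<in> hom (bs m n) H" "f (bs_a m n) = x" "f (bs_t m n) = y"
proof -
  interpret group H by fact
  let ?h = "\<lambda>i::nat. if i = 0 then x else y"
  have h: "?h ` {..<2} \<subseteq> carrier H" using H by auto
  have "\<exists>f\<in>hom (presented_group {..<2} (bs_rel m n)) H. \<forall>i\<in>{..<2}. f (pgen {..<2} (bs_rel m n) i) = ?h i"
    by (rule von_dyck[OF H(1) h]) (use H in \<open>auto simp: bs_rel_def weval_relator[OF h] weval_append[OF h]
        weval_winv[OF h] weval_wpow[OF h] weval_gen m_assoc\<close>)
  then obtain f where "f \<in> hom (bs m n) H" "\<forall>i\<in>{..<2}. f (pgen {..<2} (bs_rel m n) i) = ?h i"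
    unfolding bs_def by blast
  then show thesis by (intro that[of f]) (auto simp: bs_a_def bs_t_def)
qed

lemma inv_perms: "bij f \<Longrightarrow> inv\<^bsub>perms\<^esub> f = inv_into UNIV f"
  by (rule group.inv_equality[OF group_perms]) (auto simp: bij_is_inj bij_imp_bij_inv)

lemma perms_pow: "f [^]\<^sub>perms n = f ^^ n"
proof -
  interpret monoid "perms :: ('a \<Rightarrow> 'a) monoid" by (rule group.is_monoid[OF group_perms])
  show ?thesis by (induction n) (simp_all add: funpow_swap1 fun_eq_iff)
qed

text \<open>Affine maps of the rationals satisfy the relation, with translation by 1 for the base
  letter and multiplication by n/m for the stable letter. The translation has infinite
  order.\<close>

lemma bs_a_order:
  assumes "m > 0" "n > 0" "bs_a m n [^]\<^bsub>bs m n\<^esub> (k::nat) = \<one>\<^bsub>bs m n\<^esub>"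
  shows "k = 0"
proof -
  interpret P: group "perms :: (rat \<Rightarrow> rat) monoid" by (rule group_perms)
  let ?x = "\<lambda>z::rat. z + 1" let ?q = "of_nat n / of_nat m :: rat" let ?y = "\<lambda>z::rat. ?q * z"
  have q: "?q \<noteq> 0" using assms by simp
  have xp: "?x [^]\<^sub>perms (k::nat) = (\<lambda>z. z + of_nat k)" for k
    unfolding perms_pow by (induction k) (auto simp: fun_eq_iff)
  have x: "bij ?x" by (rule bij_betw_byWitness[where f' = "\<lambda>z. z - 1"]) auto
  have xb: "bij (\<lambda>z::rat. z + of_nat k)" for k by (rule bij_betw_byWitness[where f' = "\<lambda>z. z - of_nat k"]) auto
  have y: "bij ?y" using q by (intro bij_betw_byWitness[where f' = "\<lambda>z. z / ?q"]) auto
  have "?y \<otimes>\<^sub>perms ?x [^]\<^sub>perms m = ?x [^]\<^sub>perms n \<otimes>\<^sub>perms ?y"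
    unfolding xp using assms by (auto simp: fun_eq_iff field_simps)
  then have "?y \<otimes>\<^sub>perms ?x [^]\<^sub>perms m \<otimes>\<^sub>perms inv\<^bsub>perms\<^esub> ?y = ?x [^]\<^sub>perms n"
    using x y xb by (intro P.inv_solve_right'[THEN iffD2]) (simp_all add: xp bij_comp)
  then obtain f where f: "f \<in> hom (bs m n) perms" "f (bs_a m n) = ?x"
    using bs_hom[OF group_perms, of ?x ?y m n] x y by auto
  interpret f: group_hom "bs m n" perms f by (rule group_homI[OF group_bs group_perms f(1)])
  have "?x [^]\<^sub>perms k = id" using f.hom_nat_pow[OF bs_closed(1), of k] assms(3) f(2) by simp
  then have "(0::rat) + of_nat k = 0" unfolding xp by (metis id_apply)
  then show ?thesis by simp
qed

lemma derivation_group_pow_zero: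
  assumes "group P" "total_action P act" "a \<in> carrier P"
  shows "(\<lambda>k. 0, a) [^]\<^bsub>derivation_group P act\<^esub> (n::nat) = (\<lambda>k. 0, a [^]\<^sub>P n)"
proof -
  interpret D: monoid "derivation_group P act" by (rule group.is_monoid[OF group_derivation_group[OF assms(1,2)]])
  interpret group P by (rule assms(1))
  show ?thesis by (induction n) (use assms(3) in simp_all)
qed

lemma torsion_free_cyclic:
  fixes G (structure)
  assumes "group G" "a \<in> carrier G" "\<And>n::nat. a [^] n = \<one> \<Longrightarrow> n = 0"
  shows "torsion_free (G\<lparr>carrier := cyclic G a\<rparr>)"
  unfolding torsion_free_def
proof (intro ballI allI impI)
  interpret group G by fact
  fix x and n :: nat
  assume x: "x \<in> carrier (G\<lparr>carrier := cyclic G a\<rparr>)" "n > 0"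
    "x [^]\<^bsub>G\<lparr>carrier := cyclic G a\<rparr>\<^esub> n = \<one>\<^bsub>G\<lparr>carrier := cyclic G a\<rparr>\<^esub>"
  then obtain i :: int where i: "x = a [^] i" by (auto simp: cyclic_def)
  have "x [^] n = \<one>" using x(3) by (simp flip: nat_pow_consistent)
  then have "a [^] (i * int n) = \<one>" using assms(2) i by (simp add: int_pow_pow flip: int_pow_int)
  then have "i * int n = 0" using int_pow_eq_one[OF assms(2,3)] by blast
  then show "x = \<one>\<^bsub>G\<lparr>carrier := cyclic G a\<rparr>\<^esub>" using x(2) i by simp
qed

text \<open>The derivation of an HNN extension with stable letter \<open>t\<close> exists because \<open>t C\<close> is fixed by the
  conjugate \<open>t C t\<^sup>-\<^sup>1\<close>.\<close>

lemma (in group) stable_letter_relation: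
  assumes C: "subgroup C G" and t: "t \<in> carrier G" and c: "c \<in> C" and d: "d \<in> carrier G"
    and rel: "t \<otimes> c \<otimes> inv t = d"
    and \<delta>: "\<delta> = (\<lambda>k::_ \<Rightarrow> 'r::ab_group_add. k (t <#\<^bsub>G\<^esub> C))"
  shows "(\<delta>, t) \<otimes>\<^bsub>derivation_group G (lact G C)\<^esub> (\<lambda>k. 0, c) \<otimes>\<^bsub>derivation_group G (lact G C)\<^esub>
      inv\<^bsub>derivation_group G (lact G C)\<^esub> (\<delta>, t) = (\<lambda>k. 0, d)"
proof -
  let ?D = "derivation_group G (lact G C) :: (((_ \<Rightarrow> 'r) \<Rightarrow> 'r) \<times> _) monoid"
  interpret D: group ?D by (rule group_derivation_group[OF group_axioms total_action_lact[OF C]])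
  have cc: "c \<in> carrier G" using subgroup.mem_carrier[OF C c] .
  have dt: "d \<otimes> t = t \<otimes> c" using rel t cc by (auto simp: m_assoc)
  have "t <#\<^bsub>G\<^esub> C = (d \<otimes> t) <#\<^bsub>G\<^esub> C" using lcos_eq_iff[OF C t m_closed[OF d t]] dt c by blast
  then have e: "lact G C d (t <#\<^bsub>G\<^esub> C) = t <#\<^bsub>G\<^esub> C" using lact_coset[OF C d t] by simp
  have X: "(\<delta>, t) \<otimes>\<^sub>?D (\<lambda>k. 0, c) = (\<lambda>k. 0, d) \<otimes>\<^sub>?D (\<delta>, t)"
    unfolding \<delta> by (simp add: e dt)
  have "(\<delta>, t) \<in> carrier ?D" "(\<lambda>k. 0, c) \<in> carrier ?D" "(\<lambda>k. 0, d) \<in> carrier ?D"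
    using t cc d by (auto simp: additive_functional_def \<delta>)
  then show ?thesis
    by (subst D.inv_solve_right') (simp_all only: X D.m_closed)
qed

text \<open>An HNN extension of the infinite cyclic group of \<open>a\<close>, with the powers of
  the m-th power of \<open>a\<close> as edge group. The derivation kills \<open>a\<close> and sends
  \<open>t\<close> to its own coset; it respects the only relator by
  \<open>stable_letter_relation\<close>.\<close>

lemma torsion_free_bs:
  assumes mn: "m > 0" "n > 0"
  shows "torsion_free (bs m n)"
proof -
  let ?P = "bs m n" let ?R = "bs_rel m n"
  interpret group ?P by (rule group_bs)
  define a where "a = bs_a m n" define t where "t = bs_t m n"
  have c: "a \<in> carrier ?P" "t \<in> carrier ?P" by (simp_all add: a_def t_def bs_closed)
  have g: "pgen {..<2} ?R 0 = a" "pgen {..<2} ?R 1 = t" "pgen {..<2} ?R (Suc 0) = t" by (simp_all add: a_def t_def bs_a_def bs_t_def)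
  have rel: "t \<otimes>\<^sub>?P a [^]\<^sub>?P m \<otimes>\<^sub>?P inv\<^bsub>?P\<^esub> t = a [^]\<^sub>?P n"
    unfolding a_def t_def by (rule bs_relation)
  let ?V = "cyclic ?P a" let ?C = "cyclic ?P (a [^]\<^sub>?P m)"
  have V: "subgroup ?V ?P" and C: "subgroup ?C ?P" using c by (simp_all add: subgroup_cyclic)
  have apow: "a [^]\<^sub>?P (i::nat) \<in> ?V" for i unfolding cyclic_def by (rule image_eqI[of _ _ "int i"]) (simp_all add: int_pow_int)
  have CV: "?C \<subseteq> ?V"
  proof
    fix x assume "x \<in> ?C"
    then obtain i :: int where "x = (a [^]\<^sub>?P m) [^]\<^sub>?P i" by (auto simp: cyclic_def)
    then show "x \<in> ?V" using subgroup_int_pow_closed[OF V apow] by simp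
  qed
  interpret cj: group_hom ?P ?P "\<lambda>y. t \<otimes>\<^sub>?P y \<otimes>\<^sub>?P inv\<^bsub>?P\<^esub> t"
    by (rule group_homI[OF group_axioms group_axioms]) (use c in \<open>auto intro!: homI simp: m_assoc\<close>)
  have conj: "t \<otimes>\<^sub>?P x \<otimes>\<^sub>?P inv\<^bsub>?P\<^esub> t \<in> ?V" if "x \<in> ?C" for x
  proof -
    obtain i :: int where "x = (a [^]\<^sub>?P m) [^]\<^sub>?P i" using \<open>x \<in> ?C\<close> by (auto simp: cyclic_def)
    then have "t \<otimes>\<^sub>?P x \<otimes>\<^sub>?P inv\<^bsub>?P\<^esub> t = (a [^]\<^sub>?P n) [^]\<^sub>?P i"
      using cj.hom_int_pow[of "a [^]\<^sub>?P m" i] c rel by simp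
    then show ?thesis using subgroup_int_pow_closed[OF V apow] by simp
  qed
  have gen: "generates ?P (insert t ?V)"
    unfolding generates_def
  proof (intro conjI allI impI)
    show "insert t ?V \<subseteq> carrier ?P" using c subgroup.subset[OF V] by auto
    fix N assume "subgroup N ?P" "insert t ?V \<subseteq> N"
    then show "N = carrier ?P" using generates_bs[of m n] cyclic_self[OF c(1)] unfolding generates_def a_def t_def by blast
  qed
  let ?\<delta> = "\<lambda>(i::nat) (k :: _ \<Rightarrow> int). if i = 0 then 0 else k (t <#\<^bsub>?P\<^esub> ?C)"
  let ?act = "lact ?P ?C"
  let ?D = "derivation_group ?P ?act :: (((_ \<Rightarrow> int) \<Rightarrow> int) \<times> _) monoid"
  have act: "total_action ?P ?act" by (rule total_action_lact[OF C])
  interpret D: group ?D by (rule group_derivation_group[OF group_axioms act])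
  let ?h = "\<lambda>i. (?\<delta> i, pgen {..<2} ?R i)"
  have hc: "?h i \<in> carrier ?D" if "i \<in> {..<2}" for i
    using that pgen_closed[OF that, of ?R] by (simp add: additive_functional_def bs_def)
  then have h: "?h ` {..<2} \<subseteq> carrier ?D" by blast
  have ev: "weval ?D ?h (gen i) = ?h i" if "i \<in> {..<2}" for i
    by (rule D.weval_gen[where h = "?h", OF hc[OF that]])
  have am: "a [^]\<^sub>?P m \<in> ?C" using cyclic_self[of "a [^]\<^sub>?P m"] c by simp
  obtain T where T: "derivation ?P ?act T" "\<And>x. x \<in> {..<2} \<Longrightarrow> T (pgen {..<2} ?R x) = ?\<delta> x"
  proof (rule presentation_derivation[of "{..<2::nat}" ?R ?act ?\<delta>, folded bs_def])
    fix r assume "r \<in> ?R" "r \<in> gwords {..<2}"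
    then have r: "r = relator (gen 1 @ wpow (gen 0) m @ winv (gen 1)) (wpow (gen 0) n)"
      by (simp add: bs_rel_def)
    show "weval ?D ?h r = \<one>\<^sub>?D"
      unfolding r using stable_letter_relation[OF C c(2) am _ rel, of "?\<delta> 1"] c
      by (simp add: D.weval_relator[OF h] D.weval_append[OF h] D.weval_winv[OF h] D.weval_wpow[OF h]
          ev g derivation_group_pow_zero[OF group_axioms act] D.m_assoc[symmetric] additive_functional_def del: derivation_group_simps(2,3))
  qed (auto simp: act additive_functional_def)
  have Ta: "T a k = 0" and Tt: "T t k = k (t <#\<^bsub>?P\<^esub> ?C)" for k
    using T(2)[of 0] T(2)[of 1] by (simp_all add: g)
  have "a \<in> {p \<in> carrier ?P. \<forall>k. T p k = 0}" using c Ta by simp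
  then have TV: "T v k = 0" if "v \<in> ?V" for v k
    using subgroup_int_pow_closed[OF derivation_zero_subgroup[OF group_axioms act T(1)]] \<open>v \<in> ?V\<close>
    unfolding cyclic_def by blast
  have tf: "torsion_free (?P\<lparr>carrier := ?V\<rparr>)"
    by (rule torsion_free_cyclic[OF group_axioms c(1)]) (use bs_a_order[OF mn] in \<open>simp add: a_def\<close>)
  show ?thesis by (rule torsion_free_HNN[OF group_axioms V tf c(2) C CV conj gen T(1) TV Tt])
qed

section \<open>The free group of rank two\<close>

abbreviation F2 :: "nat gword set monoid" where "F2 \<equiv> free_group {..<2::nat}"

definition fx :: "nat gword set" where "fx = pgen {..<2} {} 0"
definition fy :: "nat gword set" where "fy = pgen {..<2} {} 1"

lemma group_F2: "group F2"
  by (simp add: free_group_def group_presented_group)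

lemma F2_closed [simp]: "fx \<in> carrier F2" "fy \<in> carrier F2"
  by (simp_all add: free_group_def fx_def fy_def pgen_closed)

lemma generates_F2: "generates F2 {fx, fy}"
proof -
  have "{..<2::nat} = {0, 1}" by auto
  then show ?thesis using generates_presented_group[of "{..<2::nat}" "{}"]
    by (simp add: free_group_def fx_def fy_def)
qed

lemma countable_F2: "countable (carrier F2)"
  by (simp add: free_group_def countable_presented_group)

lemma F2_hom:
  assumes H: "group H" "x \<in> carrier H" "y \<in> carrier H"
  obtains f where "f \<in> hom F2 H" "f fx = x" "f fy = y"
proof -
  let ?h = "\<lambda>i::nat. if i = 0 then x else y"
  have "\<exists>f\<in>hom (presented_group {..<2} {}) H. \<forall>i\<in>{..<2}. f (pgen {..<2} {} i) = ?h i"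
    by (rule von_dyck[OF H(1)]) (use H in auto)
  then obtain f where f: "f \<in> hom F2 H" "\<forall>i\<in>{..<2}. f (pgen {..<2} {} i) = ?h i"
    unfolding free_group_def by blast
  show thesis by (rule that[OF f(1)]) (use f(2) in \<open>auto simp: fx_def fy_def\<close>)
qed

lemma fx_order: "fx [^]\<^sub>F2 (i::int) = \<one>\<^sub>F2 \<Longrightarrow> i = 0"
proof -
  assume i: "fx [^]\<^sub>F2 i = \<one>\<^sub>F2"
  obtain f where f: "f \<in> hom F2 integer_group" "f fx = 1" "f fy = 0"
    using F2_hom[OF group_integer_group, of 1 0] by auto
  interpret group_hom F2 integer_group f by (rule group_homI[OF group_F2 group_integer_group f(1)])
  show ?thesis using hom_int_pow[of fx i] f(2) i by simp
qed

text \<open>The swap is its own inverse on generators, hence everywhere, and so it is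
  injective.\<close>

lemma F2_swap:
  obtains \<sigma> where "\<sigma> \<in> hom F2 F2" "\<sigma> fx = fy" "\<sigma> fy = fx" "inj_on \<sigma> (carrier F2)"
proof -
  obtain \<sigma> where s: "\<sigma> \<in> hom F2 F2" "\<sigma> fx = fy" "\<sigma> fy = fx"
    using F2_hom[OF group_F2 F2_closed(2,1)] by blast
  have "(\<sigma> \<circ> \<sigma>) g = id g" if "g \<in> carrier F2" for g
    by (rule hom_eq_on_generators[where f = "\<sigma> \<circ> \<sigma>" and g = id, OF generates_F2 group_F2 group_F2 _ _ _ that])
       (use s hom_compose[OF s(1) s(1)] in \<open>auto simp: hom_def\<close>)
  then have "inj_on \<sigma> (carrier F2)" by (intro inj_on_inverseI[where g = \<sigma>]) simp
  then show thesis by (rule that[OF s])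
qed

text \<open>The freeness test used for both families. If the two images act on an embedded copy of
  the free group as left multiplication by the generators, then every \<open>\<chi> g\<close> takes
  the base point of the copy to the point of \<open>g\<close>, and an element of the kernel fixes
  it.\<close>

lemma F2_faithful:
  assumes K: "group K" "\<chi> \<in> hom F2 K" "\<Theta> \<in> hom K perms" and j: "inj_on j (carrier F2)"
    and x: "\<And>f. f \<in> carrier F2 \<Longrightarrow> \<Theta> (\<chi> fx) (j f) = j (fx \<otimes>\<^sub>F2 f)"
    and y: "\<And>f. f \<in> carrier F2 \<Longrightarrow> \<Theta> (\<chi> fy) (j f) = j (fy \<otimes>\<^sub>F2 f)"
  shows "inj_on \<chi> (carrier F2)"
proof (rule inj_on_homI[OF group_F2 K(1,2)])
  interpret F: group F2 by (rule group_F2)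
  have "\<Theta> \<circ> \<chi> \<in> hom F2 perms" by (rule hom_compose[OF K(2,3)])
  then interpret c: group_hom F2 perms "\<Theta> \<circ> \<chi>" by (rule group_homI[OF group_F2 group_perms])
  let ?N = "{g \<in> carrier F2. \<forall>f\<in>carrier F2. \<Theta> (\<chi> g) (j f) = j (g \<otimes>\<^sub>F2 f)}"
  have mult: "\<Theta> (\<chi> (g \<otimes>\<^sub>F2 h)) z = \<Theta> (\<chi> g) (\<Theta> (\<chi> h) z)" if "g \<in> carrier F2" "h \<in> carrier F2" for g h z
    using c.hom_mult[OF that] by simp
  have one: "\<Theta> (\<chi> \<one>\<^sub>F2) z = z" for z using c.hom_one by simp
  have "subgroup ?N F2"
  proof (rule F.subgroupI)
    have "\<one>\<^sub>F2 \<in> ?N" using one by simp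
    then show "?N \<noteq> {}" by blast
    fix g assume "g \<in> ?N"
    then have g: "g \<in> carrier F2" "\<And>f. f \<in> carrier F2 \<Longrightarrow> \<Theta> (\<chi> g) (j f) = j (g \<otimes>\<^sub>F2 f)" by simp_all
    have "\<Theta> (\<chi> (inv\<^bsub>F2\<^esub> g)) (j f) = j (inv\<^bsub>F2\<^esub> g \<otimes>\<^sub>F2 f)" if f: "f \<in> carrier F2" for f
    proof -
      have "\<Theta> (\<chi> (inv\<^bsub>F2\<^esub> g)) (\<Theta> (\<chi> g) (j (inv\<^bsub>F2\<^esub> g \<otimes>\<^sub>F2 f))) = j (inv\<^bsub>F2\<^esub> g \<otimes>\<^sub>F2 f)"
        using mult[of "inv\<^bsub>F2\<^esub> g" g] g(1) one by simp
      moreover have "\<Theta> (\<chi> g) (j (inv\<^bsub>F2\<^esub> g \<otimes>\<^sub>F2 f)) = j f" using g f by simp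
      ultimately show ?thesis by simp
    qed
    then show "inv\<^bsub>F2\<^esub> g \<in> ?N" using g(1) by simp
    fix h assume "h \<in> ?N"
    then show "g \<otimes>\<^sub>F2 h \<in> ?N" using g by (simp add: mult F.m_assoc)
  qed blast
  then have N: "g \<in> ?N" if "g \<in> carrier F2" for g
    by (rule generatesD[OF generates_F2 _ _ that]) (use x y in auto)
  fix g assume g: "g \<in> carrier F2" "\<chi> g = \<one>\<^sub>K"
  have "\<Theta> \<one>\<^sub>K = id" using hom_one[OF K(3) K(1) group_perms] by simp
  then have "j (g \<otimes>\<^sub>F2 \<one>\<^sub>F2) = j \<one>\<^sub>F2" using N[OF g(1)] g(2) F.one_closed by (metis (mono_tags, lifting) id_apply mem_Collect_eq)
  then show "g = \<one>\<^sub>F2" using j g(1) by (simp add: inj_on_eq_iff)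
qed

text \<open>Both families of groups have this shape, with \<open>\<chi>\<close> and its composition with the swap of the
  free generators as the two embeddings.\<close>

lemma torsion_free_swap_amalgam:
  assumes K: "group K" "countable (carrier K)" "torsion_free K"
    and chi: "\<chi> \<in> hom F2 K" "inj_on \<chi> (carrier F2)"
    and s: "\<sigma> \<in> hom F2 F2" "inj_on \<sigma> (carrier F2)"
  shows "torsion_free (amalgamated_product K K (carrier F2) \<chi> (\<chi> \<circ> \<sigma>))"
proof -
  interpret K: group K by fact
  have cs: "\<chi> \<circ> \<sigma> \<in> hom F2 K" by (rule hom_compose[OF s(1) chi(1)])
  have inj: "inj_on (\<chi> \<circ> \<sigma>) (carrier F2)"
    using hom_carrier[OF s(1)] by (intro comp_inj_on[OF s(2)] inj_on_subset[OF chi(2)])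
  interpret am: amalgam K K "carrier F2" \<chi> "\<chi> \<circ> \<sigma>"
    by unfold_locales (use hom_carrier[OF chi(1)] hom_carrier[OF cs] in auto)
  interpret c: group_hom F2 am.P "am.i1 \<circ> \<chi>"
    by (rule group_homI[OF group_F2 am.P.group_axioms hom_compose[OF chi(1) am.i1_hom]])
  have "subgroup (am.i1 ` \<chi> ` carrier F2) am.P"
    using c.img_is_subgroup by (simp add: image_comp)
  then show ?thesis
    by (rule am.torsion_free_amalgam[OF _ am.inclusions_injective[OF group_F2 HOL.refl chi cs inj K(2) K(2)] K(3) K(3)])
qed

section \<open>The vertex groups of the four-generator groups\<close>

text \<open>Two positions on a line at distance at most one lie in different orbits of the shift by
  \<open>m\<close>, unless they are equal.\<close>

lemma small_multiple: "(m::int) \<ge> 2 \<Longrightarrow> \<bar>m * k\<bar> \<le> 1 \<Longrightarrow> k = 0"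
proof (rule ccontr)
  assume m: "m \<ge> 2" "\<bar>m * k\<bar> \<le> 1" and k: "k \<noteq> 0"
  have "m * 1 \<le> m * \<bar>k\<bar>" using k m by (intro mult_left_mono) auto
  then have "m \<le> \<bar>m * k\<bar>" using m by (simp add: abs_mult)
  then show False using m by linarith
qed

text \<open>The graph behind this permutation representation consists of \<open>a\<close>-lines indexed by \<open>(f, l)\<close>;
  line \<open>0\<close> carries the vertex \<open>f\<close> at position \<open>0\<close>, lines \<open>1\<close> and \<open>2\<close> carry the interior vertices of the
  path that spells \<open>w t\<^sup>-\<^sup>1\<close> from \<open>f\<close> to \<open>y x\<^sup>-\<^sup>1 f\<close>, and the other lines make room for extending \<open>t\<close>.\<close>

lemma four_generator_rep:
  fixes p :: nat
  assumes p: "p \<ge> 2"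
  obtains a t :: "nat gword set \<times> nat \<times> int \<Rightarrow> nat gword set \<times> nat \<times> int" and j where
    "bij a" "bij t" "a ^^ p \<circ> t = t \<circ> a ^^ (p + 1)" "inj_on j (carrier F2)"
    "\<forall>f \<in> carrier F2. t (j f) = j (fx \<otimes>\<^sub>F2 f)"
    "\<forall>f \<in> carrier F2. \<exists>u1 u2 u3 u4. t (j f) = a u1 \<and> t u2 = u1 \<and> u2 = a u3 \<and> a (t u3) = t u4 \<and> a u4 = j (fy \<otimes>\<^sub>F2 f)"
proof -
  interpret F: group F2 by (rule group_F2)
  let ?X = "carrier F2 \<times> (UNIV :: nat set) \<times> (UNIV :: int set)"
  \<comment> \<open>A map that intertwines the shift by p + 1 with the shift by p is an equivariant
    map between these two actions of the integers; this is how the relation for \<open>t\<close>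
    will be met.\<close>
  define a1 where "a1 k = (\<lambda>(f :: nat gword set, l :: nat, i :: int). (f, l, i + (int p + 1) * k))" for k
  define a2 where "a2 k = (\<lambda>(f :: nat gword set, l :: nat, i :: int). (f, l, i + int p * k))" for k
  have fa: "free_action integer_group ?X a1"
    using p by (auto simp: free_action_def action_def a1_def distrib_left)
  have fb: "free_action integer_group ?X a2"
    using p by (auto simp: free_action_def action_def a2_def distrib_left)
  let ?B = "carrier F2 \<times> {(0::nat, -1::int), (0, 0), (1, 0), (1, -1)}"
  let ?D = "carrier F2 \<times> {(0::nat, -1::int), (0, 0), (2, 0), (2, 1)}"
  define \<beta> where "\<beta> = (\<lambda>(f :: nat gword set, l :: nat, i :: int).
    if l = 0 then if i = 0 then (fx \<otimes>\<^sub>F2 f, 0::nat, 0::int) else (fx \<otimes>\<^sub>F2 (inv\<^bsub>F2\<^esub> fy \<otimes>\<^sub>F2 f), 2, 1)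
    else if i = 0 then (f, 0, -1) else (f, 2, 0))"
  define \<beta>' where "\<beta>' = (\<lambda>(f :: nat gword set, l :: nat, i :: int).
    if l = 0 then if i = 0 then (inv\<^bsub>F2\<^esub> fx \<otimes>\<^sub>F2 f, 0::nat, 0::int) else (f, 1, 0)
    else if i = 0 then (f, 1, -1) else (fy \<otimes>\<^sub>F2 (inv\<^bsub>F2\<^esub> fx \<otimes>\<^sub>F2 f), 0, -1))"
  have bet: "bij_betw \<beta> ?B ?D"
    by (rule bij_betw_byWitness[where f' = \<beta>']) (auto simp: \<beta>_def \<beta>'_def)
  have sB: "separated integer_group ?X a1 ?B"
    unfolding separated_def
  proof (intro conjI ballI impI)
    fix k u assume "u \<in> ?B" "a1 k u \<in> ?B"
    then have "\<bar>(int p + 1) * k\<bar> \<le> 1" by (auto simp: a1_def)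
    then have "k = 0" using p by (intro small_multiple[of "int p + 1"]) auto
    then show "a1 k u = u" by (simp add: a1_def split_def)
  qed auto
  have sD: "separated integer_group ?X a2 ?D"
    unfolding separated_def
  proof (intro conjI ballI impI)
    fix k u assume "u \<in> ?D" "a2 k u \<in> ?D"
    then have "\<bar>int p * k\<bar> \<le> 1" by (auto simp: a2_def)
    then have "k = 0" using p by (intro small_multiple[of "int p"]) auto
    then show "a2 k u = u" by (simp add: a2_def split_def)
  qed auto
  have cnt: "countable ?X" using countable_F2 by auto
  have sp1: "spare_orbits integer_group ?X a1 ?B (\<lambda>n. (\<one>\<^sub>F2, n + 3, 0))"
    and sp2: "spare_orbits integer_group ?X a2 ?D (\<lambda>n. (\<one>\<^sub>F2, n + 3, 0))"
    by (auto simp: spare_orbits_def a1_def a2_def)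
  obtain \<theta> where th: "bij_betw \<theta> ?X ?X" "\<And>k x. x \<in> ?X \<Longrightarrow> \<theta> (a1 k x) = a2 k (\<theta> x)"
    "\<And>x. x \<in> ?B \<Longrightarrow> \<theta> x = \<beta> x"
    using equivariant_extension[OF group_integer_group fa fb cnt cnt sB sp1 sD sp2 bet]
    by (metis UNIV_I carrier_integer_group)
  define sh where "sh = (\<lambda>(f :: nat gword set, l :: nat, i :: int). (f, l, i + 1))"
  define a where "a = extend_id ?X sh"
  define t where "t = extend_id ?X \<theta>"
  define j where "j f = (f, 0::nat, 0::int)" for f :: "nat gword set"
  have "bij_betw sh ?X ?X"
    by (rule bij_betw_byWitness[where f' = "\<lambda>(f, l, i). (f, l, i - 1)"]) (auto simp: sh_def)
  then have ba: "bij a" unfolding a_def by (rule bij_extend_id)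
  have bt: "bij t" unfolding t_def using th(1) by (rule bij_extend_id)
  have aX: "a (f, l, i) = (f, l, i + 1)" if "f \<in> carrier F2" for f l i
    using that by (simp add: a_def extend_id_def sh_def)
  have an: "(a ^^ n) x = (if x \<in> ?X then (fst x, fst (snd x), snd (snd x) + int n) else x)" for n x
  proof (induction n)
    case (Suc n)
    then show ?case by (cases x) (auto simp: aX, simp add: a_def extend_id_def)
  qed (cases x, auto)
  have tX: "t x \<in> ?X" if "x \<in> ?X" for x
    using bij_betw_apply[OF th(1) that] that by (simp only: t_def extend_id_def if_True)
  have comm: "(a ^^ p \<circ> t) x = (t \<circ> a ^^ (p + 1)) x" for x
  proof (cases "x \<in> ?X")
    case True
    have 1: "(a ^^ (p + 1)) x = a1 1 x" using True by (cases x) (auto simp only: an a1_def split: if_splits, auto)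
    have 2: "(a ^^ p) (t x) = a2 1 (t x)" using tX[OF True] by (cases "t x") (auto simp only: an a2_def, auto)
    have "a1 1 x \<in> ?X" using True by (cases x) (auto simp: a1_def)
    then have "t (a1 1 x) = a2 1 (t x)" using th(2)[OF True, of 1] True by (simp only: t_def extend_id_def if_True)
    then show ?thesis unfolding comp_apply 1 2 by simp
  next
    case False
    then have "t x = x" by (simp only: t_def extend_id_def if_False)
    then show ?thesis using False by (simp only: comp_apply an if_False)
  qed
  have tB: "t x = \<beta> x" if "x \<in> ?B" for x
    using th(3)[OF that] that by (auto simp: t_def extend_id_def)
  have c1: "a ^^ p \<circ> t = t \<circ> a ^^ (p + 1)" using comm by (rule ext)
  have c2: "inj_on j (carrier F2)" by (auto simp: j_def inj_on_def)
  have tj: "t (j f) = j (fx \<otimes>\<^sub>F2 f)" if "f \<in> carrier F2" for f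
    using tB[of "j f"] that by (simp add: j_def \<beta>_def)
  have c4: "\<exists>u1 u2 u3 u4. t (j f) = a u1 \<and> t u2 = u1 \<and> u2 = a u3 \<and> a (t u3) = t u4
      \<and> a u4 = j (fy \<otimes>\<^sub>F2 f)" if f: "f \<in> carrier F2" for f
  proof -
    let ?f = "fx \<otimes>\<^sub>F2 f" let ?g = "fy \<otimes>\<^sub>F2 f"
    have c: "?f \<in> carrier F2" "?g \<in> carrier F2" using f by simp_all
    have "t (?f, 1, 0) = (?f, 0, -1)" "t (?f, 1, -1) = (?f, 2, 0)" "t (?g, 0, -1) = (?f, 2, 1)"
      using tB[of "(?f, 1, 0)"] tB[of "(?f, 1, -1)"] tB[of "(?g, 0, -1)"] f by (simp_all add: \<beta>_def)
    then show ?thesis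
      using c unfolding tj[OF f]
      by (intro exI[of _ "(?f, 0, -1)"] exI[of _ "(?f, 1, 0)"] exI[of _ "(?f, 1, -1)"] exI[of _ "(?g, 0, -1)"])
        (simp add: aX j_def)
  qed
  show thesis by (rule that[OF ba bt c1 c2]) (intro ballI tj c4; assumption)+
qed

text \<open>The first two relators give two copies of \<open>bs p (p + 1)\<close>, and each of the
  other two identifies the stable letter of one copy with the commutator word \<open>w\<close> of
  the other. The group thus embeds in the amalgam of the copies along the group generated by
  \<open>t\<close> and \<open>w\<close>, which \<open>four_generator_rep\<close> shows to be
  free.\<close>

lemma torsion_free_four_generator_group:
  assumes p: "p \<ge> 3"
  shows "torsion_free (four_generator_group p)"
proof -
  obtain q where q: "p + 1 = q" by simp
  have p2: "p \<ge> 2" using p by simp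
  let ?K = "bs p q"
  interpret K: group ?K by (rule group_bs)
  define a where "a = bs_a p q"
  \<comment> \<open>Inverted because the relators of this family conjugate a2 by the inverse of a1,
    while \<open>bs\<close> conjugates by its stable letter itself.\<close>
  define t where "t = inv\<^bsub>?K\<^esub> (bs_t p q)"
  have c: "a \<in> carrier ?K" "t \<in> carrier ?K" by (simp_all add: a_def t_def bs_closed)
  define w where "w = a \<otimes>\<^sub>?K (inv\<^bsub>?K\<^esub> t \<otimes>\<^sub>?K a \<otimes>\<^sub>?K t) \<otimes>\<^sub>?K inv\<^bsub>?K\<^esub> a
    \<otimes>\<^sub>?K inv\<^bsub>?K\<^esub> (inv\<^bsub>?K\<^esub> t \<otimes>\<^sub>?K a \<otimes>\<^sub>?K t)"
  have wc: "w \<in> carrier ?K" using c by (simp add: w_def)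
  have rel: "inv\<^bsub>?K\<^esub> t \<otimes>\<^sub>?K a [^]\<^sub>?K p \<otimes>\<^sub>?K t = a [^]\<^sub>?K q"
    using bs_relation[of p "q"] by (simp only: a_def t_def K.inv_inv bs_closed)
  obtain \<chi> where chi: "\<chi> \<in> hom F2 ?K" "\<chi> fx = t" "\<chi> fy = w"
    using F2_hom[OF K.group_axioms c(2) wc] by blast
  have inj: "inj_on \<chi> (carrier F2)"
  proof -
    obtain pa pt :: "nat gword set \<times> nat \<times> int \<Rightarrow> nat gword set \<times> nat \<times> int" and j where
      r: "bij pa" "bij pt" "pa ^^ p \<circ> pt = pt \<circ> pa ^^ q" and j: "inj_on j (carrier F2)"
        "\<forall>f \<in> carrier F2. pt (j f) = j (fx \<otimes>\<^sub>F2 f)"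
        "\<forall>f \<in> carrier F2. \<exists>u1 u2 u3 u4. pt (j f) = pa u1 \<and> pt u2 = u1 \<and> u2 = pa u3 \<and> pa (pt u3) = pt u4 \<and> pa u4 = j (fy \<otimes>\<^sub>F2 f)"
      by (rule four_generator_rep[OF p2, unfolded q])
    let ?S = "perms :: (nat gword set \<times> nat \<times> int \<Rightarrow> _) monoid"
    interpret S: group ?S by (rule group_perms)
    have S: "pa \<in> carrier ?S" "pt \<in> carrier ?S" using r by simp_all
    have pw: "pa ^^ n \<in> carrier ?S" for n using S.nat_pow_closed[OF S(1), of n] by (simp add: perms_pow)
    have "inv\<^bsub>?S\<^esub> pt \<otimes>\<^sub>?S (pa ^^ p \<otimes>\<^sub>?S pt) = pa ^^ q"
      using r(3) S(2) pw[of "q"] by (subst S.inv_solve_left') (simp_all only: perms_simps S.m_closed pw, simp_all add: bij_comp)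
    then have "inv\<^bsub>?S\<^esub> pt \<otimes>\<^sub>?S pa [^]\<^sub>?S p \<otimes>\<^sub>?S inv\<^bsub>?S\<^esub> (inv\<^bsub>?S\<^esub> pt) = pa [^]\<^sub>?S q"
      using S pw[of p] by (simp only: perms_pow S.inv_inv S.m_assoc S.inv_closed)
    then obtain \<Theta> where Th: "\<Theta> \<in> hom ?K ?S" "\<Theta> (bs_a p q) = pa" "\<Theta> (bs_t p q) = inv\<^bsub>?S\<^esub> pt"
      using bs_hom[OF S.group_axioms S(1) S.inv_closed[OF S(2)], of p "q"] by blast
    interpret Th: group_hom ?K ?S \<Theta> by (rule group_homI[OF K.group_axioms S.group_axioms Th(1)])
    have Ta: "\<Theta> a = pa" and Tt: "\<Theta> t = pt"
      using Th(2,3) S(2) by (simp_all only: a_def t_def Th.hom_inv bs_closed S.inv_inv)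
    show ?thesis
    proof (rule F2_faithful[OF K.group_axioms chi(1) Th(1) j(1)])
      fix f assume f: "f \<in> carrier F2"
      show "\<Theta> (\<chi> fx) (j f) = j (fx \<otimes>\<^sub>F2 f)" using bspec[OF j(2) f] by (simp add: chi Tt)
      obtain u1 u2 u3 u4 where u: "pt (j f) = pa u1" "pt u2 = u1" "u2 = pa u3" "pa (pt u3) = pt u4" "pa u4 = j (fy \<otimes>\<^sub>F2 f)"
        using bspec[OF j(3) f] by blast
      \<comment> \<open>Inverse permutations are evaluated by exhibiting preimages; the points
        \<open>u1\<close> to \<open>u4\<close> are the ones needed along the word
        \<open>w\<close>.\<close>
      have bk: "(inv\<^bsub>?S\<^esub> g) v = u" if "bij g" "g u = v" for g u v
        using that by (auto simp: inv_perms bij_is_inj)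
      have "\<Theta> w = pa \<otimes>\<^sub>?S (inv\<^bsub>?S\<^esub> pt \<otimes>\<^sub>?S pa \<otimes>\<^sub>?S pt) \<otimes>\<^sub>?S inv\<^bsub>?S\<^esub> pa
          \<otimes>\<^sub>?S (inv\<^bsub>?S\<^esub> pt \<otimes>\<^sub>?S (inv\<^bsub>?S\<^esub> pa \<otimes>\<^sub>?S pt))"
        using c S by (simp only: w_def Th.hom_mult Th.hom_inv K.m_closed K.inv_closed Ta Tt S.inv_mult_group S.inv_inv S.m_closed S.inv_closed)
      then have "\<Theta> w (j f) = pa ((inv\<^bsub>?S\<^esub> pt) (pa (pt ((inv\<^bsub>?S\<^esub> pa) ((inv\<^bsub>?S\<^esub> pt) ((inv\<^bsub>?S\<^esub> pa) (pt (j f))))))))"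
        by simp
      also have "(inv\<^bsub>?S\<^esub> pa) (pt (j f)) = u1" by (rule bk[OF r(1)]) (simp add: u(1))
      also have "(inv\<^bsub>?S\<^esub> pt) u1 = u2" by (rule bk[OF r(2) u(2)])
      also have "(inv\<^bsub>?S\<^esub> pa) u2 = u3" by (rule bk[OF r(1)]) (simp add: u(3))
      also have "(inv\<^bsub>?S\<^esub> pt) (pa (pt u3)) = u4" by (rule bk[OF r(2)]) (simp add: u(4))
      finally show "\<Theta> (\<chi> fy) (j f) = j (fy \<otimes>\<^sub>F2 f)" by (simp add: chi u(5))
    qed
  qed
  obtain \<sigma> where s: "\<sigma> \<in> hom F2 F2" "\<sigma> fx = fy" "\<sigma> fy = fx" "inj_on \<sigma> (carrier F2)"
    using F2_swap by blast
  have cntK: "countable (carrier ?K)" by (simp add: bs_def countable_presented_group)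
  let ?Q = "amalgamated_product ?K ?K (carrier F2) \<chi> (\<chi> \<circ> \<sigma>)"
  have tf: "torsion_free ?Q"
    by (rule torsion_free_swap_amalgam[OF K.group_axioms cntK torsion_free_bs chi(1) inj s(1,4)]) (use p q in auto)
  have cs: "\<chi> \<circ> \<sigma> \<in> hom F2 ?K" by (rule hom_compose[OF s(1) chi(1)])
  interpret am: amalgam ?K ?K "carrier F2" \<chi> "\<chi> \<circ> \<sigma>"
    by unfold_locales (use hom_carrier[OF chi(1)] hom_carrier[OF cs] in auto)
  interpret i1: group_hom ?K ?Q am.i1 by (rule group_homI[OF K.group_axioms am.P.group_axioms am.i1_hom])
  interpret i2: group_hom ?K ?Q am.i2 by (rule group_homI[OF K.group_axioms am.P.group_axioms am.i2_hom])
  have gl: "am.i1 t = am.i2 w" "am.i1 w = am.i2 t"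
    using am.i1_i2[of fx] am.i1_i2[of fy] by (simp_all add: s chi)
  define R where "R = (let a1 = gen 0; a2 = gen 1; b1 = gen 2; b2 = gen (3::nat) in
      {winv a1 @ wpow a2 p @ a1 @ wpow (winv a2) q,
       winv b1 @ wpow b2 p @ b1 @ wpow (winv b2) q,
       winv a1 @ wcomm b2 (winv b1 @ b2 @ b1),
       winv b1 @ wcomm a2 (winv a1 @ a2 @ a1)})"
  have A: "four_generator_group p = presented_group {..<4} R"
    unfolding four_generator_group_def R_def Let_def q ..
  let ?A = "presented_group {..<4} R"
  interpret A: group ?A by (rule group_presented_group)
  let ?h = "\<lambda>i::nat. if i = 0 then am.i1 t else if i = 1 then am.i1 a else if i = 2 then am.i2 t else am.i2 a"
  have h: "?h ` {..<4} \<subseteq> carrier ?Q" using c by auto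
  have four: "r \<in> R \<Longrightarrow> P (winv (gen 0) @ wpow (gen 1) p @ gen 0 @ wpow (winv (gen 1)) q) \<Longrightarrow>
      P (winv (gen 2) @ wpow (gen 3) p @ gen 2 @ wpow (winv (gen 3)) q) \<Longrightarrow>
      P (winv (gen 0) @ wcomm (gen 3) (winv (gen 2) @ gen 3 @ gen 2)) \<Longrightarrow>
      P (winv (gen 2) @ wcomm (gen 1) (winv (gen 0) @ gen 1 @ gen 0)) \<Longrightarrow> P r" for P r
    unfolding R_def Let_def by blast
  have "\<exists>f\<in>hom ?A ?Q. \<forall>i\<in>{..<4}. f (pgen {..<4} R i) = ?h i"
  proof (rule von_dyck[OF am.P.group_axioms h])
    have ra: "inv\<^bsub>?K\<^esub> t \<otimes>\<^sub>?K (a [^]\<^sub>?K p \<otimes>\<^sub>?K (t \<otimes>\<^sub>?K inv\<^bsub>?K\<^esub> a [^]\<^sub>?K q)) = \<one>\<^sub>?K"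
      using rel c by (simp only: K.nat_pow_inv K.m_assoc[symmetric] K.m_closed K.inv_closed K.nat_pow_closed K.r_inv)
    have wi: "w = a \<otimes>\<^sub>?K (inv\<^bsub>?K\<^esub> t \<otimes>\<^sub>?K (a \<otimes>\<^sub>?K t)) \<otimes>\<^sub>?K inv\<^bsub>?K\<^esub> a
        \<otimes>\<^sub>?K inv\<^bsub>?K\<^esub> (inv\<^bsub>?K\<^esub> t \<otimes>\<^sub>?K (a \<otimes>\<^sub>?K t))"
      unfolding w_def using c by (simp only: K.m_assoc K.m_closed K.inv_closed)
    have h1: "am.i1 (inv\<^bsub>?K\<^esub> t \<otimes>\<^sub>?K (a [^]\<^sub>?K p \<otimes>\<^sub>?K (t \<otimes>\<^sub>?K inv\<^bsub>?K\<^esub> a [^]\<^sub>?K q))) = \<one>\<^sub>?Q"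
      unfolding ra by (rule i1.hom_one)
    have h2: "am.i2 (inv\<^bsub>?K\<^esub> t \<otimes>\<^sub>?K (a [^]\<^sub>?K p \<otimes>\<^sub>?K (t \<otimes>\<^sub>?K inv\<^bsub>?K\<^esub> a [^]\<^sub>?K q))) = \<one>\<^sub>?Q"
      unfolding ra by (rule i2.hom_one)
    have h3: "inv\<^bsub>?Q\<^esub> (am.i1 t) \<otimes>\<^sub>?Q am.i2 w = \<one>\<^sub>?Q" using gl wc by simp
    have h4: "inv\<^bsub>?Q\<^esub> (am.i2 t) \<otimes>\<^sub>?Q am.i1 w = \<one>\<^sub>?Q" using gl c by simp
    fix r assume "r \<in> R"
    then show "weval ?Q ?h r = \<one>\<^sub>?Q"
    proof (rule four[of r "\<lambda>r. weval ?Q ?h r = \<one>\<^sub>?Q"], goal_cases)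
      case 1 then show ?case using h1 c
        by (simp add: am.P.weval_append[OF h] am.P.weval_winv[OF h] am.P.weval_wpow[OF h] am.P.weval_gen i1.hom_nat_pow del: nat_pow_Suc)
    next
      case 2 then show ?case using h2 c
        by (simp add: am.P.weval_append[OF h] am.P.weval_winv[OF h] am.P.weval_wpow[OF h] am.P.weval_gen i2.hom_nat_pow del: nat_pow_Suc)
    next
      case 3 then show ?case using h3[unfolded wi] c
        by (simp add: am.P.weval_append[OF h] am.P.weval_winv[OF h] am.P.weval_wcomm[OF h] am.P.weval_gen)
    next
      case 4 then show ?case using h4[unfolded wi] c
        by (simp add: am.P.weval_append[OF h] am.P.weval_winv[OF h] am.P.weval_wcomm[OF h] am.P.weval_gen)
    qed
  qed
  then obtain f where f: "f \<in> hom ?A ?Q" "\<forall>i\<in>{..<4}. f (pgen {..<4} R i) = ?h i" by blast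
  let ?g = "pgen {..<4} R"
  have gc: "?g 0 \<in> carrier ?A" "?g 1 \<in> carrier ?A" "?g 2 \<in> carrier ?A" "?g 3 \<in> carrier ?A" by (simp_all add: pgen_closed)
  have gh: "?g ` {..<4} \<subseteq> carrier ?A" by (auto simp: pgen_closed)
  have rels: "weval ?A ?g (winv (gen 0) @ wpow (gen 1) p @ gen 0 @ wpow (winv (gen 1)) q) = \<one>\<^sub>?A"
      "weval ?A ?g (winv (gen 2) @ wpow (gen 3) p @ gen 2 @ wpow (winv (gen 3)) q) = \<one>\<^sub>?A"
      "weval ?A ?g (winv (gen 0) @ wcomm (gen 3) (winv (gen 2) @ gen 3 @ gen 2)) = \<one>\<^sub>?A"
      "weval ?A ?g (winv (gen 2) @ wcomm (gen 1) (winv (gen 0) @ gen 1 @ gen 0)) = \<one>\<^sub>?A"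
    by (rule pgen_relation; simp add: R_def Let_def)+
  have bsA: "inv\<^bsub>?A\<^esub> u \<otimes>\<^sub>?A v [^]\<^sub>?A p \<otimes>\<^sub>?A inv\<^bsub>?A\<^esub> (inv\<^bsub>?A\<^esub> u) = v [^]\<^sub>?A q"
    if "inv\<^bsub>?A\<^esub> u \<otimes>\<^sub>?A (v [^]\<^sub>?A p \<otimes>\<^sub>?A (u \<otimes>\<^sub>?A inv\<^bsub>?A\<^esub> v [^]\<^sub>?A q)) = \<one>\<^sub>?A" "u \<in> carrier ?A" "v \<in> carrier ?A" for u v
  proof -
    let ?z = "inv\<^bsub>?A\<^esub> u \<otimes>\<^sub>?A v [^]\<^sub>?A p \<otimes>\<^sub>?A u"
    have "?z \<otimes>\<^sub>?A inv\<^bsub>?A\<^esub> (v [^]\<^sub>?A q) = \<one>\<^sub>?A"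
      using that by (simp only: A.nat_pow_inv A.m_assoc A.m_closed A.inv_closed A.nat_pow_closed)
    then have "?z = \<one>\<^sub>?A \<otimes>\<^sub>?A v [^]\<^sub>?A q"
      using A.inv_solve_right'[of "\<one>\<^sub>?A" ?z "v [^]\<^sub>?A q"] that(2,3) by (simp only: A.m_closed A.inv_closed A.nat_pow_closed A.one_closed)
    then show ?thesis using that(2,3) by (simp only: A.inv_inv A.l_one A.nat_pow_closed)
  qed
  have rA: "inv\<^bsub>?A\<^esub> (?g 0) \<otimes>\<^sub>?A (?g 1 [^]\<^sub>?A p \<otimes>\<^sub>?A (?g 0 \<otimes>\<^sub>?A inv\<^bsub>?A\<^esub> (?g 1) [^]\<^sub>?A q)) = \<one>\<^sub>?A"
    "inv\<^bsub>?A\<^esub> (?g 2) \<otimes>\<^sub>?A (?g 3 [^]\<^sub>?A p \<otimes>\<^sub>?A (?g 2 \<otimes>\<^sub>?A inv\<^bsub>?A\<^esub> (?g 3) [^]\<^sub>?A q)) = \<one>\<^sub>?A"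
    using rels(1,2) gc by (simp_all add: A.weval_append[OF gh] A.weval_winv[OF gh] A.weval_wpow[OF gh] A.weval_gen del: nat_pow_Suc)
  obtain e1 where e1: "e1 \<in> hom ?K ?A" "e1 (bs_a p q) = ?g 1" "e1 (bs_t p q) = inv\<^bsub>?A\<^esub> (?g 0)"
    using bs_hom[OF A.group_axioms gc(2) A.inv_closed[OF gc(1)] bsA[OF rA(1) gc(1,2)]] by blast
  obtain e2 where e2: "e2 \<in> hom ?K ?A" "e2 (bs_a p q) = ?g 3" "e2 (bs_t p q) = inv\<^bsub>?A\<^esub> (?g 2)"
    using bs_hom[OF A.group_axioms gc(4) A.inv_closed[OF gc(3)] bsA[OF rA(2) gc(3,4)]] by blast
  interpret e1: group_hom ?K ?A e1 by (rule group_homI[OF K.group_axioms A.group_axioms e1(1)])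
  interpret e2: group_hom ?K ?A e2 by (rule group_homI[OF K.group_axioms A.group_axioms e2(1)])
  have ea: "e1 a = ?g 1" "e1 t = ?g 0" "e2 a = ?g 3" "e2 t = ?g 2"
    using e1(2,3) e2(2,3) gc by (simp_all add: a_def t_def bs_closed)
  have ew: "e1 w = ?g 2" "e2 w = ?g 0"
  proof -
    have "inv\<^bsub>?A\<^esub> (?g 2) \<otimes>\<^sub>?A e1 w = \<one>\<^sub>?A" "inv\<^bsub>?A\<^esub> (?g 0) \<otimes>\<^sub>?A e2 w = \<one>\<^sub>?A"
      using rels(3,4) gc c
      by (simp_all add: A.weval_append[OF gh] A.weval_winv[OF gh] A.weval_wcomm[OF gh] A.weval_gen w_def ea A.m_assoc A.inv_mult_group)
    then show "e1 w = ?g 2" "e2 w = ?g 0" using gc e1.hom_closed[OF wc] e2.hom_closed[OF wc]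
      by (metis A.inv_equality A.inv_closed A.inv_inv A.inv_comm)+
  qed
  have agree: "e1 (\<chi> z) = e2 ((\<chi> \<circ> \<sigma>) z)" if "z \<in> carrier F2" for z
  proof -
    have "(e1 \<circ> \<chi>) z = (e2 \<circ> (\<chi> \<circ> \<sigma>)) z"
      by (rule hom_eq_on_generators[where f = "e1 \<circ> \<chi>" and g = "e2 \<circ> (\<chi> \<circ> \<sigma>)", OF generates_F2 group_F2 A.group_axioms hom_compose[OF chi(1) e1(1)] hom_compose[OF cs e2(1)] _ that])
        (auto simp: chi s ea ew)
    then show ?thesis by simp
  qed
  obtain k where k: "k \<in> hom ?Q ?A" "\<And>x. x \<in> carrier ?K \<Longrightarrow> k (am.i1 x) = e1 x" "\<And>x. x \<in> carrier ?K \<Longrightarrow> k (am.i2 x) = e2 x"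
    using am.universal[OF A.group_axioms e1(1) e2(1) agree] by blast
  \<comment> \<open>Torsion-freeness passes to a group that injects, so a left inverse of
    \<open>f\<close>, checked on the four generators, is enough.\<close>
  have kf: "(k \<circ> f) z = id z" if "z \<in> carrier ?A" for z
  proof (rule hom_eq_on_generators[where f = "k \<circ> f" and g = id, OF generates_presented_group A.group_axioms A.group_axioms hom_compose[OF f(1) k(1)] _ _ that])
    show "id \<in> hom ?A ?A" by (simp add: hom_def)
    fix b assume "b \<in> ?g ` {..<4}"
    then obtain i where i: "i < 4" "b = ?g i" by auto
    then consider "i = 0" | "i = 1" | "i = 2" | "i = 3" by linarith
    then show "(k \<circ> f) b = id b" using f(2) i by cases (simp_all add: k c ea)
  qed
  have "inj_on f (carrier ?A)" using kf by (intro inj_on_inverseI[where g = k]) simp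
  then show ?thesis unfolding A by (rule torsion_free_inj[OF A.group_axioms am.P.group_axioms f(1) _ tf])
qed

section \<open>The vertex groups of the Higman group\<close>

text \<open>One half of the Higman group. The whole group is the amalgam of a half on a, b, c and a
  half on c, d, a along the free group on a and c.\<close>

definition hk_rel :: "nat gword set" where
  "hk_rel = {relator (gen 1 @ gen 0 @ winv (gen 1)) (wpow (gen 0) 2),
    relator (gen 2 @ gen 1 @ winv (gen 2)) (wpow (gen 1) 2)}"

definition hk :: "nat gword set monoid" where
  "hk = presented_group {..<3} hk_rel"

definition hk_gen :: "nat \<Rightarrow> nat gword set" where
  "hk_gen = pgen {..<3} hk_rel"

lemma group_hk: "group hk"
  by (simp add: hk_def group_presented_group)

lemma hk_closed: "i < 3 \<Longrightarrow> hk_gen i \<in> carrier hk"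
  by (simp add: hk_def hk_gen_def pgen_closed)

lemma hk_relations:
  "hk_gen 1 \<otimes>\<^sub>hk hk_gen 0 \<otimes>\<^sub>hk inv\<^bsub>hk\<^esub> (hk_gen 1) = hk_gen 0 [^]\<^sub>hk (2::nat)"
  "hk_gen 2 \<otimes>\<^sub>hk hk_gen 1 \<otimes>\<^sub>hk inv\<^bsub>hk\<^esub> (hk_gen 2) = hk_gen 1 [^]\<^sub>hk (2::nat)"
proof -
  interpret group hk by (rule group_hk)
  have h: "hk_gen ` {..<3} \<subseteq> carrier hk" by (auto simp: hk_closed)
  have "weval hk hk_gen (gen 1 @ gen 0 @ winv (gen 1)) = weval hk hk_gen (wpow (gen 0) 2)"
    "weval hk hk_gen (gen 2 @ gen 1 @ winv (gen 2)) = weval hk hk_gen (wpow (gen 1) 2)"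
    unfolding hk_def hk_gen_def by (rule pgen_relator; simp add: hk_rel_def)+
  then show "hk_gen 1 \<otimes>\<^sub>hk hk_gen 0 \<otimes>\<^sub>hk inv\<^bsub>hk\<^esub> (hk_gen 1) = hk_gen 0 [^]\<^sub>hk (2::nat)"
    "hk_gen 2 \<otimes>\<^sub>hk hk_gen 1 \<otimes>\<^sub>hk inv\<^bsub>hk\<^esub> (hk_gen 2) = hk_gen 1 [^]\<^sub>hk (2::nat)"
    by (simp_all add: weval_append[OF h] weval_winv[OF h] weval_wpow[OF h] weval_gen hk_closed m_assoc)
qed

lemma hk_hom:
  fixes H (structure)
  assumes H: "group H" "x \<in> carrier H" "y \<in> carrier H" "z \<in> carrier H"
    and rel: "y \<otimes> x \<otimes> inv y = x [^] (2::nat)" "z \<otimes> y \<otimes> inv z = y [^] (2::nat)"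
  shows "\<exists>f\<in>hom hk H. f (hk_gen 0) = x \<and> f (hk_gen 1) = y \<and> f (hk_gen 2) = z"
proof -
  interpret group H by (rule H(1))
  let ?h = "\<lambda>i::nat. if i = 0 then x else if i = 1 then y else z"
  have h: "?h ` {..<3} \<subseteq> carrier H" using H by auto
  have r: "weval H ?h (relator (gen 1 @ gen 0 @ winv (gen 1)) (wpow (gen 0) 2)) = \<one>"
    "weval H ?h (relator (gen 2 @ gen 1 @ winv (gen 2)) (wpow (gen 1) 2)) = \<one>"
    using H rel by (simp_all add: weval_relator[OF h] weval_append[OF h]
        weval_winv[OF h] weval_wpow[OF h] weval_gen m_assoc)
  have "\<exists>f\<in>hom (presented_group {..<3} hk_rel) H. \<forall>i\<in>{..<3}. f (pgen {..<3} hk_rel i) = ?h i"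
    by (rule von_dyck[OF H(1) h]) (use r in \<open>auto simp: hk_rel_def\<close>)
  then obtain f where f: "f \<in> hom hk H" "\<forall>i\<in>{..<3}. f (hk_gen i) = ?h i"
    unfolding hk_def hk_gen_def by blast
  show ?thesis by (rule bexI[OF _ f(1)]) (use f(2) in auto)
qed

lemma generates_hk: "generates hk {hk_gen 0, hk_gen 1, hk_gen 2}"
proof -
  have "{..<3::nat} = {0, 1, 2}" by auto
  then show ?thesis using generates_presented_group[of "{..<3}" hk_rel]
    by (simp add: hk_def hk_gen_def)
qed

text \<open>The exponent sum of the stable letter is a homomorphism to the integers, and the base
  letter has infinite order.\<close>

lemma bs_t_independent:
  assumes "m > 0" "n > 0"
    and "bs_t m n [^]\<^bsub>bs m n\<^esub> (k::int) \<otimes>\<^bsub>bs m n\<^esub> bs_a m n [^]\<^bsub>bs m n\<^esub> (i::int) = bs_a m n [^]\<^bsub>bs m n\<^esub> (j::int)"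
  shows "k = 0" "i = j"
proof -
  interpret P: group "bs m n" by (rule group_bs)
  obtain f where f: "f \<in> hom (bs m n) integer_group" "f (bs_a m n) = 0" "f (bs_t m n) = 1"
    using bs_hom[OF group_integer_group, of 0 1 m n] by auto
  interpret f: group_hom "bs m n" integer_group f by (rule group_homI[OF group_bs group_integer_group f(1)])
  note c = bs_closed[of m n]
  have "f (bs_t m n [^]\<^bsub>bs m n\<^esub> k \<otimes>\<^bsub>bs m n\<^esub> bs_a m n [^]\<^bsub>bs m n\<^esub> i) = f (bs_a m n [^]\<^bsub>bs m n\<^esub> j)" using assms(3) by simp
  then show k: "k = 0"
    using c f(2,3) by (simp add: f.hom_int_pow)
  have "bs_a m n [^]\<^bsub>bs m n\<^esub> (i - j) = bs_a m n [^]\<^bsub>bs m n\<^esub> i \<otimes>\<^bsub>bs m n\<^esub> inv\<^bsub>bs m n\<^esub> (bs_a m n [^]\<^bsub>bs m n\<^esub> j)"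
    by (rule P.int_pow_diff) (use c in simp)
  also have "\<dots> = \<one>\<^bsub>bs m n\<^esub>" using assms(3) k c by simp
  finally show "i = j" using P.int_pow_eq_one[OF c(1) bs_a_order[OF assms(1,2)]] by fastforce
qed

text \<open>The permutation \<open>z\<close> extends left multiplication by the second free generator from a copy of the
  free group inside a free \<open>bs m n\<close>-set.\<close>

lemma higman_rep:
  assumes mn: "m > 0" "n > 0"
  obtains \<Theta> :: "nat gword set \<Rightarrow> nat gword set \<times> nat gword set \<times> nat \<Rightarrow> nat gword set \<times> nat gword set \<times> nat"
    and z j where
    "\<Theta> \<in> hom (bs m n) perms" "inj_on \<Theta> (carrier (bs m n))" "bij z"
    "z \<circ> \<Theta> (bs_t m n) = \<Theta> (bs_t m n) \<circ> \<Theta> (bs_t m n) \<circ> z" "inj_on j (carrier F2)"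
    "\<forall>f\<in>carrier F2. \<Theta> (bs_a m n) (j f) = j (fx \<otimes>\<^sub>F2 f)"
    "\<forall>f\<in>carrier F2. z (j f) = j (fy \<otimes>\<^sub>F2 f)"
proof -
  let ?K = "bs m n"
  interpret F: group F2 by (rule group_F2)
  interpret K: group ?K by (rule group_bs)
  define a where "a = bs_a m n" define t where "t = bs_t m n"
  have c: "a \<in> carrier ?K" "t \<in> carrier ?K" by (simp_all add: a_def t_def bs_closed)
  have ind: "k = 0" "i = l" if "t [^]\<^sub>?K (k::int) \<otimes>\<^sub>?K a [^]\<^sub>?K (i::int) = a [^]\<^sub>?K (l::int)" for k i l
    using bs_t_independent[OF mn, of k i l] that by (simp_all add: a_def t_def)
  have tpow: "t [^]\<^sub>?K (k::int) = \<one>\<^sub>?K \<Longrightarrow> k = 0" for k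
    using ind(1)[of k 0 0] by simp
  have fF: "free_action integer_group (carrier F2) (\<lambda>(i::int) f. fx [^]\<^sub>F2 i \<otimes>\<^sub>F2 f)"
    unfolding free_action_def action_def
    by (auto simp: F.int_pow_mult F.m_assoc intro!: fx_order)
  have s0: "separated integer_group (carrier F2) (\<lambda>(i::int) f. fx [^]\<^sub>F2 i \<otimes>\<^sub>F2 f) {}"
    by (simp add: separated_def)
  obtain I where "{} \<subseteq> I" and I: "I \<subseteq> carrier F2" "bij_betw (\<lambda>(i::int, f). fx [^]\<^sub>F2 i \<otimes>\<^sub>F2 f) (UNIV \<times> I) (carrier F2)"
    by (rule transversal[OF group_integer_group fF s0, unfolded carrier_integer_group], rule that)
  let ?u = "\<lambda>(i::int, f). fx [^]\<^sub>F2 i \<otimes>\<^sub>F2 f"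
  \<comment> \<open>Coordinates of the free group along the cosets of the powers of
    \<open>fx\<close>: the exponent of \<open>fx\<close> and the chosen representative.\<close>
  define d where "d = inv_into (UNIV \<times> I) ?u"
  have dI: "d f \<in> UNIV \<times> I" "?u (d f) = f" if "f \<in> carrier F2" for f
    using that bij_betw_inv_into_right[OF I(2)] bij_betw_apply[OF bij_betw_inv_into[OF I(2)]] by (simp_all add: d_def)
  have du: "d (fx [^]\<^sub>F2 i \<otimes>\<^sub>F2 f) = (i, f)" if "f \<in> I" for i f
    using bij_betw_inv_into_left[OF I(2), of "(i, f)"] that by (simp add: d_def)
  have dx: "d (fx \<otimes>\<^sub>F2 f) = (fst (d f) + 1, snd (d f))" if "f \<in> carrier F2" for f
  proof -
    have s: "snd (d f) \<in> I" "snd (d f) \<in> carrier F2" using dI(1)[OF that] I(1) by (auto simp: mem_Times_iff)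
    have "f = fx [^]\<^sub>F2 fst (d f) \<otimes>\<^sub>F2 snd (d f)" using dI(2)[OF that] by (simp add: split_def)
    then have "fx \<otimes>\<^sub>F2 f = fx \<otimes>\<^sub>F2 (fx [^]\<^sub>F2 fst (d f) \<otimes>\<^sub>F2 snd (d f))" by simp
    also have "\<dots> = fx [^]\<^sub>F2 (1 + fst (d f)) \<otimes>\<^sub>F2 snd (d f)"
      using s by (simp add: F.int_pow_mult F.m_assoc)
    finally show ?thesis using du[OF s(1)] by (simp add: add.commute)
  qed
  \<comment> \<open>Powers of \<open>fx\<close> turn into powers of \<open>a\<close>, and the
    representative is kept as a label. Left multiplication by \<open>a\<close> therefore acts on
    this copy of the free group as left multiplication by \<open>fx\<close>.\<close>
  define j where "j f = (a [^]\<^sub>?K fst (d f), snd (d f), 0::nat)" for f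
  let ?X = "carrier ?K \<times> carrier F2 \<times> (UNIV :: nat set)"
  have jX: "j f \<in> ?X" if "f \<in> carrier F2" for f
    using dI(1)[OF that] I(1) c by (auto simp: j_def mem_Times_iff)
  have jinj: "inj_on j (carrier F2)"
  proof (rule inj_onI)
    fix f g assume fg: "f \<in> carrier F2" "g \<in> carrier F2" "j f = j g"
    then have "\<one>\<^sub>?K \<otimes>\<^sub>?K a [^]\<^sub>?K fst (d f) = a [^]\<^sub>?K fst (d g)" "snd (d f) = snd (d g)" using c by (simp_all add: j_def)
    then have "d f = d g" using ind(2)[of 0 "fst (d f)" "fst (d g)"] by (simp add: prod_eq_iff)
    then have "?u (d f) = ?u (d g)" by (rule arg_cong)
    then show "f = g" unfolding dI(2)[OF fg(1)] dI(2)[OF fg(2)] .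
  qed
  define mu where "mu g = (\<lambda>(h, q :: nat gword set \<times> nat). (g \<otimes>\<^sub>?K h, q))" for g
  have mu: "action ?K ?X mu" by (auto simp: action_def mu_def K.m_assoc)
  have mu_hom: "(\<lambda>g. extend_id ?X (mu g)) \<in> hom ?K perms" by (rule action_hom[OF K.group_axioms mu])
  \<comment> \<open>The relation required of \<open>z\<close> says that it carries the action of
    \<open>t\<close> to the action of its square; equivariance between \<open>a1\<close> and
    \<open>a2\<close> states just that.\<close>
  define a1 where "a1 k = mu (t [^]\<^sub>?K (k::int))" for k
  define a2 where "a2 k = mu (t [^]\<^sub>?K (2 * k::int))" for k
  have fa: "free_action integer_group ?X a1"
    using c by (auto simp: free_action_def action_def a1_def mu_def K.int_pow_mult K.m_assoc intro!: tpow)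
  have fb: "free_action integer_group ?X a2"
  proof -
    have "k = 0" if "t [^]\<^sub>?K (2 * k) = \<one>\<^sub>?K" for k :: int using tpow[OF that] by simp
    then show ?thesis
      using c by (auto simp: free_action_def action_def a2_def mu_def K.int_pow_mult K.m_assoc distrib_left)
  qed
  let ?B = "j ` carrier F2"
  \<comment> \<open>First coordinates of points in the copy are powers of \<open>a\<close>, so a
    power of \<open>t\<close> that links two such points is trivial by independence of
    \<open>t\<close> and \<open>a\<close>.\<close>
  have sep: "t [^]\<^sub>?K k = \<one>\<^sub>?K" if "f \<in> carrier F2" "g \<in> carrier F2" "mu (t [^]\<^sub>?K k) (j f) = j g" for k :: int and f g
    using that(3) ind(1)[of k "fst (d f)" "fst (d g)"] by (simp add: mu_def j_def)
  have one: "mu \<one>\<^sub>?K x = x" if "x \<in> ?X" for x using actionD(3)[OF mu that K.one_closed] .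
  have sB: "separated integer_group ?X a1 ?B" "separated integer_group ?X a2 ?B"
    unfolding separated_def a1_def a2_def
    by (intro conjI ballI impI; (elim imageE)?; (use jX sep one in \<open>force\<close>))+
  \<comment> \<open>The copy of the free group occupies layer 0 only, which leaves every higher
    layer as reserve.\<close>
  have sp: "spare_orbits integer_group ?X a1 ?B (\<lambda>n. (\<one>\<^sub>?K, \<one>\<^sub>F2, n + 1))"
    "spare_orbits integer_group ?X a2 ?B (\<lambda>n. (\<one>\<^sub>?K, \<one>\<^sub>F2, n + 1))"
    by (auto simp: spare_orbits_def a1_def a2_def mu_def j_def)
  have cnt: "countable ?X" using countable_F2 by (auto simp: bs_def countable_presented_group)
  define jd where "jd = inv_into (carrier F2) j"
  have jd: "jd (j f) = f" if "f \<in> carrier F2" for f using jinj that by (simp add: jd_def inv_into_f_f)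
  have bet: "bij_betw (\<lambda>x. j (fy \<otimes>\<^sub>F2 jd x)) ?B ?B"
    by (rule bij_betw_byWitness[where f' = "\<lambda>x. j (inv\<^bsub>F2\<^esub> fy \<otimes>\<^sub>F2 jd x)"]) (auto simp: jd)
  obtain \<theta> where th: "bij_betw \<theta> ?X ?X" "\<And>k x. x \<in> ?X \<Longrightarrow> \<theta> (a1 k x) = a2 k (\<theta> x)"
    "\<And>x. x \<in> ?B \<Longrightarrow> \<theta> x = j (fy \<otimes>\<^sub>F2 jd x)"
    using equivariant_extension[OF group_integer_group fa fb cnt cnt sB(1) sp(1) sB(2) sp(2) bet]
    by (metis UNIV_I carrier_integer_group)
  define z where "z = extend_id ?X \<theta>"
  let ?T = "\<lambda>g. extend_id ?X (mu g)"
  have zX: "\<theta> x \<in> ?X" if "x \<in> ?X" for x by (rule bij_betw_apply[OF th(1) that])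
  have muX: "mu t x \<in> ?X" if "x \<in> ?X" for x by (rule actionD(1)[OF mu that c(2)])
  have comm: "z (?T t x) = ?T t (?T t (z x))" for x
  proof (cases "x \<in> ?X")
    case True
    have "\<theta> (mu t x) = mu (t [^]\<^sub>?K (2::int)) (\<theta> x)" using th(2)[OF True, of 1] c by (simp add: a1_def a2_def)
    also have "t [^]\<^sub>?K (2::int) = t \<otimes>\<^sub>?K t" using K.int_pow_mult[OF c(2), of 1 1] c by simp
    also have "mu (t \<otimes>\<^sub>?K t) (\<theta> x) = mu t (mu t (\<theta> x))" by (rule actionD(2)[OF mu zX[OF True] c(2) c(2)])
    finally show ?thesis using True muX zX by (simp only: z_def extend_id_def if_True)
  next
    case False
    then show ?thesis by (simp only: z_def extend_id_def if_False)
  qed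
  show thesis
  proof (rule that[of ?T z j, folded a_def t_def])
    show "?T \<in> hom ?K perms" by (rule mu_hom)
    show "inj_on ?T (carrier ?K)"
    proof (rule inj_onI)
      fix g h assume gh: "g \<in> carrier ?K" "h \<in> carrier ?K" "?T g = ?T h"
      from fun_cong[OF gh(3), of "(\<one>\<^sub>?K, \<one>\<^sub>F2, 0)"] show "g = h"
        using gh by (simp add: extend_id_def mu_def)
    qed
    show "bij z" unfolding z_def by (rule bij_extend_id[OF th(1)])
    show "z \<circ> ?T t = ?T t \<circ> ?T t \<circ> z" using comm by (auto simp: fun_eq_iff)
    show "inj_on j (carrier F2)" by (rule jinj)
    show "\<forall>f\<in>carrier F2. ?T a (j f) = j (fx \<otimes>\<^sub>F2 f)"
    proof
      fix f assume f: "f \<in> carrier F2"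
      have "a \<otimes>\<^sub>?K a [^]\<^sub>?K fst (d f) = a [^]\<^sub>?K (fst (d f) + 1)"
        using K.int_pow_mult[OF c(1), of 1 "fst (d f)"] c by (simp add: add.commute)
      then have "mu a (j f) = j (fx \<otimes>\<^sub>F2 f)" by (simp add: mu_def j_def dx[OF f])
      then show "?T a (j f) = j (fx \<otimes>\<^sub>F2 f)" using jX[OF f] by (simp only: extend_id_def if_True)
    qed
    show "\<forall>f\<in>carrier F2. z (j f) = j (fy \<otimes>\<^sub>F2 f)"
    proof
      fix f assume f: "f \<in> carrier F2"
      then show "z (j f) = j (fy \<otimes>\<^sub>F2 f)" using th(3)[of "j f"] jX[OF f] by (simp only: z_def extend_id_def if_True jd imageI)
    qed
  qed
qed

lemma torsion_free_image:
  assumes "group G" "group H" "f \<in> hom G H" "inj_on f (carrier G)" "torsion_free G"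
  shows "torsion_free (H\<lparr>carrier := f ` carrier G\<rparr>)"
  unfolding torsion_free_def
proof (intro ballI allI impI)
  interpret group_hom G H f by (rule group_homI[OF assms(1-3)])
  fix x and n :: nat
  assume x: "x \<in> carrier (H\<lparr>carrier := f ` carrier G\<rparr>)" "n > 0"
    "x [^]\<^bsub>H\<lparr>carrier := f ` carrier G\<rparr>\<^esub> n = \<one>\<^bsub>H\<lparr>carrier := f ` carrier G\<rparr>\<^esub>"
  then obtain y where y: "y \<in> carrier G" "x = f y" by auto
  have "f y [^]\<^sub>H n = \<one>\<^sub>H" using x(3) y(2) by (simp flip: H.nat_pow_consistent)
  then have "f (y [^]\<^sub>G n) = f \<one>\<^sub>G" using hom_nat_pow[OF y(1), of n] by simp
  then have "y [^]\<^sub>G n = \<one>\<^sub>G" by (rule inj_onD[OF assms(4)]) (use y in auto)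
  then have "y = \<one>\<^sub>G" using assms(5) x(2) y(1) unfolding torsion_free_def by blast
  then show "x = \<one>\<^bsub>H\<lparr>carrier := f ` carrier G\<rparr>\<^esub>" using y by simp
qed

lemma subgroup_preimage:
  assumes "group G" "group H" "f \<in> hom G H" "subgroup N H"
  shows "subgroup {x \<in> carrier G. f x \<in> N} G"
proof -
  interpret group_hom G H f by (rule group_homI[OF assms(1-3)])
  have "\<one>\<^sub>G \<in> {x \<in> carrier G. f x \<in> N}" using subgroup.one_closed[OF assms(4)] by simp
  then show ?thesis
    by (intro group.subgroupI[OF assms(1)])
      (blast, blast, simp_all add: subgroup.m_closed[OF assms(4)] subgroup.m_inv_closed[OF assms(4)])
qed

text \<open>One permutation representation serves two purposes. It restricts to a faithful one of
  \<open>bs (Suc 0) 2\<close>, so \<open>e\<close> is injective; and the letters a and c act on a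
  copy of the free group by left multiplication, so they generate it freely.\<close>

lemma hk_free_subgroup_and_vertex:
  obtains e where "e \<in> hom (bs (Suc 0) 2) hk" "inj_on e (carrier (bs (Suc 0) 2))"
    "e (bs_a (Suc 0) 2) = hk_gen 0" "e (bs_t (Suc 0) 2) = hk_gen 1"
    "\<And>\<chi>. \<chi> \<in> hom F2 hk \<Longrightarrow> \<chi> fx = hk_gen 0 \<Longrightarrow> \<chi> fy = hk_gen 2 \<Longrightarrow> inj_on \<chi> (carrier F2)"
proof -
  let ?K = "bs (Suc 0) 2"
  interpret K: group ?K by (rule group_bs)
  interpret H: group hk by (rule group_hk)
  note c = bs_closed[of "Suc 0" 2]
  have g: "hk_gen 0 \<in> carrier hk" "hk_gen 1 \<in> carrier hk" "hk_gen 2 \<in> carrier hk" by (simp_all add: hk_closed)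
  have "hk_gen 1 \<otimes>\<^sub>hk hk_gen 0 [^]\<^sub>hk Suc 0 \<otimes>\<^sub>hk inv\<^bsub>hk\<^esub> (hk_gen 1) = hk_gen 0 [^]\<^sub>hk (2::nat)"
    using hk_relations(1) g by simp
  then obtain e where e: "e \<in> hom ?K hk" "e (bs_a (Suc 0) 2) = hk_gen 0" "e (bs_t (Suc 0) 2) = hk_gen 1"
    by (rule bs_hom[OF group_hk g(1,2)])
  obtain \<Theta>0 :: "nat gword set \<Rightarrow> nat gword set \<times> nat gword set \<times> nat \<Rightarrow> nat gword set \<times> nat gword set \<times> nat"
    and z j where T0: "\<Theta>0 \<in> hom ?K perms" "inj_on \<Theta>0 (carrier ?K)" and z: "bij z"
      "z \<circ> \<Theta>0 (bs_t (Suc 0) 2) = \<Theta>0 (bs_t (Suc 0) 2) \<circ> \<Theta>0 (bs_t (Suc 0) 2) \<circ> z" and j: "inj_on j (carrier F2)"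
      "\<forall>f\<in>carrier F2. \<Theta>0 (bs_a (Suc 0) 2) (j f) = j (fx \<otimes>\<^sub>F2 f)"
      "\<forall>f\<in>carrier F2. z (j f) = j (fy \<otimes>\<^sub>F2 f)"
    by (rule higman_rep[of "Suc 0" 2]) (simp, simp, rule that)
  let ?S = "perms :: (nat gword set \<times> nat gword set \<times> nat \<Rightarrow> _) monoid"
  interpret S: group ?S by (rule group_perms)
  interpret T0: group_hom ?K ?S \<Theta>0 by (rule group_homI[OF group_bs group_perms T0(1)])
  let ?a = "\<Theta>0 (bs_a (Suc 0) 2)" let ?t = "\<Theta>0 (bs_t (Suc 0) 2)"
  have Sc: "?a \<in> carrier ?S" "?t \<in> carrier ?S" "z \<in> carrier ?S"
    using T0.hom_closed[OF c(1)] T0.hom_closed[OF c(2)] z(1) by simp_all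
  have r1: "?t \<otimes>\<^sub>?S ?a \<otimes>\<^sub>?S inv\<^bsub>?S\<^esub> ?t = ?a [^]\<^sub>?S (2::nat)"
  proof -
    have "bs_t (Suc 0) 2 \<otimes>\<^sub>?K bs_a (Suc 0) 2 \<otimes>\<^sub>?K inv\<^bsub>?K\<^esub> (bs_t (Suc 0) 2) = bs_a (Suc 0) 2 [^]\<^sub>?K (2::nat)"
      using bs_relation[of "Suc 0" 2] c by simp
    from arg_cong[OF this, of \<Theta>0] show ?thesis
      using c by (simp only: T0.hom_mult T0.hom_inv T0.hom_nat_pow K.m_closed K.inv_closed)
  qed
  have t2: "?t [^]\<^sub>?S (2::nat) = ?t \<otimes>\<^sub>?S ?t" using Sc(2) by (simp only: numeral_2_eq_2 S.nat_pow_Suc S.nat_pow_0 S.l_one)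
  have r2: "z \<otimes>\<^sub>?S ?t \<otimes>\<^sub>?S inv\<^bsub>?S\<^esub> z = ?t [^]\<^sub>?S (2::nat)"
    unfolding t2 using Sc by (subst S.inv_solve_right') (simp_all only: S.m_closed, simp add: z(2))
  obtain \<Theta> where Th: "\<Theta> \<in> hom hk ?S" "\<Theta> (hk_gen 0) = ?a" "\<Theta> (hk_gen 1) = ?t" "\<Theta> (hk_gen 2) = z"
    using hk_hom[OF group_perms Sc r1 r2] by blast
  have eq: "(\<Theta> \<circ> e) g = \<Theta>0 g" if "g \<in> carrier ?K" for g
    by (rule hom_eq_on_generators[where f = "\<Theta> \<circ> e" and g = \<Theta>0, OF generates_bs group_bs group_perms hom_compose[OF e(1) Th(1)] T0(1) _ that])
      (auto simp: e Th simp del: One_nat_def)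
  have "inj_on e (carrier ?K)"
    by (rule inj_onI) (metis T0(2) comp_apply eq inj_onD)
  moreover have "inj_on \<chi> (carrier F2)" if "\<chi> \<in> hom F2 hk" "\<chi> fx = hk_gen 0" "\<chi> fy = hk_gen 2" for \<chi>
    by (rule F2_faithful[OF group_hk that(1) Th(1) j(1)]) (use j(2,3) in \<open>simp_all add: that Th\<close>)
  ultimately show thesis using that[OF e(1) _ e(2,3)] by blast
qed

text \<open>An HNN extension of the group \<open>bs (Suc 0) 2\<close> generated by a and b, with
  stable letter c that conjugates b to its square; the edge group is the cyclic group of b.\<close>

lemma torsion_free_hk: "torsion_free hk"
proof -
  interpret group hk by (rule group_hk)
  obtain e where e: "e \<in> hom (bs (Suc 0) 2) hk" "inj_on e (carrier (bs (Suc 0) 2))"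
    "e (bs_a (Suc 0) 2) = hk_gen 0" "e (bs_t (Suc 0) 2) = hk_gen 1"
    by (rule hk_free_subgroup_and_vertex) (rule that)
  interpret e: group_hom "bs (Suc 0) 2" hk e by (rule group_homI[OF group_bs group_hk e(1)])
  define b where "b = hk_gen 1" define c where "c = hk_gen 2" define a where "a = hk_gen 0"
  have cl: "a \<in> carrier hk" "b \<in> carrier hk" "c \<in> carrier hk" by (simp_all add: a_def b_def c_def hk_closed)
  let ?V = "e ` carrier (bs (Suc 0) 2)" let ?C = "cyclic hk b"
  have V: "subgroup ?V hk" by (rule e.img_is_subgroup)
  have C: "subgroup ?C hk" using cl by (simp add: subgroup_cyclic)
  have aV: "a \<in> ?V" "b \<in> ?V" unfolding a_def b_def e(3,4)[symmetric] by (rule imageI[OF bs_closed(1)], rule imageI[OF bs_closed(2)])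
  have CV: "?C \<subseteq> ?V" using subgroup_int_pow_closed[OF V aV(2)] by (auto simp: cyclic_def)
  have rel: "b \<otimes>\<^sub>hk a \<otimes>\<^sub>hk inv\<^bsub>hk\<^esub> b = a [^]\<^sub>hk (2::nat)" "c \<otimes>\<^sub>hk b \<otimes>\<^sub>hk inv\<^bsub>hk\<^esub> c = b [^]\<^sub>hk (2::nat)"
    unfolding a_def b_def c_def by (rule hk_relations)+
  interpret cj: group_hom hk hk "\<lambda>y. c \<otimes>\<^sub>hk y \<otimes>\<^sub>hk inv\<^bsub>hk\<^esub> c"
    by (rule group_homI[OF group_axioms group_axioms]) (use cl in \<open>auto intro!: homI simp: m_assoc\<close>)
  have b2V: "b [^]\<^sub>hk (2::nat) \<in> ?V" using subgroup_int_pow_closed[OF V aV(2), of 2] int_pow_int[of hk b 2] by simp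
  have conj: "c \<otimes>\<^sub>hk x \<otimes>\<^sub>hk inv\<^bsub>hk\<^esub> c \<in> ?V" if x: "x \<in> ?C" for x
  proof -
    obtain i :: int where i: "x = b [^]\<^sub>hk i" using x by (auto simp: cyclic_def)
    have "c \<otimes>\<^sub>hk x \<otimes>\<^sub>hk inv\<^bsub>hk\<^esub> c = (b [^]\<^sub>hk (2::nat)) [^]\<^sub>hk i"
      unfolding i using cj.hom_int_pow[OF cl(2), of i] rel(2) by simp
    then show ?thesis using subgroup_int_pow_closed[OF V b2V, of i] by simp
  qed
  have gen: "generates hk (insert c ?V)"
    unfolding generates_def
  proof (intro conjI allI impI)
    show "insert c ?V \<subseteq> carrier hk" using cl subgroup.subset[OF V] by auto
    fix N assume "subgroup N hk" "insert c ?V \<subseteq> N"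
    then show "N = carrier hk" using generates_hk aV unfolding generates_def a_def b_def c_def by blast
  qed
  \<comment> \<open>Only the stable letter contributes an edge, so the derivation vanishes on the
    two generators of the vertex group.\<close>
  let ?\<delta> = "\<lambda>(i::nat) (k :: _ \<Rightarrow> int). if i = 2 then k (c <#\<^bsub>hk\<^esub> ?C) else 0"
  let ?act = "lact hk ?C"
  let ?D = "derivation_group hk ?act :: (((_ \<Rightarrow> int) \<Rightarrow> int) \<times> _) monoid"
  have act: "total_action hk ?act" by (rule total_action_lact[OF C])
  interpret D: group ?D by (rule group_derivation_group[OF group_axioms act])
  let ?h = "\<lambda>i. (?\<delta> i, hk_gen i)"
  have hc: "?h i \<in> carrier ?D" if "i < 3" for i
    using hk_closed[OF that] by (simp add: additive_functional_def)
  then have h: "?h ` {..<3} \<subseteq> carrier ?D" by blast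
  have ev: "weval ?D ?h (gen i) = ?h i" if "i < 3" for i
    by (rule D.weval_gen[where h = "?h", OF hc[OF that]])
  let ?z = "\<lambda>p. (\<lambda>k :: _ \<Rightarrow> int. 0 :: int, p)"
  have zc: "?z p \<in> carrier ?D" if "p \<in> carrier hk" for p using that by (simp add: additive_functional_def)
  have r1: "?z b \<otimes>\<^sub>?D ?z a \<otimes>\<^sub>?D inv\<^bsub>?D\<^esub> (?z b) = ?z a [^]\<^sub>?D (2::nat)"
  proof -
    have "b \<otimes>\<^sub>hk a = a [^]\<^sub>hk (2::nat) \<otimes>\<^sub>hk b" using rel(1) cl by (intro inv_solve_right'[THEN iffD1]) simp_all
    then have "?z b \<otimes>\<^sub>?D ?z a = ?z (a [^]\<^sub>hk (2::nat)) \<otimes>\<^sub>?D ?z b" by simp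
    then show ?thesis unfolding derivation_group_pow_zero[OF group_axioms act cl(1)]
      by (subst D.inv_solve_right') (use zc cl in \<open>simp_all only: D.m_closed nat_pow_closed\<close>)
  qed
  have r2: "(?\<delta> 2, c) \<otimes>\<^sub>?D ?z b \<otimes>\<^sub>?D inv\<^bsub>?D\<^esub> (?\<delta> 2, c) = ?z b [^]\<^sub>?D (2::nat)"
    unfolding derivation_group_pow_zero[OF group_axioms act cl(2)]
    by (rule stable_letter_relation[OF C cl(3) cyclic_self[OF cl(2)] _ rel(2)]) (use cl in simp_all)
  have he: "?h 0 = ?z a" "?h 1 = ?z b" "?h 2 = (?\<delta> 2, c)" by (simp_all add: a_def b_def c_def)
  obtain T where T: "derivation hk ?act T" "\<And>x. x \<in> {..<3} \<Longrightarrow> T (hk_gen x) = ?\<delta> x"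
  proof (rule presentation_derivation[of "{..<3::nat}" hk_rel ?act ?\<delta>, folded hk_def hk_gen_def])
    fix r assume "r \<in> hk_rel" "r \<in> gwords {..<3}"
    then consider "r = relator (gen 1 @ gen 0 @ winv (gen 1)) (wpow (gen 0) 2)"
      | "r = relator (gen 2 @ gen 1 @ winv (gen 2)) (wpow (gen 1) 2)" by (auto simp: hk_rel_def)
    then show "weval ?D ?h r = \<one>\<^sub>?D"
    proof cases
      case 1
      have "weval ?D ?h (gen 1 @ gen 0 @ winv (gen 1)) = ?h 1 \<otimes>\<^sub>?D ?h 0 \<otimes>\<^sub>?D inv\<^bsub>?D\<^esub> (?h 1)"
        using hc[of 0] hc[of 1] by (simp only: D.weval_append[OF h] D.weval_winv[OF h] ev gwords_app gwords_gen gwords_winv lessThan_iff D.m_assoc D.inv_closed zero_less_numeral one_less_numeral_iff semiring_norm)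
      moreover have "weval ?D ?h (wpow (gen 0) 2) = ?h 0 [^]\<^sub>?D (2::nat)"
        using hc[of 0] by (simp only: D.weval_wpow[OF h] ev gwords_gen lessThan_iff zero_less_numeral)
      ultimately have "weval ?D ?h (gen 1 @ gen 0 @ winv (gen 1)) = weval ?D ?h (wpow (gen 0) 2)" using r1 unfolding he by (simp only:)
      then show ?thesis unfolding 1 by (subst D.weval_relator[OF h]) (simp_all del: derivation_group_simps)
    next
      case 2
      have "weval ?D ?h (gen 2 @ gen 1 @ winv (gen 2)) = ?h 2 \<otimes>\<^sub>?D ?h 1 \<otimes>\<^sub>?D inv\<^bsub>?D\<^esub> (?h 2)"
        using hc[of 2] hc[of 1] by (simp only: D.weval_append[OF h] D.weval_winv[OF h] ev gwords_app gwords_gen gwords_winv lessThan_iff D.m_assoc D.inv_closed numeral_less_iff one_less_numeral_iff semiring_norm)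
      moreover have "weval ?D ?h (wpow (gen 1) 2) = ?h 1 [^]\<^sub>?D (2::nat)"
        using hc[of 1] by (simp only: D.weval_wpow[OF h] ev gwords_gen lessThan_iff one_less_numeral_iff semiring_norm)
      ultimately have "weval ?D ?h (gen 2 @ gen 1 @ winv (gen 2)) = weval ?D ?h (wpow (gen 1) 2)" using r2 unfolding he by (simp only:)
      then show ?thesis unfolding 2 by (subst D.weval_relator[OF h]) (simp_all del: derivation_group_simps)
    qed
  qed (auto simp: act additive_functional_def)
  have T0: "T a k = 0" "T b k = 0" and Tc: "T c k = k (c <#\<^bsub>hk\<^esub> ?C)" for k
    using T(2)[of 0] T(2)[of 1] T(2)[of 2] by (simp_all add: a_def b_def c_def)
  have N: "subgroup {p \<in> carrier hk. \<forall>k. T p k = 0} hk" by (rule derivation_zero_subgroup[OF group_axioms act T(1)])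
  have "subgroup {x \<in> carrier (bs (Suc 0) 2). e x \<in> {p \<in> carrier hk. \<forall>k. T p k = 0}} (bs (Suc 0) 2)"
    by (rule subgroup_preimage[OF group_bs group_hk e(1) N])
  then have "x \<in> {x \<in> carrier (bs (Suc 0) 2). e x \<in> {p \<in> carrier hk. \<forall>k. T p k = 0}}" if "x \<in> carrier (bs (Suc 0) 2)" for x
    by (rule generatesD[OF generates_bs _ _ that]) (use T0 cl bs_closed[of "Suc 0" 2] in \<open>auto simp: e a_def b_def\<close>)
  then have TV: "T v k = 0" if "v \<in> ?V" for v k using that by auto
  have tf: "torsion_free (hk\<lparr>carrier := ?V\<rparr>)"
    by (rule torsion_free_image[OF group_bs group_hk e(1,2) torsion_free_bs]) simp_all
  show ?thesis by (rule torsion_free_HNN[OF group_axioms V tf cl(3) C CV conj gen T(1) TV Tc])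
qed

text \<open>The letters a and c of one half are c and a of the other, which is the swap of the free
  group. As in the other family, an embedding into the amalgam with a left inverse on generators
  suffices.\<close>

lemma torsion_free_higman_group: "torsion_free higman_group"
proof -
  interpret K: group hk by (rule group_hk)
  let ?a = "hk_gen 0" let ?b = "hk_gen 1" let ?c = "hk_gen 2"
  have c: "?a \<in> carrier hk" "?b \<in> carrier hk" "?c \<in> carrier hk" by (simp_all add: hk_closed)
  obtain \<chi> where chi: "\<chi> \<in> hom F2 hk" "\<chi> fx = ?a" "\<chi> fy = ?c"
    using F2_hom[OF group_hk c(1,3)] by blast
  have inj: "inj_on \<chi> (carrier F2)"
    by (rule hk_free_subgroup_and_vertex) (use chi in blast)
  obtain \<sigma> where s: "\<sigma> \<in> hom F2 F2" "\<sigma> fx = fy" "\<sigma> fy = fx" "inj_on \<sigma> (carrier F2)"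
    using F2_swap by blast
  have cntK: "countable (carrier hk)" by (simp add: hk_def countable_presented_group)
  let ?Q = "amalgamated_product hk hk (carrier F2) \<chi> (\<chi> \<circ> \<sigma>)"
  have tf: "torsion_free ?Q"
    by (rule torsion_free_swap_amalgam[OF group_hk cntK torsion_free_hk chi(1) inj s(1,4)])
  have cs: "\<chi> \<circ> \<sigma> \<in> hom F2 hk" by (rule hom_compose[OF s(1) chi(1)])
  interpret am: amalgam hk hk "carrier F2" \<chi> "\<chi> \<circ> \<sigma>"
    by unfold_locales (use hom_carrier[OF chi(1)] hom_carrier[OF cs] in auto)
  interpret i1: group_hom hk ?Q am.i1 by (rule group_homI[OF group_hk am.P.group_axioms am.i1_hom])
  interpret i2: group_hom hk ?Q am.i2 by (rule group_homI[OF group_hk am.P.group_axioms am.i2_hom])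
  have gl: "am.i1 ?a = am.i2 ?c" "am.i1 ?c = am.i2 ?a"
    using am.i1_i2[of fx] am.i1_i2[of fy] by (simp_all add: s chi)
  define R where "R = {relator (gen 1 @ gen 0 @ winv (gen 1)) (wpow (gen (0::nat)) 2),
       relator (gen 2 @ gen 1 @ winv (gen 2)) (wpow (gen 1) 2),
       relator (gen 3 @ gen 2 @ winv (gen 3)) (wpow (gen 2) 2),
       relator (gen 0 @ gen 3 @ winv (gen 0)) (wpow (gen 3) 2)}"
  have A: "higman_group = presented_group {..<4} R"
    by (simp add: higman_group_def R_def Let_def)
  let ?A = "presented_group {..<4} R"
  interpret A: group ?A by (rule group_presented_group)
  let ?h = "\<lambda>i::nat. if i = 0 then am.i1 ?a else if i = 1 then am.i1 ?b else if i = 2 then am.i1 ?c else am.i2 ?b"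
  have h: "?h ` {..<4} \<subseteq> carrier ?Q" using c by auto
  have img1: "am.i1 x \<otimes>\<^sub>?Q am.i1 y \<otimes>\<^sub>?Q inv\<^bsub>?Q\<^esub> (am.i1 x) = am.i1 y [^]\<^sub>?Q (2::nat)"
    if "x \<otimes>\<^sub>hk y \<otimes>\<^sub>hk inv\<^bsub>hk\<^esub> x = y [^]\<^sub>hk (2::nat)" "x \<in> carrier hk" "y \<in> carrier hk" for x y
    using arg_cong[OF that(1), of am.i1] that(2,3)
    by (simp only: i1.hom_mult i1.hom_inv i1.hom_nat_pow K.m_closed K.inv_closed)
  have img2: "am.i2 x \<otimes>\<^sub>?Q am.i2 y \<otimes>\<^sub>?Q inv\<^bsub>?Q\<^esub> (am.i2 x) = am.i2 y [^]\<^sub>?Q (2::nat)"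
    if "x \<otimes>\<^sub>hk y \<otimes>\<^sub>hk inv\<^bsub>hk\<^esub> x = y [^]\<^sub>hk (2::nat)" "x \<in> carrier hk" "y \<in> carrier hk" for x y
    using arg_cong[OF that(1), of am.i2] that(2,3)
    by (simp only: i2.hom_mult i2.hom_inv i2.hom_nat_pow K.m_closed K.inv_closed)
  have relQ: "am.i1 ?b \<otimes>\<^sub>?Q am.i1 ?a \<otimes>\<^sub>?Q inv\<^bsub>?Q\<^esub> (am.i1 ?b) = am.i1 ?a [^]\<^sub>?Q (2::nat)"
    "am.i1 ?c \<otimes>\<^sub>?Q am.i1 ?b \<otimes>\<^sub>?Q inv\<^bsub>?Q\<^esub> (am.i1 ?c) = am.i1 ?b [^]\<^sub>?Q (2::nat)"
    "am.i2 ?b \<otimes>\<^sub>?Q am.i1 ?c \<otimes>\<^sub>?Q inv\<^bsub>?Q\<^esub> (am.i2 ?b) = am.i1 ?c [^]\<^sub>?Q (2::nat)"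
    "am.i1 ?a \<otimes>\<^sub>?Q am.i2 ?b \<otimes>\<^sub>?Q inv\<^bsub>?Q\<^esub> (am.i1 ?a) = am.i2 ?b [^]\<^sub>?Q (2::nat)"
    unfolding gl(2) by (rule img1[OF hk_relations(1) c(2,1)], rule img1[OF hk_relations(2) c(3,2), unfolded gl(2)],
        rule img2[OF hk_relations(1) c(2,1)], rule img2[OF hk_relations(2) c(3,2), folded gl(1)])
  have "\<exists>f\<in>hom ?A ?Q. \<forall>i\<in>{..<4}. f (pgen {..<4} R i) = ?h i"
  proof (rule von_dyck[OF am.P.group_axioms h])
    fix r assume "r \<in> R"
    then consider "r = relator (gen 1 @ gen 0 @ winv (gen 1)) (wpow (gen (0::nat)) 2)"
      | "r = relator (gen 2 @ gen 1 @ winv (gen 2)) (wpow (gen 1) 2)"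
      | "r = relator (gen 3 @ gen 2 @ winv (gen 3)) (wpow (gen 2) 2)"
      | "r = relator (gen 0 @ gen 3 @ winv (gen 0)) (wpow (gen 3) 2)"
      unfolding R_def by blast
    then show "weval ?Q ?h r = \<one>\<^sub>?Q"
      by cases (use c relQ in \<open>simp_all add: am.P.weval_relator[OF h] am.P.weval_append[OF h] am.P.weval_winv[OF h]
        am.P.weval_wpow[OF h] am.P.weval_gen am.P.m_assoc\<close>)
  qed
  then obtain f where f: "f \<in> hom ?A ?Q" "\<forall>i\<in>{..<4}. f (pgen {..<4} R i) = ?h i" by blast
  let ?g = "pgen {..<4} R"
  have gc: "?g 0 \<in> carrier ?A" "?g 1 \<in> carrier ?A" "?g 2 \<in> carrier ?A" "?g 3 \<in> carrier ?A" by (simp_all add: pgen_closed)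
  have gh: "?g ` {..<4} \<subseteq> carrier ?A" by (auto simp: pgen_closed)
  have relA: "?g j \<otimes>\<^sub>?A ?g i \<otimes>\<^sub>?A inv\<^bsub>?A\<^esub> (?g j) = ?g i [^]\<^sub>?A (2::nat)"
    if "relator (gen j @ gen i @ winv (gen j)) (wpow (gen i) 2) \<in> R" "i < 4" "j < 4" for i j
    using pgen_relator[OF that(1), of "{..<4}"] that(2,3)
    by (simp add: A.weval_append[OF gh] A.weval_winv[OF gh] A.weval_wpow[OF gh] A.weval_gen A.m_assoc pgen_closed)
  have rA: "?g 1 \<otimes>\<^sub>?A ?g 0 \<otimes>\<^sub>?A inv\<^bsub>?A\<^esub> (?g 1) = ?g 0 [^]\<^sub>?A (2::nat)"
    "?g 2 \<otimes>\<^sub>?A ?g 1 \<otimes>\<^sub>?A inv\<^bsub>?A\<^esub> (?g 2) = ?g 1 [^]\<^sub>?A (2::nat)"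
    "?g 3 \<otimes>\<^sub>?A ?g 2 \<otimes>\<^sub>?A inv\<^bsub>?A\<^esub> (?g 3) = ?g 2 [^]\<^sub>?A (2::nat)"
    "?g 0 \<otimes>\<^sub>?A ?g 3 \<otimes>\<^sub>?A inv\<^bsub>?A\<^esub> (?g 0) = ?g 3 [^]\<^sub>?A (2::nat)"
    by (rule relA; simp add: R_def)+
  obtain e1 where e1: "e1 \<in> hom hk ?A" "e1 ?a = ?g 0" "e1 ?b = ?g 1" "e1 ?c = ?g 2"
    using hk_hom[OF A.group_axioms gc(1,2,3) rA(1,2)] by blast
  obtain e2 where e2: "e2 \<in> hom hk ?A" "e2 ?a = ?g 2" "e2 ?b = ?g 3" "e2 ?c = ?g 0"
    using hk_hom[OF A.group_axioms gc(3,4,1) rA(3,4)] by blast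
  have agree: "e1 (\<chi> z) = e2 ((\<chi> \<circ> \<sigma>) z)" if "z \<in> carrier F2" for z
  proof -
    have "(e1 \<circ> \<chi>) z = (e2 \<circ> (\<chi> \<circ> \<sigma>)) z"
      by (rule hom_eq_on_generators[where f = "e1 \<circ> \<chi>" and g = "e2 \<circ> (\<chi> \<circ> \<sigma>)", OF generates_F2 group_F2 A.group_axioms hom_compose[OF chi(1) e1(1)] hom_compose[OF cs e2(1)] _ that])
        (auto simp: chi s e1 e2)
    then show ?thesis by simp
  qed
  obtain k where k: "k \<in> hom ?Q ?A" "\<And>x. x \<in> carrier hk \<Longrightarrow> k (am.i1 x) = e1 x" "\<And>x. x \<in> carrier hk \<Longrightarrow> k (am.i2 x) = e2 x"
    using am.universal[OF A.group_axioms e1(1) e2(1) agree] by blast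
  have kf: "(k \<circ> f) z = id z" if "z \<in> carrier ?A" for z
  proof (rule hom_eq_on_generators[where f = "k \<circ> f" and g = id, OF generates_presented_group A.group_axioms A.group_axioms hom_compose[OF f(1) k(1)] _ _ that])
    show "id \<in> hom ?A ?A" by (simp add: hom_def)
    fix b assume "b \<in> ?g ` {..<4}"
    then obtain i where i: "i < 4" "b = ?g i" by auto
    then consider "i = 0" | "i = 1" | "i = 2" | "i = 3" by linarith
    then show "(k \<circ> f) b = id b" using f(2) i by cases (simp_all add: k c e1 e2 del: One_nat_def)
  qed
  have "inj_on f (carrier ?A)" using kf by (intro inj_on_inverseI[where g = k]) simp
  then show ?thesis unfolding A by (rule torsion_free_inj[OF A.group_axioms am.P.group_axioms f(1) _ tf])
qed

section \<open>Perfect groups and central extensions\<close>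

definition perfect :: "('g, 'm) monoid_scheme \<Rightarrow> bool" where
  "perfect G \<longleftrightarrow> (\<forall>N. subgroup N G \<longrightarrow>
    (\<forall>x\<in>carrier G. \<forall>y\<in>carrier G. x \<otimes>\<^sub>G y \<otimes>\<^sub>G inv\<^bsub>G\<^esub> x \<otimes>\<^sub>G inv\<^bsub>G\<^esub> y \<in> N) \<longrightarrow> N = carrier G)"

definition central :: "('g, 'm) monoid_scheme \<Rightarrow> 'g \<Rightarrow> bool" where
  "central G k \<longleftrightarrow> k \<in> carrier G \<and> (\<forall>x\<in>carrier G. k \<otimes>\<^sub>G x = x \<otimes>\<^sub>G k)"

definition conjugate :: "('g, 'm) monoid_scheme \<Rightarrow> 'g \<Rightarrow> 'g \<Rightarrow> 'g" where
  "conjugate G x y = x \<otimes>\<^sub>G y \<otimes>\<^sub>G inv\<^bsub>G\<^esub> x"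

definition commutator :: "('g, 'm) monoid_scheme \<Rightarrow> 'g \<Rightarrow> 'g \<Rightarrow> 'g" where
  "commutator G x y = x \<otimes>\<^sub>G y \<otimes>\<^sub>G inv\<^bsub>G\<^esub> x \<otimes>\<^sub>G inv\<^bsub>G\<^esub> y"

context group begin

lemma conj_closed [simp]: "x \<in> carrier G \<Longrightarrow> y \<in> carrier G \<Longrightarrow> conjugate G x y \<in> carrier G"
  by (simp add: conjugate_def)

lemma comm_closed [simp]: "x \<in> carrier G \<Longrightarrow> y \<in> carrier G \<Longrightarrow> commutator G x y \<in> carrier G"
  by (simp add: commutator_def)

lemma conj_mult: "x \<in> carrier G \<Longrightarrow> y \<in> carrier G \<Longrightarrow> z \<in> carrier G \<Longrightarrow>
    conjugate G x (y \<otimes> z) = conjugate G x y \<otimes> conjugate G x z"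
  by (simp add: conjugate_def m_assoc)

lemma conj_mult_left: "x \<in> carrier G \<Longrightarrow> y \<in> carrier G \<Longrightarrow> z \<in> carrier G \<Longrightarrow>
    conjugate G (x \<otimes> y) z = conjugate G x (conjugate G y z)"
  by (simp add: conjugate_def m_assoc inv_mult_group)

lemma conj_hom: "x \<in> carrier G \<Longrightarrow> conjugate G x \<in> hom G G"
  by (intro homI) (simp_all add: conj_mult)

lemma conj_nat_pow: "x \<in> carrier G \<Longrightarrow> y \<in> carrier G \<Longrightarrow> conjugate G x (y [^] (n::nat)) = conjugate G x y [^] n"
  using group_hom.hom_nat_pow[OF group_homI[OF group_axioms group_axioms conj_hom]] .

lemma conj_int_pow: "x \<in> carrier G \<Longrightarrow> y \<in> carrier G \<Longrightarrow> conjugate G x (y [^] (n::int)) = conjugate G x y [^] n"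
  using group_hom.hom_int_pow[OF group_homI[OF group_axioms group_axioms conj_hom]] .

lemma comm_eq_one_iff: "x \<in> carrier G \<Longrightarrow> y \<in> carrier G \<Longrightarrow> commutator G x y = \<one> \<longleftrightarrow> x \<otimes> y = y \<otimes> x"
proof -
  assume c: "x \<in> carrier G" "y \<in> carrier G"
  have "commutator G x y = x \<otimes> y \<otimes> inv (y \<otimes> x)" using c by (simp add: commutator_def m_assoc inv_mult_group)
  then show ?thesis using inv_solve_right'[of \<one> "x \<otimes> y" "y \<otimes> x"] c by simp
qed

lemma centralD: "central G k \<Longrightarrow> k \<in> carrier G" "central G k \<Longrightarrow> x \<in> carrier G \<Longrightarrow> k \<otimes> x = x \<otimes> k"
  by (simp_all add: central_def)

lemma central_conj: "central G k \<Longrightarrow> x \<in> carrier G \<Longrightarrow> conjugate G x k = k"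
  "central G k \<Longrightarrow> x \<in> carrier G \<Longrightarrow> conjugate G k x = x"
proof -
  assume k: "central G k" and x: "x \<in> carrier G"
  have kc: "k \<in> carrier G" using k by (rule centralD)
  have "conjugate G x k = k \<otimes> x \<otimes> inv x" unfolding conjugate_def centralD(2)[OF k x] ..
  then show "conjugate G x k = k" using x kc by (simp add: m_assoc)
  have "conjugate G k x = x \<otimes> k \<otimes> inv k" unfolding conjugate_def centralD(2)[OF k x] ..
  then show "conjugate G k x = x" using x kc by (simp add: m_assoc)
qed

lemma conj_central_mult:
  assumes "central G k" "central G l" "x \<in> carrier G" "y \<in> carrier G"
  shows "conjugate G (x \<otimes> k) (y \<otimes> l) = conjugate G x y \<otimes> l"
  using assms centralD(1)[OF assms(1)] centralD(1)[OF assms(2)]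
  by (simp add: conj_mult conj_mult_left central_conj)

lemma comm_central_mult:
  assumes k: "central G k" "central G l" and c: "x \<in> carrier G" "y \<in> carrier G"
  shows "commutator G (x \<otimes> k) (y \<otimes> l) = commutator G x y"
proof -
  note kc = centralD(1)[OF k(1)] centralD(1)[OF k(2)]
  have "commutator G (x \<otimes> k) (y \<otimes> l) = conjugate G (x \<otimes> k) (y \<otimes> l) \<otimes> inv (y \<otimes> l)" by (simp add: commutator_def conjugate_def)
  also have "\<dots> = conjugate G x y \<otimes> l \<otimes> inv (y \<otimes> l)" using conj_central_mult[OF k c] by simp
  also have "\<dots> = conjugate G x y \<otimes> inv y" using c kc by (simp add: inv_mult_group m_assoc)
  finally show ?thesis by (simp add: commutator_def conjugate_def)
qed

lemma nat_pow_central_mult: "central G k \<Longrightarrow> x \<in> carrier G \<Longrightarrow> (x \<otimes> k) [^] (n::nat) = x [^] n \<otimes> k [^] n"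
  by (rule pow_mult_distrib[OF centralD(2)[symmetric]]) (simp_all add: centralD(1))

end

lemma comm_hom: "group G \<Longrightarrow> group H \<Longrightarrow> f \<in> hom G H \<Longrightarrow> x \<in> carrier G \<Longrightarrow> y \<in> carrier G \<Longrightarrow>
    f (commutator G x y) = commutator H (f x) (f y)"
  and conj_hom_image: "group G \<Longrightarrow> group H \<Longrightarrow> f \<in> hom G H \<Longrightarrow> x \<in> carrier G \<Longrightarrow> y \<in> carrier G \<Longrightarrow>
    f (conjugate G x y) = conjugate H (f x) (f y)"
proof -
  assume a: "group G" "group H" "f \<in> hom G H" "x \<in> carrier G" "y \<in> carrier G"
  interpret group_hom G H f by (rule group_homI[OF a(1-3)])
  show "f (commutator G x y) = commutator H (f x) (f y)" "f (conjugate G x y) = conjugate H (f x) (f y)"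
    using a(4,5) by (simp_all add: commutator_def conjugate_def)
qed

lemma perfectD:
  assumes "perfect G" "subgroup N G" "\<And>x y. x \<in> carrier G \<Longrightarrow> y \<in> carrier G \<Longrightarrow> commutator G x y \<in> N" "g \<in> carrier G"
  shows "g \<in> N"
  using assms unfolding perfect_def commutator_def by blast

lemma perfect_hom_trivial:
  assumes G: "group G" "perfect G" and H: "group H" "f \<in> hom G H"
    and ab: "\<And>x y. x \<in> carrier G \<Longrightarrow> y \<in> carrier G \<Longrightarrow> f x \<otimes>\<^sub>H f y = f y \<otimes>\<^sub>H f x"
    and g: "g \<in> carrier G"
  shows "f g = \<one>\<^sub>H"
proof -
  interpret group_hom G H f by (rule group_homI[OF G(1) H])
  have N: "subgroup {x \<in> carrier G. f x \<in> {\<one>\<^sub>H}} G"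
    by (rule subgroup_preimage[OF G(1) H H.triv_subgroup])
  have "g \<in> {x \<in> carrier G. f x \<in> {\<one>\<^sub>H}}"
  proof (rule perfectD[OF G(2) N _ g])
    fix x y assume xy: "x \<in> carrier G" "y \<in> carrier G"
    have "f (commutator G x y) = \<one>\<^sub>H"
      using ab[OF xy] xy by (simp add: comm_hom[OF G(1) H xy] H.comm_eq_one_iff)
    then show "commutator G x y \<in> {x \<in> carrier G. f x \<in> {\<one>\<^sub>H}}" using xy by simp
  qed
  then show ?thesis by simp
qed

text \<open>If all commutators of \<open>y\<close> with the image of a perfect group are central, then \<open>x \<mapsto> [f x, y]\<close>
  is a homomorphism to an abelian group.\<close>

lemma perfect_central_commute:
  assumes G: "group G" "perfect G" and H: "group H" "f \<in> hom G H" and y: "y \<in> carrier H"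
    and c: "\<And>x. x \<in> carrier G \<Longrightarrow> central H (commutator H (f x) y)" and g: "g \<in> carrier G"
  shows "f g \<otimes>\<^sub>H y = y \<otimes>\<^sub>H f g"
proof -
  interpret group_hom G H f by (rule group_homI[OF G(1) H])
  have cm: "commutator H (f (x \<otimes>\<^sub>G x')) y = commutator H (f x) y \<otimes>\<^sub>H commutator H (f x') y"
    if x: "x \<in> carrier G" "x' \<in> carrier G" for x x'
  proof -
    let ?k = "commutator H (f x') y"
    have kc: "?k \<in> carrier H" using x y by simp
    have "commutator H (f (x \<otimes>\<^sub>G x')) y = f x \<otimes>\<^sub>H (?k \<otimes>\<^sub>H (y \<otimes>\<^sub>H (inv\<^bsub>H\<^esub> (f x) \<otimes>\<^sub>H inv\<^bsub>H\<^esub> y)))"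
      using x y by (simp add: commutator_def H.m_assoc H.inv_mult_group)
    also have "\<dots> = (f x \<otimes>\<^sub>H (y \<otimes>\<^sub>H (inv\<^bsub>H\<^esub> (f x) \<otimes>\<^sub>H inv\<^bsub>H\<^esub> y))) \<otimes>\<^sub>H ?k"
      using H.centralD(2)[OF c[OF x(2)], of "y \<otimes>\<^sub>H (inv\<^bsub>H\<^esub> (f x) \<otimes>\<^sub>H inv\<^bsub>H\<^esub> y)"] x y kc by (simp add: H.m_assoc)
    also have "\<dots> = commutator H (f x) y \<otimes>\<^sub>H ?k" using x y by (simp add: commutator_def H.m_assoc)
    finally show ?thesis .
  qed
  have "(\<lambda>x. commutator H (f x) y) g = \<one>\<^sub>H"
  proof (rule perfect_hom_trivial[OF G H(1) _ _ g])
    show "(\<lambda>x. commutator H (f x) y) \<in> hom G H"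
    proof (rule homI)
      show "commutator H (f x) y \<in> carrier H" if "x \<in> carrier G" for x using that y by simp
    qed (rule cm)
    show "commutator H (f x) y \<otimes>\<^sub>H commutator H (f x') y = commutator H (f x') y \<otimes>\<^sub>H commutator H (f x) y"
      if "x \<in> carrier G" "x' \<in> carrier G" for x x'
      using H.centralD(2)[OF c[OF that(1)]] that y by simp
  qed
  then show ?thesis using g y by (simp add: H.comm_eq_one_iff)
qed

section \<open>The two families of acyclic groups\<close>

text \<open>Merges the two families into one parameter, so that perfectness, finite images and
  lifting are each stated once.\<close>

definition base :: "nat option \<Rightarrow> nat gword set monoid" where
  "base q = (case q of None \<Rightarrow> higman_group | Some p \<Rightarrow> four_generator_group p)"

definition base_rel :: "nat option \<Rightarrow> nat gword set" where
  "base_rel q = (case q of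
     None \<Rightarrow> {relator (gen 1 @ gen 0 @ winv (gen 1)) (wpow (gen 0) 2),
       relator (gen 2 @ gen 1 @ winv (gen 2)) (wpow (gen 1) 2),
       relator (gen 3 @ gen 2 @ winv (gen 3)) (wpow (gen 2) 2),
       relator (gen 0 @ gen 3 @ winv (gen 0)) (wpow (gen 3) 2)}
   | Some p \<Rightarrow> {winv (gen 0) @ wpow (gen 1) p @ gen 0 @ wpow (winv (gen 1)) (p + 1),
       winv (gen 2) @ wpow (gen 3) p @ gen 2 @ wpow (winv (gen 3)) (p + 1),
       winv (gen 0) @ wcomm (gen 3) (winv (gen 2) @ gen 3 @ gen 2),
       winv (gen 2) @ wcomm (gen 1) (winv (gen 0) @ gen 1 @ gen 0)})"

definition base_gen :: "nat option \<Rightarrow> nat \<Rightarrow> nat gword set" where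
  "base_gen q = pgen {..<4} (base_rel q)"

text \<open>The relators rewritten as equations between conjugates, powers and commutators, the form
  in which central corrections and finite images are computed.\<close>

definition base_relations :: "nat option \<Rightarrow> ('h, 'm) monoid_scheme \<Rightarrow> (nat \<Rightarrow> 'h) \<Rightarrow> bool" where
  "base_relations q H g = (case q of
     None \<Rightarrow> conjugate H (g 1) (g 0) = g 0 [^]\<^sub>H (2::nat) \<and> conjugate H (g 2) (g 1) = g 1 [^]\<^sub>H (2::nat)
       \<and> conjugate H (g 3) (g 2) = g 2 [^]\<^sub>H (2::nat) \<and> conjugate H (g 0) (g 3) = g 3 [^]\<^sub>H (2::nat)
   | Some p \<Rightarrow> conjugate H (inv\<^bsub>H\<^esub> (g 0)) (g 1 [^]\<^sub>H p) = g 1 [^]\<^sub>H (p + 1)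
       \<and> conjugate H (inv\<^bsub>H\<^esub> (g 2)) (g 3 [^]\<^sub>H p) = g 3 [^]\<^sub>H (p + 1)
       \<and> g 0 = commutator H (g 3) (conjugate H (inv\<^bsub>H\<^esub> (g 2)) (g 3))
       \<and> g 2 = commutator H (g 1) (conjugate H (inv\<^bsub>H\<^esub> (g 0)) (g 1)))"

lemma base_eq: "base q = presented_group {..<4} (base_rel q)"
  by (cases q) (simp_all add: base_def base_rel_def higman_group_def four_generator_group_def Let_def)

lemma group_base: "group (base q)"
  by (simp add: base_eq group_presented_group)

lemma base_gen_closed: "i < 4 \<Longrightarrow> base_gen q i \<in> carrier (base q)"
  by (simp add: base_eq base_gen_def pgen_closed)

lemma generates_base: "generates (base q) (base_gen q ` {..<4})"
  by (simp add: base_eq base_gen_def generates_presented_group)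

lemma countable_base: "countable (carrier (base q))"
  by (simp add: base_eq countable_presented_group)

lemma finite_base_rel: "finite (base_rel q)"
  by (cases q) (simp_all add: base_rel_def)

lemma base_rel_gwords: "base_rel q \<subseteq> gwords {..<4}"
  by (cases q) (simp_all add: base_rel_def relator_def)

lemma less_4_cases: "i < (4::nat) \<Longrightarrow> (i = 0 \<Longrightarrow> P) \<Longrightarrow> (i = 1 \<Longrightarrow> P) \<Longrightarrow> (i = 2 \<Longrightarrow> P) \<Longrightarrow> (i = 3 \<Longrightarrow> P) \<Longrightarrow> P"
  by linarith

lemma base_relations_iff:
  assumes H: "group H" and h: "g ` {..<4} \<subseteq> carrier H"
  shows "(\<forall>r\<in>base_rel q. weval H g r = \<one>\<^sub>H) \<longleftrightarrow> base_relations q H g"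
proof -
  interpret group H by (rule H)
  have c: "g 0 \<in> carrier H" "g 1 \<in> carrier H" "g 2 \<in> carrier H" "g 3 \<in> carrier H" using h by auto
  note W = weval_append[OF h] weval_winv[OF h] weval_wpow[OF h] weval_wcomm[OF h] weval_gen c
  show ?thesis
  proof (cases q)
    case None
    have r: "weval H g (relator (gen j @ gen i @ winv (gen j)) (wpow (gen i) 2)) = \<one>\<^sub>H \<longleftrightarrow> conjugate H (g j) (g i) = g i [^]\<^sub>H (2::nat)"
      if ij: "i < 4" "j < 4" for i j
    proof -
      have "g i \<in> carrier H" "g j \<in> carrier H" using h ij by auto
      then show ?thesis using ij by (simp add: weval_relator[OF h] W conjugate_def m_assoc)
    qed
    show ?thesis unfolding None base_rel_def base_relations_def option.case
      by (simp only: ball_simps r zero_less_numeral one_less_numeral_iff numeral_less_iff semiring_norm simp_thms)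
  next
    case (Some p)
    have 1: "weval H g (winv (gen i) @ wpow (gen j) p @ gen i @ wpow (winv (gen j)) n) = \<one>\<^sub>H
        \<longleftrightarrow> conjugate H (inv\<^bsub>H\<^esub> (g i)) (g j [^]\<^sub>H p) = g j [^]\<^sub>H n" if ij: "i < 4" "j < 4" for i j and n :: nat
    proof -
      have gc: "g i \<in> carrier H" "g j \<in> carrier H" using h ij by auto
      have "weval H g (winv (gen i) @ wpow (gen j) p @ gen i @ wpow (winv (gen j)) n)
          = conjugate H (inv\<^bsub>H\<^esub> (g i)) (g j [^]\<^sub>H p) \<otimes>\<^sub>H inv\<^bsub>H\<^esub> (g j [^]\<^sub>H n)"
        using ij gc by (simp add: W conjugate_def m_assoc nat_pow_inv)
      then show ?thesis using inv_solve_right'[of "\<one>\<^sub>H" "conjugate H (inv\<^bsub>H\<^esub> (g i)) (g j [^]\<^sub>H p)" "g j [^]\<^sub>H n"] gc by simp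
    qed
    have 2: "weval H g (winv (gen i) @ wcomm (gen k) (winv (gen j) @ gen k @ gen j)) = \<one>\<^sub>H
        \<longleftrightarrow> g i = commutator H (g k) (conjugate H (inv\<^bsub>H\<^esub> (g j)) (g k))" if ij: "i < 4" "j < 4" "k < 4" for i j k
    proof -
      have gc: "g i \<in> carrier H" "g j \<in> carrier H" "g k \<in> carrier H" using h ij by auto
      have "weval H g (winv (gen i) @ wcomm (gen k) (winv (gen j) @ gen k @ gen j))
          = inv\<^bsub>H\<^esub> (g i) \<otimes>\<^sub>H commutator H (g k) (conjugate H (inv\<^bsub>H\<^esub> (g j)) (g k))"
        using ij gc by (simp add: W conjugate_def commutator_def m_assoc)
      then show ?thesis using inv_solve_left'[of "\<one>\<^sub>H" "g i" "commutator H (g k) (conjugate H (inv\<^bsub>H\<^esub> (g j)) (g k))"] gc by auto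
    qed
    show ?thesis unfolding Some base_rel_def base_relations_def option.case
      by (simp only: ball_simps 1 2 zero_less_numeral one_less_numeral_iff numeral_less_iff semiring_norm simp_thms)
  qed
qed

lemma base_relations_base: "base_relations q (base q) (base_gen q)"
proof -
  have "base_gen q ` {..<4} \<subseteq> carrier (base q)" by (auto simp: base_gen_closed)
  moreover have "\<forall>r\<in>base_rel q. weval (base q) (base_gen q) r = \<one>\<^bsub>base q\<^esub>"
    using pgen_relation[of _ "base_rel q" "{..<4}"] base_rel_gwords[of q] unfolding base_eq base_gen_def by blast
  ultimately show ?thesis using base_relations_iff[OF group_base] by blast
qed

lemma base_hom:
  assumes H: "group H" "g ` {..<4} \<subseteq> carrier H" "base_relations q H g"
  obtains f where "f \<in> hom (base q) H" "\<And>i. i < 4 \<Longrightarrow> f (base_gen q i) = g i"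
proof -
  have "\<exists>f\<in>hom (base q) H. \<forall>i\<in>{..<4}. f (base_gen q i) = g i"
    unfolding base_eq base_gen_def
    by (rule von_dyck[OF H(1,2)]) (use base_relations_iff[OF H(1,2)] H(3) in blast)
  then show thesis using that by blast
qed

lemma base_relations_hom:
  assumes H: "group H" "f \<in> hom (base q) H"
  shows "base_relations q H (f \<circ> base_gen q)"
proof -
  interpret group_hom "base q" H f by (rule group_homI[OF group_base H])
  have c: "base_gen q ` {..<4} \<subseteq> carrier (base q)" by (auto simp: base_gen_closed)
  then have c': "(f \<circ> base_gen q) ` {..<4} \<subseteq> carrier H" by auto
  have "weval H (f \<circ> base_gen q) r = \<one>\<^sub>H" if "r \<in> base_rel q" for r
    using weval_hom[OF group_base H c, of r] base_relations_iff[OF group_base c] base_relations_base that base_rel_gwords[of q]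
    by (metis hom_one subsetD)
  then show ?thesis using base_relations_iff[OF H(1) c'] by blast
qed

text \<open>Each relation exhibits a generator as a commutator. In the Higman group [b, a] = a, and
  so on around the cycle. In the other family a1 and b1 are commutators outright, while
  [a1^-1, a2^p] = a2 and likewise for b2.\<close>

lemma perfect_base: "perfect (base q)"
  unfolding perfect_def commutator_def[symmetric]
proof (intro allI impI)
  interpret group "base q" by (rule group_base)
  fix N assume N: "subgroup N (base q)"
    and "\<forall>x\<in>carrier (base q). \<forall>y\<in>carrier (base q). commutator (base q) x y \<in> N"
  then have cm: "commutator (base q) x y \<in> N" if "x \<in> carrier (base q)" "y \<in> carrier (base q)" for x y using that by blast
  let ?g = "base_gen q"
  have c: "?g 0 \<in> carrier (base q)" "?g 1 \<in> carrier (base q)" "?g 2 \<in> carrier (base q)" "?g 3 \<in> carrier (base q)"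
    by (simp_all add: base_gen_closed)
  have "?g 0 \<in> N \<and> ?g 1 \<in> N \<and> ?g 2 \<in> N \<and> ?g 3 \<in> N"
  proof (cases q)
    case None
    have x: "x \<in> N" if "x \<in> carrier (base q)" "y \<in> carrier (base q)" "conjugate (base q) y x = x [^]\<^bsub>base q\<^esub> (2::nat)" for x y
    proof -
      have "commutator (base q) y x = x [^]\<^bsub>base q\<^esub> (2::nat) \<otimes>\<^bsub>base q\<^esub> inv\<^bsub>base q\<^esub> x"
        using that(3) by (simp add: commutator_def conjugate_def)
      also have "\<dots> = x" using that by (simp add: numeral_2_eq_2 m_assoc)
      finally show ?thesis using cm[OF that(2,1)] by simp
    qed
    show ?thesis using base_relations_base[of q] x[OF c(1,2)] x[OF c(2,3)] x[OF c(3,4)] x[OF c(4,1)]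
      by (simp add: base_relations_def None)
  next
    case (Some p)
    have x: "x \<in> N" if "x \<in> carrier (base q)" "y \<in> carrier (base q)"
      "conjugate (base q) (inv\<^bsub>base q\<^esub> y) (x [^]\<^bsub>base q\<^esub> p) = x [^]\<^bsub>base q\<^esub> (p + 1)" for x y
    proof -
      have "commutator (base q) (inv\<^bsub>base q\<^esub> y) (x [^]\<^bsub>base q\<^esub> p) = x [^]\<^bsub>base q\<^esub> (p + 1) \<otimes>\<^bsub>base q\<^esub> inv\<^bsub>base q\<^esub> (x [^]\<^bsub>base q\<^esub> p)"
        using that(3) by (simp only: commutator_def conjugate_def)
      also have "x [^]\<^bsub>base q\<^esub> (p + 1) = x \<otimes>\<^bsub>base q\<^esub> x [^]\<^bsub>base q\<^esub> p"
        using nat_pow_Suc2[OF that(1), of p] by (simp only: Suc_eq_plus1)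
      also have "x \<otimes>\<^bsub>base q\<^esub> x [^]\<^bsub>base q\<^esub> p \<otimes>\<^bsub>base q\<^esub> inv\<^bsub>base q\<^esub> (x [^]\<^bsub>base q\<^esub> p) = x" using that(1) by (simp add: m_assoc)
      finally show ?thesis using cm[of "inv\<^bsub>base q\<^esub> y" "x [^]\<^bsub>base q\<^esub> p"] that by simp
    qed
    have r: "conjugate (base q) (inv\<^bsub>base q\<^esub> (?g 0)) (?g 1 [^]\<^bsub>base q\<^esub> p) = ?g 1 [^]\<^bsub>base q\<^esub> (p + 1)"
      "conjugate (base q) (inv\<^bsub>base q\<^esub> (?g 2)) (?g 3 [^]\<^bsub>base q\<^esub> p) = ?g 3 [^]\<^bsub>base q\<^esub> (p + 1)"
      "?g 0 = commutator (base q) (?g 3) (conjugate (base q) (inv\<^bsub>base q\<^esub> (?g 2)) (?g 3))"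
      "?g 2 = commutator (base q) (?g 1) (conjugate (base q) (inv\<^bsub>base q\<^esub> (?g 0)) (?g 1))"
      using base_relations_base[of q] unfolding base_relations_def Some option.case by blast+
    have "?g 0 \<in> N" by (subst r(3)) (use c in \<open>intro cm conj_closed inv_closed\<close>)
    moreover have "?g 2 \<in> N" by (subst r(4)) (use c in \<open>intro cm conj_closed inv_closed\<close>)
    ultimately show ?thesis using x[OF c(2,1) r(1)] x[OF c(4,3) r(2)] by blast
  qed
  then have "?g ` {..<4} \<subseteq> N" by (auto elim!: less_4_cases)
  then show "N = carrier (base q)" using generates_base[of q] N unfolding generates_def by blast
qed

lemma torsion_free_base:
  assumes "\<And>p. q = Some p \<Longrightarrow> p \<ge> 3"
  shows "torsion_free (base q)"
  using assms torsion_free_higman_group torsion_free_four_generator_group by (cases q) (auto simp: base_def)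

section \<open>Triviality of the finite images of the base groups\<close>

lemma generates_hom_trivial:
  assumes "generates G B" "group G" "group H" "f \<in> hom G H" "\<And>b. b \<in> B \<Longrightarrow> f b = \<one>\<^sub>H" "x \<in> carrier G"
  shows "f x = \<one>\<^sub>H"
  by (rule hom_eq_on_generators[where g = "\<lambda>_. \<one>\<^sub>H", OF assms(1-4) _ assms(5,6)])
    (simp_all add: trivial_hom assms(3))

text \<open>Higman's argument. Conjugating as often as the order of \<open>y\<close> shows that 2 to
  this order is 1 modulo \<open>p\<close>. The multiplicative order of 2 modulo \<open>p\<close>
  thus divides both the order of \<open>y\<close> and p - 1; it is not 1, so it has a prime factor
  below \<open>p\<close>.\<close>

lemma finite_group_squaring_descent:
  fixes G (structure)
  assumes G: "group G" "finite (carrier G)" and c: "x \<in> carrier G" "y \<in> carrier G"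
    and rel: "conjugate G y x = x [^] (2::nat)" and p: "prime p" "p dvd group.ord G x"
  shows "\<exists>q. prime q \<and> q dvd group.ord G y \<and> q < p"
proof -
  interpret group G by (rule G(1))
  have it: "conjugate G (y [^] k) x = x [^] ((2::nat) ^ k)" for k :: nat
  proof (induction k)
    case (Suc k)
    have "conjugate G (y [^] Suc k) x = conjugate G (y [^] k) (conjugate G y x)" using c by (simp add: conj_mult_left)
    also have "\<dots> = conjugate G (y [^] k) x [^] (2::nat)" using c rel by (simp add: conj_nat_pow)
    also have "\<dots> = x [^] ((2::nat) ^ Suc k)" using c Suc by (simp add: nat_pow_pow mult.commute)
    finally show ?case .
  qed (use c in \<open>simp add: conjugate_def\<close>)
  let ?k = "group.ord G y"
  have "y [^] ?k = \<one>" using c by (simp add: pow_ord_eq_1)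
  then have xk: "x [^] ((2::nat) ^ ?k) = x" using it[of ?k] c by (simp add: conjugate_def)
  obtain M where M: "(2::nat) ^ ?k = Suc M" by (metis not0_implies_Suc power_not_zero zero_neq_numeral)
  have "x [^] M \<otimes> x = x" using xk unfolding M by simp
  then have "x [^] M = \<one>" using c by (metis l_one nat_pow_closed one_closed right_cancel)
  then have "group.ord G x dvd 2 ^ ?k - 1" using c M by (simp add: pow_eq_id)
  then have pd: "p dvd 2 ^ ?k - 1" using p(2) by (rule dvd_trans[rotated])
  then have c1: "[2 ^ ?k = 1] (mod p)" by (simp add: cong_altdef_nat)
  then have "Pocklington.ord p 2 dvd ?k" by (rule ord_divides[THEN iffD1])
  have k0: "?k > 0" using ord_ge_1[OF G(2) c(2)] by simp
  \<comment> \<open>Fermat's theorem for base 2 needs an odd prime; here 2 is excluded because it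
    would divide two consecutive numbers.\<close>
  have "\<not> p dvd 2"
  proof
    assume "p dvd 2"
    then have "p dvd 2 ^ ?k" using k0 by (meson dvd_power dvd_trans)
    then have "p dvd 2 ^ ?k - (2 ^ ?k - 1)" using pd by (rule dvd_diff_nat)
    then show False using p(1) by simp
  qed
  then have "[2 ^ (p - 1) = 1] (mod p)" using fermat_theorem[OF p(1)] by simp
  then have o: "Pocklington.ord p 2 dvd p - 1" by (rule ord_divides[THEN iffD1])
  have "Pocklington.ord p 2 \<noteq> 1"
  proof
    assume "Pocklington.ord p 2 = 1"
    then have "[2 ^ 1 = 1] (mod p)" unfolding ord_divides by simp
    then have "p dvd 2 - 1" by (simp add: cong_altdef_nat)
    then show False using p(1) by simp
  qed
  then obtain r where r: "prime r" "r dvd Pocklington.ord p 2" using prime_factor_nat by blast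
  have "p - 1 > 0" using prime_gt_1_nat[OF p(1)] by simp
  then have "r \<le> p - 1" using r(2) o by (meson dvd_imp_le dvd_trans)
  then have "r < p" using \<open>p - 1 > 0\<close> by linarith
  then show ?thesis using r \<open>Pocklington.ord p 2 dvd ?k\<close> by (meson dvd_trans)
qed

text \<open>In a finite group the relation forces \<open>p\<close> to be prime to the order of
  \<open>x\<close>. Then \<open>x\<close> is a power of its own p-th power, and its conjugate by
  \<open>y\<close> is again a power of \<open>x\<close>.\<close>

lemma finite_group_bs_normalizes:
  fixes G (structure)
  assumes G: "group G" "finite (carrier G)" and c: "x \<in> carrier G" "y \<in> carrier G"
    and rel: "conjugate G y (x [^] p) = x [^] (p + 1 :: nat)"
  shows "commutator G x (conjugate G y x) = \<one>"
proof -
  interpret group G by (rule G(1))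
  let ?n = "group.ord G x"
  have n0: "?n > 0" using ord_ge_1[OF G(2) c(1)] by simp
  \<comment> \<open>For a common prime r, with r m the order of \<open>x\<close>, the m-th power
    kills the p-th power of \<open>x\<close>, hence also its conjugate, the (p+1)-th power. So r
    would divide both p and p + 1.\<close>
  have "coprime p ?n"
  proof (rule ccontr)
    assume "\<not> coprime p ?n"
    then have "gcd p ?n \<noteq> 1" unfolding coprime_iff_gcd_eq_1 .
    then obtain r where "prime r" "r dvd gcd p ?n" using prime_factor_nat by blast
    then have r: "prime r" "r dvd p" "r dvd ?n" by simp_all
    obtain m where m: "?n = r * m" using r(3) by (auto elim: dvdE)
    have "?n dvd p * m" using r(2) m by (simp add: mult_dvd_mono)
    then have "(x [^] p) [^] m = \<one>" using c by (simp add: nat_pow_pow pow_eq_id)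
    then have "(x [^] (p + 1)) [^] m = \<one>" using conj_nat_pow[OF c(2), of "x [^] p" m] c rel by (simp add: conjugate_def)
    then have "?n dvd (p + 1) * m" using c by (simp only: nat_pow_pow pow_eq_id)
    then have d: "r * m dvd (p + 1) * m" by (simp only: m)
    have "m \<noteq> 0" using n0 m by simp
    moreover have "m * r dvd m * (p + 1)" using d by (simp only: mult.commute)
    ultimately have "r dvd p + 1" using nat_mult_dvd_cancel_disj[of m r "p + 1"] by blast
    then have "r dvd 1" using r(2) by (metis dvd_add_right_iff)
    then show False using r(1) by simp
  qed
  then obtain u v where uv: "u * int p + v * int ?n = 1"
    using bezout_int[of "int p" "int ?n"] by auto
  have "x [^] (v * int ?n) = \<one>" using c by (simp add: int_pow_eq_id)
  then have "x [^] (u * int p) = x [^] (u * int p + v * int ?n)" using c by (simp add: int_pow_mult)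
  then have xu: "x = x [^] (u * int p)" using uv c by simp
  have "x [^] (u * int p) = (x [^] p) [^] u"
    using int_pow_pow[OF c(1), of "int p" u] by (simp add: int_pow_int mult.commute)
  then have "conjugate G y x = conjugate G y ((x [^] p) [^] u)" using xu by simp
  also have "\<dots> = (x [^] (p + 1)) [^] u" using c rel by (simp only: conj_int_pow nat_pow_closed)
  also have "\<dots> = x [^] (int (p + 1) * u)" using int_pow_pow[OF c(1), of "int (p + 1)" u] by (simp only: int_pow_int)
  finally have e: "conjugate G y x = x [^] (int (p + 1) * u)" .
  have "x \<otimes> x [^] i = x [^] i \<otimes> x" for i :: int
    using int_pow_mult[OF c(1), of 1 i] int_pow_mult[OF c(1), of i 1] c by (simp add: add.commute)
  then show ?thesis using e c by (simp add: comm_eq_one_iff)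
qed

text \<open>Around the cycle of the four Higman relations the prime divisors of the orders would
  descend forever. In the other family both commutators vanish, so a1 and b1 are trivial, and then a
  p-th power equals the next power.\<close>

lemma base_relations_finite:
  assumes G: "group G" "finite (carrier G)" and g: "g ` {..<4} \<subseteq> carrier G" "base_relations q G g" and i: "i < 4"
  shows "g i = \<one>\<^sub>G"
proof -
  interpret group G by (rule G(1))
  have c: "g 0 \<in> carrier G" "g 1 \<in> carrier G" "g 2 \<in> carrier G" "g 3 \<in> carrier G" using g(1) by auto
  have all: "g 0 = \<one>\<^sub>G \<and> g 1 = \<one>\<^sub>G \<and> g 2 = \<one>\<^sub>G \<and> g 3 = \<one>\<^sub>G"
  proof (cases q)
    case None
    have r: "conjugate G (g 1) (g 0) = g 0 [^]\<^sub>G (2::nat)" "conjugate G (g 2) (g 1) = g 1 [^]\<^sub>G (2::nat)"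
      "conjugate G (g 3) (g 2) = g 2 [^]\<^sub>G (2::nat)" "conjugate G (g 0) (g 3) = g 3 [^]\<^sub>G (2::nat)"
      using g(2) by (simp_all add: base_relations_def None)
    note D = finite_group_squaring_descent[OF G]
    define Q where "Q p \<longleftrightarrow> prime p \<and> (\<exists>x\<in>{g 0, g 1, g 2, g 3}. p dvd group.ord G x)" for p
    have "\<not> Q p" for p
    proof (induction p rule: less_induct)
      case (less p)
      show ?case
      proof
        assume "Q p"
        then have "prime p" and p: "p dvd group.ord G (g 0) \<or> p dvd group.ord G (g 1) \<or> p dvd group.ord G (g 2) \<or> p dvd group.ord G (g 3)"
          unfolding Q_def by auto
        from p have "\<exists>q<p. Q q"
          using D[OF c(1,2) r(1) \<open>prime p\<close>] D[OF c(2,3) r(2) \<open>prime p\<close>] D[OF c(3,4) r(3) \<open>prime p\<close>] D[OF c(4,1) r(4) \<open>prime p\<close>]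
          unfolding Q_def by blast
        then show False using less by blast
      qed
    qed
    then have o1: "group.ord G x = 1" if "x \<in> {g 0, g 1, g 2, g 3}" for x
      using prime_factor_nat that unfolding Q_def by blast
    have "x = \<one>\<^sub>G" if "x \<in> {g 0, g 1, g 2, g 3}" for x
    proof -
      have x: "x \<in> carrier G" using that c by blast
      have "x [^]\<^sub>G (1::nat) = \<one>\<^sub>G" using pow_eq_id[OF x, of 1] o1[OF that] by simp
      then show ?thesis using x by simp
    qed
    then show ?thesis by blast
  next
    case (Some p)
    have r: "conjugate G (inv\<^bsub>G\<^esub> (g 0)) (g 1 [^]\<^sub>G p) = g 1 [^]\<^sub>G (p + 1)"
      "conjugate G (inv\<^bsub>G\<^esub> (g 2)) (g 3 [^]\<^sub>G p) = g 3 [^]\<^sub>G (p + 1)"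
      "g 0 = commutator G (g 3) (conjugate G (inv\<^bsub>G\<^esub> (g 2)) (g 3))"
      "g 2 = commutator G (g 1) (conjugate G (inv\<^bsub>G\<^esub> (g 0)) (g 1))"
      using g(2) unfolding base_relations_def Some option.case by blast+
    have 1: "g 0 = \<one>\<^sub>G" "g 2 = \<one>\<^sub>G"
      by (rule HOL.trans[OF r(3) finite_group_bs_normalizes[OF G c(4) inv_closed[OF c(3)] r(2)]],
          rule HOL.trans[OF r(4) finite_group_bs_normalizes[OF G c(2) inv_closed[OF c(1)] r(1)]])
    have "x = \<one>\<^sub>G" if "x \<in> carrier G" "conjugate G (inv\<^bsub>G\<^esub> \<one>\<^sub>G) (x [^]\<^sub>G p) = x [^]\<^sub>G (p + 1)" for x
      using that by (simp add: conjugate_def)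
    from this[OF c(2)] this[OF c(4)] show ?thesis using r(1,2) unfolding 1 by simp
  qed
  show ?thesis using i all by (elim less_4_cases) simp_all
qed

lemma base_finite_hom_trivial:
  assumes H: "group H" "finite (carrier H)" "f \<in> hom (base q) H" "x \<in> carrier (base q)"
  shows "f x = \<one>\<^sub>H"
proof (rule generates_hom_trivial[OF generates_base group_base H(1,3) _ H(4)])
  fix b assume "b \<in> base_gen q ` {..<4}"
  then obtain i where i: "i < 4" "b = base_gen q i" by auto
  have "(f \<circ> base_gen q) ` {..<4} \<subseteq> carrier H"
    using hom_in_carrier[OF H(3)] base_gen_closed by auto
  from base_relations_finite[OF H(1,2) this base_relations_hom[OF H(1,3)] i(1)] show "f b = \<one>\<^sub>H"
    by (simp add: i(2))
qed

text \<open>The relators can be corrected one generator at a time because the matrix of their exponent sums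
  is invertible over the integers.\<close>

lemma base_lift:
  assumes H: "group H" and Y: "group Y" and rho: "\<rho> \<in> hom H Y"
    and ker: "\<And>k. k \<in> carrier H \<Longrightarrow> \<rho> k = \<one>\<^sub>Y \<Longrightarrow> central H k"
    and f: "f \<in> hom (base q) Y" "f ` carrier (base q) \<subseteq> \<rho> ` carrier H"
  obtains F where "F \<in> hom (base q) H" "\<And>x. x \<in> carrier (base q) \<Longrightarrow> \<rho> (F x) = f x"
proof -
  interpret H: group H by (rule H)
  interpret Y: group Y by (rule Y)
  interpret rho: group_hom H Y \<rho> by (rule group_homI[OF H Y rho])
  have yc: "(f \<circ> base_gen q) ` {..<4} \<subseteq> carrier Y"
    using hom_in_carrier[OF f(1)] base_gen_closed by auto
  have yr: "base_relations q Y (f \<circ> base_gen q)" by (rule base_relations_hom[OF Y f(1)])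
  have "\<forall>i<4. \<exists>h\<in>carrier H. \<rho> h = f (base_gen q i)" using f(2) base_gen_closed by fastforce
  then obtain h where h: "\<And>i. i < 4 \<Longrightarrow> h i \<in> carrier H" "\<And>i. i < 4 \<Longrightarrow> \<rho> (h i) = f (base_gen q i)" by metis
  have "\<exists>g. g ` {..<4} \<subseteq> carrier H \<and> base_relations q H g \<and> (\<forall>i<4. \<rho> (g i) = f (base_gen q i))"
  proof (cases q)
    case None
    have r: "conjugate Y (f (base_gen q 1)) (f (base_gen q 0)) = f (base_gen q 0) [^]\<^sub>Y (2::nat)"
      "conjugate Y (f (base_gen q 2)) (f (base_gen q 1)) = f (base_gen q 1) [^]\<^sub>Y (2::nat)"
      "conjugate Y (f (base_gen q 3)) (f (base_gen q 2)) = f (base_gen q 2) [^]\<^sub>Y (2::nat)"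
      "conjugate Y (f (base_gen q 0)) (f (base_gen q 3)) = f (base_gen q 3) [^]\<^sub>Y (2::nat)"
      using yr by (simp_all add: base_relations_def None)
    define nx where "nx i = (if i = 3 then 0 else i + 1)" for i :: nat
    have nx: "nx i < 4" if "i < 4" for i using that by (auto simp: nx_def)
    have rr: "conjugate Y (f (base_gen q (nx i))) (f (base_gen q i)) = f (base_gen q i) [^]\<^sub>Y (2::nat)" if "i < 4" for i
      using that r by (elim less_4_cases) (simp_all add: nx_def numeral_2_eq_2 numeral_3_eq_3)
    \<comment> \<open>The defect of the relation at \<open>i\<close>. As a central factor of the
      generator it enters once on the conjugated side and twice in the square, which absorbs exactly
      one defect.\<close>
    define k where "k i = conjugate H (h (nx i)) (h i) \<otimes>\<^sub>H inv\<^bsub>H\<^esub> (h i [^]\<^sub>H (2::nat))" for i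
    have kc: "k i \<in> carrier H" if "i < 4" for i using h(1)[OF that] h(1)[OF nx[OF that]] by (simp add: k_def)
    have k1: "\<rho> (k i) = \<one>\<^sub>Y" if "i < 4" for i
    proof -
      have "\<rho> (conjugate H (h (nx i)) (h i)) = \<rho> (h i) [^]\<^sub>Y (2::nat)"
        using conj_hom_image[OF H Y rho h(1)[OF nx[OF that]] h(1)[OF that]] rr[OF that] h(2)[OF that] h(2)[OF nx[OF that]] by simp
      then show ?thesis using h(1)[OF that] h(1)[OF nx[OF that]] by (simp add: k_def rho.hom_nat_pow)
    qed
    have kz: "central H (k i)" if "i < 4" for i by (rule ker[OF kc[OF that] k1[OF that]])
    define g where "g i = h i \<otimes>\<^sub>H k i" for i
    have gr: "conjugate H (g (nx i)) (g i) = g i [^]\<^sub>H (2::nat)" if i: "i < 4" for i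
    proof -
      note hc = h(1)[OF i] h(1)[OF nx[OF i]] and zz = kz[OF i] kz[OF nx[OF i]]
      have hk: "conjugate H (h (nx i)) (h i) = k i \<otimes>\<^sub>H h i [^]\<^sub>H (2::nat)" using hc by (simp add: k_def H.m_assoc)
      have "conjugate H (g (nx i)) (g i) = k i \<otimes>\<^sub>H h i [^]\<^sub>H (2::nat) \<otimes>\<^sub>H k i"
        unfolding g_def using H.conj_central_mult[OF zz(2,1) hc(2,1)] hk by simp
      also have "\<dots> = h i [^]\<^sub>H (2::nat) \<otimes>\<^sub>H k i [^]\<^sub>H (2::nat)"
        using H.centralD(2)[OF zz(1), of "h i [^]\<^sub>H (2::nat)"] hc kc[OF i] by (simp add: numeral_2_eq_2 H.m_assoc)
      also have "\<dots> = g i [^]\<^sub>H (2::nat)" unfolding g_def using H.nat_pow_central_mult[OF zz(1) hc(1)] by simp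
      finally show ?thesis .
    qed
    have "base_relations q H g"
      using gr[of 0] gr[of 1] gr[of 2] gr[of 3] by (simp add: base_relations_def None nx_def numeral_2_eq_2 numeral_3_eq_3)
    moreover have "\<rho> (g i) = f (base_gen q i)" if "i < 4" for i
      using h[OF that] k1[OF that] kc[OF that] hom_in_carrier[OF f(1) base_gen_closed[OF that]] by (simp add: g_def)
    moreover have "g ` {..<4} \<subseteq> carrier H" using h(1) kc by (auto simp: g_def)
    ultimately show ?thesis by blast
  next
    case (Some p)
    let ?y = "\<lambda>i. f (base_gen q i)"
    have r: "conjugate Y (inv\<^bsub>Y\<^esub> (?y 0)) (?y 1 [^]\<^sub>Y p) = ?y 1 [^]\<^sub>Y (p + 1)"
      "conjugate Y (inv\<^bsub>Y\<^esub> (?y 2)) (?y 3 [^]\<^sub>Y p) = ?y 3 [^]\<^sub>Y (p + 1)"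
      "?y 0 = commutator Y (?y 3) (conjugate Y (inv\<^bsub>Y\<^esub> (?y 2)) (?y 3))"
      "?y 2 = commutator Y (?y 1) (conjugate Y (inv\<^bsub>Y\<^esub> (?y 0)) (?y 1))"
      using yr unfolding base_relations_def Some option.case comp_apply by blast+
    have hc: "h 0 \<in> carrier H" "h 1 \<in> carrier H" "h 2 \<in> carrier H" "h 3 \<in> carrier H" by (simp_all add: h(1))
    have hr: "\<rho> (h 0) = ?y 0" "\<rho> (h 1) = ?y 1" "\<rho> (h 2) = ?y 2" "\<rho> (h 3) = ?y 3" by (simp_all add: h(2))
    have cm: "\<rho> (commutator H x (conjugate H (inv\<^bsub>H\<^esub> y) x)) = commutator Y (\<rho> x) (conjugate Y (inv\<^bsub>Y\<^esub> (\<rho> y)) (\<rho> x))"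
      if "x \<in> carrier H" "y \<in> carrier H" for x y
      using that by (simp add: comm_hom[OF H Y rho] conj_hom_image[OF H Y rho])
    \<comment> \<open>Generators 0 and 2 are replaced by the commutators that they have to equal.
      Central corrections of generators 1 and 3 do not alter these commutators, so they can be made
      afterwards.\<close>
    define a where "a = commutator H (h 3) (conjugate H (inv\<^bsub>H\<^esub> (h 2)) (h 3))"
    define b where "b = commutator H (h 1) (conjugate H (inv\<^bsub>H\<^esub> (h 0)) (h 1))"
    have ab: "a \<in> carrier H" "b \<in> carrier H" using hc by (simp_all add: a_def b_def)
    have abr: "\<rho> a = ?y 0" "\<rho> b = ?y 2"
      unfolding a_def b_def cm[OF hc(4,3)] cm[OF hc(2,1)] hr using r(3,4) by simp_all
    \<comment> \<open>A central factor of \<open>x\<close> enters with exponent p on one side and p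
      + 1 on the other, so the defect itself is the correction.\<close>
    have fix_pow: "\<exists>k. central H k \<and> \<rho> k = \<one>\<^sub>Y \<and> conjugate H (inv\<^bsub>H\<^esub> t) ((x \<otimes>\<^sub>H k) [^]\<^sub>H p) = (x \<otimes>\<^sub>H k) [^]\<^sub>H (p + 1)"
      if t: "t \<in> carrier H" "x \<in> carrier H" "conjugate Y (inv\<^bsub>Y\<^esub> (\<rho> t)) (\<rho> x [^]\<^sub>Y p) = \<rho> x [^]\<^sub>Y (p + 1)" for t x
    proof -
      define k where "k = conjugate H (inv\<^bsub>H\<^esub> t) (x [^]\<^sub>H p) \<otimes>\<^sub>H inv\<^bsub>H\<^esub> (x [^]\<^sub>H (p + 1))"
      have kc: "k \<in> carrier H" unfolding k_def using t by (intro H.m_closed H.conj_closed H.inv_closed H.nat_pow_closed)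
      have xp: "x [^]\<^sub>H n \<in> carrier H" for n :: nat using t by simp
      have "\<rho> (conjugate H (inv\<^bsub>H\<^esub> t) (x [^]\<^sub>H p)) = \<rho> (x [^]\<^sub>H (p + 1))"
        using t by (simp only: conj_hom_image[OF H Y rho] H.inv_closed H.nat_pow_closed rho.hom_inv rho.hom_nat_pow)
      then have k1: "\<rho> k = \<one>\<^sub>Y" unfolding k_def
        using t xp by (simp only: rho.hom_mult H.conj_closed H.inv_closed rho.hom_inv) (simp add: rho.hom_closed[OF xp])
      have z: "central H k" by (rule ker[OF kc k1])
      have e: "conjugate H (inv\<^bsub>H\<^esub> t) (x [^]\<^sub>H p) = k \<otimes>\<^sub>H x [^]\<^sub>H (p + 1)"
        using t xp[of "p + 1"] H.conj_closed[OF H.inv_closed[OF t(1)] xp[of p]]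
        by (simp only: k_def H.m_assoc H.inv_closed H.l_inv H.r_one)
      have "conjugate H (inv\<^bsub>H\<^esub> t) ((x \<otimes>\<^sub>H k) [^]\<^sub>H p) = conjugate H (inv\<^bsub>H\<^esub> t) (x [^]\<^sub>H p) \<otimes>\<^sub>H conjugate H (inv\<^bsub>H\<^esub> t) k [^]\<^sub>H p"
        using t kc z by (simp add: H.nat_pow_central_mult H.conj_mult H.conj_nat_pow)
      also have "\<dots> = k \<otimes>\<^sub>H x [^]\<^sub>H (p + 1) \<otimes>\<^sub>H k [^]\<^sub>H p"
        unfolding e using H.central_conj(1)[OF z] t by simp
      also have "\<dots> = x [^]\<^sub>H (p + 1) \<otimes>\<^sub>H (k \<otimes>\<^sub>H k [^]\<^sub>H p)"
        using H.centralD(2)[OF z xp[of "p + 1"]] kc xp[of "p + 1"] by (simp only: H.m_assoc H.nat_pow_closed)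
      also have "k \<otimes>\<^sub>H k [^]\<^sub>H p = k [^]\<^sub>H (p + 1)" using H.nat_pow_Suc2[OF kc, of p] by (simp only: Suc_eq_plus1)
      also have "x [^]\<^sub>H (p + 1) \<otimes>\<^sub>H k [^]\<^sub>H (p + 1) = (x \<otimes>\<^sub>H k) [^]\<^sub>H (p + 1)"
        by (rule H.nat_pow_central_mult[OF z t(2), symmetric])
      finally show ?thesis using z k1 by blast
    qed
    obtain k where k: "central H k" "\<rho> k = \<one>\<^sub>Y" "conjugate H (inv\<^bsub>H\<^esub> a) ((h 1 \<otimes>\<^sub>H k) [^]\<^sub>H p) = (h 1 \<otimes>\<^sub>H k) [^]\<^sub>H (p + 1)"
      using fix_pow[OF ab(1) hc(2)] r(1) unfolding abr hr by blast
    obtain l where l: "central H l" "\<rho> l = \<one>\<^sub>Y" "conjugate H (inv\<^bsub>H\<^esub> b) ((h 3 \<otimes>\<^sub>H l) [^]\<^sub>H p) = (h 3 \<otimes>\<^sub>H l) [^]\<^sub>H (p + 1)"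
      using fix_pow[OF ab(2) hc(4)] r(2) unfolding abr hr by blast
    note kl = H.centralD(1)[OF k(1)] H.centralD(1)[OF l(1)]
    have same: "commutator H (x \<otimes>\<^sub>H m) (conjugate H (inv\<^bsub>H\<^esub> t') (x \<otimes>\<^sub>H m)) = commutator H x (conjugate H (inv\<^bsub>H\<^esub> t) x)"
      if "x \<in> carrier H" "t \<in> carrier H" "t' \<in> carrier H" "\<rho> t = \<rho> t'" "central H m" for x t t' m
    proof -
      define n where "n = inv\<^bsub>H\<^esub> (inv\<^bsub>H\<^esub> t) \<otimes>\<^sub>H inv\<^bsub>H\<^esub> t'"
      have nc: "n \<in> carrier H" using that by (simp add: n_def)
      have nz: "central H n" by (rule ker[OF nc]) (use that in \<open>simp add: n_def\<close>)
      have t': "inv\<^bsub>H\<^esub> t' = inv\<^bsub>H\<^esub> t \<otimes>\<^sub>H n" unfolding n_def using that(2,3) by simp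
      show ?thesis unfolding t'
        using that(1,2) H.conj_central_mult[OF nz that(5) H.inv_closed[OF that(2)] that(1)]
          H.comm_central_mult[OF that(5,5) that(1), of "conjugate H (inv\<^bsub>H\<^esub> t) x"] by simp
    qed
    define g where "g i = (if i = 0 then a else if i = 1 then h 1 \<otimes>\<^sub>H k else if i = 2 then b else h 3 \<otimes>\<^sub>H l)" for i :: nat
    have g: "g 0 = a" "g 1 = h 1 \<otimes>\<^sub>H k" "g 2 = b" "g 3 = h 3 \<otimes>\<^sub>H l" by (simp_all add: g_def)
    have "a = commutator H (h 3 \<otimes>\<^sub>H l) (conjugate H (inv\<^bsub>H\<^esub> b) (h 3 \<otimes>\<^sub>H l))"
      using same[OF hc(4,3) ab(2) _ l(1)] abr hr by (simp add: a_def)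
    moreover have "b = commutator H (h 1 \<otimes>\<^sub>H k) (conjugate H (inv\<^bsub>H\<^esub> a) (h 1 \<otimes>\<^sub>H k))"
      using same[OF hc(2,1) ab(1) _ k(1)] abr hr by (simp add: b_def)
    ultimately have "base_relations q H g" unfolding base_relations_def Some option.case g using k(3) l(3) by blast
    moreover have "\<rho> (g i) = f (base_gen q i)" if "i < 4" for i
      using that abr hr hc k(2) l(2) kl hom_in_carrier[OF f(1) base_gen_closed[OF that]]
      by (elim less_4_cases) (simp_all add: g[simplified])
    moreover have "g ` {..<4} \<subseteq> carrier H" using hc kl ab by (auto simp: g_def)
    ultimately show ?thesis by blast
  qed
  then obtain g where g: "g ` {..<4} \<subseteq> carrier H" "base_relations q H g" "\<And>i. i < 4 \<Longrightarrow> \<rho> (g i) = f (base_gen q i)" by blast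
  obtain F where F: "F \<in> hom (base q) H" "\<And>i. i < 4 \<Longrightarrow> F (base_gen q i) = g i"
    by (rule base_hom[OF H g(1,2)], rule that)
  have "(\<rho> \<circ> F) x = f x" if "x \<in> carrier (base q)" for x
    by (rule hom_eq_on_generators[where f = "\<rho> \<circ> F" and g = f, OF generates_base group_base Y hom_compose[OF F(1) rho] f(1) _ that])
      (auto simp: F(2) g(3))
  then show thesis using that[OF F(1)] by simp
qed

section \<open>Free bases adapted to a homomorphism\<close>

text \<open>The universal property is tied to target groups over a single type, to be instantiated
  by that of \<open>fox_group\<close>.\<close>

definition free_basis :: "'h itself \<Rightarrow> ('g, 'm) monoid_scheme \<Rightarrow> 'g \<Rightarrow> 'g \<Rightarrow> bool" where
  "free_basis T K x y \<longleftrightarrow> x \<in> carrier K \<and> y \<in> carrier K \<and> generates K {x, y} \<and>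
    (\<forall>(H :: 'h monoid) a b. group H \<longrightarrow> a \<in> carrier H \<longrightarrow> b \<in> carrier H \<longrightarrow>
      (\<exists>f\<in>hom K H. f x = a \<and> f y = b))"

lemma free_basis_hom:
  fixes T :: "'h itself" and H :: "'h monoid"
  assumes "free_basis T K x y" "group H" "a \<in> carrier H" "b \<in> carrier H"
  shows "\<exists>f\<in>hom K H. f x = a \<and> f y = b"
  using assms unfolding free_basis_def by blast

lemma free_basis_swap: "free_basis T K x y \<Longrightarrow> free_basis T K y x"
  unfolding free_basis_def by (simp add: insert_commute) blast

lemma free_basis_inv:
  fixes T :: "'h itself"
  assumes K: "group K" and b: "free_basis T K x y"
  shows "free_basis T K (inv\<^bsub>K\<^esub> x) y"
proof -
  interpret group K by (rule K)
  have xy: "x \<in> carrier K" "y \<in> carrier K" using b by (auto simp: free_basis_def)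
  have "generates K {inv\<^bsub>K\<^esub> x, y}"
    unfolding generates_def
  proof (intro conjI allI impI)
    show "{inv\<^bsub>K\<^esub> x, y} \<subseteq> carrier K" using xy by simp
    fix N assume N: "subgroup N K" "{inv\<^bsub>K\<^esub> x, y} \<subseteq> N"
    have "inv\<^bsub>K\<^esub> (inv\<^bsub>K\<^esub> x) \<in> N" by (rule subgroup.m_inv_closed[OF N(1)]) (use N(2) in simp)
    then have "{x, y} \<subseteq> N" using N(2) xy by simp
    moreover have "generates K {x, y}" using b by (simp add: free_basis_def)
    ultimately show "N = carrier K" using N(1) by (simp only: generates_def)
  qed
  moreover have "\<exists>f\<in>hom K H. f (inv\<^bsub>K\<^esub> x) = a \<and> f y = c"
    if H: "group (H :: 'h monoid)" "a \<in> carrier H" "c \<in> carrier H" for H a c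
  proof -
    interpret H: group H by (rule H(1))
    obtain f where f: "f \<in> hom K H" "f x = inv\<^bsub>H\<^esub> a" "f y = c"
      using free_basis_hom[OF b H(1) H.inv_closed[OF H(2)] H(3)] by blast
    interpret f: group_hom K H f by (rule group_homI[OF K H(1) f(1)])
    show ?thesis using f H xy by (intro bexI[of _ f]) auto
  qed
  ultimately show ?thesis unfolding free_basis_def using xy by blast
qed

lemma free_basis_shear:
  fixes T :: "'h itself"
  assumes K: "group K" and b: "free_basis T K x y"
  shows "free_basis T K (x \<otimes>\<^sub>K y [^]\<^sub>K (i::int)) y"
proof -
  interpret group K by (rule K)
  have xy: "x \<in> carrier K" "y \<in> carrier K" using b by (auto simp: free_basis_def)
  let ?z = "x \<otimes>\<^sub>K y [^]\<^sub>K i"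
  have "generates K {?z, y}"
    unfolding generates_def
  proof (intro conjI allI impI)
    show "{?z, y} \<subseteq> carrier K" using xy by simp
    fix N assume N: "subgroup N K" "{?z, y} \<subseteq> N"
    have yi: "y [^]\<^sub>K i \<in> N" using N by (intro subgroup_int_pow_closed) auto
    have "?z \<otimes>\<^sub>K inv\<^bsub>K\<^esub> (y [^]\<^sub>K i) \<in> N"
      by (rule subgroup.m_closed[OF N(1) _ subgroup.m_inv_closed[OF N(1) yi]]) (use N(2) in blast)
    then have "{x, y} \<subseteq> N" using N(2) xy by (simp add: m_assoc)
    moreover have "generates K {x, y}" using b by (simp add: free_basis_def)
    ultimately show "N = carrier K" using N(1) by (simp only: generates_def)
  qed
  moreover have "\<exists>f\<in>hom K H. f ?z = a \<and> f y = c"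
    if H: "group (H :: 'h monoid)" "a \<in> carrier H" "c \<in> carrier H" for H a c
  proof -
    interpret H: group H by (rule H(1))
    have "a \<otimes>\<^sub>H inv\<^bsub>H\<^esub> (c [^]\<^sub>H i) \<in> carrier H" using H by simp
    then obtain f where f: "f \<in> hom K H" "f x = a \<otimes>\<^sub>H inv\<^bsub>H\<^esub> (c [^]\<^sub>H i)" "f y = c"
      using free_basis_hom[OF b H(1) _ H(3)] by blast
    interpret f: group_hom K H f by (rule group_homI[OF K H(1) f(1)])
    have "f ?z = a" using f H xy by (simp add: f.hom_int_pow H.m_assoc)
    then show ?thesis using f by blast
  qed
  ultimately show ?thesis unfolding free_basis_def using xy by simp
qed

lemma free_basis_F2:
  assumes "group K" "K \<cong> F2"
  obtains x y where "free_basis TYPE('h) K x y"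
proof -
  interpret K: group K by (rule assms(1))
  obtain h where h: "h \<in> iso K F2" using assms(2) by (auto simp: is_iso_def)
  define g where "g = inv_into (carrier K) h"
  have g: "g \<in> iso F2 K" unfolding g_def by (rule K.iso_set_sym[OF h])
  have hh: "h \<in> hom K F2" "bij_betw h (carrier K) (carrier F2)" using h by (auto simp: iso_def)
  have gh: "g \<in> hom F2 K" "bij_betw g (carrier F2) (carrier K)" using g by (auto simp: iso_def)
  interpret gg: group_hom F2 K g by (rule group_homI[OF group_F2 assms(1) gh(1)])
  have hg: "h (g z) = z" if "z \<in> carrier F2" for z
    unfolding g_def by (rule bij_betw_inv_into_right[OF hh(2) that])
  have gen: "generates K {g fx, g fy}"
    unfolding generates_def
  proof (intro conjI allI impI)
    show "{g fx, g fy} \<subseteq> carrier K" by simp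
    fix N assume N: "subgroup N K" "{g fx, g fy} \<subseteq> N"
    have "subgroup {z \<in> carrier F2. g z \<in> N} F2" by (rule subgroup_preimage[OF group_F2 assms(1) gh(1) N(1)])
    then have "z \<in> {z \<in> carrier F2. g z \<in> N}" if "z \<in> carrier F2" for z
      by (rule generatesD[OF generates_F2 _ _ that]) (use N in auto)
    then have "g ` carrier F2 \<subseteq> N" by blast
    then show "N = carrier K" using gh(2) subgroup.subset[OF N(1)] by (auto simp: bij_betw_def)
  qed
  have "\<exists>f\<in>hom K H. f (g fx) = a \<and> f (g fy) = c"
    if H: "group (H :: 'h monoid)" "a \<in> carrier H" "c \<in> carrier H" for H a c
  proof -
    obtain f where f: "f \<in> hom F2 H" "f fx = a" "f fy = c" by (rule F2_hom[OF H], rule that)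
    have "f \<circ> h \<in> hom K H" by (rule hom_compose[OF hh(1) f(1)])
    then show ?thesis using f hg by (intro bexI[of _ "f \<circ> h"]) simp_all
  qed
  then have "free_basis TYPE('h) K (g fx) (g fy)" unfolding free_basis_def using gen by simp
  then show thesis by (rule that)
qed

text \<open>Euclid's algorithm on the two values of \<open>f\<close>, performed by Nielsen moves on
  the basis. Once one value is 0, surjectivity makes the other one a unit, and an inversion fixes
  the sign.\<close>

lemma free_basis_adapted:
  assumes K: "group K" and b: "free_basis T K x0 y0"
    and f: "f \<in> hom K integer_group" and surj: "f ` carrier K = UNIV"
  obtains x y where "free_basis T K x y" "f x = 1" "f y = 0"
proof -
  interpret K: group K by (rule K)
  interpret f: group_hom K integer_group f by (rule group_homI[OF K group_integer_group f])
  have "\<exists>x y. free_basis T K x y \<and> f y = 0"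
    using b
  proof (induction "nat \<bar>f y0\<bar>" arbitrary: x0 y0 rule: less_induct)
    case less
    have xy: "x0 \<in> carrier K" "y0 \<in> carrier K" using less.prems by (auto simp: free_basis_def)
    show ?case
    proof (cases "f y0 = 0")
      case False
      let ?z = "x0 \<otimes>\<^sub>K y0 [^]\<^sub>K (- (f x0 div f y0))"
      have "f ?z = f x0 - (f x0 div f y0) * f y0" using xy by (simp add: f.hom_int_pow)
      then have z: "f ?z = f x0 mod f y0" by (simp add: minus_div_mult_eq_mod)
      have "\<bar>f x0 mod f y0\<bar> < \<bar>f y0\<bar>" using False by (rule abs_mod_less)
      then have "nat \<bar>f ?z\<bar> < nat \<bar>f y0\<bar>" using z by simp
      then show ?thesis
        using less.hyps[of ?z y0] free_basis_swap[OF free_basis_shear[OF K less.prems]] by blast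
    qed (use less.prems in blast)
  qed
  then obtain x y where xy: "free_basis T K x y" "f y = 0" by blast
  have c: "x \<in> carrier K" "y \<in> carrier K" using xy(1) by (auto simp: free_basis_def)
  \<comment> \<open>As \<open>f y\<close> is 0, all values of \<open>f\<close> are multiples of
    \<open>f x\<close>, and 1 is among them.\<close>
  have "subgroup {z. f x dvd z} integer_group"
    by (rule group.subgroupI[OF group_integer_group]) auto
  then have S: "subgroup {g \<in> carrier K. f g \<in> {z. f x dvd z}} K"
    by (rule subgroup_preimage[OF K group_integer_group f])
  obtain g where g: "g \<in> carrier K" "f g = 1" using surj by (metis UNIV_I imageE)
  have "g \<in> {g \<in> carrier K. f g \<in> {z. f x dvd z}}"
    by (rule generatesD[OF _ S _ g(1), of "{x, y}"]) (use xy c in \<open>auto simp: free_basis_def\<close>)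
  then have "\<bar>f x\<bar> = 1" using g(2) by simp
  then consider "f x = 1" | "f x = -1" by linarith
  then show thesis
  proof cases
    case 1 then show ?thesis using that xy by blast
  next
    case 2 then show ?thesis using that[OF free_basis_inv[OF K xy(1)]] xy(2) c by simp
  qed
qed

section \<open>Fox derivatives\<close>

text \<open>Multiplication of these finitely supported functions is convolution, so this is the
  group ring of the integers over the rationals.\<close>

type_synonym laurent = "int \<Rightarrow>\<^sub>0 rat"

abbreviation tpow :: "int \<Rightarrow> laurent" where "tpow n \<equiv> Poly_Mapping.single n 1"

lemma tpow_add: "tpow (m + n) = tpow m * tpow n"
  by (simp add: mult_single)

lemma tpow_0: "tpow 0 = 1"
  by simp

text \<open>Laurent polynomials extended by the integers acting through powers of the variable,
  times one more copy of the integers. A homomorphism into it packs a derivation, the map that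
  twists the derivation, and a further exponent sum.\<close>

definition fox_group :: "((laurent \<times> int) \<times> int) monoid" where
  "fox_group = \<lparr>carrier = UNIV,
    monoid.mult = (\<lambda>((r, n), e) ((r', n'), e'). ((r + tpow n * r', n + n'), e + e')),
    one = ((0, 0), 0)\<rparr>"

lemma carrier_fox_group [simp]: "carrier fox_group = UNIV"
  by (simp add: fox_group_def)

lemma group_fox_group: "group fox_group"
proof (rule groupI)
  fix x :: "(laurent \<times> int) \<times> int"
  obtain r n e where x: "x = ((r, n), e)" by (metis surj_pair)
  show "\<exists>y\<in>carrier fox_group. y \<otimes>\<^bsub>fox_group\<^esub> x = \<one>\<^bsub>fox_group\<^esub>"
    by (rule bexI[of _ "((- (tpow (- n) * r), - n), - e)"]) (simp_all add: fox_group_def x)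
qed (auto simp: fox_group_def algebra_simps tpow_add simp del: mult_single)

text \<open>\<open>d\<close> is the Fox derivative with respect to \<open>y\<close>, pushed into the
  Laurent ring along \<open>f\<close>, and \<open>e\<close> is the exponent sum of \<open>y\<close>.
  Both are coordinates of the homomorphism given by one choice of images in
  \<open>fox_group\<close>.\<close>

lemma fox_derivative:
  assumes K: "group K" "K \<cong> F2" and f: "f \<in> hom K integer_group" and surj: "f ` carrier K = UNIV"
  obtains x y :: 'k and d :: "'k \<Rightarrow> laurent" and e where "x \<in> carrier K" "y \<in> carrier K" "generates K {x, y}"
    "f x = 1" "f y = 0" "e \<in> hom K integer_group" "e x = 0" "e y = 1" "d x = 0" "d y = 1"
    "\<And>u v. u \<in> carrier K \<Longrightarrow> v \<in> carrier K \<Longrightarrow> d (u \<otimes>\<^sub>K v) = d u + tpow (f u) * d v"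
proof -
  obtain x0 y0 where b0: "free_basis TYPE((laurent \<times> int) \<times> int) K x0 y0"
    by (rule free_basis_F2[OF K], rule that)
  obtain x y where b: "free_basis TYPE((laurent \<times> int) \<times> int) K x y" "f x = 1" "f y = 0"
    by (rule free_basis_adapted[OF K(1) b0 f surj], rule that)
  have c: "x \<in> carrier K" "y \<in> carrier K" "generates K {x, y}" using b(1) by (auto simp: free_basis_def)
  obtain h where h: "h \<in> hom K fox_group" "h x = ((0, 1), 0)" "h y = ((1, 0), 1)"
    using free_basis_hom[OF b(1) group_fox_group, of "((0, 1), 0)" "((1, 0), 1)"] by auto
  have mult: "h (u \<otimes>\<^sub>K v) = ((fst (fst (h u)) + tpow (snd (fst (h u))) * fst (fst (h v)), snd (fst (h u)) + snd (fst (h v))), snd (h u) + snd (h v))"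
    if "u \<in> carrier K" "v \<in> carrier K" for u v
    using hom_mult[OF h(1) that] by (simp add: fox_group_def split_def)
  have n: "snd (fst (h u)) = f u" if "u \<in> carrier K" for u
    by (rule hom_eq_on_generators[where f = "\<lambda>u. snd (fst (h u))", OF c(3) K(1) group_integer_group _ f _ that])
      (use h b(2,3) mult in \<open>auto intro!: homI\<close>)
  show thesis
    by (rule that[of x y "\<lambda>u. snd (h u)" "\<lambda>u. fst (fst (h u))"]) (use h b c mult n in \<open>auto intro!: homI\<close>)
qed

section \<open>The fibre product of two free groups over the integers\<close>

definition fox_data ::
    "('k, 'm) monoid_scheme \<Rightarrow> ('k \<Rightarrow> int) \<Rightarrow> 'k \<Rightarrow> 'k \<Rightarrow> ('k \<Rightarrow> int) \<Rightarrow> ('k \<Rightarrow> laurent) \<Rightarrow> bool" where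
  "fox_data K f x y e d \<longleftrightarrow> f \<in> hom K integer_group \<and> x \<in> carrier K \<and> y \<in> carrier K \<and> generates K {x, y} \<and>
    f x = 1 \<and> f y = 0 \<and> e \<in> hom K integer_group \<and> e x = 0 \<and> e y = 1 \<and> d x = 0 \<and> d y = 1 \<and>
    (\<forall>u\<in>carrier K. \<forall>v\<in>carrier K. d (u \<otimes>\<^sub>K v) = d u + tpow (f u) * d v)"

lemma fox_data_exists:
  assumes "group K" "K \<cong> F2" "f \<in> hom K integer_group" "f ` carrier K = UNIV"
  obtains x y e d where "fox_data K f x y e d"
  by (rule fox_derivative[OF assms]) (rule that, unfold fox_data_def, intro conjI ballI assms(3))

abbreviation Z3 :: "(int \<times> int \<times> int) monoid" where
  "Z3 \<equiv> integer_group \<times>\<times> integer_group \<times>\<times> integer_group"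

lemma group_Z3: "group Z3"
  by (intro DirProd_group group_integer_group)

lemma torsion_free_DirProd:
  assumes "group G" "group H" "torsion_free G" "torsion_free H"
  shows "torsion_free (G \<times>\<times> H)"
  unfolding torsion_free_def
proof (intro ballI allI impI)
  interpret G: group G by fact
  interpret H: group H by fact
  fix x and n :: nat
  assume x: "x \<in> carrier (G \<times>\<times> H)" "n > 0" "x [^]\<^bsub>G \<times>\<times> H\<^esub> n = \<one>\<^bsub>G \<times>\<times> H\<^esub>"
  have "x [^]\<^bsub>G \<times>\<times> H\<^esub> m = (fst x [^]\<^sub>G m, snd x [^]\<^sub>H m)" for m :: nat
    by (induction m) (simp_all add: mult_DirProd')
  then show "x = \<one>\<^bsub>G \<times>\<times> H\<^esub>"
    using x assms(3,4) unfolding torsion_free_def by (cases x) auto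
qed

lemma torsion_free_integer_group: "torsion_free integer_group"
  by (simp add: torsion_free_def)

lemma (in group) mult_inv_cancel: "x \<in> carrier G \<Longrightarrow> y \<in> carrier G \<Longrightarrow> x \<otimes> y \<otimes> inv y = x"
  by (simp add: m_assoc)

lemma (in group) commute_int_pow:
  assumes "x \<in> carrier G" "y \<in> carrier G" "x \<otimes> y = y \<otimes> x"
  shows "x \<otimes> y [^] (i::int) = y [^] i \<otimes> x"
proof -
  have "conjugate G x y = y" using assms by (simp add: conjugate_def m_assoc)
  then have "conjugate G x (y [^] i) = y [^] i" using assms by (simp add: conj_int_pow)
  then show ?thesis using assms inv_solve_right'[of "y [^] i" "x \<otimes> y [^] i" x] by (simp add: conjugate_def)
qed

definition z3_power :: "('h, 'm) monoid_scheme \<Rightarrow> 'h \<Rightarrow> 'h \<Rightarrow> 'h \<Rightarrow> int \<times> int \<times> int \<Rightarrow> 'h" where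
  "z3_power H a b c = (\<lambda>(i, j, k). a [^]\<^sub>H i \<otimes>\<^sub>H (b [^]\<^sub>H j \<otimes>\<^sub>H c [^]\<^sub>H k))"

lemma (in group) commute_z3_power:
  assumes "a \<in> carrier G" "b \<in> carrier G" "c \<in> carrier G" "x \<in> carrier G"
    and "x \<otimes> a = a \<otimes> x" "x \<otimes> b = b \<otimes> x" "x \<otimes> c = c \<otimes> x"
  shows "x \<otimes> z3_power G a b c z = z3_power G a b c z \<otimes> x"
proof -
  obtain i j k where z: "z = (i, j, k)" by (metis prod_cases3)
  note c = commute_int_pow[OF assms(4,1,5), of i] commute_int_pow[OF assms(4,2,6), of j] commute_int_pow[OF assms(4,3,7), of k]
  have "x \<otimes> (a [^] i \<otimes> (b [^] j \<otimes> c [^] k)) = x \<otimes> a [^] i \<otimes> (b [^] j \<otimes> c [^] k)" using assms by (simp add: m_assoc)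
  also have "\<dots> = a [^] i \<otimes> (x \<otimes> b [^] j \<otimes> c [^] k)" using assms c(1) by (simp add: m_assoc)
  also have "\<dots> = a [^] i \<otimes> (b [^] j \<otimes> (x \<otimes> c [^] k))" unfolding c(2) using assms by (simp add: m_assoc)
  also have "\<dots> = a [^] i \<otimes> (b [^] j \<otimes> c [^] k) \<otimes> x" unfolding c(3) using assms by (simp add: m_assoc)
  finally show ?thesis by (simp add: z3_power_def z)
qed

lemma (in group) z3_power_hom:
  assumes c: "a \<in> carrier G" "b \<in> carrier G" "c \<in> carrier G"
    and cm: "a \<otimes> b = b \<otimes> a" "a \<otimes> c = c \<otimes> a" "b \<otimes> c = c \<otimes> b"
  shows "z3_power G a b c \<in> hom Z3 G"
proof (rule homI)
  show cl: "z3_power G a b c z \<in> carrier G" for z using c by (cases z) (simp add: z3_power_def)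
  fix z z' :: "int \<times> int \<times> int"
  obtain i j k where z: "z = (i, j, k)" by (metis prod_cases3)
  obtain i' j' k' where z': "z' = (i', j', k')" by (metis prod_cases3)
  have bp: "b [^] j \<otimes> c [^] k \<otimes> a [^] i' = a [^] i' \<otimes> (b [^] j \<otimes> c [^] k)"
  proof -
    have "a \<otimes> (b [^] j \<otimes> c [^] k) = (b [^] j \<otimes> c [^] k) \<otimes> a"
      using commute_z3_power[of \<one> b c a "(0, j, k)"] c cm by (simp add: z3_power_def)
    then show ?thesis using c by (intro commute_int_pow) auto
  qed
  have cp: "c [^] k \<otimes> b [^] j' = b [^] j' \<otimes> c [^] k"
    using commute_int_pow[OF c(2,3) cm(3), of k] c by (intro commute_int_pow) auto
  have "z3_power G a b c z \<otimes> z3_power G a b c z'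
      = a [^] i \<otimes> ((b [^] j \<otimes> c [^] k \<otimes> a [^] i') \<otimes> (b [^] j' \<otimes> c [^] k'))"
    using c by (simp add: z z' z3_power_def m_assoc)
  also have "\<dots> = a [^] i \<otimes> a [^] i' \<otimes> (b [^] j \<otimes> (c [^] k \<otimes> b [^] j') \<otimes> c [^] k')"
    unfolding bp using c by (simp add: m_assoc)
  also have "\<dots> = a [^] (i + i') \<otimes> (b [^] (j + j') \<otimes> c [^] (k + k'))"
    unfolding cp using c by (simp add: m_assoc int_pow_mult)
  finally show "z3_power G a b c (z \<otimes>\<^sub>Z3 z') = z3_power G a b c z \<otimes> z3_power G a b c z'"
    by (simp add: z z' z3_power_def)
qed

text \<open>The two factor maps may differ, so each factor gets its own adapted basis and
  derivative, although both factors are the same free group.\<close>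

locale fibre =
  fixes q :: "nat option" and F :: "nat gword set set"
    and f1 f2 :: "nat gword set \<Rightarrow> int" and x1 y1 x2 y2 :: "nat gword set" and e1 e2 :: "nat gword set \<Rightarrow> int"
    and d1 d2 :: "nat gword set \<Rightarrow> laurent"
  assumes q: "\<And>p. q = Some p \<Longrightarrow> p \<ge> 3"
    and F: "subgroup F (base q)"
    and fox1: "fox_data ((base q)\<lparr>carrier := F\<rparr>) f1 x1 y1 e1 d1"
    and fox2: "fox_data ((base q)\<lparr>carrier := F\<rparr>) f2 x2 y2 e2 d2"
begin

abbreviation "A \<equiv> base q"
abbreviation "K \<equiv> A\<lparr>carrier := F\<rparr>"
abbreviation "G \<equiv> A \<times>\<times> A"

definition "S = {s \<in> F \<times> F. f1 (fst s) + f2 (snd s) = 0}"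

sublocale A: group A by (rule group_base)
sublocale K: group K by (rule A.subgroup_imp_group[OF F])
sublocale G: group G by (rule DirProd_group[OF group_base group_base])

lemma FA: "u \<in> F \<Longrightarrow> u \<in> carrier A"
  using subgroup.mem_carrier[OF F] .

lemma fox1D: "x1 \<in> F" "y1 \<in> F" "generates K {x1, y1}" "f1 x1 = 1" "f1 y1 = 0" "e1 x1 = 0" "e1 y1 = 1" "d1 x1 = 0" "d1 y1 = 1"
    "\<And>u v. u \<in> F \<Longrightarrow> v \<in> F \<Longrightarrow> d1 (u \<otimes>\<^sub>A v) = d1 u + tpow (f1 u) * d1 v"
  and fox2D: "x2 \<in> F" "y2 \<in> F" "generates K {x2, y2}" "f2 x2 = 1" "f2 y2 = 0" "e2 x2 = 0" "e2 y2 = 1" "d2 x2 = 0" "d2 y2 = 1"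
    "\<And>u v. u \<in> F \<Longrightarrow> v \<in> F \<Longrightarrow> d2 (u \<otimes>\<^sub>A v) = d2 u + tpow (f2 u) * d2 v"
  using fox1 fox2 by (auto simp: fox_data_def)

sublocale f1: group_hom K integer_group f1
  by (rule group_homI[OF K.group_axioms group_integer_group]) (use fox1 in \<open>simp add: fox_data_def\<close>)
sublocale f2: group_hom K integer_group f2
  by (rule group_homI[OF K.group_axioms group_integer_group]) (use fox2 in \<open>simp add: fox_data_def\<close>)
sublocale e1: group_hom K integer_group e1
  by (rule group_homI[OF K.group_axioms group_integer_group]) (use fox1 in \<open>simp add: fox_data_def\<close>)
sublocale e2: group_hom K integer_group e2
  by (rule group_homI[OF K.group_axioms group_integer_group]) (use fox2 in \<open>simp add: fox_data_def\<close>)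

lemma F_closed: "u \<in> F \<Longrightarrow> v \<in> F \<Longrightarrow> u \<otimes>\<^sub>A v \<in> F" "u \<in> F \<Longrightarrow> inv\<^bsub>A\<^esub> u \<in> F" "\<one>\<^sub>A \<in> F"
  using subgroup.m_closed[OF F] subgroup.m_inv_closed[OF F] subgroup.one_closed[OF F] by auto

lemma F_inv: "u \<in> F \<Longrightarrow> inv\<^bsub>K\<^esub> u = inv\<^bsub>A\<^esub> u"
  by (rule A.m_inv_consistent[OF F])

lemma F_homs:
  "u \<in> F \<Longrightarrow> v \<in> F \<Longrightarrow> f1 (u \<otimes>\<^sub>A v) = f1 u + f1 v" "u \<in> F \<Longrightarrow> f1 (inv\<^bsub>A\<^esub> u) = - f1 u" "f1 \<one>\<^sub>A = 0"
  "u \<in> F \<Longrightarrow> v \<in> F \<Longrightarrow> f2 (u \<otimes>\<^sub>A v) = f2 u + f2 v" "u \<in> F \<Longrightarrow> f2 (inv\<^bsub>A\<^esub> u) = - f2 u" "f2 \<one>\<^sub>A = 0"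
  "u \<in> F \<Longrightarrow> v \<in> F \<Longrightarrow> e1 (u \<otimes>\<^sub>A v) = e1 u + e1 v" "u \<in> F \<Longrightarrow> e1 (inv\<^bsub>A\<^esub> u) = - e1 u" "e1 \<one>\<^sub>A = 0"
  "u \<in> F \<Longrightarrow> v \<in> F \<Longrightarrow> e2 (u \<otimes>\<^sub>A v) = e2 u + e2 v" "u \<in> F \<Longrightarrow> e2 (inv\<^bsub>A\<^esub> u) = - e2 u" "e2 \<one>\<^sub>A = 0"
  using f1.hom_mult[of u v] f1.hom_inv[of u] f1.hom_one f2.hom_mult[of u v] f2.hom_inv[of u] f2.hom_one
    e1.hom_mult[of u v] e1.hom_inv[of u] e1.hom_one e2.hom_mult[of u v] e2.hom_inv[of u] e2.hom_one
  by (simp_all add: F_inv)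

lemma F_pow: "u \<in> F \<Longrightarrow> u [^]\<^sub>A (i::int) \<in> F"
  by (rule A.subgroup_int_pow_closed[OF F])

lemma F_hom_pow: "u \<in> F \<Longrightarrow> f1 (u [^]\<^sub>A (i::int)) = i * f1 u" "u \<in> F \<Longrightarrow> f2 (u [^]\<^sub>A (i::int)) = i * f2 u"
  "u \<in> F \<Longrightarrow> e1 (u [^]\<^sub>A (i::int)) = i * e1 u" "u \<in> F \<Longrightarrow> e2 (u [^]\<^sub>A (i::int)) = i * e2 u"
  using f1.hom_int_pow[of u i] f2.hom_int_pow[of u i] e1.hom_int_pow[of u i] e2.hom_int_pow[of u i]
  by (simp_all add: A.int_pow_consistent[OF F])

lemma S_iff: "(u, v) \<in> S \<longleftrightarrow> u \<in> F \<and> v \<in> F \<and> f1 u + f2 v = 0"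
  by (auto simp: S_def)

lemma inv_G: "u \<in> carrier A \<Longrightarrow> v \<in> carrier A \<Longrightarrow> inv\<^bsub>G\<^esub> (u, v) = (inv\<^bsub>A\<^esub> u, inv\<^bsub>A\<^esub> v)"
  by (rule inv_DirProd[OF group_base group_base])

lemma subgroup_S: "subgroup S G"
proof (rule G.subgroupI)
  show "S \<subseteq> carrier G" using FA by (auto simp: S_def)
  have "\<one>\<^sub>G \<in> S" by (simp add: S_iff F_closed F_homs)
  then show "S \<noteq> {}" by blast
  show "inv\<^bsub>G\<^esub> s \<in> S" if "s \<in> S" for s
    using that by (cases s) (simp add: S_iff inv_G FA F_closed F_homs)
  show "s \<otimes>\<^sub>G t \<in> S" if "s \<in> S" "t \<in> S" for s t
    using that by (cases s; cases t) (simp add: S_iff F_closed F_homs)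
qed

text \<open>Three elements that will generate \<open>S\<close>: one moves the two factors in
  opposite directions, the others are the basis elements on which the factor maps vanish.\<close>

definition "s1 = (x1, inv\<^bsub>A\<^esub> x2)"
definition "s2 = (y1, \<one>\<^sub>A)"
definition "s3 = (\<one>\<^sub>A, y2)"

lemma s_in_S: "s1 \<in> S" "s2 \<in> S" "s3 \<in> S"
  by (simp_all add: s1_def s2_def s3_def S_iff fox1D fox2D F_closed F_homs)

lemma SG: "s \<in> S \<Longrightarrow> s \<in> carrier G"
  using subgroup.mem_carrier[OF subgroup_S] .

text \<open>Modulo the subgroup generated by \<open>s1, s2, s3\<close> an element of \<open>S\<close> can be moved into the second
  factor, where that subgroup is normalised by \<open>F\<close> and contains \<open>y2\<close>.\<close>

lemma S_generated:
  assumes N: "subgroup N G" "s1 \<in> N" "s2 \<in> N" "s3 \<in> N" and s: "s \<in> S"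
  shows "s \<in> N"
proof -
  note Nm = subgroup.m_closed[OF N(1)] and Ni = subgroup.m_inv_closed[OF N(1)] and N1 = subgroup.one_closed[OF N(1)]
  define M where "M = {t \<in> S. t \<in> N}"
  have MS: "subgroup M G" unfolding M_def
  proof (rule G.subgroupI)
    have "\<one>\<^sub>G \<in> {t \<in> S. t \<in> N}" using N1 subgroup.one_closed[OF subgroup_S] by simp
    then show "{t \<in> S. t \<in> N} \<noteq> {}" by blast
  qed (use SG Nm Ni subgroup.m_closed[OF subgroup_S] subgroup.m_inv_closed[OF subgroup_S] in simp_all, blast)
  have sM: "s1 \<in> M" "s2 \<in> M" "s3 \<in> M" using N s_in_S by (simp_all add: M_def)
  have M_mult: "(u \<otimes>\<^sub>A u', v \<otimes>\<^sub>A v') \<in> M" if "(u, v) \<in> M" "(u', v') \<in> M" for u v u' v'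
    using subgroup.m_closed[OF MS that] by simp
  have M_inv: "(inv\<^bsub>A\<^esub> u, inv\<^bsub>A\<^esub> v) \<in> M" if m: "(u, v) \<in> M" for u v
  proof -
    have "u \<in> carrier A" "v \<in> carrier A" using m FA by (auto simp: M_def S_iff)
    then show ?thesis using subgroup.m_inv_closed[OF MS m] inv_G by simp
  qed
  have MF: "u \<in> F" "v \<in> F" "f1 u + f2 v = 0" if "(u, v) \<in> M" for u v using that by (auto simp: M_def S_iff)
  have one: "(\<one>\<^sub>A, \<one>\<^sub>A) \<in> M" using subgroup.one_closed[OF MS] by simp
  \<comment> \<open>First coordinates of \<open>M\<close>; they fill the free group because
    \<open>s1\<close> and \<open>s2\<close> project onto its basis.\<close>
  define U where "U = {u \<in> F. \<exists>v. (u, v) \<in> M}"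
  have "subgroup U K"
  proof (rule K.subgroupI)
    show "U \<noteq> {}" using one F_closed(3) by (auto simp: U_def)
    show "inv\<^bsub>K\<^esub> u \<in> U" if "u \<in> U" for u using that M_inv F_closed(2) by (auto simp: U_def F_inv)
    show "u \<otimes>\<^sub>K u' \<in> U" if "u \<in> U" "u' \<in> U" for u u'
      using that M_mult F_closed(1) unfolding U_def by fastforce
  qed (auto simp: U_def)
  moreover have "{x1, y1} \<subseteq> U" using sM fox1D(1,2) by (auto simp: U_def s1_def s2_def)
  ultimately have U: "u \<in> U" if "u \<in> F" for u using generatesD[OF fox1D(3), of U u] that by simp
  \<comment> \<open>The part of \<open>M\<close> inside the second factor. Conjugation by
    \<open>s1\<close> and its inverse makes it stable under conjugation by \<open>x2\<close> in both
    directions.\<close>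
  define V where "V = {v \<in> F. (\<one>\<^sub>A, v) \<in> M}"
  have V_mult: "v \<otimes>\<^sub>A v' \<in> V" if "v \<in> V" "v' \<in> V" for v v'
    using that M_mult[of "\<one>\<^sub>A" v "\<one>\<^sub>A" v'] F_closed by (simp add: V_def)
  have V_inv: "inv\<^bsub>A\<^esub> v \<in> V" if "v \<in> V" for v
    using that M_inv[of "\<one>\<^sub>A" v] F_closed by (simp add: V_def)
  have V_f2: "f2 v = 0" if "v \<in> V" for v using that MF(3)[of "\<one>\<^sub>A" v] F_homs(3) by (simp add: V_def)
  have Vx: "x2 \<otimes>\<^sub>A v \<otimes>\<^sub>A inv\<^bsub>A\<^esub> x2 \<in> V" "inv\<^bsub>A\<^esub> x2 \<otimes>\<^sub>A v \<otimes>\<^sub>A x2 \<in> V" if v: "v \<in> V" for v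
  proof -
    have vM: "(\<one>\<^sub>A, v) \<in> M" "v \<in> F" using v by (simp_all add: V_def)
    have a: "(x1, inv\<^bsub>A\<^esub> x2) \<in> M" "(inv\<^bsub>A\<^esub> x1, x2) \<in> M"
      using sM(1) M_inv[of x1 "inv\<^bsub>A\<^esub> x2"] FA[OF fox2D(1)] by (simp_all add: s1_def)
    show "x2 \<otimes>\<^sub>A v \<otimes>\<^sub>A inv\<^bsub>A\<^esub> x2 \<in> V"
      using M_mult[OF M_mult[OF a(2) vM(1)] a(1)] FA[OF fox1D(1)] vM(2) fox2D(1) by (simp add: V_def F_closed)
    show "inv\<^bsub>A\<^esub> x2 \<otimes>\<^sub>A v \<otimes>\<^sub>A x2 \<in> V"
      using M_mult[OF M_mult[OF a(1) vM(1)] a(2)] FA[OF fox1D(1)] vM(2) fox2D(1) by (simp add: V_def F_closed)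
  qed
  have y2V: "y2 \<in> V" using sM(3) fox2D(2) by (simp add: V_def s3_def)
  have x2A: "x2 \<in> carrier A" by (rule FA[OF fox2D(1)])
  \<comment> \<open>Membership means that \<open>v\<close> is an element of \<open>V\<close> times
    the power of \<open>x2\<close> dictated by \<open>f2\<close>. Once this holds for all of
    \<open>F\<close>, elements on which \<open>f2\<close> vanishes lie in \<open>V\<close>.\<close>
  define W where "W = {v \<in> F. v \<otimes>\<^sub>A x2 [^]\<^sub>A (- f2 v) \<in> V}"
  have step_x: "v \<otimes>\<^sub>A x2 \<in> W \<longleftrightarrow> v \<in> W" if v: "v \<in> F" for v
  proof -
    have "x2 [^]\<^sub>A (- f2 v) = x2 \<otimes>\<^sub>A x2 [^]\<^sub>A (- f2 v - 1)"
      using A.int_pow_mult[OF x2A, of 1 "- f2 v - 1"] x2A by simp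
    then have "v \<otimes>\<^sub>A x2 \<otimes>\<^sub>A x2 [^]\<^sub>A (- f2 (v \<otimes>\<^sub>A x2)) = v \<otimes>\<^sub>A x2 [^]\<^sub>A (- f2 v)"
      using v FA[OF v] x2A by (simp add: F_homs fox2D A.m_assoc)
    then show ?thesis using v fox2D(1) F_closed by (simp add: W_def)
  qed
  have conj_pow: "x2 [^]\<^sub>A (i::int) \<otimes>\<^sub>A v \<otimes>\<^sub>A inv\<^bsub>A\<^esub> (x2 [^]\<^sub>A i) \<in> V" if v: "v \<in> V" for i v
  proof (induction i rule: int_induct[where k = 0])
    case base then show ?case using v FA by (simp add: V_def)
  next
    case (step1 i)
    have vA: "v \<in> carrier A" using v FA by (simp add: V_def)
    have "x2 [^]\<^sub>A (i + 1) = x2 \<otimes>\<^sub>A x2 [^]\<^sub>A i" using A.int_pow_mult[OF x2A, of 1 i] x2A by (simp add: add.commute)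
    then show ?case using Vx(1)[OF step1(2)] vA x2A by (simp add: A.m_assoc A.inv_mult_group)
  next
    case (step2 i)
    have vA: "v \<in> carrier A" using v FA by (simp add: V_def)
    have "x2 [^]\<^sub>A (i - 1) = inv\<^bsub>A\<^esub> x2 \<otimes>\<^sub>A x2 [^]\<^sub>A i" using A.int_pow_mult[OF x2A, of "-1" i] x2A by (simp add: A.int_pow_neg)
    then show ?case using Vx(2)[OF step2(2)] vA x2A by (simp add: A.m_assoc A.inv_mult_group)
  qed
  have step_y: "v \<otimes>\<^sub>A y2 \<in> W \<longleftrightarrow> v \<in> W" if v: "v \<in> F" for v
  proof -
    let ?p = "x2 [^]\<^sub>A (- f2 v)"
    let ?c = "inv\<^bsub>A\<^esub> ?p \<otimes>\<^sub>A y2 \<otimes>\<^sub>A ?p"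
    have c: "v \<in> carrier A" "y2 \<in> carrier A" "?p \<in> carrier A" using FA[OF v] FA[OF fox2D(2)] x2A by simp_all
    have cV: "?c \<in> V" using conj_pow[OF y2V, of "f2 v"] x2A by (simp add: A.int_pow_neg)
    have e: "v \<otimes>\<^sub>A y2 \<otimes>\<^sub>A x2 [^]\<^sub>A (- f2 (v \<otimes>\<^sub>A y2)) = v \<otimes>\<^sub>A ?p \<otimes>\<^sub>A ?c"
      using v c fox2D by (simp add: F_homs A.m_assoc)
    have "v \<otimes>\<^sub>A ?p \<otimes>\<^sub>A ?c \<in> V \<longleftrightarrow> v \<otimes>\<^sub>A ?p \<in> V"
    proof
      assume "v \<otimes>\<^sub>A ?p \<otimes>\<^sub>A ?c \<in> V"
      from V_mult[OF this V_inv[OF cV]] show "v \<otimes>\<^sub>A ?p \<in> V"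
        using A.mult_inv_cancel[of "v \<otimes>\<^sub>A ?p" ?c] c by simp
    qed (rule V_mult[OF _ cV])
    then show ?thesis using v fox2D(2) F_closed by (simp add: W_def e)
  qed
  have W: "v \<in> W" if "v \<in> F" for v
  proof (rule generates_induct[OF fox2D(3) K.group_axioms, of "\<lambda>v. v \<in> W"])
    show "\<one>\<^sub>K \<in> W" using one F_closed(3) F_homs(6) by (simp add: W_def V_def)
    show "v \<in> carrier K" using that by simp
    fix g b assume "g \<in> carrier K" "b \<in> {x2, y2}"
    then show "(g \<otimes>\<^sub>K b \<in> W) = (g \<in> W)" using step_x step_y by auto
  qed
  obtain u v where uv: "s = (u, v)" "u \<in> F" "v \<in> F" "f1 u + f2 v = 0" using s by (cases s) (auto simp: S_iff)
  obtain v' where v': "(u, v') \<in> M" using U[OF uv(2)] by (auto simp: U_def)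
  note m = MF[OF v']
  have c: "u \<in> carrier A" "v \<in> carrier A" "v' \<in> carrier A" using uv m FA by auto
  have "f2 (v \<otimes>\<^sub>A inv\<^bsub>A\<^esub> v') = 0" using uv m by (simp add: F_homs F_closed)
  then have "v \<otimes>\<^sub>A inv\<^bsub>A\<^esub> v' \<in> V" using W[of "v \<otimes>\<^sub>A inv\<^bsub>A\<^esub> v'"] uv m c by (simp add: W_def F_closed)
  then have "(\<one>\<^sub>A, v \<otimes>\<^sub>A inv\<^bsub>A\<^esub> v') \<in> M" by (simp add: V_def)
  from M_mult[OF this v'] have "s \<in> M" using c uv by (simp add: A.m_assoc)
  then show ?thesis by (simp add: M_def)
qed

text \<open>The abelianisation of \<open>S\<close>. On \<open>S\<close> the value of
  \<open>f2\<close> is determined by that of \<open>f1\<close>, so only one of them is recorded, and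
  the three generators go to the standard basis.\<close>

definition \<tau> :: "nat gword set \<times> nat gword set \<Rightarrow> int \<times> int \<times> int" where
  "\<tau> s = (f1 (fst s), e1 (fst s), e2 (snd s))"

lemma tau_mult: "s \<in> S \<Longrightarrow> t \<in> S \<Longrightarrow> \<tau> (s \<otimes>\<^sub>G t) = \<tau> s \<otimes>\<^sub>Z3 \<tau> t"
  by (cases s; cases t) (simp add: S_iff \<tau>_def F_homs)

lemma tau_s: "\<tau> s1 = (1, 0, 0)" "\<tau> s2 = (0, 1, 0)" "\<tau> s3 = (0, 0, 1)"
  by (simp_all add: \<tau>_def s1_def s2_def s3_def fox1D fox2D F_homs F_closed)

lemma tau_surj: "\<exists>s\<in>S. \<tau> s = z"
proof -
  obtain i j k where z: "z = (i, j, k)" by (metis prod_cases3)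
  let ?s = "(x1 [^]\<^sub>A i \<otimes>\<^sub>A y1 [^]\<^sub>A j, x2 [^]\<^sub>A (- i) \<otimes>\<^sub>A y2 [^]\<^sub>A k)"
  have "?s \<in> S" "\<tau> ?s = z"
    by (simp_all add: S_iff \<tau>_def z F_homs F_closed F_pow F_hom_pow fox1D fox2D)
  then show ?thesis by blast
qed

end

section \<open>Lifting homomorphisms through central extensions\<close>

lemma perfect_generated:
  assumes E: "group E" "generates E (h1 ` carrier G \<union> h2 ` carrier H)"
    and G: "group G" "perfect G" "h1 \<in> hom G E" and H: "group H" "perfect H" "h2 \<in> hom H E"
  shows "perfect E"
  unfolding perfect_def commutator_def[symmetric]
proof (intro allI impI)
  fix N assume N: "subgroup N E"
    and "\<forall>x\<in>carrier E. \<forall>y\<in>carrier E. commutator E x y \<in> N"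
  then have cm: "commutator E x y \<in> N" if "x \<in> carrier E" "y \<in> carrier E" for x y using that by blast
  have "h1 g \<in> N" if "g \<in> carrier G" for g
  proof -
    have "g \<in> {x \<in> carrier G. h1 x \<in> N}"
      by (rule perfectD[OF G(2) subgroup_preimage[OF G(1) E(1) G(3) N] _ that])
        (use cm hom_in_carrier[OF G(3)] group.comm_closed[OF G(1)] in \<open>simp add: comm_hom[OF G(1) E(1) G(3)]\<close>)
    then show ?thesis by simp
  qed
  moreover have "h2 g \<in> N" if "g \<in> carrier H" for g
  proof -
    have "g \<in> {x \<in> carrier H. h2 x \<in> N}"
      by (rule perfectD[OF H(2) subgroup_preimage[OF H(1) E(1) H(3) N] _ that])
        (use cm hom_in_carrier[OF H(3)] group.comm_closed[OF H(1)] in \<open>simp add: comm_hom[OF H(1) E(1) H(3)]\<close>)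
    then show ?thesis by simp
  qed
  ultimately show "N = carrier E" using E(2) N unfolding generates_def by (metis Un_least image_subsetI)
qed

lemma DirProd_inclusions:
  assumes "group G" "group H"
  shows "(\<lambda>x. (x, \<one>\<^sub>H)) \<in> hom G (G \<times>\<times> H)" "(\<lambda>y. (\<one>\<^sub>G, y)) \<in> hom H (G \<times>\<times> H)"
    "generates (G \<times>\<times> H) ((\<lambda>x. (x, \<one>\<^sub>H)) ` carrier G \<union> (\<lambda>y. (\<one>\<^sub>G, y)) ` carrier H)"
proof -
  interpret G: group G by fact
  interpret H: group H by fact
  show "(\<lambda>x. (x, \<one>\<^sub>H)) \<in> hom G (G \<times>\<times> H)" "(\<lambda>y. (\<one>\<^sub>G, y)) \<in> hom H (G \<times>\<times> H)"
    by (rule homI; simp)+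
  show "generates (G \<times>\<times> H) ((\<lambda>x. (x, \<one>\<^sub>H)) ` carrier G \<union> (\<lambda>y. (\<one>\<^sub>G, y)) ` carrier H)"
    unfolding generates_def
  proof (intro conjI allI impI)
    show "(\<lambda>x. (x, \<one>\<^sub>H)) ` carrier G \<union> (\<lambda>y. (\<one>\<^sub>G, y)) ` carrier H \<subseteq> carrier (G \<times>\<times> H)" by auto
    fix N assume N: "subgroup N (G \<times>\<times> H)" "(\<lambda>x. (x, \<one>\<^sub>H)) ` carrier G \<union> (\<lambda>y. (\<one>\<^sub>G, y)) ` carrier H \<subseteq> N"
    have "(x, y) \<in> N" if "x \<in> carrier G" "y \<in> carrier H" for x y
    proof -
      have "(x, \<one>\<^sub>H) \<in> N" "(\<one>\<^sub>G, y) \<in> N" using N(2) that by blast+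
      from subgroup.m_closed[OF N(1) this] show ?thesis using that by simp
    qed
    then show "N = carrier (G \<times>\<times> H)" using subgroup.subset[OF N(1)] by auto
  qed
qed

lemma perfect_DirProd: "group G \<Longrightarrow> group H \<Longrightarrow> perfect G \<Longrightarrow> perfect H \<Longrightarrow> perfect (G \<times>\<times> H)"
  by (rule perfect_generated[OF DirProd_group DirProd_inclusions(3) _ _ DirProd_inclusions(1) _ _ DirProd_inclusions(2)])

lemma DirProd_hom:
  assumes "group G" "group H" "group L" "f \<in> hom G L" "g \<in> hom H L"
    and "\<And>x y. x \<in> carrier G \<Longrightarrow> y \<in> carrier H \<Longrightarrow> f x \<otimes>\<^sub>L g y = g y \<otimes>\<^sub>L f x"
  shows "(\<lambda>(x, y). f x \<otimes>\<^sub>L g y) \<in> hom (G \<times>\<times> H) L"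
proof (rule homI)
  interpret L: group L by fact
  note fc = hom_in_carrier[OF assms(4)] and gc = hom_in_carrier[OF assms(5)]
  fix p r assume pr: "p \<in> carrier (G \<times>\<times> H)" "r \<in> carrier (G \<times>\<times> H)"
  obtain x y x' y' where p: "p = (x, y)" "r = (x', y')" by (cases p, cases r, rule that)
  have c: "x \<in> carrier G" "y \<in> carrier H" "x' \<in> carrier G" "y' \<in> carrier H" using pr by (simp_all add: p)
  show "(\<lambda>(x, y). f x \<otimes>\<^sub>L g y) p \<in> carrier L" using c fc gc by (simp add: p)
  have "f x \<otimes>\<^sub>L f x' \<otimes>\<^sub>L (g y \<otimes>\<^sub>L g y') = f x \<otimes>\<^sub>L (f x' \<otimes>\<^sub>L g y) \<otimes>\<^sub>L g y'"
    using c fc gc by (simp add: L.m_assoc)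
  also have "\<dots> = f x \<otimes>\<^sub>L g y \<otimes>\<^sub>L (f x' \<otimes>\<^sub>L g y')"
    unfolding assms(6)[OF c(3,2)] using c fc gc by (simp add: L.m_assoc)
  finally show "(\<lambda>(x, y). f x \<otimes>\<^sub>L g y) (p \<otimes>\<^bsub>G \<times>\<times> H\<^esub> r) = (\<lambda>(x, y). f x \<otimes>\<^sub>L g y) p \<otimes>\<^sub>L (\<lambda>(x, y). f x \<otimes>\<^sub>L g y) r"
    by (simp add: p hom_mult[OF assms(4) c(1,3)] hom_mult[OF assms(5) c(2,4)])
qed

context fibre begin

lemma perfect_G: "perfect G"
  by (rule perfect_DirProd[OF group_base group_base perfect_base perfect_base])

text \<open>The two factors are lifted separately. Commutators between the lifts map to 1 and are
  therefore central, and \<open>perfect_central_commute\<close> makes them trivial, so the lifts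
  combine.\<close>

lemma G_lift:
  assumes H: "group H" and Y: "group Y" and rho: "\<rho> \<in> hom H Y"
    and ker: "\<And>k. k \<in> carrier H \<Longrightarrow> \<rho> k = \<one>\<^sub>Y \<Longrightarrow> central H k"
    and f: "f \<in> hom G Y" "f ` carrier G \<subseteq> \<rho> ` carrier H"
  obtains L where "L \<in> hom G H" "\<And>x. x \<in> carrier G \<Longrightarrow> \<rho> (L x) = f x"
proof -
  interpret H: group H by (rule H)
  interpret rho: group_hom H Y \<rho> by (rule group_homI[OF H Y rho])
  note inc = DirProd_inclusions[OF group_base[of q] group_base[of q]]
  have c1: "(\<lambda>x. (x, \<one>\<^sub>A)) ` carrier A \<subseteq> carrier G" and c2: "(\<lambda>y. (\<one>\<^sub>A, y)) ` carrier A \<subseteq> carrier G" by auto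
  have h1: "f \<circ> (\<lambda>x. (x, \<one>\<^sub>A)) \<in> hom A Y" and h2: "f \<circ> (\<lambda>y. (\<one>\<^sub>A, y)) \<in> hom A Y"
    by (rule hom_compose[OF inc(1) f(1)], rule hom_compose[OF inc(2) f(1)])
  have s1: "(f \<circ> (\<lambda>x. (x, \<one>\<^sub>A))) ` carrier A \<subseteq> \<rho> ` carrier H" and s2: "(f \<circ> (\<lambda>y. (\<one>\<^sub>A, y))) ` carrier A \<subseteq> \<rho> ` carrier H"
    using f(2) by auto
  obtain L1 where L1: "L1 \<in> hom A H" "\<And>x. x \<in> carrier A \<Longrightarrow> \<rho> (L1 x) = (f \<circ> (\<lambda>x. (x, \<one>\<^sub>A))) x"
    using base_lift[OF H Y rho ker h1 s1] by blast
  obtain L2 where L2: "L2 \<in> hom A H" "\<And>x. x \<in> carrier A \<Longrightarrow> \<rho> (L2 x) = (f \<circ> (\<lambda>y. (\<one>\<^sub>A, y))) x"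
    using base_lift[OF H Y rho ker h2 s2] by blast
  have lc: "L1 x \<in> carrier H" "L2 x \<in> carrier H" if "x \<in> carrier A" for x
    using hom_in_carrier[OF L1(1) that] hom_in_carrier[OF L2(1) that] by auto
  have cm: "L1 x \<otimes>\<^sub>H L2 y = L2 y \<otimes>\<^sub>H L1 x" if x: "x \<in> carrier A" and y: "y \<in> carrier A" for x y
  proof (rule perfect_central_commute[OF group_base perfect_base H L1(1) lc(2)[OF y] _ x])
    fix z assume z: "z \<in> carrier A"
    have "commutator G (z, \<one>\<^sub>A) (\<one>\<^sub>A, y) = \<one>\<^sub>G"
      using z y by (subst G.comm_eq_one_iff) simp_all
    then have "f (commutator G (z, \<one>\<^sub>A) (\<one>\<^sub>A, y)) = \<one>\<^sub>Y" using hom_one[OF f(1) G.group_axioms Y] by simp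
    moreover have "\<rho> (commutator H (L1 z) (L2 y)) = f (commutator G (z, \<one>\<^sub>A) (\<one>\<^sub>A, y))"
      using comm_hom[OF H Y rho lc(1)[OF z] lc(2)[OF y]] comm_hom[OF G.group_axioms Y f(1), of "(z, \<one>\<^sub>A)" "(\<one>\<^sub>A, y)"] z y L1(2) L2(2) by simp
    ultimately show "central H (commutator H (L1 z) (L2 y))" using lc z y by (intro ker) simp_all
  qed
  let ?L = "\<lambda>(x, y). L1 x \<otimes>\<^sub>H L2 y"
  have "?L \<in> hom G H" by (rule DirProd_hom[OF group_base group_base H L1(1) L2(1) cm])
  moreover have "\<rho> (?L p) = f p" if "p \<in> carrier G" for p
  proof -
    obtain x y where p: "p = (x, y)" "x \<in> carrier A" "y \<in> carrier A" using \<open>p \<in> carrier G\<close> by auto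
    have "f p = f ((x, \<one>\<^sub>A) \<otimes>\<^sub>G (\<one>\<^sub>A, y))" using p by simp
    also have "\<dots> = f (x, \<one>\<^sub>A) \<otimes>\<^sub>Y f (\<one>\<^sub>A, y)" by (rule hom_mult[OF f(1)]) (use p in simp_all)
    finally show ?thesis using p L1(2) L2(2) lc by simp
  qed
  ultimately show thesis by (rule that)
qed

section \<open>An explicit model of the universal central extension\<close>

abbreviation "GZ \<equiv> G \<times>\<times> Z3"

text \<open>Twisting only one side makes the two copies of \<open>S\<close> differ in the amalgam by
  central elements, and every element of \<open>Z3\<close> arises as such a difference.\<close>

definition "glue1 = (\<lambda>(s, z). (s, \<tau> s \<otimes>\<^sub>Z3 z))"
definition "glue2 = (\<lambda>sz :: (nat gword set \<times> nat gword set) \<times> int \<times> int \<times> int. sz)"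

abbreviation "edge_group \<equiv> (G\<lparr>carrier := S\<rparr>) \<times>\<times> Z3"

lemma group_GZ: "group GZ"
  by (rule DirProd_group[OF G.group_axioms group_Z3])

sublocale Z3: group Z3 by (rule group_Z3)

lemma carrier_Z3: "z \<in> carrier Z3"
  by (cases z) simp

sublocale ee: amalgam GZ GZ "S \<times> UNIV" glue1 glue2
proof (intro amalgam.intro amalgam_axioms.intro group_GZ)
  show "glue1 ` (S \<times> UNIV) \<subseteq> carrier GZ" using SG by (auto simp: glue1_def)
  show "glue2 ` (S \<times> UNIV) \<subseteq> carrier GZ" using SG by (auto simp: glue2_def)
qed

sublocale dd: amalgam G G S "\<lambda>s. s" "\<lambda>s. s"
  by (intro amalgam.intro amalgam_axioms.intro G.group_axioms) (use SG in auto)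

abbreviation "E0 \<equiv> ee.P"
abbreviation "\<Delta> \<equiv> dd.P"

lemma group_edge: "group edge_group"
  by (rule DirProd_group[OF G.subgroup_imp_group[OF subgroup_S] group_Z3])

lemma glue_hom: "glue1 \<in> hom edge_group GZ" "glue2 \<in> hom edge_group GZ"
proof -
  show "glue1 \<in> hom edge_group GZ"
  proof (rule homI)
    fix x y assume xy: "x \<in> carrier edge_group" "y \<in> carrier edge_group"
    obtain s z t w where x: "x = (s, z)" "y = (t, w)" by (cases x, cases y, rule that)
    have st: "s \<in> S" "t \<in> S" using xy by (simp_all add: x)
    show "glue1 x \<in> carrier GZ" using st SG by (auto simp: x glue1_def)
    have "\<tau> s \<otimes>\<^sub>Z3 \<tau> t \<otimes>\<^sub>Z3 (z \<otimes>\<^sub>Z3 w) = \<tau> s \<otimes>\<^sub>Z3 z \<otimes>\<^sub>Z3 (\<tau> t \<otimes>\<^sub>Z3 w)"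
      by (cases z; cases w; cases "\<tau> s"; cases "\<tau> t") simp
    then show "glue1 (x \<otimes>\<^bsub>edge_group\<^esub> y) = glue1 x \<otimes>\<^sub>GZ glue1 y"
      using tau_mult[OF st] by (simp add: x glue1_def mult_DirProd')
  qed
  show "glue2 \<in> hom edge_group GZ"
    by (rule homI) (use SG in \<open>auto simp: glue2_def\<close>)
qed

lemma glue_inj: "inj_on glue1 (S \<times> UNIV)" "inj_on glue2 (S \<times> UNIV)"
  by (auto simp: inj_on_def glue1_def glue2_def \<tau>_def)

lemma countable_GZ: "countable (carrier GZ)"
  using countable_base by auto

lemma torsion_free_E0: "torsion_free E0"
proof -
  have tf: "torsion_free GZ"
    by (intro torsion_free_DirProd group_Z3 DirProd_group group_base group_integer_group torsion_free_integer_group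
        torsion_free_base q) auto
  have ed: "carrier edge_group = S \<times> UNIV" by auto
  interpret c: group_hom edge_group E0 "ee.i1 \<circ> glue1"
    by (rule group_homI[OF group_edge ee.P.group_axioms hom_compose[OF glue_hom(1) ee.i1_hom]])
  have C: "subgroup (ee.i1 ` glue1 ` (S \<times> UNIV)) E0"
    using c.img_is_subgroup by (simp add: image_comp ed)
  show ?thesis
    by (rule ee.torsion_free_amalgam[OF C ee.inclusions_injective[OF group_edge ed[symmetric] glue_hom(1) glue_inj(1) glue_hom(2) glue_inj(2) countable_GZ countable_GZ] tf tf])
qed

definition "\<iota>1 g = ee.i1 (g, \<one>\<^sub>Z3)"
definition "\<iota>2 g = ee.i2 (g, \<one>\<^sub>Z3)"
definition "\<zeta> z = ee.i1 (\<one>\<^sub>G, z)"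

lemma iota_hom: "\<iota>1 \<in> hom G E0" "\<iota>2 \<in> hom G E0" "\<zeta> \<in> hom Z3 E0"
  using hom_compose[OF DirProd_inclusions(1)[OF G.group_axioms group_Z3] ee.i1_hom]
    hom_compose[OF DirProd_inclusions(1)[OF G.group_axioms group_Z3] ee.i2_hom]
    hom_compose[OF DirProd_inclusions(2)[OF G.group_axioms group_Z3] ee.i1_hom]
  by (simp_all add: \<iota>1_def[abs_def] \<iota>2_def[abs_def] \<zeta>_def[abs_def] comp_def)

lemma iota_closed [simp]: "g \<in> carrier G \<Longrightarrow> \<iota>1 g \<in> carrier E0" "g \<in> carrier G \<Longrightarrow> \<iota>2 g \<in> carrier E0" "\<zeta> z \<in> carrier E0"
  using hom_in_carrier[OF iota_hom(1)] hom_in_carrier[OF iota_hom(2)] hom_in_carrier[OF iota_hom(3) carrier_Z3] by auto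

text \<open>The twist is trivial at the identity of \<open>S\<close>, so both vertex groups contain
  the same central copy of \<open>Z3\<close>.\<close>

lemma zeta_eq: "\<zeta> z = ee.i2 (\<one>\<^sub>G, z)"
proof -
  have "\<one>\<^sub>G \<in> S" by (rule subgroup.one_closed[OF subgroup_S])
  moreover have "\<tau> \<one>\<^sub>G = (0, 0, 0)" by (simp add: \<tau>_def F_homs)
  ultimately show ?thesis using ee.i1_i2[of "(\<one>\<^sub>G, z)"] by (cases z) (simp add: glue1_def glue2_def \<zeta>_def)
qed

lemma i_decomp:
  assumes "g \<in> carrier G"
  shows "ee.i1 (g, z) = \<iota>1 g \<otimes>\<^sub>E0 \<zeta> z" "ee.i2 (g, z) = \<iota>2 g \<otimes>\<^sub>E0 \<zeta> z"
    "ee.i1 (g, z) = \<zeta> z \<otimes>\<^sub>E0 \<iota>1 g" "ee.i2 (g, z) = \<zeta> z \<otimes>\<^sub>E0 \<iota>2 g"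
proof -
  have c: "(g, \<one>\<^sub>Z3) \<in> carrier GZ" "(\<one>\<^sub>G, z) \<in> carrier GZ" using assms by auto
  have e: "(g, z) = (g, \<one>\<^sub>Z3) \<otimes>\<^sub>GZ (\<one>\<^sub>G, z)" "(g, z) = (\<one>\<^sub>G, z) \<otimes>\<^sub>GZ (g, \<one>\<^sub>Z3)"
    using assms by (cases z, auto)+
  show "ee.i1 (g, z) = \<iota>1 g \<otimes>\<^sub>E0 \<zeta> z" "ee.i2 (g, z) = \<iota>2 g \<otimes>\<^sub>E0 \<zeta> z"
    unfolding \<iota>1_def \<iota>2_def \<zeta>_def by (subst e(1), rule hom_mult[OF ee.i1_hom c]) (unfold zeta_eq[unfolded \<zeta>_def], subst e(1), rule hom_mult[OF ee.i2_hom c])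
  show "ee.i1 (g, z) = \<zeta> z \<otimes>\<^sub>E0 \<iota>1 g" "ee.i2 (g, z) = \<zeta> z \<otimes>\<^sub>E0 \<iota>2 g"
    unfolding \<iota>1_def \<iota>2_def \<zeta>_def by (subst e(2), rule hom_mult[OF ee.i1_hom c(2,1)]) (unfold zeta_eq[unfolded \<zeta>_def], subst e(2), rule hom_mult[OF ee.i2_hom c(2,1)])
qed

lemma iota_S: "s \<in> S \<Longrightarrow> \<iota>2 s = \<iota>1 s \<otimes>\<^sub>E0 \<zeta> (\<tau> s)"
proof -
  assume s: "s \<in> S"
  have "ee.i1 (s, \<tau> s) = ee.i2 (s, \<one>\<^sub>Z3)"
    using ee.i1_i2[of "(s, \<one>\<^sub>Z3)"] s by (cases "\<tau> s") (simp add: glue1_def glue2_def)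
  then show ?thesis using i_decomp(1)[OF SG[OF s]] by (simp add: \<iota>2_def)
qed

text \<open>The central part needs no generators of its own: as \<tau> is surjective, every
  \<open>\<zeta> z\<close> is the discrepancy of the two embeddings at some element of
  \<open>S\<close>. This is the source of perfectness of the model.\<close>

lemma generates_E0: "generates E0 (\<iota>1 ` carrier G \<union> \<iota>2 ` carrier G)"
  unfolding generates_def
proof (intro conjI allI impI)
  show "\<iota>1 ` carrier G \<union> \<iota>2 ` carrier G \<subseteq> carrier E0" by auto
  fix N assume N: "subgroup N E0" and sub: "\<iota>1 ` carrier G \<union> \<iota>2 ` carrier G \<subseteq> N"
  have i: "\<iota>1 g \<in> N" "\<iota>2 g \<in> N" if "g \<in> carrier G" for g using sub that by auto
  have z: "\<zeta> z \<in> N" for z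
  proof -
    obtain s where s: "s \<in> S" "\<tau> s = z" using tau_surj by blast
    have "\<zeta> z = inv\<^bsub>E0\<^esub> (\<iota>1 s) \<otimes>\<^sub>E0 \<iota>2 s" using iota_S[OF s(1)] s SG[OF s(1)] by simp
    then show ?thesis using i[OF SG[OF s(1)]] subgroup.m_closed[OF N] subgroup.m_inv_closed[OF N] by simp
  qed
  have "ee.i1 ` carrier GZ \<union> ee.i2 ` carrier GZ \<subseteq> N"
    using i z subgroup.m_closed[OF N] by (auto simp: i_decomp)
  then show "N = carrier E0" using ee.generates_P N unfolding generates_def by blast
qed

lemma perfect_E0: "perfect E0"
  by (rule perfect_generated[OF ee.P.group_axioms generates_E0 G.group_axioms perfect_G iota_hom(1) G.group_axioms perfect_G iota_hom(2)])

text \<open>The elements \<open>w s\<close> measure the difference of two homomorphisms on \<open>S\<close>; once they commute with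
  both images, \<open>w\<close> is a homomorphism and factors through \<open>\<tau>\<close>.\<close>

lemma E0_universal:
  assumes H: "group H" and l: "l1 \<in> hom G H" "l2 \<in> hom G H"
    and w: "\<And>s g. s \<in> {s1, s2, s3} \<Longrightarrow> g \<in> carrier G \<Longrightarrow>
      inv\<^bsub>H\<^esub> (l1 s) \<otimes>\<^sub>H l2 s \<otimes>\<^sub>H l1 g = l1 g \<otimes>\<^sub>H (inv\<^bsub>H\<^esub> (l1 s) \<otimes>\<^sub>H l2 s)"
      "\<And>s g. s \<in> {s1, s2, s3} \<Longrightarrow> g \<in> carrier G \<Longrightarrow>
      inv\<^bsub>H\<^esub> (l1 s) \<otimes>\<^sub>H l2 s \<otimes>\<^sub>H l2 g = l2 g \<otimes>\<^sub>H (inv\<^bsub>H\<^esub> (l1 s) \<otimes>\<^sub>H l2 s)"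
  obtains f where "f \<in> hom E0 H" "\<And>g. g \<in> carrier G \<Longrightarrow> f (\<iota>1 g) = l1 g" "\<And>g. g \<in> carrier G \<Longrightarrow> f (\<iota>2 g) = l2 g"
proof -
  interpret H: group H by (rule H)
  interpret l1: group_hom G H l1 by (rule group_homI[OF G.group_axioms H l(1)])
  interpret l2: group_hom G H l2 by (rule group_homI[OF G.group_axioms H l(2)])
  \<comment> \<open>The discrepancy of the two homomorphisms; for the two embeddings into the model
    it is \<open>\<zeta> (\<tau> s)\<close>.\<close>
  define ww where "ww s = inv\<^bsub>H\<^esub> (l1 s) \<otimes>\<^sub>H l2 s" for s
  have wc: "ww s \<in> carrier H" if "s \<in> carrier G" for s using that by (simp add: ww_def)
  define com where "com x \<longleftrightarrow> (\<forall>g\<in>carrier G. x \<otimes>\<^sub>H l1 g = l1 g \<otimes>\<^sub>H x \<and> x \<otimes>\<^sub>H l2 g = l2 g \<otimes>\<^sub>H x)" for x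
  have comD: "x \<otimes>\<^sub>H l1 g = l1 g \<otimes>\<^sub>H x" "x \<otimes>\<^sub>H l2 g = l2 g \<otimes>\<^sub>H x" if "com x" "g \<in> carrier G" for x g
    using that by (auto simp: com_def)
  have wmult: "ww (s \<otimes>\<^sub>G t) = ww s \<otimes>\<^sub>H ww t" if s: "s \<in> carrier G" "com (ww s)" and t: "t \<in> carrier G" for s t
  proof -
    have "ww (s \<otimes>\<^sub>G t) = l1 (inv\<^bsub>G\<^esub> t) \<otimes>\<^sub>H ww s \<otimes>\<^sub>H l2 t"
      unfolding ww_def using s t by (simp only: l1.hom_mult l2.hom_mult l1.hom_inv H.inv_mult_group l1.hom_closed l2.hom_closed G.m_closed H.m_assoc H.m_closed H.inv_closed)
    also have "l1 (inv\<^bsub>G\<^esub> t) \<otimes>\<^sub>H ww s = ww s \<otimes>\<^sub>H l1 (inv\<^bsub>G\<^esub> t)"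
      by (rule comD(1)[OF s(2) G.inv_closed[OF t], symmetric])
    finally show ?thesis using s t wc[OF s(1)] unfolding ww_def[of t] by (simp only: l1.hom_inv H.m_assoc l1.hom_closed l2.hom_closed H.inv_closed)
  qed
  have cmult: "com (x \<otimes>\<^sub>H y)" if "com x" "com y" "x \<in> carrier H" "y \<in> carrier H" for x y
  proof -
    have "x \<otimes>\<^sub>H y \<otimes>\<^sub>H z = z \<otimes>\<^sub>H (x \<otimes>\<^sub>H y)" if "x \<otimes>\<^sub>H z = z \<otimes>\<^sub>H x" "y \<otimes>\<^sub>H z = z \<otimes>\<^sub>H y" "z \<in> carrier H" for z
    proof -
      have "x \<otimes>\<^sub>H y \<otimes>\<^sub>H z = x \<otimes>\<^sub>H (z \<otimes>\<^sub>H y)" using that \<open>x \<in> carrier H\<close> \<open>y \<in> carrier H\<close> by (simp add: H.m_assoc)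
      also have "\<dots> = z \<otimes>\<^sub>H x \<otimes>\<^sub>H y" unfolding that(1)[symmetric] using that(3) \<open>x \<in> carrier H\<close> \<open>y \<in> carrier H\<close> by (simp add: H.m_assoc)
      finally show ?thesis using that(3) \<open>x \<in> carrier H\<close> \<open>y \<in> carrier H\<close> by (simp add: H.m_assoc)
    qed
    then show ?thesis using comD[OF that(1)] comD[OF that(2)] unfolding com_def by simp
  qed
  have cinv: "com (inv\<^bsub>H\<^esub> x)" if "com x" "x \<in> carrier H" for x
  proof -
    have "inv\<^bsub>H\<^esub> x \<otimes>\<^sub>H z = z \<otimes>\<^sub>H inv\<^bsub>H\<^esub> x" if "x \<otimes>\<^sub>H z = z \<otimes>\<^sub>H x" "z \<in> carrier H" for z
    proof -
      have "inv\<^bsub>H\<^esub> x \<otimes>\<^sub>H (z \<otimes>\<^sub>H x) \<otimes>\<^sub>H inv\<^bsub>H\<^esub> x = inv\<^bsub>H\<^esub> x \<otimes>\<^sub>H (x \<otimes>\<^sub>H z) \<otimes>\<^sub>H inv\<^bsub>H\<^esub> x" using that by simp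
      then show ?thesis using that(2) \<open>x \<in> carrier H\<close> by (simp add: H.m_assoc)
    qed
    then show ?thesis using comD[OF that(1)] unfolding com_def by simp
  qed
  have com1: "com \<one>\<^sub>H" by (simp add: com_def)
  have w1: "ww \<one>\<^sub>G = \<one>\<^sub>H" unfolding ww_def by (simp only: l1.hom_one l2.hom_one H.inv_one H.l_one H.one_closed)
  have winv: "ww (inv\<^bsub>G\<^esub> s) = inv\<^bsub>H\<^esub> (ww s)" if s: "s \<in> carrier G" "com (ww s)" for s
  proof -
    have "ww s \<otimes>\<^sub>H ww (inv\<^bsub>G\<^esub> s) = \<one>\<^sub>H" using wmult[OF s G.inv_closed[OF s(1)]] s(1) w1 G.r_inv[OF s(1)] by (simp only:)
    then show ?thesis using H.inv_equality[OF _ wc[OF s(1)] wc[OF G.inv_closed[OF s(1)]]] H.inv_comm wc[OF s(1)] wc[OF G.inv_closed[OF s(1)]] by metis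
  qed
  have "subgroup {s \<in> carrier G. com (ww s)} G"
  proof (rule G.subgroupI)
    have "\<one>\<^sub>G \<in> {s \<in> carrier G. com (ww s)}" using w1 com1 G.one_closed by simp
    then show "{s \<in> carrier G. com (ww s)} \<noteq> {}" by blast
    show "inv\<^bsub>G\<^esub> s \<in> {s \<in> carrier G. com (ww s)}" if "s \<in> {s \<in> carrier G. com (ww s)}" for s
      using that winv[of s] cinv[of "ww s"] wc[of s] G.inv_closed[of s] by (simp del: carrier_DirProd)
    show "s \<otimes>\<^sub>G t \<in> {s \<in> carrier G. com (ww s)}" if "s \<in> {s \<in> carrier G. com (ww s)}" "t \<in> {s \<in> carrier G. com (ww s)}" for s t
      using that wmult[of s t] cmult[of "ww s" "ww t"] wc[of s] wc[of t] G.m_closed[of s t] by (simp del: carrier_DirProd mult_DirProd)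
  qed blast
  then have comS: "com (ww s)" if "s \<in> S" for s
    using S_generated[of "{s \<in> carrier G. com (ww s)}" s] that w SG[OF s_in_S(1)] SG[OF s_in_S(2)] SG[OF s_in_S(3)]
    by (simp del: carrier_DirProd add: com_def ww_def)
  let ?a = "ww s1" let ?b = "ww s2" let ?c = "ww s3"
  have abc: "?a \<in> carrier H" "?b \<in> carrier H" "?c \<in> carrier H" by (intro wc SG s_in_S)+
  have comW: "x \<otimes>\<^sub>H ww t = ww t \<otimes>\<^sub>H x" if x: "com x" "x \<in> carrier H" and t: "t \<in> carrier G" for x t
  proof -
    have "x \<otimes>\<^sub>H ww t = (x \<otimes>\<^sub>H l1 (inv\<^bsub>G\<^esub> t)) \<otimes>\<^sub>H l2 t"
      using x t by (simp only: ww_def l1.hom_inv H.m_assoc l1.hom_closed l2.hom_closed H.inv_closed)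
    also have "\<dots> = l1 (inv\<^bsub>G\<^esub> t) \<otimes>\<^sub>H (x \<otimes>\<^sub>H l2 t)"
      unfolding comD(1)[OF x(1) G.inv_closed[OF t]] using x t by (simp only: H.m_assoc l1.hom_closed l2.hom_closed G.inv_closed)
    also have "\<dots> = ww t \<otimes>\<^sub>H x"
      unfolding comD(2)[OF x(1) t] using x t by (simp only: ww_def l1.hom_inv H.m_assoc l1.hom_closed l2.hom_closed H.inv_closed)
    finally show ?thesis .
  qed
  note cw = comW[OF comS wc[OF SG] SG]
  \<comment> \<open>The candidate for the map through which the discrepancy factors; it has the
    right values on the three generators of \<open>S\<close>.\<close>
  let ?m = "z3_power H ?a ?b ?c"
  have m: "?m \<in> hom Z3 H" by (rule H.z3_power_hom[OF abc]) (rule cw; rule s_in_S)+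
  have mc: "?m z \<in> carrier H" for z using hom_in_carrier[OF m carrier_Z3] .
  have S1: "\<one>\<^sub>G \<in> S" by (rule subgroup.one_closed[OF subgroup_S])
  have "subgroup {s \<in> S. ww s = ?m (\<tau> s)} G"
  proof (rule G.subgroupI)
    have t1: "\<tau> \<one>\<^sub>G = \<one>\<^sub>Z3" by (simp add: \<tau>_def F_homs)
    then have "\<one>\<^sub>G \<in> {s \<in> S. ww s = ?m (\<tau> s)}"
      using S1 w1 hom_one[OF m group_Z3 H] by (simp del: one_DirProd)
    then show "{s \<in> S. ww s = ?m (\<tau> s)} \<noteq> {}" by blast
    show "{s \<in> S. ww s = ?m (\<tau> s)} \<subseteq> carrier G" using SG by blast
    fix s assume "s \<in> {s \<in> S. ww s = ?m (\<tau> s)}"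
    then have s: "s \<in> S" "ww s = ?m (\<tau> s)" by auto
    have si: "inv\<^bsub>G\<^esub> s \<in> S" by (rule subgroup.m_inv_closed[OF subgroup_S s(1)])
    have "\<tau> s \<otimes>\<^sub>Z3 \<tau> (inv\<^bsub>G\<^esub> s) = \<one>\<^sub>Z3" using tau_mult[OF s(1) si] G.r_inv[OF SG[OF s(1)]] t1 by simp
    then have "?m (\<tau> s) \<otimes>\<^sub>H ?m (\<tau> (inv\<^bsub>G\<^esub> s)) = \<one>\<^sub>H"
      using hom_mult[OF m carrier_Z3 carrier_Z3, of "\<tau> s" "\<tau> (inv\<^bsub>G\<^esub> s)"] hom_one[OF m group_Z3 H] by simp
    then have "?m (\<tau> (inv\<^bsub>G\<^esub> s)) = inv\<^bsub>H\<^esub> (ww s)"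
      using s(2) mc by (metis H.inv_comm H.inv_equality)
    then show "inv\<^bsub>G\<^esub> s \<in> {s \<in> S. ww s = ?m (\<tau> s)}" using si winv[OF SG[OF s(1)] comS[OF s(1)]] by simp
    fix t assume "t \<in> {s \<in> S. ww s = ?m (\<tau> s)}"
    then have t: "t \<in> S" "ww t = ?m (\<tau> t)" by auto
    have "ww (s \<otimes>\<^sub>G t) = ?m (\<tau> (s \<otimes>\<^sub>G t))"
      unfolding tau_mult[OF s(1) t(1)] hom_mult[OF m carrier_Z3 carrier_Z3]
      using wmult[OF SG[OF s(1)] comS[OF s(1)] SG[OF t(1)]] s(2) t(2) by (simp only:)
    then show "s \<otimes>\<^sub>G t \<in> {s \<in> S. ww s = ?m (\<tau> s)}" using subgroup.m_closed[OF subgroup_S s(1) t(1)] by blast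
  qed
  moreover have "s1 \<in> {s \<in> S. ww s = ?m (\<tau> s)}" "s2 \<in> {s \<in> S. ww s = ?m (\<tau> s)}" "s3 \<in> {s \<in> S. ww s = ?m (\<tau> s)}"
    using s_in_S abc by (simp_all add: tau_s z3_power_def)
  ultimately have wS: "ww s = ?m (\<tau> s)" if "s \<in> S" for s using S_generated[OF _ _ _ _ that, of "{s \<in> S. ww s = ?m (\<tau> s)}"] by simp
  have lm1: "l1 g \<otimes>\<^sub>H ?m z = ?m z \<otimes>\<^sub>H l1 g" if "g \<in> carrier G" for g z
    by (rule H.commute_z3_power[OF abc l1.hom_closed[OF that]]; rule comD(1)[OF comS that, symmetric]; rule s_in_S)
  have lm2: "l2 g \<otimes>\<^sub>H ?m z = ?m z \<otimes>\<^sub>H l2 g" if "g \<in> carrier G" for g z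
    by (rule H.commute_z3_power[OF abc l2.hom_closed[OF that]]; rule comD(2)[OF comS that, symmetric]; rule s_in_S)
  let ?f = "\<lambda>(g, z). l1 g \<otimes>\<^sub>H ?m z" let ?g = "\<lambda>(g, z). l2 g \<otimes>\<^sub>H ?m z"
  have fh: "?f \<in> hom GZ H" by (rule DirProd_hom[OF G.group_axioms group_Z3 H l(1) m lm1])
  have gh: "?g \<in> hom GZ H" by (rule DirProd_hom[OF G.group_axioms group_Z3 H l(2) m lm2])
  \<comment> \<open>On the first side the twist contributes the discrepancy, which turns
    \<open>l1 s\<close> into \<open>l2 s\<close>.\<close>
  have agree: "?f (glue1 c) = ?g (glue2 c)" if "c \<in> S \<times> UNIV" for c
  proof -
    obtain s z where c: "c = (s, z)" "s \<in> S" using \<open>c \<in> S \<times> UNIV\<close> by (cases c) simp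
    have sG: "s \<in> carrier G" by (rule SG[OF c(2)])
    have "?f (glue1 c) = l1 s \<otimes>\<^sub>H (ww s \<otimes>\<^sub>H ?m z)"
      unfolding c(1) glue1_def prod.case hom_mult[OF m carrier_Z3 carrier_Z3] wS[OF c(2)] ..
    also have "\<dots> = l2 s \<otimes>\<^sub>H ?m z"
      using sG mc[of z] by (simp only: ww_def H.m_assoc l1.hom_closed l2.hom_closed H.inv_closed H.m_closed H.inv_cancel_left')
    finally show ?thesis by (simp add: c glue2_def)
  qed
  obtain h where h: "h \<in> hom E0 H" "\<And>x. x \<in> carrier GZ \<Longrightarrow> h (ee.i1 x) = ?f x" "\<And>x. x \<in> carrier GZ \<Longrightarrow> h (ee.i2 x) = ?g x"
    by (rule ee.universal[OF H fh gh agree], assumption, rule that)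
  have m1: "?m \<one>\<^sub>Z3 = \<one>\<^sub>H" by (rule hom_one[OF m group_Z3 H])
  show thesis
  proof (rule that[OF h(1)])
    fix g assume g: "g \<in> carrier G"
    then have c: "(g, \<one>\<^sub>Z3) \<in> carrier GZ" by auto
    show "h (\<iota>1 g) = l1 g" "h (\<iota>2 g) = l2 g"
      unfolding \<iota>1_def \<iota>2_def h(2)[OF c] h(3)[OF c] prod.case m1
      using l1.hom_closed[OF g] l2.hom_closed[OF g] by (simp_all only: H.r_one)
  qed
qed

end

text \<open>Two lifts differ by central factors, which cancel in commutators. So they agree on all
  commutators, and hence on a perfect group.\<close>

lemma perfect_lift_unique:
  assumes E: "group E" "perfect E" and H: "group H" and Y: "group Y" and r: "\<rho> \<in> hom H Y"
    and ker: "\<And>k. k \<in> carrier H \<Longrightarrow> \<rho> k = \<one>\<^sub>Y \<Longrightarrow> central H k"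
    and f: "f \<in> hom E H" and g: "g \<in> hom E H" and fg: "\<And>x. x \<in> carrier E \<Longrightarrow> \<rho> (f x) = \<rho> (g x)"
    and x: "x \<in> carrier E"
  shows "f x = g x"
proof -
  interpret H: group H by (rule H)
  interpret E: group E by (rule E(1))
  interpret Y: group Y by (rule Y)
  interpret r: group_hom H Y \<rho> by (rule group_homI[OF H Y r])
  note fc = hom_in_carrier[OF f] and gc = hom_in_carrier[OF g]
  define k where "k x = inv\<^bsub>H\<^esub> (f x) \<otimes>\<^sub>H g x" for x
  have k: "central H (k x)" "g x = f x \<otimes>\<^sub>H k x" if "x \<in> carrier E" for x
  proof -
    show "central H (k x)"
      by (rule ker) (use that fc gc fg[OF that] in \<open>simp_all add: k_def\<close>)
    show "g x = f x \<otimes>\<^sub>H k x" using fc[OF that] gc[OF that] by (simp add: k_def)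
  qed
  have "x \<in> {x \<in> carrier E. f x = g x}"
  proof (rule perfectD[OF E(2) equalizer_subgroup[OF E(1) H f g] _ x])
    fix x y assume xy: "x \<in> carrier E" "y \<in> carrier E"
    have "commutator H (g x) (g y) = commutator H (f x) (f y)"
      unfolding k(2)[OF xy(1)] k(2)[OF xy(2)] by (rule H.comm_central_mult[OF k(1)[OF xy(1)] k(1)[OF xy(2)] fc[OF xy(1)] fc[OF xy(2)]])
    then show "commutator E x y \<in> {x \<in> carrier E. f x = g x}"
      using xy comm_hom[OF E(1) H f xy] comm_hom[OF E(1) H g xy] by simp
  qed
  then show ?thesis by simp
qed

context fibre begin

lemma central_zeta: "central E0 (\<zeta> z)"
  unfolding central_def
proof (intro conjI ballI)
  show z: "\<zeta> z \<in> carrier E0" by simp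
  fix x assume x: "x \<in> carrier E0"
  have "conjugate E0 (\<zeta> z) x = (\<lambda>x. x) x"
  proof (rule hom_eq_on_generators[OF generates_E0 ee.P.group_axioms ee.P.group_axioms ee.P.conj_hom[OF z] _ _ x])
    show "(\<lambda>x. x) \<in> hom E0 E0" by (rule homI) simp_all
    have "conjugate E0 (\<zeta> z) (\<iota>1 g) = \<iota>1 g" "conjugate E0 (\<zeta> z) (\<iota>2 g) = \<iota>2 g" if g: "g \<in> carrier G" for g
      unfolding conjugate_def using i_decomp(1,2)[OF g, of z] i_decomp(3,4)[OF g, of z] ee.P.mult_inv_cancel z iota_closed(1,2)[OF g] by metis+
    then show "conjugate E0 (\<zeta> z) b = b" if "b \<in> \<iota>1 ` carrier G \<union> \<iota>2 ` carrier G" for b using that by blast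
  qed
  then have "\<zeta> z \<otimes>\<^sub>E0 x \<otimes>\<^sub>E0 inv\<^bsub>E0\<^esub> (\<zeta> z) \<otimes>\<^sub>E0 \<zeta> z = x \<otimes>\<^sub>E0 \<zeta> z" by (simp add: conjugate_def)
  then show "\<zeta> z \<otimes>\<^sub>E0 x = x \<otimes>\<^sub>E0 \<zeta> z" using x by (simp add: ee.P.m_assoc)
qed

text \<open>Both embeddings of \<open>G\<close> are lifted by \<open>G_lift\<close>. The discrepancy
  of the lifts maps to the image of a central element, so its commutators with the lifts fall into
  the central kernel and vanish by perfectness of \<open>G\<close>. Then \<open>E0_universal\<close>
  glues the lifts.\<close>

lemma E0_lift:
  assumes H: "group H" and Y: "group Y" and rho: "\<rho> \<in> hom H Y"
    and ker: "\<And>k. k \<in> carrier H \<Longrightarrow> \<rho> k = \<one>\<^sub>Y \<Longrightarrow> central H k"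
    and f: "f \<in> hom E0 Y" "f ` carrier E0 \<subseteq> \<rho> ` carrier H"
  obtains L where "L \<in> hom E0 H" "\<And>x. x \<in> carrier E0 \<Longrightarrow> \<rho> (L x) = f x"
proof -
  interpret H: group H by (rule H)
  interpret Y: group Y by (rule Y)
  interpret rho: group_hom H Y \<rho> by (rule group_homI[OF H Y rho])
  have sub: "(f \<circ> \<iota>1) ` carrier G \<subseteq> \<rho> ` carrier H" "(f \<circ> \<iota>2) ` carrier G \<subseteq> \<rho> ` carrier H"
    using f(2) iota_closed by (simp_all add: image_subset_iff del: carrier_DirProd)
  obtain l1 where l1: "l1 \<in> hom G H" "\<And>x. x \<in> carrier G \<Longrightarrow> \<rho> (l1 x) = (f \<circ> \<iota>1) x"
    using G_lift[OF H Y rho ker hom_compose[OF iota_hom(1) f(1)] sub(1)] by blast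
  obtain l2 where l2: "l2 \<in> hom G H" "\<And>x. x \<in> carrier G \<Longrightarrow> \<rho> (l2 x) = (f \<circ> \<iota>2) x"
    using G_lift[OF H Y rho ker hom_compose[OF iota_hom(2) f(1)] sub(2)] by blast
  note lc = hom_in_carrier[OF l1(1)] hom_in_carrier[OF l2(1)]
  let ?w = "\<lambda>s. inv\<^bsub>H\<^esub> (l1 s) \<otimes>\<^sub>H l2 s"
  have wc: "?w s \<in> carrier H" if "s \<in> S" for s using lc[OF SG[OF that]] by simp
  have fi: "f (\<iota>1 s) \<in> carrier Y" if "s \<in> carrier G" for s using hom_in_carrier[OF f(1) iota_closed(1)[OF that]] .
  have fw: "\<rho> (?w s) = f (\<zeta> (\<tau> s))" if s: "s \<in> S" for s
  proof -
    have "f (\<iota>2 s) = f (\<iota>1 s) \<otimes>\<^sub>Y f (\<zeta> (\<tau> s))"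
      using iota_S[OF s] hom_mult[OF f(1) iota_closed(1)[OF SG[OF s]] iota_closed(3)] by simp
    then show ?thesis using lc[OF SG[OF s]] l1(2)[OF SG[OF s]] l2(2)[OF SG[OF s]] fi[OF SG[OF s]] hom_in_carrier[OF f(1) iota_closed(3)] by simp
  qed
  have cm: "central H (commutator H (l x) (?w s))"
    if "x \<in> carrier G" "s \<in> S" and l: "l \<in> hom G H" "\<rho> (l x) = f y" "y \<in> carrier E0" for l x y s
  proof (rule ker)
    have lx: "l x \<in> carrier H" using hom_in_carrier[OF l(1) \<open>x \<in> carrier G\<close>] .
    show "commutator H (l x) (?w s) \<in> carrier H" by (rule H.comm_closed[OF lx wc[OF \<open>s \<in> S\<close>]])
    have "\<rho> (commutator H (l x) (?w s)) = commutator Y (f y) (f (\<zeta> (\<tau> s)))"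
      using comm_hom[OF H Y rho lx wc[OF \<open>s \<in> S\<close>]] l(2) fw[OF \<open>s \<in> S\<close>] by simp
    also have "\<dots> = f (commutator E0 y (\<zeta> (\<tau> s)))"
      using comm_hom[OF ee.P.group_axioms Y f(1) l(3) iota_closed(3)] by simp
    also have "commutator E0 y (\<zeta> (\<tau> s)) = \<one>\<^sub>E0"
      using ee.P.centralD(2)[OF central_zeta l(3)] l(3) by (subst ee.P.comm_eq_one_iff) simp_all
    finally show "\<rho> (commutator H (l x) (?w s)) = \<one>\<^sub>Y" using hom_one[OF f(1) ee.P.group_axioms Y] by simp
  qed
  have c1: "?w s \<otimes>\<^sub>H l1 g = l1 g \<otimes>\<^sub>H ?w s" if "s \<in> S" "g \<in> carrier G" for s g
    by (rule perfect_central_commute[OF G.group_axioms perfect_G H l1(1) wc[OF that(1)] _ that(2), symmetric], rule cm[OF _ that(1) l1(1)])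
      (assumption, simp only: l1(2) comp_apply, rule iota_closed, assumption)
  have c2: "?w s \<otimes>\<^sub>H l2 g = l2 g \<otimes>\<^sub>H ?w s" if "s \<in> S" "g \<in> carrier G" for s g
    by (rule perfect_central_commute[OF G.group_axioms perfect_G H l2(1) wc[OF that(1)] _ that(2), symmetric], rule cm[OF _ that(1) l2(1)])
      (assumption, simp only: l2(2) comp_apply, rule iota_closed, assumption)
  have sS: "s \<in> S" if "s \<in> {s1, s2, s3}" for s using that s_in_S by blast
  obtain L where L: "L \<in> hom E0 H" "\<And>g. g \<in> carrier G \<Longrightarrow> L (\<iota>1 g) = l1 g" "\<And>g. g \<in> carrier G \<Longrightarrow> L (\<iota>2 g) = l2 g"
    by (rule E0_universal[OF H l1(1) l2(1)]) (rule c1[OF sS], assumption+, rule c2[OF sS], assumption+, rule that)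
  show thesis
  proof (rule that[OF L(1)])
    fix x assume x: "x \<in> carrier E0"
    have "(\<rho> \<circ> L) x = f x"
    proof (rule hom_eq_on_generators[where f = "\<rho> \<circ> L" and g = f, OF generates_E0 ee.P.group_axioms Y hom_compose[OF L(1) rho] f(1) _ x])
      show "(\<rho> \<circ> L) b = f b" if "b \<in> \<iota>1 ` carrier G \<union> \<iota>2 ` carrier G" for b
        using that by (elim UnE imageE) (simp_all only: comp_apply L l1(2) l2(2))
    qed
    then show "\<rho> (L x) = f x" by simp
  qed
qed

section \<open>The projection of the model to \<Delta> and its kernel\<close>

lemma pi0_exists: "\<exists>p. p \<in> hom E0 \<Delta> \<and> (\<forall>g\<in>carrier G. p (\<iota>1 g) = dd.i1 g \<and> p (\<iota>2 g) = dd.i2 g)"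
proof -
  have h: "dd.i1 \<circ> fst \<in> hom GZ \<Delta>" "dd.i2 \<circ> fst \<in> hom GZ \<Delta>"
    by (rule hom_compose[OF _ dd.i1_hom], rule homI, auto)[1] (rule hom_compose[OF _ dd.i2_hom], rule homI, auto)
  have agree: "(dd.i1 \<circ> fst) (glue1 c) = (dd.i2 \<circ> fst) (glue2 c)" if "c \<in> S \<times> UNIV" for c
    using that dd.i1_i2 by (auto simp: glue1_def glue2_def)
  obtain p where p: "p \<in> hom E0 \<Delta>" "\<And>x. x \<in> carrier GZ \<Longrightarrow> p (ee.i1 x) = (dd.i1 \<circ> fst) x" "\<And>x. x \<in> carrier GZ \<Longrightarrow> p (ee.i2 x) = (dd.i2 \<circ> fst) x"
    by (rule ee.universal[OF dd.P.group_axioms h agree], assumption, rule that)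
  have "(g, \<one>\<^sub>Z3) \<in> carrier GZ" if "g \<in> carrier G" for g using that by auto
  then show ?thesis using p by (intro exI[of _ p] conjI p(1) ballI) (simp_all add: \<iota>1_def \<iota>2_def del: carrier_DirProd one_DirProd)
qed

definition "\<pi>0 = (SOME p. p \<in> hom E0 \<Delta> \<and> (\<forall>g\<in>carrier G. p (\<iota>1 g) = dd.i1 g \<and> p (\<iota>2 g) = dd.i2 g))"

lemma pi0: "\<pi>0 \<in> hom E0 \<Delta>" "g \<in> carrier G \<Longrightarrow> \<pi>0 (\<iota>1 g) = dd.i1 g" "g \<in> carrier G \<Longrightarrow> \<pi>0 (\<iota>2 g) = dd.i2 g"
proof -
  note p = someI_ex[OF pi0_exists, folded \<pi>0_def]
  show "\<pi>0 \<in> hom E0 \<Delta>" by (rule conjunct1[OF p])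
  show "g \<in> carrier G \<Longrightarrow> \<pi>0 (\<iota>1 g) = dd.i1 g" "g \<in> carrier G \<Longrightarrow> \<pi>0 (\<iota>2 g) = dd.i2 g"
    by (rule conjunct1[OF bspec[OF conjunct2[OF p]]], assumption, rule conjunct2[OF bspec[OF conjunct2[OF p]]])
qed

text \<open>Modulo \<zeta> the two embeddings agree on \<open>S\<close>, so \<Delta> maps back to
  the quotient of the model by the central subgroup. The composite with \<open>\<pi>0\<close> is the
  quotient map, hence the kernel cannot be larger.\<close>

lemma pi0_kernel:
  assumes x: "x \<in> carrier E0" "\<pi>0 x = \<one>\<^sub>\<Delta>"
  shows "x \<in> range \<zeta>"
proof -
  let ?N = "range \<zeta>"
  interpret z: group_hom Z3 E0 \<zeta> by (rule group_homI[OF group_Z3 ee.P.group_axioms iota_hom(3)])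
  have sN: "subgroup ?N E0" using z.img_is_subgroup carrier_Z3 by (simp add: subset_antisym subsetI)
  have "?N \<lhd> E0"
    unfolding ee.P.normal_inv_iff
  proof (intro conjI ballI sN)
    fix x h assume x: "x \<in> carrier E0" and h: "h \<in> ?N"
    obtain z where z: "h = \<zeta> z" using h by blast
    have "x \<otimes>\<^sub>E0 h \<otimes>\<^sub>E0 inv\<^bsub>E0\<^esub> x = h" using ee.P.central_conj(1)[OF central_zeta x, of z] by (simp add: conjugate_def z)
    then show "x \<otimes>\<^sub>E0 h \<otimes>\<^sub>E0 inv\<^bsub>E0\<^esub> x \<in> ?N" using h by simp
  qed
  then interpret N: normal ?N E0 .
  let ?Q = "E0 Mod ?N" let ?r = "(#>\<^bsub>E0\<^esub>) ?N"
  have r: "?r \<in> hom E0 ?Q" by (rule N.r_coset_hom_Mod)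
  have agree: "(?r \<circ> \<iota>1) s = (?r \<circ> \<iota>2) s" if s: "s \<in> S" for s
  proof -
    have "?N #>\<^bsub>E0\<^esub> (\<zeta> (\<tau> s) \<otimes>\<^sub>E0 \<iota>1 s) = ?N #>\<^bsub>E0\<^esub> \<iota>1 s"
      using ee.P.coset_mult_assoc[of ?N "\<zeta> (\<tau> s)" "\<iota>1 s"] subgroup.subset[OF sN] iota_closed(1)[OF SG[OF s]] ee.P.coset_join2[OF iota_closed(3) sN, of "\<tau> s"] by simp
    then show ?thesis using iota_S[OF s] ee.P.centralD(2)[OF central_zeta iota_closed(1)[OF SG[OF s]]] by simp
  qed
  obtain h where h: "h \<in> hom \<Delta> ?Q" "\<And>x. x \<in> carrier G \<Longrightarrow> h (dd.i1 x) = (?r \<circ> \<iota>1) x" "\<And>x. x \<in> carrier G \<Longrightarrow> h (dd.i2 x) = (?r \<circ> \<iota>2) x"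
    by (rule dd.universal[OF N.factorgroup_is_group hom_compose[OF iota_hom(1) r] hom_compose[OF iota_hom(2) r] agree], assumption, rule that)
  have "(h \<circ> \<pi>0) x = ?r x"
  proof (rule hom_eq_on_generators[where f = "h \<circ> \<pi>0" and g = ?r, OF generates_E0 ee.P.group_axioms N.factorgroup_is_group hom_compose[OF pi0(1) h(1)] r _ x(1)])
    show "(h \<circ> \<pi>0) b = ?r b" if "b \<in> \<iota>1 ` carrier G \<union> \<iota>2 ` carrier G" for b
      using that by (elim UnE imageE) (simp_all only: comp_apply pi0 h)
  qed
  then have "?N #>\<^bsub>E0\<^esub> x = \<one>\<^sub>?Q" unfolding comp_apply x(2) hom_one[OF h(1) dd.P.group_axioms N.factorgroup_is_group] by (rule HOL.sym)
  then have "?N #>\<^bsub>E0\<^esub> x = ?N" unfolding one_FactGroup .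
  then show ?thesis by (rule ee.P.coset_join1[OF _ x(1) sN])
qed

lemma central_extension_pi0: "central_extension E0 \<Delta> \<pi>0"
  unfolding central_extension_def
proof (intro conjI ballI ee.P.group_axioms dd.P.group_axioms)
  interpret p: group_hom E0 \<Delta> \<pi>0 by (rule group_homI[OF ee.P.group_axioms dd.P.group_axioms pi0(1)])
  have "dd.i1 ` carrier G \<union> dd.i2 ` carrier G \<subseteq> \<pi>0 ` carrier E0"
  proof (intro Un_least image_subsetI)
    fix g assume g: "g \<in> carrier G"
    show "dd.i1 g \<in> \<pi>0 ` carrier E0" "dd.i2 g \<in> \<pi>0 ` carrier E0"
      unfolding pi0(2,3)[OF g, symmetric] by (rule imageI[OF iota_closed(1)[OF g]], rule imageI[OF iota_closed(2)[OF g]])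
  qed
  then have "\<pi>0 ` carrier E0 = carrier \<Delta>"
    using dd.generates_P p.img_is_subgroup unfolding generates_def by blast
  then show "\<pi>0 \<in> epi E0 \<Delta>" using pi0(1) by (simp add: epi_def)
  fix k x assume k: "k \<in> kernel E0 \<Delta> \<pi>0" and x: "x \<in> carrier E0"
  then obtain z where "k = \<zeta> z" using pi0_kernel unfolding kernel_def by blast
  then show "k \<otimes>\<^sub>E0 x = x \<otimes>\<^sub>E0 k" using ee.P.centralD(2)[OF central_zeta x] by simp
qed

lemma countable_Delta: "countable (carrier \<Delta>)" and countable_E0: "countable (carrier E0)"
proof -
  have "countable (carrier G)" using countable_base by simp
  then show "countable (carrier \<Delta>)" by (intro dd.countable_P)
qed (rule ee.countable_P[OF countable_GZ countable_GZ])

end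

section \<open>From countable test groups to an arbitrary universal central extension\<close>

lemma countable_copy:
  assumes H: "group H" "countable (carrier H)" and U: "infinite (UNIV :: 'u set)"
  obtains H' :: "'u monoid" and j where "group H'" "j \<in> hom H H'" "inj_on j (carrier H)" "j ` carrier H = carrier H'"
    "inv_into (carrier H) j \<in> hom H' H"
proof -
  interpret H: group H by (rule H)
  obtain u :: "nat \<Rightarrow> 'u" where u: "inj u" using U by (metis infinite_countable_subset)
  let ?C = "carrier H"
  define j where "j = u \<circ> to_nat_on ?C"
  have j: "inj_on j ?C" unfolding j_def by (intro comp_inj_on inj_on_to_nat_on H(2) inj_on_subset[OF u]) simp
  let ?k = "inv_into ?C j"
  define H' where "H' = \<lparr>carrier = j ` ?C, monoid.mult = (\<lambda>a b. j (?k a \<otimes>\<^sub>H ?k b)), one = j \<one>\<^sub>H\<rparr>"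
  have k: "?k (j x) = x" if "x \<in> ?C" for x using inv_into_f_f[OF j that] .
  have m: "j x \<otimes>\<^sub>H' j y = j (x \<otimes>\<^sub>H y)" if "x \<in> ?C" "y \<in> ?C" for x y using that by (simp add: H'_def k)
  have car: "carrier H' = j ` ?C" and one: "\<one>\<^sub>H' = j \<one>\<^sub>H" by (simp_all add: H'_def)
  have gr: "group H'"
  proof (rule groupI)
    fix x assume "x \<in> carrier H'"
    then obtain y where y: "y \<in> ?C" "x = j y" using car by auto
    show "\<one>\<^sub>H' \<otimes>\<^sub>H' x = x" using y m one by simp
    show "\<exists>y\<in>carrier H'. y \<otimes>\<^sub>H' x = \<one>\<^sub>H'"
      using y m one car by (intro bexI[of _ "j (inv\<^bsub>H\<^esub> y)"]) simp_all
  qed (auto simp: car one m H.m_assoc)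
  have "j \<in> hom H H'" by (rule homI) (simp_all add: car m)
  moreover have "?k \<in> hom H' H" by (rule homI) (auto simp: car m k)
  ultimately show thesis using that gr j car by metis
qed

text \<open>A countable extension over any type has a copy inside \<open>'u\<close>; existence and
  uniqueness are transported along the copy and back.\<close>

lemma uce_countable:
  fixes E :: "('e, 'm) monoid_scheme" and H :: "('h, 'n) monoid_scheme"
  assumes U: "infinite (UNIV :: 'u set)" and uce: "universal_central_extension TYPE('u) E Q \<pi>"
    and H: "central_extension H Q \<rho>" "countable (carrier H)"
  shows "\<exists>f\<in>hom E H. \<forall>x\<in>carrier E. \<rho> (f x) = \<pi> x"
    and "\<lbrakk>f \<in> hom E H; g \<in> hom E H; \<And>x. x \<in> carrier E \<Longrightarrow> \<rho> (f x) = \<pi> x; \<And>x. x \<in> carrier E \<Longrightarrow> \<rho> (g x) = \<pi> x; x \<in> carrier E\<rbrakk>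
      \<Longrightarrow> f x = g x"
proof -
  have gr: "group H" "group Q" "group E" and r: "\<rho> \<in> hom H Q" "\<rho> ` carrier H = carrier Q"
    using H(1) uce by (auto simp: central_extension_def universal_central_extension_def epi_def)
  have ker: "k \<otimes>\<^sub>H x = x \<otimes>\<^sub>H k" if "k \<in> carrier H" "\<rho> k = \<one>\<^sub>Q" "x \<in> carrier H" for k x
    using H(1) that by (auto simp: central_extension_def kernel_def)
  obtain H' :: "'u monoid" and j where j: "group H'" "j \<in> hom H H'" "inj_on j (carrier H)" "j ` carrier H = carrier H'"
    and k: "inv_into (carrier H) j \<in> hom H' H"
    by (rule countable_copy[OF gr(1) H(2) U])
  let ?k = "inv_into (carrier H) j"
  have kj: "?k (j x) = x" if "x \<in> carrier H" for x using inv_into_f_f[OF j(3) that] .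
  have "central_extension H' Q (\<rho> \<circ> ?k)"
    unfolding central_extension_def epi_def
  proof (intro conjI ballI j(1) gr(2) CollectI hom_compose[OF k r(1)])
    show "(\<rho> \<circ> ?k) ` carrier H' = carrier Q"
      unfolding j(4)[symmetric] r(2)[symmetric] by (auto simp: image_image kj)
    fix a b assume "a \<in> kernel H' Q (\<rho> \<circ> ?k)" "b \<in> carrier H'"
    then obtain x y where x: "a = j x" "b = j y" "x \<in> carrier H" "y \<in> carrier H" "\<rho> x = \<one>\<^sub>Q"
      unfolding kernel_def j(4)[symmetric] using kj by auto
    show "a \<otimes>\<^sub>H' b = b \<otimes>\<^sub>H' a"
      unfolding x(1,2) using ker[OF x(3,5,4)] hom_mult[OF j(2)] x(3,4) by metis
  qed
  then have ex1: "\<exists>!f. f \<in> hom E H' \<and> f \<in> extensional (carrier E) \<and> (\<forall>x\<in>carrier E. (\<rho> \<circ> ?k) (f x) = \<pi> x)"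
    using uce unfolding universal_central_extension_def by blast
  then obtain F where F: "F \<in> hom E H'" "\<forall>x\<in>carrier E. (\<rho> \<circ> ?k) (F x) = \<pi> x" by blast
  show "\<exists>f\<in>hom E H. \<forall>x\<in>carrier E. \<rho> (f x) = \<pi> x"
    by (rule bexI[OF _ hom_compose[OF F(1) k]]) (use F(2) in simp)
  assume f: "f \<in> hom E H" "\<And>x. x \<in> carrier E \<Longrightarrow> \<rho> (f x) = \<pi> x" and g: "g \<in> hom E H" "\<And>x. x \<in> carrier E \<Longrightarrow> \<rho> (g x) = \<pi> x"
    and x: "x \<in> carrier E"
  have P: "restrict (j \<circ> f) (carrier E) \<in> hom E H' \<and> restrict (j \<circ> f) (carrier E) \<in> extensional (carrier E)
      \<and> (\<forall>x\<in>carrier E. (\<rho> \<circ> ?k) (restrict (j \<circ> f) (carrier E) x) = \<pi> x)"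
    if f: "f \<in> hom E H" "\<forall>x\<in>carrier E. \<rho> (f x) = \<pi> x" for f
  proof (intro conjI ballI restrict_extensional)
    interpret E: group E by (rule gr(3))
    show "restrict (j \<circ> f) (carrier E) \<in> hom E H'"
      using hom_compose[OF f(1) j(2)] by (auto simp: hom_def Pi_def)
    show "(\<rho> \<circ> ?k) (restrict (j \<circ> f) (carrier E) x) = \<pi> x" if "x \<in> carrier E" for x
      using that hom_in_carrier[OF f(1) that] f(2) kj by simp
  qed
  have fg: "\<forall>x\<in>carrier E. \<rho> (f x) = \<pi> x" "\<forall>x\<in>carrier E. \<rho> (g x) = \<pi> x" using f(2) g(2) by blast+
  have "restrict (j \<circ> f) (carrier E) = restrict (j \<circ> g) (carrier E)"
    by (rule HOL.trans[OF HOL.sym[OF the1_equality[OF ex1, OF P[OF f(1) fg(1)]]] the1_equality[OF ex1, OF P[OF g(1) fg(2)]]])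
  from fun_cong[OF this, of x] show "f x = g x"
    using x inj_onD[OF j(3)] hom_in_carrier[OF f(1) x] hom_in_carrier[OF g(1) x] by simp
qed

lemma countable_hom:
  assumes G: "group G" and H: "group H" and f: "f \<in> hom G H" and c: "countable (kernel G H f)" "countable (carrier H)"
  shows "countable (carrier G)"
proof -
  interpret group_hom G H f by (rule group_homI[OF G H f])
  have fib: "countable {x \<in> carrier G. f x = y}" for y
  proof (cases "\<exists>a\<in>carrier G. f a = y")
    case True
    then obtain a where a: "a \<in> carrier G" "f a = y" by blast
    have "{x \<in> carrier G. f x = y} \<subseteq> (\<lambda>k. a \<otimes>\<^sub>G k) ` kernel G H f"
    proof
      fix x assume "x \<in> {x \<in> carrier G. f x = y}"
      then have x: "x \<in> carrier G" "f x = y" by auto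
      have "inv\<^bsub>G\<^esub> a \<otimes>\<^sub>G x \<in> kernel G H f" using x a hom_closed[OF a(1)] by (simp add: kernel_def)
      moreover have "x = a \<otimes>\<^sub>G (inv\<^bsub>G\<^esub> a \<otimes>\<^sub>G x)" using x(1) a(1) by (simp add: G.m_assoc[symmetric])
      ultimately show "x \<in> (\<lambda>k. a \<otimes>\<^sub>G k) ` kernel G H f" by (rule rev_image_eqI)
    qed
    then show ?thesis by (rule countable_subset[OF _ countable_image[OF c(1)]])
  next
    case False
    then have "{x \<in> carrier G. f x = y} = {}" by blast
    then show ?thesis by (simp only: countable_empty)
  qed
  have "carrier G \<subseteq> (\<Union>y\<in>carrier H. {x \<in> carrier G. f x = y})" by auto
  then show ?thesis by (rule countable_subset) (intro countable_UN c(2) fib)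
qed

text \<open>The elements of prime order \<open>r\<close> are powers of \<open>z\<close>; hence the \<open>n\<close>-th roots of any element are
  countably many, by induction on the prime factorisation of \<open>n\<close>.\<close>

lemma countable_cocyclic:
  assumes G: "group G" "\<And>x y. x \<in> carrier G \<Longrightarrow> y \<in> carrier G \<Longrightarrow> x \<otimes>\<^sub>G y = y \<otimes>\<^sub>G x"
    and z: "z \<in> carrier G" "z \<noteq> \<one>\<^sub>G" and pow: "\<And>x. x \<in> carrier G \<Longrightarrow> x \<noteq> \<one>\<^sub>G \<Longrightarrow> \<exists>k::int. x [^]\<^sub>G k = z"
  shows "countable (carrier G)"
proof -
  interpret comm_group G by (rule group.group_comm_groupI[OF G])
  let ?R = "\<lambda>n y. {x \<in> carrier G. x [^]\<^sub>G (n::nat) = y}"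
  have prime_roots: "countable (?R r \<one>\<^sub>G)" if r: "prime r" for r
  proof -
    have "?R r \<one>\<^sub>G \<subseteq> insert \<one>\<^sub>G (range (\<lambda>i::int. z [^]\<^sub>G i))"
    proof
      fix u assume "u \<in> ?R r \<one>\<^sub>G"
      then have u: "u \<in> carrier G" "u [^]\<^sub>G int r = \<one>\<^sub>G" by (simp_all add: int_pow_int)
      show "u \<in> insert \<one>\<^sub>G (range (\<lambda>i::int. z [^]\<^sub>G i))"
      proof (cases "u = \<one>\<^sub>G")
        case False
        then obtain k :: int where k: "u [^]\<^sub>G k = z" using pow u by blast
        have ur: "u [^]\<^sub>G (int r * i) = \<one>\<^sub>G" for i using u int_pow_pow[OF u(1), of "int r" i] by (simp add: int_pow_one)
        \<comment> \<open>Otherwise \<open>z\<close> would be trivial, as \<open>u\<close> has order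
          \<open>r\<close>. With \<open>k\<close> invertible modulo \<open>r\<close>, the element
          \<open>u\<close> becomes a power of \<open>z\<close>.\<close>
        have "\<not> int r dvd k" using k z(2) ur by (auto elim!: dvdE)
        then have "coprime (int r) k" using r prime_imp_coprime[of "int r" k] by simp
        then obtain a b where ab: "a * int r + b * k = 1" using bezout_int[of "int r" k] by auto
        have "u = u [^]\<^sub>G (int r * a + k * b)" using u ab by (simp add: mult.commute)
        also have "\<dots> = z [^]\<^sub>G b" using u(1) ur k int_pow_pow[OF u(1), of k b] by (simp add: int_pow_mult)
        finally show ?thesis by blast
      qed simp
    qed
    then show ?thesis by (rule countable_subset) simp
  qed
  have roots: "countable (?R n y)" if "n > 0" for n y
    using that
  proof (induction n arbitrary: y rule: prime_divisors_induct)
    case zero then show ?case by simp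
  next
    case (unit n)
    then have "?R n y \<subseteq> {y}" by auto
    then show ?case by (rule countable_subset) simp
  next
    case (factor r n)
    have fib: "countable (?R r w)" for w
    proof (cases "\<exists>a\<in>carrier G. a [^]\<^sub>G r = w")
      case True
      then obtain a where a: "a \<in> carrier G" "a [^]\<^sub>G r = w" by blast
      have "?R r w \<subseteq> (\<lambda>k. a \<otimes>\<^sub>G k) ` ?R r \<one>\<^sub>G"
      proof
        fix x assume "x \<in> ?R r w"
        then have x: "x \<in> carrier G" "x [^]\<^sub>G r = w" by auto
        have "inv\<^bsub>G\<^esub> a \<otimes>\<^sub>G x \<in> ?R r \<one>\<^sub>G" using x a nat_pow_closed[OF a(1), of r] by (simp add: nat_pow_distrib nat_pow_inv)
        moreover have "x = a \<otimes>\<^sub>G (inv\<^bsub>G\<^esub> a \<otimes>\<^sub>G x)" using x(1) a(1) by (simp add: m_assoc[symmetric])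
        ultimately show "x \<in> (\<lambda>k. a \<otimes>\<^sub>G k) ` ?R r \<one>\<^sub>G" by (rule rev_image_eqI)
      qed
      then show ?thesis by (rule countable_subset[OF _ countable_image[OF prime_roots[OF factor(1)]]])
    next
      case False
      then have "?R r w = {}" by blast
      then show ?thesis by (simp only: countable_empty)
    qed
    have sub: "?R (r * n) y \<subseteq> (\<Union>w\<in>?R n y. ?R r w)" by (auto simp: nat_pow_pow)
    have "countable (?R n y)" using factor by simp
    then show ?case by (rule countable_subset[OF sub countable_UN[OF _ fib]])
  qed
  have "carrier G \<subseteq> insert \<one>\<^sub>G (\<Union>n\<in>{n. n > 0}. ?R n z \<union> ?R n (inv\<^bsub>G\<^esub> z))"
  proof
    fix x assume x: "x \<in> carrier G"
    show "x \<in> insert \<one>\<^sub>G (\<Union>n\<in>{n. n > 0}. ?R n z \<union> ?R n (inv\<^bsub>G\<^esub> z))"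
    proof (cases "x = \<one>\<^sub>G")
      case False
      then obtain k :: int where k: "x [^]\<^sub>G k = z" using pow x by blast
      then have "k \<noteq> 0" using z(2) by auto
      moreover have "x [^]\<^sub>G nat k = z" if "k > 0" using k that int_pow_int[of G x "nat k"] by simp
      moreover have "x [^]\<^sub>G nat (- k) = inv\<^bsub>G\<^esub> z" if "k < 0" using k that int_pow_int[of G x "nat (- k)"] x by (simp add: int_pow_neg)
      ultimately have "x \<in> ?R (nat \<bar>k\<bar>) z \<union> ?R (nat \<bar>k\<bar>) (inv\<^bsub>G\<^esub> z)" "nat \<bar>k\<bar> > 0" using x by (auto simp: abs_if)
      then show ?thesis by blast
    qed simp
  qed
  then show ?thesis by (rule countable_subset) (intro countable_insert countable_UN countable_Un roots, auto)
qed


text \<open>If \<open>h\<close> and the identity differ, their difference is a central element \<open>z\<close> outside some maximal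
  subgroup \<open>M\<close> of the kernel; \<open>E Mod M\<close> is countable and would distinguish them.\<close>

lemma uce_endomorphism_id:
  fixes E :: "('e, 'm) monoid_scheme"
  assumes U: "infinite (UNIV :: 'u set)" and uce: "universal_central_extension TYPE('u) E Q \<pi>"
    and cQ: "countable (carrier Q)" and h: "h \<in> hom E E" "\<And>x. x \<in> carrier E \<Longrightarrow> \<pi> (h x) = \<pi> x" and e: "e \<in> carrier E"
  shows "h e = e"
proof (rule ccontr)
  assume ne: "h e \<noteq> e"
  have gr: "group E" "group Q" and pi: "\<pi> \<in> hom E Q" "\<pi> ` carrier E = carrier Q"
    and cen: "k \<in> kernel E Q \<pi> \<Longrightarrow> x \<in> carrier E \<Longrightarrow> k \<otimes>\<^sub>E x = x \<otimes>\<^sub>E k" for k x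
    using uce by (auto simp: central_extension_def universal_central_extension_def epi_def)
  interpret pi: group_hom E Q \<pi> by (rule group_homI[OF gr pi(1)])
  let ?K = "kernel E Q \<pi>"
  note he = hom_in_carrier[OF h(1) e]
  define z where "z = e \<otimes>\<^sub>E inv\<^bsub>E\<^esub> (h e)"
  have zE: "z \<in> carrier E" using e he by (simp add: z_def)
  have zK: "z \<in> ?K" using e he h(2)[OF e] pi.hom_closed[OF e] by (simp add: z_def kernel_def)
  have z1: "z \<noteq> \<one>\<^sub>E" using ne e he pi.G.inv_solve_right'[of "\<one>\<^sub>E" e "h e"] by (simp add: z_def)
  \<comment> \<open>A maximal member keeps \<open>z\<close> nontrivial in the quotient, whereas
    every larger subgroup of the kernel contains \<open>z\<close>. This is what makes the kernel of
    the quotient extension countable.\<close>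
  define F where "F = {N. subgroup N E \<and> N \<subseteq> ?K \<and> z \<notin> N}"
  have KE: "k \<in> carrier E" if "k \<in> ?K" for k using that by (simp add: kernel_def)
  have "{\<one>\<^sub>E} \<in> F" using z1 pi.G.triv_subgroup by (simp add: F_def kernel_def)
  moreover have "\<Union>C \<in> F" if C: "C \<noteq> {}" "subset.chain F C" for C
  proof -
    have CF: "N \<in> F" if "N \<in> C" for N using C(2) that unfolding subset.chain_def by blast
    have N: "subgroup N E" "N \<subseteq> ?K" "z \<notin> N" if "N \<in> C" for N using CF[OF that] by (auto simp: F_def)
    have "subgroup (\<Union>C) E"
    proof (rule pi.G.subgroupI)
      show "\<Union>C \<subseteq> carrier E" using N(2) KE by blast
      show "\<Union>C \<noteq> {}" using C(1) N(1) subgroup.one_closed by blast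
      show "inv\<^bsub>E\<^esub> a \<in> \<Union>C" if "a \<in> \<Union>C" for a
      proof -
        obtain X where X: "X \<in> C" "a \<in> X" using \<open>a \<in> \<Union>C\<close> by (rule UnionE)
        show ?thesis by (rule UnionI[OF X(1) subgroup.m_inv_closed[OF N(1)[OF X(1)] X(2)]])
      qed
      fix a b assume "a \<in> \<Union>C" "b \<in> \<Union>C"
      then obtain X Y where X: "X \<in> C" "Y \<in> C" "a \<in> X" "b \<in> Y" by blast
      have "X \<subseteq> Y \<or> Y \<subseteq> X" using C(2) X(1,2) unfolding subset.chain_def by blast
      then obtain Z where Z: "Z \<in> C" "a \<in> Z" "b \<in> Z" using X by blast
      show "a \<otimes>\<^sub>E b \<in> \<Union>C" by (rule UnionI[OF Z(1) subgroup.m_closed[OF N(1)[OF Z(1)] Z(2,3)]])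
    qed
    then show ?thesis using N by (auto simp: F_def)
  qed
  ultimately have "\<exists>M\<in>F. \<forall>X\<in>F. M \<subseteq> X \<longrightarrow> X = M" by (intro subset_Zorn_nonempty) blast
  then obtain M where M: "M \<in> F" and max: "\<And>X. X \<in> F \<Longrightarrow> M \<subseteq> X \<Longrightarrow> X = M" by blast
  have sM: "subgroup M E" and MK: "M \<subseteq> ?K" and zM: "z \<notin> M" using M by (auto simp: F_def)
  have nM: "M \<lhd> E"
    unfolding pi.G.normal_inv_iff
  proof (intro conjI ballI sM)
    fix x m assume x: "x \<in> carrier E" and m: "m \<in> M"
    have "x \<otimes>\<^sub>E m \<otimes>\<^sub>E inv\<^bsub>E\<^esub> x = m" 
      using cen[of m x] m MK x pi.G.mult_inv_cancel[of m x] KE by auto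
    then show "x \<otimes>\<^sub>E m \<otimes>\<^sub>E inv\<^bsub>E\<^esub> x \<in> M" using m by simp
  qed
  interpret M: normal M E by (rule nM)
  let ?Q = "E Mod M" let ?r = "(#>\<^bsub>E\<^esub>) M"
  note Qg = M.factorgroup_is_group and r = M.r_coset_hom_Mod
  interpret r: group_hom E ?Q ?r by (rule group_homI[OF gr(1) Qg r])
  have rM: "?r x = ?r y \<longleftrightarrow> x \<otimes>\<^sub>E inv\<^bsub>E\<^esub> y \<in> M" if "x \<in> carrier E" "y \<in> carrier E" for x y
  proof -
    have "?r x = ?r y \<longleftrightarrow> ?r (x \<otimes>\<^sub>E inv\<^bsub>E\<^esub> y) = \<one>\<^sub>?Q"
      using that r.H.inv_solve_right'[of "\<one>\<^sub>?Q" "?r x" "?r y"] r.hom_closed by (simp del: one_FactGroup mult_FactGroup)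
    also have "\<dots> \<longleftrightarrow> x \<otimes>\<^sub>E inv\<^bsub>E\<^esub> y \<in> M"
      using that pi.G.coset_join1[OF _ _ sM, of "x \<otimes>\<^sub>E inv\<^bsub>E\<^esub> y"] pi.G.coset_join2[OF _ sM, of "x \<otimes>\<^sub>E inv\<^bsub>E\<^esub> y"] by auto
    finally show ?thesis .
  qed
  obtain \<rho> where rho: "\<rho> \<in> hom ?Q Q" "\<And>x. x \<in> carrier E \<Longrightarrow> \<rho> (?r x) = \<pi> x"
  proof (rule FactGroup_universal[OF pi(1) nM], goal_cases)
    case (1 x y)
    then have "\<pi> (x \<otimes>\<^sub>E inv\<^bsub>E\<^esub> y) = \<one>\<^sub>Q" using rM MK by (auto simp: kernel_def)
    then show ?case using 1 pi.H.inv_solve_right'[of "\<one>\<^sub>Q" "\<pi> x" "\<pi> y"] by simp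
  qed (rule that)
  have carQ: "carrier ?Q = ?r ` carrier E" by (rule carrier_FactGroup)
  interpret rho: group_hom ?Q Q \<rho> by (rule group_homI[OF Qg gr(2) rho(1)])
  have kerr: "\<exists>k\<in>?K. X = ?r k" if "X \<in> kernel ?Q Q \<rho>" for X
    using that rho(2) by (auto simp: kernel_def carQ)
  have comm: "X \<otimes>\<^sub>?Q Y = Y \<otimes>\<^sub>?Q X" if X: "X \<in> kernel ?Q Q \<rho>" and Y: "Y \<in> carrier ?Q" for X Y
  proof -
    obtain k y where k: "k \<in> ?K" "X = ?r k" "y \<in> carrier E" "Y = ?r y" using kerr[OF X] Y carQ by auto
    show ?thesis
      using cen[OF k(1,3)] r.hom_mult[OF KE[OF k(1)] k(3)] r.hom_mult[OF k(3) KE[OF k(1)]] unfolding k(2,4) by metis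
  qed
  have cext: "central_extension ?Q Q \<rho>"
    unfolding central_extension_def epi_def
    using comm Qg gr(2) rho pi(2) by (auto simp: carQ image_image)
  have "countable (carrier (?Q\<lparr>carrier := kernel ?Q Q \<rho>\<rparr>))"
  proof (rule countable_cocyclic)
    let ?B = "?Q\<lparr>carrier := kernel ?Q Q \<rho>\<rparr>"
    have sub: "subgroup (kernel ?Q Q \<rho>) ?Q" by (rule rho.subgroup_kernel)
    show "group ?B" by (rule r.H.subgroup_imp_group[OF sub])
    show "X \<otimes>\<^sub>?B Y = Y \<otimes>\<^sub>?B X" if "X \<in> carrier ?B" "Y \<in> carrier ?B" for X Y
      using comm[of X Y] that by (simp add: kernel_def)
    show "?r z \<in> carrier ?B" using zK rho(2)[OF zE] r.hom_closed[OF zE] by (simp add: kernel_def)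
    show "?r z \<noteq> \<one>\<^sub>?B" using rM[OF zE pi.G.one_closed] zM zE sM by (simp add: subgroup.subset pi.G.coset_mult_one)
    fix X assume X: "X \<in> carrier ?B" "X \<noteq> \<one>\<^sub>?B"
    obtain x where x: "x \<in> ?K" "X = ?r x" using kerr X(1) by auto
    have xE: "x \<in> carrier E" by (rule KE[OF x(1)])
    have xM: "x \<notin> M" using X(2) pi.G.coset_join2[OF xE sM] by (auto simp: x(2))
    \<comment> \<open>The subgroup generated by \<open>M\<close> and \<open>x\<close>. It exceeds
      \<open>M\<close>, so by maximality it contains \<open>z\<close>, and some power of
      \<open>X\<close> is the class of \<open>z\<close>.\<close>
    let ?N = "{m \<otimes>\<^sub>E x [^]\<^sub>E i | m (i::int). m \<in> M}"
    have pK: "x [^]\<^sub>E (i::int) \<in> ?K" for i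
      by (rule pi.G.subgroup_int_pow_closed[OF pi.subgroup_kernel x(1)])
    have Nin: "m \<otimes>\<^sub>E x [^]\<^sub>E i \<in> ?N" if "m \<in> M" for m and i :: int
      by (rule CollectI, rule exI, rule exI, rule conjI[OF HOL.refl that])
    have MN: "M \<subseteq> ?N"
    proof
      fix m assume m: "m \<in> M"
      then show "m \<in> ?N" using Nin[OF m, of 0] subgroup.mem_carrier[OF sM m] by simp
    qed
    have xN: "x \<in> ?N" using Nin[OF subgroup.one_closed[OF sM], of 1] xE by simp
    have mm: "m \<otimes>\<^sub>E x [^]\<^sub>E i \<otimes>\<^sub>E (n \<otimes>\<^sub>E x [^]\<^sub>E j) = (m \<otimes>\<^sub>E n) \<otimes>\<^sub>E x [^]\<^sub>E (i + j)" if "m \<in> M" "n \<in> M" for m n and i j :: int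
    proof -
      have c: "m \<in> carrier E" "n \<in> carrier E" using that KE MK by auto
      have "m \<otimes>\<^sub>E x [^]\<^sub>E i \<otimes>\<^sub>E (n \<otimes>\<^sub>E x [^]\<^sub>E j) = m \<otimes>\<^sub>E (x [^]\<^sub>E i \<otimes>\<^sub>E n) \<otimes>\<^sub>E x [^]\<^sub>E j" using c xE by (simp add: pi.G.m_assoc)
      also have "\<dots> = (m \<otimes>\<^sub>E n) \<otimes>\<^sub>E x [^]\<^sub>E (i + j)" unfolding cen[OF pK c(2)] using c xE by (simp add: pi.G.m_assoc pi.G.int_pow_mult)
      finally show ?thesis .
    qed
    have "subgroup ?N E"
    proof (rule pi.G.subgroupI)
      show "?N \<subseteq> carrier E" using xE KE MK by auto
      show "?N \<noteq> {}" by (rule notI, drule equalityD1, drule subsetD[OF _ xN], erule emptyE)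
      show "a \<otimes>\<^sub>E b \<in> ?N" if ab: "a \<in> ?N" "b \<in> ?N" for a b
      proof -
        obtain m i n j where m: "a = m \<otimes>\<^sub>E x [^]\<^sub>E (i::int)" "b = n \<otimes>\<^sub>E x [^]\<^sub>E (j::int)" "m \<in> M" "n \<in> M" using ab by blast
        show ?thesis unfolding m(1,2) mm[OF m(3,4)] by (rule Nin[OF subgroup.m_closed[OF sM m(3,4)]])
      qed
      show "inv\<^bsub>E\<^esub> a \<in> ?N" if a: "a \<in> ?N" for a
      proof -
        obtain m i where m: "a = m \<otimes>\<^sub>E x [^]\<^sub>E (i::int)" "m \<in> M" using a by blast
        have mi: "inv\<^bsub>E\<^esub> m \<in> M" "m \<in> carrier E" using m(2) sM MK KE by (auto simp: subgroup.m_inv_closed)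
        have "inv\<^bsub>E\<^esub> m \<otimes>\<^sub>E x [^]\<^sub>E (- i) \<otimes>\<^sub>E a = \<one>\<^sub>E" unfolding m(1) mm[OF mi(1) m(2)] using mi(2) by simp
        then have "inv\<^bsub>E\<^esub> a = inv\<^bsub>E\<^esub> m \<otimes>\<^sub>E x [^]\<^sub>E (- i)" using mi xE by (intro pi.G.inv_equality) (simp_all add: m(1))
        then show ?thesis using Nin[OF mi(1)] by simp
      qed
    qed
    moreover have "?N \<subseteq> ?K"
    proof
      fix a assume "a \<in> ?N"
      then obtain m i where m: "a = m \<otimes>\<^sub>E x [^]\<^sub>E (i::int)" "m \<in> M" by blast
      show "a \<in> ?K" unfolding m(1) by (rule subgroup.m_closed[OF pi.subgroup_kernel subsetD[OF MK m(2)] pK])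
    qed
    ultimately have "z \<in> ?N" using max[of ?N] MN xN xM by (auto simp: F_def)
    then obtain m i where m: "z = m \<otimes>\<^sub>E x [^]\<^sub>E (i::int)" "m \<in> M" by blast
    have "?r z = ?r (x [^]\<^sub>E i)"
      using m KE MK xE pi.G.mult_inv_cancel[of m "x [^]\<^sub>E i"] by (subst rM) (auto simp: zE)
    then have "X [^]\<^sub>?Q i = ?r z" using r.hom_int_pow[OF xE, of i] by (simp add: x(2))
    then show "\<exists>k::int. X [^]\<^sub>?B k = ?r z" using r.H.int_pow_consistent[OF sub, of X i] X(1) by auto
  qed
  then have "countable (kernel ?Q Q \<rho>)" by simp
  then have cnt: "countable (carrier ?Q)" by (rule countable_hom[OF Qg gr(2) rho(1) _ cQ])
  \<comment> \<open>Uniqueness becomes available here, since both maps end in a countable central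
    extension of \<open>Q\<close>.\<close>
  have "(?r \<circ> h) e = ?r e"
  proof (rule uce_countable(2)[OF U uce cext cnt hom_compose[OF h(1) r] r _ _ e])
    fix x assume x: "x \<in> carrier E"
    show "\<rho> ((?r \<circ> h) x) = \<pi> x" "\<rho> (?r x) = \<pi> x"
      using rho(2)[OF x] rho(2)[OF hom_in_carrier[OF h(1) x]] h(2)[OF x] by simp_all
  qed
  then have "e \<otimes>\<^sub>E inv\<^bsub>E\<^esub> (h e) \<in> M" using rM[OF e he] by simp
  then show False using zM by (simp add: z_def)
qed

lemma commute_on_generators:
  assumes "generates G B" "group G" and H: "group H" and f: "f \<in> hom G H" and y: "y \<in> carrier H"
    and c: "\<And>b. b \<in> B \<Longrightarrow> y \<otimes>\<^sub>H f b = f b \<otimes>\<^sub>H y" and x: "x \<in> carrier G"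
  shows "y \<otimes>\<^sub>H f x = f x \<otimes>\<^sub>H y"
proof -
  interpret H: group H by (rule H)
  note fc = hom_in_carrier[OF f]
  have cj: "conjugate H y z = z \<longleftrightarrow> y \<otimes>\<^sub>H z = z \<otimes>\<^sub>H y" if "z \<in> carrier H" for z
    using that y H.inv_solve_right'[of z "y \<otimes>\<^sub>H z" y] by (simp add: conjugate_def)
  have "b \<in> carrier G" if "b \<in> B" for b using that assms(1) by (auto simp: generates_def)
  then have "(conjugate H y \<circ> f) x = f x"
    by (intro hom_eq_on_generators[where f = "conjugate H y \<circ> f" and g = f, OF assms(1,2) H hom_compose[OF f H.conj_hom[OF y]] f _ x])
      (simp add: cj[OF fc] c)
  then show ?thesis using cj[OF fc[OF x]] by simp
qed

text \<open>The universal property yields \<open>f\<close>, because the model is countable, and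
  \<open>E0_lift\<close> yields \<open>k\<close> in the other direction. One composite is the
  identity by perfectness of the model. The other is an endomorphism of E over \<Delta>, to which
  uniqueness does not apply directly because E may not fit into \<open>'u\<close>; this is what
  \<open>uce_endomorphism_id\<close> is for.\<close>

lemma (in fibre) uce_iso:
  fixes E :: "'e monoid"
  assumes U: "infinite (UNIV :: 'u set)" and uce: "universal_central_extension TYPE('u) E \<Delta> \<pi>"
  obtains k where "k \<in> iso E0 E" "\<And>x. x \<in> carrier E0 \<Longrightarrow> \<pi> (k x) = \<pi>0 x"
proof -
  have E: "group E" and pi: "\<pi> \<in> hom E \<Delta>" "\<pi> ` carrier E = carrier \<Delta>"
    and cen: "x \<in> carrier E \<Longrightarrow> \<pi> x = \<one>\<^sub>\<Delta> \<Longrightarrow> central E x" for x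
    using uce by (auto simp: central_extension_def universal_central_extension_def epi_def central_def kernel_def)
  have cen0: "central E0 x" if "x \<in> carrier E0" "\<pi>0 x = \<one>\<^sub>\<Delta>" for x
    using pi0_kernel[OF that] central_zeta by auto
  obtain f where f: "f \<in> hom E E0" "\<forall>x\<in>carrier E. \<pi>0 (f x) = \<pi> x"
    using uce_countable(1)[OF U uce central_extension_pi0 countable_E0] by (rule bexE)
  have sub: "\<pi>0 ` carrier E0 \<subseteq> \<pi> ` carrier E" unfolding pi(2) using hom_in_carrier[OF pi0(1)] by blast
  obtain k where k: "k \<in> hom E0 E" "\<And>x. x \<in> carrier E0 \<Longrightarrow> \<pi> (k x) = \<pi>0 x"
    by (rule E0_lift[OF E dd.P.group_axioms pi(1) cen pi0(1) sub], assumption, assumption, rule that)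
  have fk: "(f \<circ> k) x = x" if x: "x \<in> carrier E0" for x
  proof (rule perfect_lift_unique[where g = "\<lambda>x. x", OF ee.P.group_axioms perfect_E0 ee.P.group_axioms dd.P.group_axioms pi0(1) cen0 hom_compose[OF k(1) f(1)] _ _ x])
    show "(\<lambda>x. x) \<in> hom E0 E0" by (rule homI) simp_all
    show "\<pi>0 ((f \<circ> k) x) = \<pi>0 x" if "x \<in> carrier E0" for x
      using f(2) hom_in_carrier[OF k(1) that] k(2)[OF that] by simp
  qed
  have kf: "(k \<circ> f) x = x" if x: "x \<in> carrier E" for x
  proof (rule uce_endomorphism_id[OF U uce countable_Delta hom_compose[OF f(1) k(1)] _ x])
    show "\<pi> ((k \<circ> f) x) = \<pi> x" if "x \<in> carrier E" for x
      using f(2) that k(2)[OF hom_in_carrier[OF f(1) that]] by simp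
  qed
  have "bij_betw k (carrier E0) (carrier E)"
    by (rule bij_betw_byWitness[where f' = f]) (use fk kf f(1) k(1) hom_in_carrier in fastforce)+
  then show thesis using k by (intro that) (simp_all add: iso_def)
qed

locale uce_model = fibre +
  fixes E :: "'e monoid" and \<pi> :: "'e \<Rightarrow> ((nat gword set \<times> nat gword set) + (nat gword set \<times> nat gword set)) gword set"
    and k :: "_ \<Rightarrow> 'e"
  assumes E: "group E" and k: "k \<in> iso E0 E" and pi: "\<pi> \<in> hom E \<Delta>"
    and pi_k: "\<And>x. x \<in> carrier E0 \<Longrightarrow> \<pi> (k x) = \<pi>0 x"
begin

sublocale E: group E by (rule E)

definition "\<kappa>1 = k \<circ> \<iota>1"
definition "\<kappa>2 = k \<circ> \<iota>2"

lemma k_hom: "k \<in> hom E0 E" and k_bij: "bij_betw k (carrier E0) (carrier E)"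
  using k by (simp_all add: iso_def)

lemma kappa_hom: "\<kappa>1 \<in> hom G E" "\<kappa>2 \<in> hom G E"
  unfolding \<kappa>1_def \<kappa>2_def by (rule hom_compose[OF iota_hom(1) k_hom], rule hom_compose[OF iota_hom(2) k_hom])

lemma pi_kappa: "g \<in> carrier G \<Longrightarrow> \<pi> (\<kappa>1 g) = dd.i1 g" "g \<in> carrier G \<Longrightarrow> \<pi> (\<kappa>2 g) = dd.i2 g"
  by (simp_all only: \<kappa>1_def \<kappa>2_def comp_apply pi_k iota_closed pi0)

abbreviation "k' \<equiv> inv_into (carrier E0) k"

lemma k': "k' \<in> iso E E0" "k' \<in> hom E E0" "x \<in> carrier E \<Longrightarrow> k (k' x) = x"
  "inj_on k' (carrier E)"
  using ee.P.iso_set_sym[OF k] bij_betw_inv_into_right[OF k_bij] bij_betw_inv_into_left[OF k_bij]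
  by (auto simp: iso_def bij_betw_def)

lemma torsion_free_E: "torsion_free E"
  by (rule torsion_free_inj[OF E ee.P.group_axioms k'(2,4) torsion_free_E0])

lemma generates_E: "generates E (\<kappa>1 ` carrier G \<union> \<kappa>2 ` carrier G)"
  unfolding generates_def
proof (intro conjI allI impI)
  show "\<kappa>1 ` carrier G \<union> \<kappa>2 ` carrier G \<subseteq> carrier E"
    using hom_in_carrier[OF kappa_hom(1)] hom_in_carrier[OF kappa_hom(2)] by blast
  fix N assume N: "subgroup N E" "\<kappa>1 ` carrier G \<union> \<kappa>2 ` carrier G \<subseteq> N"
  have "x \<in> {y \<in> carrier E0. k y \<in> N}" if "x \<in> carrier E0" for x
    by (rule generatesD[OF generates_E0 subgroup_preimage[OF ee.P.group_axioms E k_hom N(1)] _ that])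
      (use N(2) iota_closed in \<open>auto simp: \<kappa>1_def \<kappa>2_def simp del: carrier_DirProd\<close>)
  then have "k ` carrier E0 \<subseteq> N" by blast
  then show "N = carrier E" using k_bij subgroup.subset[OF N(1)] by (auto simp: bij_betw_def)
qed

lemma perfect_E: "perfect E"
  by (rule perfect_generated[OF E generates_E G.group_axioms perfect_G kappa_hom(1) G.group_axioms perfect_G kappa_hom(2)])

lemma E_lift:
  assumes H: "group H" and Y: "group Y" and rho: "\<rho> \<in> hom H Y"
    and ker: "\<And>k. k \<in> carrier H \<Longrightarrow> \<rho> k = \<one>\<^sub>Y \<Longrightarrow> central H k"
    and f: "f \<in> hom E Y" "f ` carrier E \<subseteq> \<rho> ` carrier H"
  obtains L where "L \<in> hom E H" "\<And>x. x \<in> carrier E \<Longrightarrow> \<rho> (L x) = f x"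
proof -
  have sub: "(f \<circ> k) ` carrier E0 \<subseteq> \<rho> ` carrier H" unfolding image_comp[symmetric] using f(2) k_bij by (simp add: bij_betw_def)
  obtain L where L: "L \<in> hom E0 H" "\<And>x. x \<in> carrier E0 \<Longrightarrow> \<rho> (L x) = (f \<circ> k) x"
    by (rule E0_lift[OF H Y rho ker hom_compose[OF k_hom f(1)] sub], assumption, assumption, rule that)
  show thesis
    by (rule that[OF hom_compose[OF k'(2) L(1)]]) (simp add: L(2)[OF hom_in_carrier[OF k'(2)]] k'(3))
qed

text \<open>Four copies of the base group generate E, and each of them dies in every finite
  quotient.\<close>

lemma no_finite_quotients_E: "no_nontrivial_finite_quotients E"
  unfolding no_nontrivial_finite_quotients_def
proof (intro allI impI)
  fix N assume N: "N \<lhd> E" and fin: "finite (carrier (E Mod N))"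
  interpret N: normal N E by (rule N)
  let ?r = "(#>\<^bsub>E\<^esub>) N"
  note Q = N.factorgroup_is_group and r = N.r_coset_hom_Mod
  note inc = DirProd_inclusions[OF group_base[of q] group_base[of q]]
  have G1: "f g = \<one>\<^bsub>E Mod N\<^esub>" if f: "f \<in> hom G (E Mod N)" and g: "g \<in> carrier G" for f g
  proof (rule generates_hom_trivial[OF inc(3) G.group_axioms Q f _ g])
    show "f b = \<one>\<^bsub>E Mod N\<^esub>" if "b \<in> (\<lambda>x. (x, \<one>\<^sub>A)) ` carrier A \<union> Pair \<one>\<^sub>A ` carrier A" for b
      using that base_finite_hom_trivial[OF Q fin hom_compose[OF inc(1) f]] base_finite_hom_trivial[OF Q fin hom_compose[OF inc(2) f]]
      by (elim UnE imageE) (simp_all only: comp_apply)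
  qed
  have "?r x = \<one>\<^bsub>E Mod N\<^esub>" if "x \<in> carrier E" for x
  proof (rule generates_hom_trivial[OF generates_E E Q r _ that])
    show "?r b = \<one>\<^bsub>E Mod N\<^esub>" if "b \<in> \<kappa>1 ` carrier G \<union> \<kappa>2 ` carrier G" for b
      using that G1[OF hom_compose[OF kappa_hom(1) r]] G1[OF hom_compose[OF kappa_hom(2) r]]
      by (elim UnE imageE) (simp_all only: comp_apply)
  qed
  then have "carrier (E Mod N) = {\<one>\<^bsub>E Mod N\<^esub>}"
    using E.one_closed unfolding carrier_FactGroup by blast
  then show "trivial_group (E Mod N)" using Q by (simp add: trivial_group_def)
qed

end

section \<open>A finite presentation\<close>

definition wshift :: "nat \<Rightarrow> nat gword \<Rightarrow> nat gword" where
  "wshift c = map (\<lambda>(i, e). (i + c, e))"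

lemma weval_wshift: "weval H h (wshift c w) = weval H (\<lambda>i. h (i + c)) w"
  by (induction w) (auto simp: wshift_def)

lemma wshift_gwords: "w \<in> gwords {..<4} \<Longrightarrow> c \<le> 12 \<Longrightarrow> wshift c w \<in> gwords {..<16}"
  by (induction w) (auto simp: wshift_def)

lemma base_word:
  assumes "u \<in> carrier (base q)"
  obtains w where "w \<in> gwords {..<4}" "u = weval (base q) (base_gen q) w"
  using assms weval_pgen[of _ "{..<4}" "base_rel q"] unfolding base_eq base_gen_def carrier_presented_group by blast

lemma weval_base_hom:
  assumes "group H" "f \<in> hom (base q) H" "w \<in> gwords {..<4}"
  shows "f (weval (base q) (base_gen q) w) = weval H (f \<circ> base_gen q) w"
  by (rule weval_hom[OF group_base assms(1,2) _ assms(3)]) (auto simp: base_gen_closed)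

context fibre begin

definition "word x = (SOME w. w \<in> gwords {..<4} \<and> x = weval A (base_gen q) w)"

lemma word: "u \<in> carrier A \<Longrightarrow> word u \<in> gwords {..<4} \<and> u = weval A (base_gen q) (word u)"
  unfolding word_def by (rule base_word, assumption, rule someI, rule conjI)

text \<open>The generators \<open>c + i\<close> with \<open>c = 0, 4, 8, 12\<close> are the generators of the four copies of \<open>A\<close>, and
  \<open>wpair c s\<close> represents \<open>s\<close> in the copies \<open>c\<close> and \<open>c + 4\<close>.\<close>

definition "wpair c s = wshift c (word (fst s)) @ wshift (c + 4) (word (snd s))"
definition "wdiff s = winv (wpair 0 s) @ wpair 8 s"
text \<open>Only generators of \<open>S\<close> enter, never its relations: once the three
  discrepancies are central, \<open>E0_universal\<close> accounts for all of \<open>S\<close> and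
  for \<open>Z3\<close>. This is how a finite presentation arises from an infinite gluing.\<close>

definition "E0_rel = (\<Union>c\<in>{0, 4, 8, 12}. wshift c ` base_rel q)
  \<union> (\<lambda>(c, i, j). wcomm (gen (i + c)) (gen (j + (c + 4)))) ` ({0, 8} \<times> {..<4} \<times> {..<4})
  \<union> (\<lambda>(s, i). wcomm (wdiff s) (gen i)) ` ({s1, s2, s3} \<times> {..<16})"

abbreviation "PE \<equiv> presented_group {..<16} E0_rel"
abbreviation "pg \<equiv> pgen {..<16} E0_rel"

lemma wpair_gwords: "s \<in> carrier G \<Longrightarrow> c \<le> 8 \<Longrightarrow> wpair c s \<in> gwords {..<16}"
  using word by (auto simp: wpair_def intro!: wshift_gwords)

lemma wdiff_gwords: "s \<in> carrier G \<Longrightarrow> wdiff s \<in> gwords {..<16}"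
  by (simp add: wdiff_def wpair_gwords del: carrier_DirProd)

lemma s_in_G: "s \<in> {s1, s2, s3} \<Longrightarrow> s \<in> S" "s \<in> {s1, s2, s3} \<Longrightarrow> s \<in> carrier G"
  using s_in_S SG by blast+

lemma E0_relE:
  assumes "r \<in> E0_rel"
  obtains c w where "r = wshift c w" "c \<in> {0, 8}" "w \<in> base_rel q" | c w where "r = wshift (c + 4) w" "c \<in> {0, 8}" "w \<in> base_rel q"
    | c i j where "r = wcomm (gen (i + c)) (gen (j + (c + 4)))" "c \<in> {0, 8}" "i < 4" "j < 4"
    | s i where "r = wcomm (wdiff s) (gen i)" "s \<in> {s1, s2, s3}" "i < 16"
  using assms unfolding E0_rel_def
proof (elim UnE UN_E imageE, goal_cases)
  case (1 c w)
  then have "c \<in> {0, 8} \<or> (\<exists>d\<in>{0, 8}. c = d + 4)" by auto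
  then show ?case by (elim disjE bexE) (use 1 in blast)+
next
  case (2 x)
  then show ?case by (cases x) simp
next
  case (3 x)
  then show ?case by (cases x) simp
qed

lemma E0_relI: "c \<in> {0, 8} \<Longrightarrow> i < 4 \<Longrightarrow> j < 4 \<Longrightarrow> wcomm (gen (i + c)) (gen (j + (c + 4))) \<in> E0_rel"
  "s \<in> {s1, s2, s3} \<Longrightarrow> k < 16 \<Longrightarrow> wcomm (wdiff s) (gen k) \<in> E0_rel"
  "c \<in> {0, 8} \<Longrightarrow> a \<in> {c, c + 4} \<Longrightarrow> w \<in> base_rel q \<Longrightarrow> wshift a w \<in> E0_rel"
proof -
  assume "c \<in> {0, 8}" "i < 4" "j < 4"
  then have "(c, i, j) \<in> {0, 8} \<times> {..<4} \<times> {..<4}" by simp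
  then show "wcomm (gen (i + c)) (gen (j + (c + 4))) \<in> E0_rel"
    unfolding E0_rel_def by (intro UnI1 UnI2) (rule rev_image_eqI, assumption, simp)
next
  assume "s \<in> {s1, s2, s3}" "k < 16"
  then have "(s, k) \<in> {s1, s2, s3} \<times> {..<16}" by (intro SigmaI) simp_all
  then show "wcomm (wdiff s) (gen k) \<in> E0_rel"
    unfolding E0_rel_def by (intro UnI2) (rule rev_image_eqI, assumption, simp)
next
  assume "c \<in> {0, 8}" "a \<in> {c, c + 4}" "w \<in> base_rel q"
  then show "wshift a w \<in> E0_rel" unfolding E0_rel_def by (intro UnI1 UN_I[of a] imageI) auto
qed

lemma E0_rel_gwords: "E0_rel \<subseteq> gwords {..<16}"
proof
  fix r assume "r \<in> E0_rel"
  then show "r \<in> gwords {..<16}"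
  proof (cases rule: E0_relE)
    case (1 c w) then show ?thesis using base_rel_gwords[of q] by (simp only: 1(1)) (rule wshift_gwords, auto)
  next
    case (2 c w) then show ?thesis using base_rel_gwords[of q] by (simp only: 2(1)) (rule wshift_gwords, auto)
  next
    case (3 c i j) then show ?thesis by (simp only: 3(1)) (rule gwords_wcomm, auto)
  next
    case (4 s i) then show ?thesis using wdiff_gwords[OF s_in_G(2)] by (simp only: 4(1)) (rule gwords_wcomm, auto)
  qed
qed

lemma finite_E0_rel: "finite E0_rel"
  unfolding E0_rel_def by (intro finite_UnI finite_UN_I finite_imageI finite_base_rel finite_cartesian_product) auto

text \<open>A family of generators satisfying the relators amounts to two homomorphisms on \<open>G\<close>.\<close>

lemma pair_hom:
  assumes H: "group H" and h: "h ` {..<16} \<subseteq> carrier H" and c: "c \<in> {0, 8}"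
    and rel: "\<And>w a. w \<in> base_rel q \<Longrightarrow> a \<in> {c, c + 4} \<Longrightarrow> weval H h (wshift a w) = \<one>\<^sub>H"
    and cm: "\<And>i j. i < 4 \<Longrightarrow> j < 4 \<Longrightarrow> h (i + c) \<otimes>\<^sub>H h (j + (c + 4)) = h (j + (c + 4)) \<otimes>\<^sub>H h (i + c)"
  obtains l where "l \<in> hom G H" "\<And>i. i < 4 \<Longrightarrow> l (base_gen q i, \<one>\<^sub>A) = h (i + c)"
    "\<And>i. i < 4 \<Longrightarrow> l (\<one>\<^sub>A, base_gen q i) = h (i + (c + 4))" "\<And>s. s \<in> carrier G \<Longrightarrow> l s = weval H h (wpair c s)"
proof -
  interpret H: group H by (rule H)
  have hc: "(\<lambda>i. h (i + a)) ` {..<4} \<subseteq> carrier H" if "a \<in> {c, c + 4}" for a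
    using that c h by (auto simp: image_subset_iff)
  have r: "base_relations q H (\<lambda>i. h (i + a))" if "a \<in> {c, c + 4}" for a
    using base_relations_iff[OF H hc[OF that], of q] rel[OF _ that] by (simp add: weval_wshift)
  have m: "c \<in> {c, c + 4}" "c + 4 \<in> {c, c + 4}" by auto
  obtain L1 where L1: "L1 \<in> hom A H" "\<And>i. i < 4 \<Longrightarrow> L1 (base_gen q i) = h (i + c)"
    by (rule base_hom[OF H hc[OF m(1)] r[OF m(1)]], rule that)
  obtain L2 where L2: "L2 \<in> hom A H" "\<And>i. i < 4 \<Longrightarrow> L2 (base_gen q i) = h (i + (c + 4))"
    by (rule base_hom[OF H hc[OF m(2)] r[OF m(2)]], rule that)
  note lc = hom_in_carrier[OF L1(1)] hom_in_carrier[OF L2(1)]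
  have gc: "h (i + c) \<in> carrier H" "h (i + (c + 4)) \<in> carrier H" if "i < 4" for i using hc that by auto
  have 1: "L1 x \<otimes>\<^sub>H h (j + (c + 4)) = h (j + (c + 4)) \<otimes>\<^sub>H L1 x" if "x \<in> carrier A" "j < 4" for x j
    by (rule commute_on_generators[OF generates_base group_base H L1(1) gc(2)[OF that(2)] _ that(1), symmetric])
      (use L1(2) cm that(2) in auto)
  have 2: "L1 x \<otimes>\<^sub>H L2 y = L2 y \<otimes>\<^sub>H L1 x" if "x \<in> carrier A" "y \<in> carrier A" for x y
    by (rule commute_on_generators[OF generates_base group_base H L2(1) lc(1)[OF that(1)] _ that(2)])
      (use L2(2) 1[OF that(1)] in auto)
  let ?l = "\<lambda>(x, y). L1 x \<otimes>\<^sub>H L2 y"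
  have one: "L1 \<one>\<^sub>A = \<one>\<^sub>H" "L2 \<one>\<^sub>A = \<one>\<^sub>H" by (rule hom_one[OF L1(1) group_base H], rule hom_one[OF L2(1) group_base H])
  show thesis
  proof (rule that)
    show "?l \<in> hom G H" by (rule DirProd_hom[OF group_base group_base H L1(1) L2(1) 2])
    show "?l (base_gen q i, \<one>\<^sub>A) = h (i + c)" "?l (\<one>\<^sub>A, base_gen q i) = h (i + (c + 4))" if "i < 4" for i
      using that gc[OF that] by (simp_all add: one L1 L2)
    fix s assume "s \<in> carrier G"
    then obtain u v where s: "s = (u, v)" "u \<in> carrier A" "v \<in> carrier A" by auto
    have "L1 u = weval H h (wshift c (word u))" "L2 v = weval H h (wshift (c + 4) (word v))"
      using word[OF s(2)] word[OF s(3)] weval_base_hom[OF H L1(1), of "word u"] weval_base_hom[OF H L2(1), of "word v"]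
        weval_cong[of "word u" "{..<4}" "L1 \<circ> base_gen q" "\<lambda>i. h (i + c)" H] weval_cong[of "word v" "{..<4}" "L2 \<circ> base_gen q" "\<lambda>i. h (i + (c + 4))" H]
      by (simp_all add: weval_wshift L1 L2)
    moreover have "wshift c (word u) \<in> gwords {..<16}" "wshift (c + 4) (word v) \<in> gwords {..<16}"
      using word[OF s(2)] word[OF s(3)] c by (auto intro!: wshift_gwords)
    ultimately show "?l s = weval H h (wpair c s)"
      by (simp add: s(1) wpair_def H.weval_append[OF h])
  qed
qed

definition "E0_gen i = (if i < 4 then \<iota>1 (base_gen q i, \<one>\<^sub>A) else if i < 8 then \<iota>1 (\<one>\<^sub>A, base_gen q (i - 4))
  else if i < 12 then \<iota>2 (base_gen q (i - 8), \<one>\<^sub>A) else \<iota>2 (\<one>\<^sub>A, base_gen q (i - 12)))" for i :: nat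

lemma E0_gen: "i < 4 \<Longrightarrow> E0_gen (i + 0) = \<iota>1 (base_gen q i, \<one>\<^sub>A)" "i < 4 \<Longrightarrow> E0_gen (i + (0 + 4)) = \<iota>1 (\<one>\<^sub>A, base_gen q i)"
    "i < 4 \<Longrightarrow> E0_gen (i + 8) = \<iota>2 (base_gen q i, \<one>\<^sub>A)" "i < 4 \<Longrightarrow> E0_gen (i + (8 + 4)) = \<iota>2 (\<one>\<^sub>A, base_gen q i)"
  by (simp_all add: E0_gen_def)

lemma E0_gen_closed: "i < 16 \<Longrightarrow> E0_gen i \<in> carrier E0"
  using base_gen_closed[of i q] base_gen_closed[of "i - 4" q] base_gen_closed[of "i - 8" q] base_gen_closed[of "i - 12" q]
  by (auto simp: E0_gen_def intro!: iota_closed)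

lemma generates_G: "generates G ((\<lambda>i. (base_gen q i, \<one>\<^sub>A)) ` {..<4} \<union> (\<lambda>i. (\<one>\<^sub>A, base_gen q i)) ` {..<4})"
  (is "generates G ?B")
  unfolding generates_def
proof (intro conjI allI impI)
  note inc = DirProd_inclusions[OF group_base[of q] group_base[of q]]
  show "?B \<subseteq> carrier G" using base_gen_closed by auto
  fix N assume N: "subgroup N G" and sub: "?B \<subseteq> N"
  have "x \<in> {x \<in> carrier A. (x, \<one>\<^sub>A) \<in> N}" if "x \<in> carrier A" for x
    by (rule generatesD[OF generates_base subgroup_preimage[OF group_base G.group_axioms inc(1) N] _ that]) (use sub base_gen_closed in auto)
  moreover have "x \<in> {x \<in> carrier A. (\<one>\<^sub>A, x) \<in> N}" if "x \<in> carrier A" for x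
    by (rule generatesD[OF generates_base subgroup_preimage[OF group_base G.group_axioms inc(2) N] _ that]) (use sub base_gen_closed in auto)
  ultimately have "(\<lambda>x. (x, \<one>\<^sub>A)) ` carrier A \<union> Pair \<one>\<^sub>A ` carrier A \<subseteq> N" by blast
  then show "N = carrier G" using inc(3) N unfolding generates_def by blast
qed

lemma E0_pair: 
  assumes "c \<in> {0, 8}" "s \<in> carrier G"
  shows "weval E0 E0_gen (wpair c s) = (if c = 0 then \<iota>1 s else \<iota>2 s)"
    and "\<And>w a. w \<in> base_rel q \<Longrightarrow> a \<in> {c, c + 4} \<Longrightarrow> weval E0 E0_gen (wshift a w) = \<one>\<^sub>E0"
    and "\<And>i j. i < 4 \<Longrightarrow> j < 4 \<Longrightarrow> E0_gen (i + c) \<otimes>\<^sub>E0 E0_gen (j + (c + 4)) = E0_gen (j + (c + 4)) \<otimes>\<^sub>E0 E0_gen (i + c)"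
proof -
  let ?i = "if c = 0 then \<iota>1 else \<iota>2"
  note inc = DirProd_inclusions[OF group_base[of q] group_base[of q]]
  have i: "?i \<in> hom G E0" using iota_hom by simp
  have g: "E0_gen (j + c) = (?i \<circ> (\<lambda>x. (x, \<one>\<^sub>A))) (base_gen q j)" "E0_gen (j + (c + 4)) = (?i \<circ> Pair \<one>\<^sub>A) (base_gen q j)"
    if "j < 4" for j using assms(1) E0_gen[OF that] by auto
  show rel: "weval E0 E0_gen (wshift a w) = \<one>\<^sub>E0" if w: "w \<in> base_rel q" and a: "a \<in> {c, c + 4}" for w a
  proof -
    have "\<exists>f\<in>hom A E0. \<forall>j<4. E0_gen (j + a) = f (base_gen q j)"
      using a g hom_compose[OF inc(1) i] hom_compose[OF inc(2) i] by blast
    then obtain f where f: "f \<in> hom A E0" "\<And>j. j < 4 \<Longrightarrow> E0_gen (j + a) = f (base_gen q j)" by blast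
    have "weval E0 (f \<circ> base_gen q) w = \<one>\<^sub>E0"
      using base_relations_iff[OF ee.P.group_axioms, of "f \<circ> base_gen q" q] base_relations_hom[OF ee.P.group_axioms f(1)]
        hom_in_carrier[OF f(1) base_gen_closed] w by auto
    then show ?thesis
      using weval_cong[of w "{..<4}" "f \<circ> base_gen q" "\<lambda>j. E0_gen (j + a)" E0] w base_rel_gwords f(2) by (simp add: weval_wshift subset_iff)
  qed
  show cm: "E0_gen (i + c) \<otimes>\<^sub>E0 E0_gen (j + (c + 4)) = E0_gen (j + (c + 4)) \<otimes>\<^sub>E0 E0_gen (i + c)" if "i < 4" "j < 4" for i j
  proof -
    have m: "(base_gen q i, \<one>\<^sub>A) \<in> carrier G" "(\<one>\<^sub>A, base_gen q j) \<in> carrier G" using that base_gen_closed by auto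
    then have "(base_gen q i, \<one>\<^sub>A) \<otimes>\<^sub>G (\<one>\<^sub>A, base_gen q j) = (\<one>\<^sub>A, base_gen q j) \<otimes>\<^sub>G (base_gen q i, \<one>\<^sub>A)" by simp
    then show ?thesis unfolding g(1)[OF that(1)] g(2)[OF that(2)] comp_apply using hom_mult[OF i m] hom_mult[OF i m(2,1)] by simp
  qed
  have sub: "E0_gen ` {..<16} \<subseteq> carrier E0" using E0_gen_closed by auto
  obtain l where l: "l \<in> hom G E0" "\<And>i. i < 4 \<Longrightarrow> l (base_gen q i, \<one>\<^sub>A) = E0_gen (i + c)"
    "\<And>i. i < 4 \<Longrightarrow> l (\<one>\<^sub>A, base_gen q i) = E0_gen (i + (c + 4))" "\<And>s. s \<in> carrier G \<Longrightarrow> l s = weval E0 E0_gen (wpair c s)"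
    by (rule pair_hom[OF ee.P.group_axioms sub assms(1) rel cm]; (rule that)?) assumption+
  have "l s = ?i s"
    by (rule hom_eq_on_generators[OF generates_G G.group_axioms ee.P.group_axioms l(1) i _ assms(2)]) (use l(2,3) g in auto)
  then show "weval E0 E0_gen (wpair c s) = (if c = 0 then \<iota>1 s else \<iota>2 s)" using l(4)[OF assms(2)] by simp
qed

text \<open>One map comes from checking the relators in the model, the other from the universal
  property of the model, whose hypothesis is exactly what the relators built from
  \<open>wdiff\<close> assert. They are inverse to each other on generators.\<close>

lemma E0_presented: "E0 \<cong> PE"
proof -
  interpret PE: group PE by (rule group_presented_group)
  have eg: "E0_gen ` {..<16} \<subseteq> carrier E0" using E0_gen_closed by auto
  have pg: "pg ` {..<16} \<subseteq> carrier PE" by (auto intro!: pgen_closed)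
  have split16: "(\<exists>j<4. i = j + 0) \<or> (\<exists>j<4. i = j + (0 + 4)) \<or> (\<exists>j<4. i = j + 8) \<or> (\<exists>j<4. i = j + (8 + 4))" if "i < 16" for i :: nat
  proof -
    consider "i < 4" | "i - 4 < 4" "i = i - 4 + 4" | "i - 8 < 4" "i = i - 8 + 8" | "i - 12 < 4" "i = i - 12 + 12"
      using \<open>i < 16\<close> by linarith
    then show ?thesis
    proof cases
      case 1 then show ?thesis by (intro disjI1 exI[of _ i]) simp
    next
      case 2 show ?thesis by (rule disjI2, rule disjI1, rule exI[of _ "i - 4"]) (use 2 in simp)
    next
      case 3 show ?thesis by (rule disjI2, rule disjI2, rule disjI1, rule exI[of _ "i - 8"]) (use 3 in simp)
    next
      case 4 show ?thesis by (rule disjI2, rule disjI2, rule disjI2, rule exI[of _ "i - 12"]) (use 4 in simp)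
    qed
  qed
  have wcm: "weval E0 E0_gen (wcomm u (gen i)) = \<one>\<^sub>E0"
    if u: "u \<in> gwords {..<16}" "i < 16" "weval E0 E0_gen u \<otimes>\<^sub>E0 E0_gen i = E0_gen i \<otimes>\<^sub>E0 weval E0 E0_gen u" for u i
  proof -
    have "weval E0 E0_gen (wcomm u (gen i)) = commutator E0 (weval E0 E0_gen u) (E0_gen i)"
      using u(1,2) by (simp add: ee.P.weval_wcomm[OF eg] ee.P.weval_gen[of E0_gen, OF E0_gen_closed] commutator_def)
    then show ?thesis using u(3) by (simp only: ee.P.comm_eq_one_iff[OF ee.P.weval_closed[OF eg u(1)] E0_gen_closed[OF u(2)]])
  qed
  have rel: "weval E0 E0_gen r = \<one>\<^sub>E0" if "r \<in> E0_rel" for r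
    using that
  proof (cases rule: E0_relE)
    case (1 c w) then show ?thesis using E0_pair(2)[OF 1(2) G.one_closed 1(3), of c] by (simp only: insert_iff simp_thms)
  next
    case (2 c w) then show ?thesis using E0_pair(2)[OF 2(2) G.one_closed 2(3), of "c + 4"] by (simp only: insert_iff simp_thms)
  next
    case (3 c i j)
    have "i + c < 16" "j + (c + 4) < 16" using 3 by auto
    then show ?thesis
      using E0_pair(3)[OF 3(2) G.one_closed 3(3,4)] unfolding 3(1) by (intro wcm) (simp_all add: ee.P.weval_gen[of E0_gen, OF E0_gen_closed])
  next
    case (4 s i)
    note s = s_in_G[OF 4(2)]
    have "weval E0 E0_gen (wdiff s) = inv\<^bsub>E0\<^esub> (\<iota>1 s) \<otimes>\<^sub>E0 \<iota>2 s"
      using E0_pair(1)[OF _ s(2), of 0] E0_pair(1)[OF _ s(2), of 8] wpair_gwords[OF s(2), of 0] wpair_gwords[OF s(2), of 8]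
      by (simp add: wdiff_def ee.P.weval_append[OF eg] ee.P.weval_winv[OF eg])
    also have "\<dots> = \<zeta> (\<tau> s)" unfolding iota_S[OF s(1)] using iota_closed(1)[OF s(2)] by simp
    finally show ?thesis
      unfolding 4(1) using ee.P.centralD(2)[OF central_zeta E0_gen_closed[OF 4(3)]] by (intro wcm wdiff_gwords[OF s(2)] 4(3)) simp
  qed
  have "\<exists>f\<in>hom PE E0. \<forall>i\<in>{..<16}. f (pg i) = E0_gen i" by (rule von_dyck[OF ee.P.group_axioms eg rel])
  then obtain \<theta> where th: "\<theta> \<in> hom PE E0" "\<And>i. i < 16 \<Longrightarrow> \<theta> (pg i) = E0_gen i" by blast
  have prel: "weval PE pg r = \<one>\<^sub>PE" if "r \<in> E0_rel" for r
    using pgen_relation[OF that subsetD[OF E0_rel_gwords that]] .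
  have pc: "pg i \<in> carrier PE" if "i < 16" for i using pg that by blast
  have P1: "weval PE pg (wshift a w) = \<one>\<^sub>PE" if "c \<in> {0, 8}" "w \<in> base_rel q" "a \<in> {c, c + 4}" for c w a
    by (rule prel[OF E0_relI(3)[OF that(1,3,2)]])
  have P2: "pg (i + c) \<otimes>\<^sub>PE pg (j + (c + 4)) = pg (j + (c + 4)) \<otimes>\<^sub>PE pg (i + c)" if c: "c \<in> {0, 8}" "i < 4" "j < 4" for c i j
  proof -
    have l: "i + c < 16" "j + (c + 4) < 16" using c by auto
    have "commutator PE (pg (i + c)) (pg (j + (c + 4))) = \<one>\<^sub>PE"
      using prel[OF E0_relI(1)[OF c]] l by (simp add: PE.weval_wcomm[OF pg] PE.weval_gen[of pg, OF pc] commutator_def)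
    then show ?thesis by (simp only: PE.comm_eq_one_iff[OF pc[OF l(1)] pc[OF l(2)]])
  qed
  obtain l1 where l1: "l1 \<in> hom G PE" "\<And>i. i < 4 \<Longrightarrow> l1 (base_gen q i, \<one>\<^sub>A) = pg (i + 0)"
    "\<And>i. i < 4 \<Longrightarrow> l1 (\<one>\<^sub>A, base_gen q i) = pg (i + (0 + 4))" "\<And>s. s \<in> carrier G \<Longrightarrow> l1 s = weval PE pg (wpair 0 s)"
    by (rule pair_hom[where c = 0, OF PE.group_axioms pg _ P1[of 0] P2[of 0]]) (simp, simp, assumption+, simp, assumption+, rule that)
  obtain l2 where l2: "l2 \<in> hom G PE" "\<And>i. i < 4 \<Longrightarrow> l2 (base_gen q i, \<one>\<^sub>A) = pg (i + 8)"
    "\<And>i. i < 4 \<Longrightarrow> l2 (\<one>\<^sub>A, base_gen q i) = pg (i + (8 + 4))" "\<And>s. s \<in> carrier G \<Longrightarrow> l2 s = weval PE pg (wpair 8 s)"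
    by (rule pair_hom[where c = 8, OF PE.group_axioms pg _ P1[of 8] P2[of 8]]) (simp, simp, assumption+, simp, assumption+, rule that)
  have cen: "inv\<^bsub>PE\<^esub> (l1 s) \<otimes>\<^sub>PE l2 s \<otimes>\<^sub>PE x = x \<otimes>\<^sub>PE (inv\<^bsub>PE\<^esub> (l1 s) \<otimes>\<^sub>PE l2 s)"
    if s: "s \<in> {s1, s2, s3}" and x: "x \<in> carrier PE" for s x
  proof -
    note sG = s_in_G(2)[OF s]
    have w: "inv\<^bsub>PE\<^esub> (l1 s) \<otimes>\<^sub>PE l2 s = weval PE pg (wdiff s)"
      using wpair_gwords[OF sG, of 0] wpair_gwords[OF sG, of 8]
      by (simp add: l1(4)[OF sG] l2(4)[OF sG] wdiff_def PE.weval_append[OF pg] PE.weval_winv[OF pg])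
    have wc: "weval PE pg (wdiff s) \<in> carrier PE" by (rule PE.weval_closed[OF pg wdiff_gwords[OF sG]])
    have "weval PE pg (wdiff s) \<otimes>\<^sub>PE pg i = pg i \<otimes>\<^sub>PE weval PE pg (wdiff s)" if i: "i < 16" for i
    proof -
      from prel[OF E0_relI(2)[OF s i]] have "commutator PE (weval PE pg (wdiff s)) (pg i) = \<one>\<^sub>PE"
        using i wdiff_gwords[OF sG] by (simp add: PE.weval_wcomm[OF pg] PE.weval_gen[of pg, OF pc[OF i]] commutator_def)
      then show ?thesis by (simp only: PE.comm_eq_one_iff[OF wc pc[OF i]])
    qed
    then show ?thesis unfolding w
      by (intro commute_on_generators[where f = "\<lambda>x. x", OF generates_presented_group PE.group_axioms PE.group_axioms _ wc _ x])
        (auto intro!: homI)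
  qed
  obtain \<psi> where ps: "\<psi> \<in> hom E0 PE" "\<And>g. g \<in> carrier G \<Longrightarrow> \<psi> (\<iota>1 g) = l1 g" "\<And>g. g \<in> carrier G \<Longrightarrow> \<psi> (\<iota>2 g) = l2 g"
    by (rule E0_universal[OF PE.group_axioms l1(1) l2(1)]; (rule cen)?; (rule that)?)
      (assumption | erule hom_in_carrier[OF l1(1)] | erule hom_in_carrier[OF l2(1)])+
  have bg: "(base_gen q i, \<one>\<^sub>A) \<in> carrier G" "(\<one>\<^sub>A, base_gen q i) \<in> carrier G" if "i < 4" for i using base_gen_closed[OF that] by auto
  have psg: "\<psi> (E0_gen i) = pg i" if "i < 16" for i
    using split16[OF that] by (elim disjE exE conjE) (simp_all only: E0_gen ps bg l1(2,3) l2(2,3))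
  have pt: "(\<psi> \<circ> \<theta>) x = x" if x: "x \<in> carrier PE" for x
    by (rule hom_eq_on_generators[where f = "\<psi> \<circ> \<theta>" and g = "\<lambda>x. x", OF generates_presented_group PE.group_axioms PE.group_axioms hom_compose[OF th(1) ps(1)] _ _ x])
      (auto intro!: homI simp: th psg)
  have tG: "(\<theta> \<circ> l1) g = \<iota>1 g" "(\<theta> \<circ> l2) g = \<iota>2 g" if g: "g \<in> carrier G" for g
  proof -
    have e: "(\<theta> \<circ> l1) b = \<iota>1 b" "(\<theta> \<circ> l2) b = \<iota>2 b" if "b \<in> (\<lambda>i. (base_gen q i, \<one>\<^sub>A)) ` {..<4} \<union> (\<lambda>i. (\<one>\<^sub>A, base_gen q i)) ` {..<4}" for b
      using that th(2) by (auto simp: l1 l2 E0_gen[simplified])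
    show "(\<theta> \<circ> l1) g = \<iota>1 g" by (rule hom_eq_on_generators[where f = "\<theta> \<circ> l1", OF generates_G G.group_axioms ee.P.group_axioms hom_compose[OF l1(1) th(1)] iota_hom(1) e(1) g])
    show "(\<theta> \<circ> l2) g = \<iota>2 g" by (rule hom_eq_on_generators[where f = "\<theta> \<circ> l2", OF generates_G G.group_axioms ee.P.group_axioms hom_compose[OF l2(1) th(1)] iota_hom(2) e(2) g])
  qed
  have tp: "(\<theta> \<circ> \<psi>) x = x" if x: "x \<in> carrier E0" for x
  proof (rule hom_eq_on_generators[where f = "\<theta> \<circ> \<psi>" and g = "\<lambda>x. x", OF generates_E0 ee.P.group_axioms ee.P.group_axioms hom_compose[OF ps(1) th(1)] _ _ x])
    show "(\<lambda>x. x) \<in> hom E0 E0" by (rule homI) simp_all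
    show "(\<theta> \<circ> \<psi>) b = b" if "b \<in> \<iota>1 ` carrier G \<union> \<iota>2 ` carrier G" for b
      using that by (elim UnE imageE) (use tG in \<open>simp_all add: ps del: carrier_DirProd\<close>)
  qed
  have "bij_betw \<psi> (carrier E0) (carrier PE)"
    by (rule bij_betw_byWitness[where f' = \<theta>]) (use pt tp hom_in_carrier[OF th(1)] hom_in_carrier[OF ps(1)] in auto)
  then show ?thesis using ps(1) by (auto simp: is_iso_def iso_def)
qed

end

lemma (in uce_model) finitely_presented_E: "finitely_presented E"
proof -
  have "E \<cong> E0" using k'(1) by (auto simp: is_iso_def)
  then have "E \<cong> PE" by (rule iso_trans[OF _ E0_presented])
  then show ?thesis unfolding finitely_presented_def using finite_E0_rel E0_rel_gwords by blast
qed

section \<open>Low-dimensional homology\<close>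

lemma bar_boundary_lists:
  "bar_boundary G (Poly_Mapping.single [g] a) = 0"
  "bar_boundary G (Poly_Mapping.single [g, h] a) = Poly_Mapping.single [h] a - Poly_Mapping.single [g \<otimes>\<^sub>G h] a + Poly_Mapping.single [g] a"
  "bar_boundary G (Poly_Mapping.single [g, h, k] a) = Poly_Mapping.single [h, k] a - Poly_Mapping.single [g \<otimes>\<^sub>G h, k] a
    + Poly_Mapping.single [g, h \<otimes>\<^sub>G k] a - Poly_Mapping.single [g, h] a"
  "bar_boundary G (Poly_Mapping.single [g, h, k, l] a) = Poly_Mapping.single [h, k, l] a - Poly_Mapping.single [g \<otimes>\<^sub>G h, k, l] a
    + Poly_Mapping.single [g, h \<otimes>\<^sub>G k, l] a - Poly_Mapping.single [g, h, k \<otimes>\<^sub>G l] a + Poly_Mapping.single [g, h, k] a"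
  by (simp_all add: bar_boundary_single bar_term_def bar_face_def atMost_Suc single_uminus)

lemma bar_chains_induct [consumes 1, case_names zero add single]:
  assumes c: "c \<in> bar_chains G n" and P0: "P 0" and Padd: "\<And>c d. P c \<Longrightarrow> P d \<Longrightarrow> P (c + d)"
    and single: "\<And>gs a. length gs = n \<Longrightarrow> set gs \<subseteq> carrier G \<Longrightarrow> P (Poly_Mapping.single gs a)"
  shows "P c"
proof -
  have "P (\<Sum>gs\<in>K. Poly_Mapping.single gs (Poly_Mapping.lookup c gs))" if "finite K" "K \<subseteq> Poly_Mapping.keys c" for K
    using that by (induction K) (use P0 Padd single c in \<open>auto simp: bar_chains_def subset_iff\<close>)
  moreover have "c = (\<Sum>gs\<in>Poly_Mapping.keys c. Poly_Mapping.single gs (Poly_Mapping.lookup c gs))"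
    by (rule poly_mapping_eqI) (simp add: lookup_sum lookup_single when_def in_keys_iff)
  ultimately show ?thesis using finite_keys by (metis order_refl)
qed

lemma bar_boundaries_closed:
  shows "0 \<in> bar_boundaries G n" "x \<in> bar_boundaries G n \<Longrightarrow> y \<in> bar_boundaries G n \<Longrightarrow> x + y \<in> bar_boundaries G n"
    "x \<in> bar_boundaries G n \<Longrightarrow> scl r x \<in> bar_boundaries G n" "x \<in> bar_boundaries G n \<Longrightarrow> - x \<in> bar_boundaries G n"
    "x \<in> bar_boundaries G n \<Longrightarrow> y \<in> bar_boundaries G n \<Longrightarrow> x - y \<in> bar_boundaries G n"
proof -
  show "0 \<in> bar_boundaries G n"
    unfolding bar_boundaries_def by (rule image_eqI[of _ _ 0]) (simp_all add: bar_chains_closed)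
  show add: "x + y \<in> bar_boundaries G n" if "x \<in> bar_boundaries G n" "y \<in> bar_boundaries G n" for x y
    using that unfolding bar_boundaries_def by (auto simp: bar_boundary_add[symmetric] bar_chains_closed)
  show scl: "scl r x \<in> bar_boundaries G n" if "x \<in> bar_boundaries G n" for x r
    using that unfolding bar_boundaries_def by (auto simp: bar_boundary_scl[symmetric] bar_chains_closed)
  show neg: "- x \<in> bar_boundaries G n" if "x \<in> bar_boundaries G n" for x
    using scl[OF that, of "- 1"] by (simp only: scl_simps)
  show "x - y \<in> bar_boundaries G n" if "x \<in> bar_boundaries G n" "y \<in> bar_boundaries G n"
    using add[OF that(1) neg[OF that(2)]] by simp
qed

lemma homology_trivialI:
  fixes G :: "('g, 'm) monoid_scheme"
  assumes "(bar_cycles G n :: ('g list \<Rightarrow>\<^sub>0 'r::comm_ring_1) set) \<subseteq> bar_boundaries G n"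
  shows "carrier (group_homology G n :: ('r, _) module) = {\<zero>\<^bsub>(group_homology G n :: ('r, _) module)\<^esub>}"
proof -
  let ?B = "bar_boundaries G n :: ('g list \<Rightarrow>\<^sub>0 'r) set"
  have eq: "{z + b | b. b \<in> ?B} = ?B" if z: "z \<in> ?B" for z
  proof (intro subset_antisym subsetI)
    fix x assume "x \<in> ?B"
    then have "x - z \<in> ?B" "x = z + (x - z)" using bar_boundaries_closed(5)[OF _ z] by simp_all
    then show "x \<in> {z + b | b. b \<in> ?B}" by blast
  qed (use z bar_boundaries_closed(2) in auto)
  have "(0 :: 'g list \<Rightarrow>\<^sub>0 'r) \<in> bar_cycles G n" by (simp add: bar_cycles_def bar_chains_closed)
  then have "\<exists>z\<in>bar_cycles G n. ?B = {z + b | b. b \<in> ?B}" using eq[OF bar_boundaries_closed(1)] by blast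
  then show ?thesis using assms eq unfolding group_homology_def by auto
qed

text \<open>Modulo boundaries the chain \<open>[g]\<close> is additive in \<open>g\<close>, so the
  elements for which it bounds form a subgroup, and this subgroup contains all commutators.\<close>

lemma perfect_H1:
  assumes G: "group G" "perfect G"
  shows "(bar_cycles G 1 :: ('g list \<Rightarrow>\<^sub>0 int) set) \<subseteq> bar_boundaries G 1"
proof
  interpret G: group G by (rule G(1))
  let ?B = "bar_boundaries G 1 :: ('g list \<Rightarrow>\<^sub>0 int) set"
  let ?s = "\<lambda>g. Poly_Mapping.single [g] (1::int)"
  note Bc = bar_boundaries_closed[where G = G and n = 1]
  have m: "?s g + ?s h - ?s (g \<otimes>\<^sub>G h) \<in> ?B" if "g \<in> carrier G" "h \<in> carrier G" for g h
    unfolding bar_boundaries_def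
    by (rule image_eqI[of _ _ "Poly_Mapping.single [g, h] 1"]) (use that in \<open>auto simp: bar_boundary_lists bar_chains_def\<close>)
  define N where "N = {g \<in> carrier G. ?s g \<in> ?B}"
  have one: "\<one>\<^sub>G \<in> N" using m[of "\<one>\<^sub>G" "\<one>\<^sub>G"] by (simp add: N_def)
  have pair: "?s (g \<otimes>\<^sub>G h) \<in> ?B \<longleftrightarrow> ?s g + ?s h \<in> ?B" if "g \<in> carrier G" "h \<in> carrier G" for g h
    using Bc(2)[OF m[OF that], of "?s (g \<otimes>\<^sub>G h)"] Bc(5)[OF _ m[OF that], of "?s g + ?s h"] by auto
  have inv: "?s g + ?s (inv\<^bsub>G\<^esub> g) \<in> ?B" if "g \<in> carrier G" for g
    using pair[of g "inv\<^bsub>G\<^esub> g"] that one by (simp add: N_def)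
  have N: "subgroup N G"
  proof (rule G.subgroupI)
    show "N \<noteq> {}" using one by blast
    show "inv\<^bsub>G\<^esub> g \<in> N" if "g \<in> N" for g
      using that inv[of g] Bc(5)[of "?s g + ?s (inv\<^bsub>G\<^esub> g)" "?s g"] by (simp add: N_def)
    show "g \<otimes>\<^sub>G h \<in> N" if "g \<in> N" "h \<in> N" for g h
      using that by (simp add: N_def pair Bc(2) del: One_nat_def)
  qed (auto simp: N_def)
  have "g \<in> N" if "g \<in> carrier G" for g
  proof (rule perfectD[OF G(2) N _ that])
    fix x y assume xy: "x \<in> carrier G" "y \<in> carrier G"
    let ?u = "x \<otimes>\<^sub>G y" let ?v = "inv\<^bsub>G\<^esub> x" let ?w = "inv\<^bsub>G\<^esub> y"
    \<comment> \<open>The commutator is the sum of its four letters up to three boundaries of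
      products, and the letters cancel in pairs with their inverses.\<close>
    have e: "?s (?u \<otimes>\<^sub>G ?v \<otimes>\<^sub>G ?w) = (?s x + ?s ?v) + (?s y + ?s ?w) - (?s x + ?s y - ?s ?u) - (?s ?u + ?s ?v - ?s (?u \<otimes>\<^sub>G ?v))
        - (?s (?u \<otimes>\<^sub>G ?v) + ?s ?w - ?s (?u \<otimes>\<^sub>G ?v \<otimes>\<^sub>G ?w))" by simp
    have "?s (?u \<otimes>\<^sub>G ?v \<otimes>\<^sub>G ?w) \<in> ?B"
      by (subst e) (use xy in \<open>intro Bc(2) Bc(5) m inv G.m_closed G.inv_closed\<close>)
    then show "commutator G x y \<in> N" using xy by (simp add: N_def commutator_def)
  qed
  then have s1: "?s g \<in> ?B" if "g \<in> carrier G" for g using that by (simp add: N_def)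
  have "c \<in> ?B" if "c \<in> bar_chains G 1" for c :: "'g list \<Rightarrow>\<^sub>0 int"
    using that
  proof (induction rule: bar_chains_induct)
    case (single gs a)
    then obtain g where g: "gs = [g]" "g \<in> carrier G" by (auto simp: length_Suc_conv)
    have "Poly_Mapping.single gs a = scl a (?s g)" by (auto intro!: poly_mapping_eqI simp: lookup_single when_def g)
    then show ?case using Bc(3)[OF s1[OF g(2)]] by simp
  qed (rule Bc(1), rule Bc(2))
  then show "c \<in> ?B" if "c \<in> bar_cycles G 1" for c using that by (simp add: bar_cycles_def)
qed

text \<open>A cocycle modulo \<open>B\<close> defines a central extension with kernel the quotient by \<open>B\<close>, realised on the
  representatives \<open>\<nu> c\<close>; a homomorphic section bounds the cocycle.\<close>

lemma cocycle_trivial: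
  fixes \<alpha> :: "'e \<Rightarrow> 'e \<Rightarrow> 'r::ab_group_add" and E :: "'e monoid"
  assumes E: "group E" and B: "0 \<in> B" "\<And>x y. x \<in> B \<Longrightarrow> y \<in> B \<Longrightarrow> x - y \<in> B"
    and cocycle: "\<And>g h k. g \<in> carrier E \<Longrightarrow> h \<in> carrier E \<Longrightarrow> k \<in> carrier E \<Longrightarrow>
      \<alpha> h k - \<alpha> (g \<otimes>\<^sub>E h) k + \<alpha> g (h \<otimes>\<^sub>E k) - \<alpha> g h \<in> B"
    and lift: "\<And>(H :: ('e \<times> 'r) monoid) \<rho>. group H \<Longrightarrow> \<rho> \<in> hom H E \<Longrightarrow>
      (\<And>k. k \<in> carrier H \<Longrightarrow> \<rho> k = \<one>\<^sub>E \<Longrightarrow> central H k) \<Longrightarrow> \<rho> ` carrier H = carrier E \<Longrightarrow>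
      \<exists>L\<in>hom E H. \<forall>x\<in>carrier E. \<rho> (L x) = x"
  shows "\<exists>s. \<forall>g\<in>carrier E. \<forall>h\<in>carrier E. \<alpha> g h + s g + s h - s (g \<otimes>\<^sub>E h) \<in> B"
proof -
  interpret E: group E by (rule E)
  have Bm: "- x \<in> B" if "x \<in> B" for x using B(2)[OF B(1) that] by simp
  have Ba: "x + y \<in> B" if "x \<in> B" "y \<in> B" for x y using B(2)[OF that(1) Bm[OF that(2)]] by simp
  \<comment> \<open>A canonical representative of each class modulo \<open>B\<close>. The extension
    can thus be realised on pairs of a group element and a chain, without sets of chains.\<close>
  define \<nu> where "\<nu> c = (SOME d. c - d \<in> B)" for c
  have nu: "c - \<nu> c \<in> B" for c unfolding \<nu>_def by (rule someI[of _ c]) (simp add: B)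
  have nu_eq: "\<nu> c = \<nu> d" if "c - d \<in> B" for c d
  proof -
    have "c - x \<in> B \<longleftrightarrow> d - x \<in> B" for x
      using Ba[OF that, of "d - x"] B(2)[OF _ that, of "c - x"] by auto
    then show ?thesis unfolding \<nu>_def by simp
  qed
  have nu_nu: "\<nu> (\<nu> c + x) = \<nu> (c + x)" for c x using Bm[OF nu[of c]] by (intro nu_eq) simp
  have nu_nu': "\<nu> (x + \<nu> c) = \<nu> (x + c)" for c x using nu_nu[of c x] by (simp add: add.commute)
  have nu_id: "\<nu> c = c" if "c \<in> range \<nu>" for c using that nu_nu[of _ 0] by auto
  define H where "H = \<lparr>carrier = carrier E \<times> range \<nu>,
    monoid.mult = (\<lambda>(g, c) (h, d). (g \<otimes>\<^sub>E h, \<nu> (c + d + \<alpha> g h))), one = (\<one>\<^sub>E, \<nu> (- \<alpha> \<one>\<^sub>E \<one>\<^sub>E))\<rparr>"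
  have car: "carrier H = carrier E \<times> range \<nu>" and one: "\<one>\<^sub>H = (\<one>\<^sub>E, \<nu> (- \<alpha> \<one>\<^sub>E \<one>\<^sub>E))"
    and mult: "(g, c) \<otimes>\<^sub>H (h, d) = (g \<otimes>\<^sub>E h, \<nu> (c + d + \<alpha> g h))" for g c h d
    by (simp_all add: H_def)
  \<comment> \<open>The cocycle is not normalised. Its values with one argument equal to the
    identity agree modulo \<open>B\<close> with the value at two identities, which explains the unit
    of \<open>H\<close>.\<close>
  have al: "\<alpha> \<one>\<^sub>E h - \<alpha> \<one>\<^sub>E \<one>\<^sub>E \<in> B" "\<alpha> h \<one>\<^sub>E - \<alpha> \<one>\<^sub>E \<one>\<^sub>E \<in> B" if h: "h \<in> carrier E" for h
    using cocycle[of "\<one>\<^sub>E" "\<one>\<^sub>E" h] cocycle[of h "\<one>\<^sub>E" "\<one>\<^sub>E"] Bm[of "\<alpha> \<one>\<^sub>E \<one>\<^sub>E - \<alpha> h \<one>\<^sub>E"] h by simp_all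
  have H: "group H"
  proof (rule groupI)
    show "\<one>\<^sub>H \<in> carrier H" by (simp add: car one)
    fix x assume "x \<in> carrier H"
    then obtain g c where x: "x = (g, c)" "g \<in> carrier E" "c \<in> range \<nu>" by (auto simp: car)
    have "\<nu> (\<nu> (- \<alpha> \<one>\<^sub>E \<one>\<^sub>E) + (c + \<alpha> \<one>\<^sub>E g)) = \<nu> c"
      unfolding nu_nu using al(1)[OF x(2)] by (intro nu_eq) (simp add: algebra_simps)
    then show "\<one>\<^sub>H \<otimes>\<^sub>H x = x" using x(2) nu_id[OF x(3)] by (simp add: x(1) one mult add.assoc)
    let ?y = "(inv\<^bsub>E\<^esub> g, \<nu> (- c - \<alpha> (inv\<^bsub>E\<^esub> g) g - \<alpha> \<one>\<^sub>E \<one>\<^sub>E))"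
    have "?y \<otimes>\<^sub>H x = \<one>\<^sub>H" "?y \<in> carrier H"
      using x(2) nu_nu[of "- c - \<alpha> (inv\<^bsub>E\<^esub> g) g - \<alpha> \<one>\<^sub>E \<one>\<^sub>E" "c + \<alpha> (inv\<^bsub>E\<^esub> g) g"]
      by (simp_all add: x(1) mult one car add.assoc)
    then show "\<exists>y\<in>carrier H. y \<otimes>\<^sub>H x = \<one>\<^sub>H" by blast
    fix y z assume "y \<in> carrier H" "z \<in> carrier H"
    then obtain h d k e where y: "y = (h, d)" "z = (k, e)" "h \<in> carrier E" "k \<in> carrier E" by (auto simp: car)
    show "x \<otimes>\<^sub>H y \<in> carrier H" using x(2) y(3) by (simp add: x(1) y(1) mult car)
    have "\<nu> (\<nu> (c + d + \<alpha> g h) + (e + \<alpha> (g \<otimes>\<^sub>E h) k)) = \<nu> (c + \<alpha> g (h \<otimes>\<^sub>E k) + \<nu> (d + e + \<alpha> h k))"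
      unfolding nu_nu nu_nu' using Bm[OF cocycle[OF x(2) y(3,4)]] by (intro nu_eq) (simp add: algebra_simps)
    then show "x \<otimes>\<^sub>H y \<otimes>\<^sub>H z = x \<otimes>\<^sub>H (y \<otimes>\<^sub>H z)"
      using x(2) y(3,4) by (simp add: x(1) y(1,2) mult E.m_assoc add_ac)
  qed
  have "\<exists>L\<in>hom E H. \<forall>x\<in>carrier E. fst (L x) = x"
  proof (rule lift[OF H])
    show "fst \<in> hom H E" by (rule homI) (auto simp: car mult)
    show "fst ` carrier H = carrier E" by (auto simp: car)
    fix k assume k: "k \<in> carrier H" "fst k = \<one>\<^sub>E"
    then obtain c where c: "k = (\<one>\<^sub>E, c)" by (cases k) simp
    have "\<nu> (c + d + \<alpha> \<one>\<^sub>E h) = \<nu> (d + c + \<alpha> h \<one>\<^sub>E)" if "h \<in> carrier E" for h d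
      using B(2)[OF al[OF that]] by (intro nu_eq) (simp add: algebra_simps)
    then show "central H k" using k(1) by (auto simp: central_def c car mult)
  qed
  then obtain L where L: "L \<in> hom E H" "\<And>x. x \<in> carrier E \<Longrightarrow> fst (L x) = x" by blast
  have "\<alpha> g h + snd (L g) + snd (L h) - snd (L (g \<otimes>\<^sub>E h)) \<in> B" if gh: "g \<in> carrier E" "h \<in> carrier E" for g h
  proof -
    have "L (g \<otimes>\<^sub>E h) = (g, snd (L g)) \<otimes>\<^sub>H (h, snd (L h))" using hom_mult[OF L(1) gh] L(2)[OF gh(1)] L(2)[OF gh(2)] by (metis prod.collapse)
    then show ?thesis using nu[of "snd (L g) + snd (L h) + \<alpha> g h"] by (simp add: mult algebra_simps)
  qed
  then show ?thesis by (intro exI[of _ "\<lambda>g. snd (L g)"]) blast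
qed

definition lin :: "('k \<Rightarrow> ('j \<Rightarrow>\<^sub>0 'r)) \<Rightarrow> ('k \<Rightarrow>\<^sub>0 'r::comm_ring_1) \<Rightarrow> ('j \<Rightarrow>\<^sub>0 'r)" where
  "lin s c = (\<Sum>k\<in>Poly_Mapping.keys c. scl (Poly_Mapping.lookup c k) (s k))"

lemma scl_zero_left [simp]: "scl 0 x = 0"
  by (auto intro!: poly_mapping_eqI)

lemma lin_superset: "finite K \<Longrightarrow> Poly_Mapping.keys c \<subseteq> K \<Longrightarrow> lin s c = (\<Sum>k\<in>K. scl (Poly_Mapping.lookup c k) (s k))"
  unfolding lin_def by (rule sum.mono_neutral_left) (auto simp: in_keys_iff)

lemma lin_simps [simp]: "lin s 0 = 0" "lin s (c + d) = lin s c + lin s d" "lin s (Poly_Mapping.single k a) = scl a (s k)"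
  "lin s (- c) = - lin s c" "lin s (c - d) = lin s c - lin s d"
proof -
  show z: "lin s 0 = 0" by (simp add: lin_def)
  show add: "lin s (c + d) = lin s c + lin s d" for c d
  proof -
    let ?K = "Poly_Mapping.keys c \<union> Poly_Mapping.keys d"
    have K: "finite ?K" "Poly_Mapping.keys (c + d) \<subseteq> ?K" by (auto simp: Poly_Mapping.keys_add)
    show ?thesis by (subst (1 2 3) lin_superset[OF K(1)]) (use K in \<open>auto simp: lookup_add scl_simps sum.distrib\<close>)
  qed
  show "lin s (Poly_Mapping.single k a) = scl a (s k)"
    by (subst lin_superset[of "{k}"]) auto
  show m: "lin s (- c) = - lin s c" for c using add[of c "- c"] z by (simp add: eq_neg_iff_add_eq_0 add.commute)
  show "lin s (c - d) = lin s c - lin s d" using add[of c "- d"] m[of d] by simp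
qed

text \<open>The symbol \<open>[g, h]\<close> modulo boundaries is a tautological 2-cocycle. A
  section of its extension provides a linear correction through the boundary that makes every
  2-chain bound; on a cycle this correction is zero.\<close>

lemma lifting_H2:
  fixes E :: "'e monoid"
  assumes E: "group E"
    and lift: "\<And>(H :: ('e \<times> ('e list \<Rightarrow>\<^sub>0 int)) monoid) \<rho>. group H \<Longrightarrow> \<rho> \<in> hom H E \<Longrightarrow>
      (\<And>k. k \<in> carrier H \<Longrightarrow> \<rho> k = \<one>\<^sub>E \<Longrightarrow> central H k) \<Longrightarrow> \<rho> ` carrier H = carrier E \<Longrightarrow>
      \<exists>L\<in>hom E H. \<forall>x\<in>carrier E. \<rho> (L x) = x"
  shows "(bar_cycles E 2 :: ('e list \<Rightarrow>\<^sub>0 int) set) \<subseteq> bar_boundaries E 2"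
proof
  let ?B = "bar_boundaries E 2 :: ('e list \<Rightarrow>\<^sub>0 int) set"
  let ?s = "\<lambda>gs. Poly_Mapping.single gs (1::int)"
  note Bc = bar_boundaries_closed[where G = E and n = 2]
  have "?s [h, k] - ?s [g \<otimes>\<^sub>E h, k] + ?s [g, h \<otimes>\<^sub>E k] - ?s [g, h] \<in> ?B"
    if "g \<in> carrier E" "h \<in> carrier E" "k \<in> carrier E" for g h k
    unfolding bar_boundaries_def
    by (rule image_eqI[of _ _ "?s [g, h, k]"]) (use that in \<open>auto simp: bar_boundary_lists bar_chains_def\<close>)
  from cocycle_trivial[OF E Bc(1,5) this lift] obtain s
    where s: "\<And>g h. g \<in> carrier E \<Longrightarrow> h \<in> carrier E \<Longrightarrow> ?s [g, h] + s g + s h - s (g \<otimes>\<^sub>E h) \<in> ?B" by blast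
  have "c + lin (\<lambda>gs. s (hd gs)) (bar_boundary E c) \<in> ?B" if "c \<in> bar_chains E 2" for c
    using that
  proof (induction rule: bar_chains_induct)
    case zero then show ?case using Bc(1) by simp
  next
    case (add c d)
    from Bc(2)[OF this] show ?case by (simp add: bar_boundary_add algebra_simps)
  next
    case (single gs a)
    then obtain g h where g: "gs = [g, h]" "g \<in> carrier E" "h \<in> carrier E" by (auto simp: length_Suc_conv numeral_2_eq_2)
    have "Poly_Mapping.single gs a = scl a (?s [g, h])" by (auto intro!: poly_mapping_eqI simp: lookup_single when_def g)
    moreover have "lin (\<lambda>gs. s (hd gs)) (bar_boundary E (Poly_Mapping.single gs a)) = scl a (s g) + scl a (s h) - scl a (s (g \<otimes>\<^sub>E h))"
      by (simp add: g(1) bar_boundary_lists)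
    moreover have "scl a (x - y) = scl a x - scl a y" for x y :: "'e list \<Rightarrow>\<^sub>0 int"
      by (simp only: eq_diff_eq scl_simps(1)[symmetric] diff_add_cancel)
    ultimately have "Poly_Mapping.single gs a + lin (\<lambda>gs. s (hd gs)) (bar_boundary E (Poly_Mapping.single gs a))
        = scl a (?s [g, h] + s g + s h - s (g \<otimes>\<^sub>E h))" by (simp add: scl_simps)
    then show ?case using Bc(3)[OF s[OF g(2,3)]] by simp
  qed
  then show "c \<in> ?B" if "c \<in> bar_cycles E 2" for c using that unfolding bar_cycles_def by fastforce
qed

lemma (in uce_model) super_perfect_E: "super_perfect E"
proof -
  have lift: "\<exists>L\<in>hom E H. \<forall>x\<in>carrier E. \<rho> (L x) = x"
    if H: "group H" "\<rho> \<in> hom H E" "\<And>k. k \<in> carrier H \<Longrightarrow> \<rho> k = \<one>\<^sub>E \<Longrightarrow> central H k" "\<rho> ` carrier H = carrier E"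
    for H :: "('e \<times> ('e list \<Rightarrow>\<^sub>0 int)) monoid" and \<rho>
  proof -
    have id: "(\<lambda>x. x) \<in> hom E E" "(\<lambda>x. x) ` carrier E \<subseteq> \<rho> ` carrier H" using H(4) by (auto intro!: homI)
    obtain L where "L \<in> hom E H" "\<And>x. x \<in> carrier E \<Longrightarrow> \<rho> (L x) = x"
      by (rule E_lift[OF H(1) E H(2,3) id], assumption, assumption, rule that)
    then show ?thesis by blast
  qed
  show ?thesis
    unfolding super_perfect_def
    using homology_trivialI[OF perfect_H1[OF E perfect_E]] homology_trivialI[OF lifting_H2[OF E lift]] by blast
qed

section \<open>The third homology group\<close>

text \<open>An Alexander-Whitney cup product. On the simplex with vertices 1, g, gh, ghk the
  derivation is read on the first edge and the homogeneous 2-cocycle \<Phi> on the opposite face.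
  Equivariance of \<Phi> undoes the translation that the derivation rule produces.\<close>

lemma derivation_cocycle:
  fixes T :: "'p \<Rightarrow> ('x \<Rightarrow> 'r::ab_group_add) \<Rightarrow> 'r"
  assumes P: "group P" and T: "derivation P act T"
    and eq: "\<And>X g a b c. g \<in> carrier P \<Longrightarrow> a \<in> carrier P \<Longrightarrow> b \<in> carrier P \<Longrightarrow> c \<in> carrier P \<Longrightarrow>
      \<Phi> (act g X) (g \<otimes>\<^sub>P a) (g \<otimes>\<^sub>P b) (g \<otimes>\<^sub>P c) = \<Phi> X a b c"
    and coc: "\<And>X a b c d. \<Phi> X b c d - \<Phi> X a c d + \<Phi> X a b d - \<Phi> X a b c = 0"
    and F: "\<And>g h k. F g h k = T g (\<lambda>X. \<Phi> X g (g \<otimes>\<^sub>P h) (g \<otimes>\<^sub>P h \<otimes>\<^sub>P k))"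
    and g: "g \<in> carrier P" "h \<in> carrier P" "k \<in> carrier P" "l \<in> carrier P"
  shows "F h k l - F (g \<otimes>\<^sub>P h) k l + F g (h \<otimes>\<^sub>P k) l - F g h (k \<otimes>\<^sub>P l) + F g h k = 0"
proof -
  interpret P: group P by (rule P)
  have add: "T g (\<lambda>X. u X + v X) = T g u + T g v" for u v
    using T g(1) unfolding derivation_def additive_functional_def by blast
  have diff: "T g (\<lambda>X. u X - v X) = T g u - T g v" for u v
    using add[of "\<lambda>X. u X - v X" v] by simp
  let ?b = "g \<otimes>\<^sub>P h" let ?c = "g \<otimes>\<^sub>P (h \<otimes>\<^sub>P k)" let ?d = "g \<otimes>\<^sub>P (h \<otimes>\<^sub>P (k \<otimes>\<^sub>P l))"
  have "F ?b k l = T g (\<lambda>X. \<Phi> X ?b ?c ?d) + T h (\<lambda>X. \<Phi> (act g X) ?b ?c ?d)"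
    using T g unfolding derivation_def by (simp add: F P.m_assoc)
  also have "T h (\<lambda>X. \<Phi> (act g X) ?b ?c ?d) = F h k l" using g by (simp add: F eq P.m_assoc)
  finally have "F h k l - F ?b k l + F g (h \<otimes>\<^sub>P k) l - F g h (k \<otimes>\<^sub>P l) + F g h k
      = - T g (\<lambda>X. \<Phi> X ?b ?c ?d) + T g (\<lambda>X. \<Phi> X g ?c ?d) - T g (\<lambda>X. \<Phi> X g ?b ?d) + T g (\<lambda>X. \<Phi> X g ?b ?c)"
    using g by (simp add: F P.m_assoc)
  also have "\<dots> = - T g (\<lambda>X. \<Phi> X ?b ?c ?d - \<Phi> X g ?c ?d + \<Phi> X g ?b ?d - \<Phi> X g ?b ?c)"
    by (simp add: add diff)
  finally show ?thesis using add[of "\<lambda>_. 0" "\<lambda>_. 0"] by (simp add: coc)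
qed

section \<open>A 3-cocycle on \<Delta> with values in the Laurent polynomials\<close>

context fibre begin

lemma i1_inj: "inj_on dd.i1 (carrier G)"
proof (rule dd.inclusions_injective(1)[where Cg = "G\<lparr>carrier := S\<rparr>"])
  show "countable (carrier G)" "countable (carrier G)" using countable_base by simp_all
  show "(\<lambda>s. s) \<in> hom (G\<lparr>carrier := S\<rparr>) G" "(\<lambda>s. s) \<in> hom (G\<lparr>carrier := S\<rparr>) G"
    by (rule homI; simp add: SG del: carrier_DirProd)+
qed (simp_all add: G.subgroup_imp_group[OF subgroup_S])

abbreviation "SD \<equiv> dd.i1 ` S"

lemma subgroup_SD: "subgroup SD \<Delta>"
proof -
  interpret s: group_hom "G\<lparr>carrier := S\<rparr>" \<Delta> dd.i1
    by (rule group_homI[OF G.subgroup_imp_group[OF subgroup_S] dd.P.group_axioms])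
      (use dd.i1_hom SG in \<open>auto simp: hom_def Pi_iff simp del: carrier_DirProd\<close>)
  show ?thesis using s.img_is_subgroup by simp
qed

text \<open>A point is chosen in each right coset of \<open>S\<close>, and \<open>x\<close> is
  compared with the point of its own coset. The result is a map of sets that is equivariant for left
  multiplication by \<open>S\<close>, not a homomorphism.\<close>

definition "ret x = inv_into S dd.i1 (x \<otimes>\<^sub>\<Delta> inv\<^bsub>\<Delta>\<^esub> (SOME y. y \<in> SD #>\<^bsub>\<Delta>\<^esub> x))"

lemma ret:
  assumes x: "x \<in> carrier \<Delta>"
  shows "ret x \<in> S" and "s \<in> S \<Longrightarrow> ret (dd.i1 s \<otimes>\<^sub>\<Delta> x) = s \<otimes>\<^sub>G ret x"
proof -
  let ?y = "SOME y. y \<in> SD #>\<^bsub>\<Delta>\<^esub> x"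
  have iS: "dd.i1 s \<in> carrier \<Delta>" if "s \<in> S" for s using hom_in_carrier[OF dd.i1_hom SG[OF that]] .
  have "x \<in> SD #>\<^bsub>\<Delta>\<^esub> x" by (rule dd.P.rcos_self[OF x subgroup_SD])
  then have "?y \<in> SD #>\<^bsub>\<Delta>\<^esub> x" by (rule someI)
  then obtain t where t: "t \<in> S" "?y = dd.i1 t \<otimes>\<^sub>\<Delta> x" unfolding r_coset_def by blast
  have inj: "inj_on dd.i1 S" by (rule inj_on_subset[OF i1_inj]) (use SG in blast)
  have "x \<otimes>\<^sub>\<Delta> inv\<^bsub>\<Delta>\<^esub> ?y = inv\<^bsub>\<Delta>\<^esub> (dd.i1 t)"
    unfolding t(2) using x iS[OF t(1)] by (simp add: dd.P.inv_mult_group)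
  then have "x \<otimes>\<^sub>\<Delta> inv\<^bsub>\<Delta>\<^esub> ?y \<in> SD" using subgroup.m_inv_closed[OF subgroup_SD imageI[OF t(1)]] by simp
  then obtain a where a: "a \<in> S" "dd.i1 a = x \<otimes>\<^sub>\<Delta> inv\<^bsub>\<Delta>\<^esub> ?y" by (rule imageE) (rule that, assumption, rule HOL.sym)
  have yc: "?y \<in> carrier \<Delta>" unfolding t(2) using iS[OF t(1)] x by simp
  have ra: "ret x = a" unfolding ret_def a(2)[symmetric] by (rule inv_into_f_f[OF inj a(1)])
  then show "ret x \<in> S" using a(1) by simp
  assume s: "s \<in> S"
  have cos: "SD #>\<^bsub>\<Delta>\<^esub> (dd.i1 s \<otimes>\<^sub>\<Delta> x) = SD #>\<^bsub>\<Delta>\<^esub> x"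
    using dd.P.coset_mult_assoc[OF subgroup.subset[OF subgroup_SD] iS[OF s] x] dd.P.coset_join2[OF iS[OF s] subgroup_SD imageI[OF s]] by simp
  have "dd.i1 s \<otimes>\<^sub>\<Delta> x \<otimes>\<^sub>\<Delta> inv\<^bsub>\<Delta>\<^esub> ?y = dd.i1 (s \<otimes>\<^sub>G a)"
    unfolding hom_mult[OF dd.i1_hom SG[OF s] SG[OF a(1)]] a(2) using iS[OF s] x yc by (simp add: dd.P.m_assoc)
  then have "ret (dd.i1 s \<otimes>\<^sub>\<Delta> x) = s \<otimes>\<^sub>G a"
    unfolding ret_def cos by (simp only: inv_into_f_f[OF inj subgroup.m_closed[OF subgroup_S s a(1)]])
  then show "ret (dd.i1 s \<otimes>\<^sub>\<Delta> x) = s \<otimes>\<^sub>G ret x" using ra by simp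
qed

text \<open>A 0-cochain that continues the Fox derivative to \<Delta>. Left translation by
  \<open>S\<close> acts on it by an affine map, so its differences are merely multiplied by a power
  of the variable.\<close>

definition "PP x = d1 (fst (ret x))"
definition "QQ x = d2 (snd (ret x))"

lemma PQ_mult:
  assumes "(u, v) \<in> S" "x \<in> carrier \<Delta>"
  shows "PP (dd.i1 (u, v) \<otimes>\<^sub>\<Delta> x) = d1 u + tpow (f1 u) * PP x" "QQ (dd.i1 (u, v) \<otimes>\<^sub>\<Delta> x) = d2 v + tpow (f2 v) * QQ x"
proof -
  obtain a b where ab: "ret x = (a, b)" by (cases "ret x")
  then have "a \<in> F" "b \<in> F" using ret(1)[OF assms(2)] by (simp_all add: S_iff)
  then show "PP (dd.i1 (u, v) \<otimes>\<^sub>\<Delta> x) = d1 u + tpow (f1 u) * PP x" "QQ (dd.i1 (u, v) \<otimes>\<^sub>\<Delta> x) = d2 v + tpow (f2 v) * QQ x"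
    using assms(1) fox1D(10) fox2D(10) by (simp_all add: PP_def QQ_def ret(2)[OF assms(2,1)] ab S_iff)
qed

text \<open>The factors \<open>tpow (f1 u)\<close> and \<open>tpow (f2 v)\<close> cancel because \<open>f1 u + f2 v = 0\<close> on \<open>S\<close>.\<close>

definition "PQ a b c = (PP b - PP a) * (QQ c - QQ b)"

lemma PQ_invariant:
  assumes "s \<in> SD" "a \<in> carrier \<Delta>" "b \<in> carrier \<Delta>" "c \<in> carrier \<Delta>"
  shows "PQ (s \<otimes>\<^sub>\<Delta> a) (s \<otimes>\<^sub>\<Delta> b) (s \<otimes>\<^sub>\<Delta> c) = PQ a b c"
proof -
  obtain u v where uv: "s = dd.i1 (u, v)" "(u, v) \<in> S" using assms(1) by auto
  have "tpow (f1 u) * tpow (f2 v) = 1" using uv(2) by (simp add: tpow_add[symmetric] S_iff)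
  then have "tpow (f1 u) * x * (tpow (f2 v) * y) = x * y" for x y by (metis mult.assoc mult.commute mult_1)
  from this[of "PP b - PP a" "QQ c - QQ b"] show ?thesis
    unfolding uv(1) by (simp add: PQ_def PQ_mult[OF uv(2)] assms algebra_simps)
qed

text \<open>Induction from \<open>S\<close> to \<Delta>: on the coset of \<open>w\<close> all
  vertices are moved back by \<open>w\<close>, and invariance of \<open>PQ\<close> under
  \<open>S\<close> makes the choice of \<open>w\<close> immaterial.\<close>

definition "\<Phi> X a b c = (if X \<in> lcosets \<Delta> SD then
  let w = inv\<^bsub>\<Delta>\<^esub> (SOME w. w \<in> carrier \<Delta> \<and> X = w <#\<^bsub>\<Delta>\<^esub> SD) in PQ (w \<otimes>\<^sub>\<Delta> a) (w \<otimes>\<^sub>\<Delta> b) (w \<otimes>\<^sub>\<Delta> c) else 0)"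

lemma Phi_coset:
  assumes w: "w \<in> carrier \<Delta>" and abc: "a \<in> carrier \<Delta>" "b \<in> carrier \<Delta>" "c \<in> carrier \<Delta>"
  shows "\<Phi> (w <#\<^bsub>\<Delta>\<^esub> SD) a b c = PQ (inv\<^bsub>\<Delta>\<^esub> w \<otimes>\<^sub>\<Delta> a) (inv\<^bsub>\<Delta>\<^esub> w \<otimes>\<^sub>\<Delta> b) (inv\<^bsub>\<Delta>\<^esub> w \<otimes>\<^sub>\<Delta> c)"
proof -
  let ?v = "SOME v. v \<in> carrier \<Delta> \<and> w <#\<^bsub>\<Delta>\<^esub> SD = v <#\<^bsub>\<Delta>\<^esub> SD"
  have v: "?v \<in> carrier \<Delta> \<and> w <#\<^bsub>\<Delta>\<^esub> SD = ?v <#\<^bsub>\<Delta>\<^esub> SD" by (rule someI[of _ w]) (simp add: w)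
  obtain s where s: "s \<in> SD" "w = ?v \<otimes>\<^sub>\<Delta> s"
    using iffD1[OF dd.P.lcos_eq_iff[OF subgroup_SD conjunct1[OF v] w] conjunct2[OF v, symmetric]] by (rule bexE)
  have sc: "s \<in> carrier \<Delta>" by (rule subgroup.mem_carrier[OF subgroup_SD s(1)])
  have e: "inv\<^bsub>\<Delta>\<^esub> ?v \<otimes>\<^sub>\<Delta> x = s \<otimes>\<^sub>\<Delta> (inv\<^bsub>\<Delta>\<^esub> w \<otimes>\<^sub>\<Delta> x)" if "x \<in> carrier \<Delta>" for x
    by (subst s(2)) (use v sc that in \<open>simp add: dd.P.inv_mult_group dd.P.m_assoc\<close>)
  have "w <#\<^bsub>\<Delta>\<^esub> SD \<in> lcosets \<Delta> SD" using w by (simp add: lcosets_def)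
  then have "\<Phi> (w <#\<^bsub>\<Delta>\<^esub> SD) a b c = PQ (inv\<^bsub>\<Delta>\<^esub> ?v \<otimes>\<^sub>\<Delta> a) (inv\<^bsub>\<Delta>\<^esub> ?v \<otimes>\<^sub>\<Delta> b) (inv\<^bsub>\<Delta>\<^esub> ?v \<otimes>\<^sub>\<Delta> c)"
    unfolding \<Phi>_def Let_def by (rule if_P)
  also have "\<dots> = PQ (inv\<^bsub>\<Delta>\<^esub> w \<otimes>\<^sub>\<Delta> a) (inv\<^bsub>\<Delta>\<^esub> w \<otimes>\<^sub>\<Delta> b) (inv\<^bsub>\<Delta>\<^esub> w \<otimes>\<^sub>\<Delta> c)"
    unfolding e[OF abc(1)] e[OF abc(2)] e[OF abc(3)] by (intro PQ_invariant s(1) dd.P.m_closed dd.P.inv_closed w abc)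
  finally show ?thesis .
qed

lemma Phi_equivariant:
  assumes "g \<in> carrier \<Delta>" "a \<in> carrier \<Delta>" "b \<in> carrier \<Delta>" "c \<in> carrier \<Delta>"
  shows "\<Phi> (lact \<Delta> SD g X) (g \<otimes>\<^sub>\<Delta> a) (g \<otimes>\<^sub>\<Delta> b) (g \<otimes>\<^sub>\<Delta> c) = \<Phi> X a b c"
proof (cases "X \<in> lcosets \<Delta> SD")
  case True
  then obtain w where w: "w \<in> carrier \<Delta>" "X = w <#\<^bsub>\<Delta>\<^esub> SD" by (auto simp: lcosets_def)
  have "inv\<^bsub>\<Delta>\<^esub> (g \<otimes>\<^sub>\<Delta> w) \<otimes>\<^sub>\<Delta> (g \<otimes>\<^sub>\<Delta> x) = inv\<^bsub>\<Delta>\<^esub> w \<otimes>\<^sub>\<Delta> x" if "x \<in> carrier \<Delta>" for x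
    using that assms(1) w(1) by (simp add: dd.P.inv_mult_group dd.P.m_assoc)
  then show ?thesis
    unfolding w(2) dd.P.lact_coset[OF subgroup_SD assms(1) w(1)] using assms w(1) by (simp add: Phi_coset)
qed (simp add: lact_def \<Phi>_def)

text \<open>For each coset separately \<Phi> is a cup product of the coboundaries of two 0-cochains,
  so its own coboundary vanishes as a polynomial identity.\<close>

lemma Phi_cocycle: "\<Phi> X b c d - \<Phi> X a c d + \<Phi> X a b d - \<Phi> X a b c = 0"
  by (simp add: \<Phi>_def Let_def PQ_def algebra_simps)

text \<open>As \<open>d1\<close> vanishes on \<open>x1\<close>, conjugation by \<open>x1\<close>
  just multiplies the derivative of \<open>y1\<close> by the variable.\<close>

lemma d1_conj: "d1 (x1 [^]\<^sub>A n \<otimes>\<^sub>A y1 \<otimes>\<^sub>A inv\<^bsub>A\<^esub> (x1 [^]\<^sub>A n)) = tpow (int n)" for n :: nat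
proof -
  have xn: "x1 [^]\<^sub>A n \<in> F" for n :: nat using F_pow[OF fox1D(1), of "int n"] by (simp add: int_pow_int)
  have f: "f1 (x1 [^]\<^sub>A n) = int n" for n :: nat using F_hom_pow(1)[OF fox1D(1), of "int n"] fox1D(4) by (simp add: int_pow_int)
  have d1: "d1 \<one>\<^sub>A = 0" using fox1D(10)[OF F_closed(3) F_closed(3)] by (simp add: F_homs)
  have d: "d1 (x1 [^]\<^sub>A n) = 0" for n :: nat by (induction n) (simp_all add: d1 fox1D xn)
  let ?x = "x1 [^]\<^sub>A n"
  let ?y = "?x \<otimes>\<^sub>A y1 \<otimes>\<^sub>A inv\<^bsub>A\<^esub> ?x"
  \<comment> \<open>Cancelling the inverse first means that the product rule is applied to
    \<open>?y\<close> and \<open>?x\<close> only.\<close>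
  have "?y \<otimes>\<^sub>A ?x = ?x \<otimes>\<^sub>A y1" using FA[OF xn] FA[OF fox1D(2)] by (simp add: A.m_assoc)
  then have "d1 (?y \<otimes>\<^sub>A ?x) = d1 (?x \<otimes>\<^sub>A y1)" by simp
  then show ?thesis using xn[of n] fox1D(2) F_closed by (simp add: fox1D f d)
qed

text \<open>\<open>W\<close> is the cup product of the tree derivation with \<Phi>. At the image of
  the n-th power of \<open>x1\<close> in the second copy the derivation is the base coset minus its
  translate. Seen from the base coset the pair of y1 and y2 has weight t^n, seen from the translate
  it has weight 1.\<close>

lemma cocycle_exists:
  obtains W where "\<And>g h k l. g \<in> carrier \<Delta> \<Longrightarrow> h \<in> carrier \<Delta> \<Longrightarrow> k \<in> carrier \<Delta> \<Longrightarrow> l \<in> carrier \<Delta> \<Longrightarrow>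
      W h k l - W (g \<otimes>\<^sub>\<Delta> h) k l + W g (h \<otimes>\<^sub>\<Delta> k) l - W g h (k \<otimes>\<^sub>\<Delta> l) + W g h k = (0 :: laurent)"
    "\<And>a g h. a \<in> carrier G \<Longrightarrow> W (dd.i1 a) g h = 0"
    "\<And>n. W (dd.i2 (x1 [^]\<^sub>A (n::nat), \<one>\<^sub>A)) (dd.i2 (y1, \<one>\<^sub>A)) (dd.i1 (\<one>\<^sub>A, y2))
      - W (dd.i2 (x1 [^]\<^sub>A n, \<one>\<^sub>A)) (dd.i1 (\<one>\<^sub>A, y2)) (dd.i2 (y1, \<one>\<^sub>A)) = tpow (int n) - 1"
proof -
  have sub: "subgroup (dd.i1 ` (\<lambda>s. s) ` S) \<Delta>" unfolding image_ident by (rule subgroup_SD)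
  obtain T :: "_ \<Rightarrow> (_ \<Rightarrow> laurent) \<Rightarrow> laurent" where T: "derivation \<Delta> (lact \<Delta> SD) T" "\<And>g k. g \<in> carrier G \<Longrightarrow> T (dd.i1 g) k = 0"
      "\<And>h k. h \<in> carrier G \<Longrightarrow> T (dd.i2 h) k = k SD - k (dd.i2 h <#\<^bsub>\<Delta>\<^esub> SD)"
    by (rule dd.amalgam_derivation[OF sub, where 'r = laurent, unfolded image_ident]) (rule that)
  define W where "W g h k = T g (\<lambda>X. \<Phi> X g (g \<otimes>\<^sub>\<Delta> h) (g \<otimes>\<^sub>\<Delta> h \<otimes>\<^sub>\<Delta> k))" for g h k
  show thesis
  proof (rule that)
    show "W h k l - W (g \<otimes>\<^sub>\<Delta> h) k l + W g (h \<otimes>\<^sub>\<Delta> k) l - W g h (k \<otimes>\<^sub>\<Delta> l) + W g h k = 0"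
      if "g \<in> carrier \<Delta>" "h \<in> carrier \<Delta>" "k \<in> carrier \<Delta>" "l \<in> carrier \<Delta>" for g h k l
      by (rule derivation_cocycle[where \<Phi> = \<Phi> and F = W, OF dd.P.group_axioms T(1) _ _ W_def that])
        (rule Phi_equivariant, assumption+, rule Phi_cocycle)
    show "W (dd.i1 a) g h = 0" if "a \<in> carrier G" for a g h unfolding W_def by (rule T(2)[OF that])
    fix n :: nat
    let ?x = "x1 [^]\<^sub>A n"
    have xF: "?x \<in> F" using F_pow[OF fox1D(1), of "int n"] by (simp add: int_pow_int)
    let ?y = "?x \<otimes>\<^sub>A y1 \<otimes>\<^sub>A inv\<^bsub>A\<^esub> ?x"
    have yF: "?y \<in> F" using xF fox1D(2) F_closed by simp
    define X where "X = dd.i2 (?x, \<one>\<^sub>A)"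
    define Y where "Y = dd.i2 (y1, \<one>\<^sub>A)"
    define V where "V = dd.i1 (\<one>\<^sub>A, y2)"
    \<comment> \<open>The conjugate of \<open>y1\<close> lies in \<open>S\<close> and hence in both
      copies of \<open>G\<close>. It turns the product of \<open>X\<close> and \<open>Y\<close> into
      an \<open>S\<close>-translate of \<open>X\<close>, to which the equivariance formulas
      apply.\<close>
    define Z where "Z = dd.i1 (?y, \<one>\<^sub>A)"
    have inS: "(y1, \<one>\<^sub>A) \<in> S" "(\<one>\<^sub>A, y2) \<in> S" "(?y, \<one>\<^sub>A) \<in> S"
      using yF xF fox1D(2) fox2D(2) F_closed by (simp_all add: S_iff F_homs fox1D fox2D)
    have G: "(?x, \<one>\<^sub>A) \<in> carrier G" using FA[OF xF] by simp
    note cl = hom_in_carrier[OF dd.i2_hom G] hom_in_carrier[OF dd.i1_hom SG[OF inS(1)]] hom_in_carrier[OF dd.i1_hom SG[OF inS(2)]] hom_in_carrier[OF dd.i1_hom SG[OF inS(3)]]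
    have Y1: "Y = dd.i1 (y1, \<one>\<^sub>A)" and V2: "V = dd.i2 (\<one>\<^sub>A, y2)" and Z2: "Z = dd.i2 (?y, \<one>\<^sub>A)"
      using dd.i1_i2[OF inS(1)] dd.i1_i2[OF inS(2)] dd.i1_i2[OF inS(3)] by (simp_all add: Y_def V_def Z_def)
    have c: "X \<in> carrier \<Delta>" "Y \<in> carrier \<Delta>" "V \<in> carrier \<Delta>" "Z \<in> carrier \<Delta>"
      using cl by (simp_all add: X_def Y1 V_def Z_def)
    have XY: "X \<otimes>\<^sub>\<Delta> Y = Z \<otimes>\<^sub>\<Delta> X"
      unfolding X_def Y_def Z2 hom_mult[OF dd.i2_hom G SG[OF inS(1)], symmetric] hom_mult[OF dd.i2_hom SG[OF inS(3)] G, symmetric]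
      using FA[OF xF] FA[OF fox1D(2)] by (simp add: A.m_assoc)
    have XV: "X \<otimes>\<^sub>\<Delta> V = V \<otimes>\<^sub>\<Delta> X"
      unfolding X_def V2 hom_mult[OF dd.i2_hom G SG[OF inS(2)], symmetric] hom_mult[OF dd.i2_hom SG[OF inS(2)] G, symmetric]
      using FA[OF xF] FA[OF fox2D(2)] by simp
    have YV: "Y \<otimes>\<^sub>\<Delta> V = V \<otimes>\<^sub>\<Delta> Y"
      unfolding Y_def V2 hom_mult[OF dd.i2_hom SG[OF inS(1)] SG[OF inS(2)], symmetric] hom_mult[OF dd.i2_hom SG[OF inS(2)] SG[OF inS(1)], symmetric]
      using FA[OF fox1D(2)] FA[OF fox2D(2)] by simp
    have d0: "d1 \<one>\<^sub>A = 0" using fox1D(10)[OF F_closed(3) F_closed(3)] by (simp add: F_homs)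
    have fy: "f1 ?y = 0" using xF fox1D(2) F_closed by (simp add: F_homs fox1D)
    have PV: "PP (V \<otimes>\<^sub>\<Delta> x) = PP x" "QQ (V \<otimes>\<^sub>\<Delta> x) = 1 + QQ x" and PY: "PP (Y \<otimes>\<^sub>\<Delta> x) = 1 + PP x"
      and PZ: "PP (Z \<otimes>\<^sub>\<Delta> x) = tpow (int n) + PP x" if "x \<in> carrier \<Delta>" for x
      using PQ_mult[OF inS(1) that] PQ_mult[OF inS(2) that] PQ_mult[OF inS(3) that]
      by (simp_all only: V_def Y1 Z_def d0 F_homs fox1D fox2D d1_conj fy tpow_0 mult_1_left add_0)
    have e1: "\<Phi> SD a b c = PQ a b c" if "a \<in> carrier \<Delta>" "b \<in> carrier \<Delta>" "c \<in> carrier \<Delta>" for a b c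
      using Phi_coset[OF dd.P.one_closed that] that subgroup.subset[OF subgroup_SD] by (simp add: dd.P.lcos_mult_one)
    have TX: "T X k = k SD - k (X <#\<^bsub>\<Delta>\<^esub> SD)" for k unfolding X_def by (rule T(3)[OF G])
    have c1: "PQ X (X \<otimes>\<^sub>\<Delta> Y) (X \<otimes>\<^sub>\<Delta> Y \<otimes>\<^sub>\<Delta> V) = tpow (int n)"
    proof -
      have "X \<otimes>\<^sub>\<Delta> Y \<otimes>\<^sub>\<Delta> V = V \<otimes>\<^sub>\<Delta> (X \<otimes>\<^sub>\<Delta> Y)" using c XV YV by (metis dd.P.m_assoc)
      then show ?thesis using PZ[OF c(1)] PV[of "X \<otimes>\<^sub>\<Delta> Y"] c by (simp add: PQ_def XY)
    qed
    have c2: "PQ \<one>\<^sub>\<Delta> Y (Y \<otimes>\<^sub>\<Delta> V) = 1"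
      using PY[OF dd.P.one_closed] PV[OF c(2)] c by (simp add: PQ_def YV)
    \<comment> \<open>\<open>V\<close> comes from the second factor and leaves \<open>PP\<close>
      unchanged, so the first factor of \<open>PQ\<close> is zero for every last argument.\<close>
    have c3: "PQ X (X \<otimes>\<^sub>\<Delta> V) z = 0" "PQ \<one>\<^sub>\<Delta> V z = 0" for z
      using PV(1)[OF c(1)] PV(1)[OF dd.P.one_closed] c by (simp_all add: PQ_def XV)
    have "W X Y V = tpow (int n) - 1"
      using c c1 c2 by (simp add: W_def TX e1 Phi_coset dd.P.m_assoc)
    moreover have "W X V Y = 0"
      using c c3 by (simp add: W_def TX e1 Phi_coset dd.P.m_assoc)
    ultimately show "W (dd.i2 (?x, \<one>\<^sub>A)) (dd.i2 (y1, \<one>\<^sub>A)) (dd.i1 (\<one>\<^sub>A, y2))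
        - W (dd.i2 (?x, \<one>\<^sub>A)) (dd.i1 (\<one>\<^sub>A, y2)) (dd.i2 (y1, \<one>\<^sub>A)) = tpow (int n) - 1"
      by (simp add: X_def Y_def V_def)
  qed
qed

end

section \<open>Shuffle products of bar chains with a commuting element\<close>

definition shuffle :: "'g \<Rightarrow> 'g \<Rightarrow> 'g \<Rightarrow> ('g list \<Rightarrow>\<^sub>0 rat)" where
  "shuffle V g h = Poly_Mapping.single [g, h, V] 1 - Poly_Mapping.single [g, V, h] 1 + Poly_Mapping.single [V, g, h] 1"

text \<open>\<open>[u|yx] + [y|x] - [x|y]\<close> bounds \<open>[u]\<close> for the commutator \<open>u\<close> of \<open>x\<close> and \<open>y\<close>; this is its shuffle
  product with \<open>V\<close>.\<close>

definition comm_shuffle :: "('g, 'm) monoid_scheme \<Rightarrow> 'g \<Rightarrow> 'g \<Rightarrow> 'g \<Rightarrow> 'g \<Rightarrow> ('g list \<Rightarrow>\<^sub>0 rat)" where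
  "comm_shuffle G V u x y = shuffle V u (y \<otimes>\<^sub>G x) + shuffle V y x - shuffle V x y"

lemma bar_boundary_minus: "bar_boundary G (c - d) = bar_boundary G c - bar_boundary G d"
  using bar_boundary_add[of G "c - d" d] by simp

text \<open>The Leibniz rule for the Eilenberg-Zilber product of the chain \<open>[g, h]\<close>
  with \<open>[V]\<close>. Commutation of \<open>V\<close> with both entries cancels the faces in
  which \<open>V\<close> is multiplied with a neighbour.\<close>

lemma boundary_shuffle:
  assumes "V \<otimes>\<^sub>G g = g \<otimes>\<^sub>G V" "V \<otimes>\<^sub>G h = h \<otimes>\<^sub>G V"
  shows "bar_boundary G (shuffle V g h) = (Poly_Mapping.single [h, V] 1 - Poly_Mapping.single [V, h] 1)
    - (Poly_Mapping.single [g \<otimes>\<^sub>G h, V] 1 - Poly_Mapping.single [V, g \<otimes>\<^sub>G h] 1) + (Poly_Mapping.single [g, V] 1 - Poly_Mapping.single [V, g] 1)"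
  by (simp add: shuffle_def bar_boundary_add bar_boundary_minus bar_boundary_lists assms)

text \<open>The boundary depends on \<open>u\<close> and \<open>V\<close> alone, not on the way
  \<open>u\<close> is written as a commutator. So two such expressions with the same
  \<open>u\<close> and \<open>V\<close> differ by a cycle.\<close>

lemma boundary_comm_shuffle:
  assumes G: "group G" and c: "V \<in> carrier G" "u \<in> carrier G" "x \<in> carrier G" "y \<in> carrier G"
    and V: "V \<otimes>\<^sub>G u = u \<otimes>\<^sub>G V" "V \<otimes>\<^sub>G x = x \<otimes>\<^sub>G V" "V \<otimes>\<^sub>G y = y \<otimes>\<^sub>G V"
    and u: "u \<otimes>\<^sub>G (y \<otimes>\<^sub>G x) = x \<otimes>\<^sub>G y"
  shows "bar_boundary G (comm_shuffle G V u x y) = Poly_Mapping.single [u, V] 1 - Poly_Mapping.single [V, u] 1"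
    and "comm_shuffle G V u x y \<in> bar_chains G 3"
proof -
  interpret G: group G by (rule G)
  have Vyx: "V \<otimes>\<^sub>G (y \<otimes>\<^sub>G x) = (y \<otimes>\<^sub>G x) \<otimes>\<^sub>G V"
    using c V by (metis G.m_assoc)
  show "bar_boundary G (comm_shuffle G V u x y) = Poly_Mapping.single [u, V] 1 - Poly_Mapping.single [V, u] 1"
    unfolding comm_shuffle_def bar_boundary_add bar_boundary_minus boundary_shuffle[OF V(1) Vyx] boundary_shuffle[OF V(3,2)] boundary_shuffle[OF V(2,3)] u
    by (simp add: algebra_simps)
  have s: "Poly_Mapping.single [a, b, d] (r::rat) \<in> bar_chains G 3" if "a \<in> carrier G" "b \<in> carrier G" "d \<in> carrier G" for a b d r
    using that by (auto simp: bar_chains_def)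
  have m: "a - b \<in> bar_chains G 3" if "a \<in> bar_chains G 3" "b \<in> bar_chains G 3" for a b :: "'a list \<Rightarrow>\<^sub>0 rat"
    using bar_chains_closed(2)[OF that(1) bar_chains_closed(3)[OF that(2), of "- 1"]] by (simp only: scl_simps add_uminus_conv_diff)
  show "comm_shuffle G V u x y \<in> bar_chains G 3"
    unfolding comm_shuffle_def shuffle_def by (intro m bar_chains_closed(2) s c G.m_closed)
qed

lemma lin_scl:
  fixes s :: "'k \<Rightarrow> ('j \<Rightarrow>\<^sub>0 'r::comm_ring_1)"
  shows "lin s (scl r c) = scl r (lin s c)"
proof -
  have e: "scl r (sum f I) = (\<Sum>i\<in>I. scl r (f i))" for f :: "'k \<Rightarrow> 'j \<Rightarrow>\<^sub>0 'r" and I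
    by (induction I rule: infinite_finite_induct) (auto simp: scl_simps)
  have "Poly_Mapping.keys (scl r c) \<subseteq> Poly_Mapping.keys c" by (auto simp: in_keys_iff)
  then have "lin s (scl r c) = (\<Sum>k\<in>Poly_Mapping.keys c. scl (r * Poly_Mapping.lookup c k) (s k))"
    by (subst lin_superset[OF finite_keys]) simp_all
  then show ?thesis by (simp add: lin_def[of s c] e scl_simps(3))
qed

text \<open>The values of \<open>lin s\<close> on the span of finitely many classes have a common finite support.\<close>

lemma homology_not_fin_dim:
  fixes E :: "('e, 'm) monoid_scheme" and s :: "'e list \<Rightarrow> (int \<Rightarrow>\<^sub>0 rat)"
  assumes E: "group E" and coc: "\<And>c. c \<in> bar_chains E (Suc n) \<Longrightarrow> lin s (bar_boundary E c) = 0"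
    and z: "\<And>m. z m \<in> bar_cycles E n" "\<And>m. m > 0 \<Longrightarrow> int m \<in> Poly_Mapping.keys (lin s (z m))"
  shows "\<not> vectorspace.fin_dim (class_ring :: rat ring) (group_homology E n)"
proof
  let ?V = "group_homology E n :: (rat, _) module"
  let ?B = "bar_boundaries E n :: ('e list \<Rightarrow>\<^sub>0 rat) set"
  interpret V: vectorspace "class_ring :: rat ring" ?V by (rule vectorspace_group_homology[OF E])
  assume "vectorspace.fin_dim (class_ring :: rat ring) ?V"
  then obtain A where A: "finite A" "A \<subseteq> carrier ?V" "V.span A = carrier ?V" unfolding V.fin_dim_def by blast
  have B: "lin s b = 0" if "b \<in> ?B" for b using that coc unfolding bar_boundaries_def by auto
  have car: "X \<in> carrier ?V \<longleftrightarrow> (\<exists>c\<in>bar_cycles E n. X = {c + b | b. b \<in> ?B})" for X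
    by (auto simp: group_homology_def)
  have const: "finite (lin s ` X)" if X: "X \<in> carrier ?V" for X
  proof -
    obtain c where "X = {c + b | b. b \<in> ?B}" using X car by blast
    then have "lin s ` X \<subseteq> {lin s c}" using B by auto
    then show ?thesis by (rule finite_subset) simp
  qed
  define W where "W = (\<Union>X\<in>A. \<Union>v\<in>lin s ` X. Poly_Mapping.keys v)"
  have W: "finite W" unfolding W_def using A const by (intro finite_UN_I) auto
  define N where "N = {X \<in> carrier ?V. \<forall>x\<in>X. Poly_Mapping.keys (lin s x) \<subseteq> W}"
  have "submodule class_ring N ?V"
  proof (rule submodule.intro[OF module_group_homology[OF E]])
    show "\<zero>\<^bsub>?V\<^esub> \<in> N" using B V.M.zero_closed by (simp add: N_def) (simp add: group_homology_def)
    show "X \<oplus>\<^bsub>?V\<^esub> Y \<in> N" if XY: "X \<in> N" "Y \<in> N" for X Y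
    proof -
      have "Poly_Mapping.keys (lin s w) \<subseteq> W" if "w \<in> X \<oplus>\<^bsub>?V\<^esub> Y" for w
      proof -
        obtain x y where w: "w = x + y" "x \<in> X" "y \<in> Y" using \<open>w \<in> X \<oplus>\<^bsub>?V\<^esub> Y\<close> by (auto simp: group_homology_def)
        then have "Poly_Mapping.keys (lin s x) \<subseteq> W" "Poly_Mapping.keys (lin s y) \<subseteq> W" using XY by (auto simp: N_def)
        then show ?thesis using Poly_Mapping.keys_add[of "lin s x" "lin s y"] by (simp add: w(1)) blast
      qed
      then show ?thesis using V.M.a_closed XY by (simp add: N_def)
    qed
    show "r \<odot>\<^bsub>?V\<^esub> X \<in> N" if r: "r \<in> carrier class_ring" and X: "X \<in> N" for r :: rat and X
    proof -
      have "Poly_Mapping.keys (lin s w) \<subseteq> W" if "w \<in> r \<odot>\<^bsub>?V\<^esub> X" for w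
      proof -
        obtain x b where w: "w = scl r x + b" "x \<in> X" "b \<in> ?B" using \<open>w \<in> r \<odot>\<^bsub>?V\<^esub> X\<close> by (auto simp: group_homology_def)
        then have "Poly_Mapping.keys (lin s x) \<subseteq> W" using X by (auto simp: N_def)
        moreover have "Poly_Mapping.keys (scl r (lin s x)) \<subseteq> Poly_Mapping.keys (lin s x)" by (auto simp: in_keys_iff)
        ultimately show ?thesis using B[OF w(3)] by (simp add: w(1) lin_scl)
      qed
      then show ?thesis using V.smult_closed[OF r, of X] X by (simp add: N_def)
    qed
  qed (simp add: N_def)
  moreover have "A \<subseteq> N" using A(2) by (auto simp: N_def W_def)
  ultimately have N: "carrier ?V \<subseteq> N" using V.span_is_subset[of A N] A(3) by simp
  obtain m where m: "m > 0" "int m \<notin> W"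
  proof -
    have "finite (int -` W)" by (rule finite_vimageI[OF W]) simp
    then have "infinite (- (int -` W))" by (metis finite_compl infinite_UNIV_nat)
    then have "infinite (- (int -` W) - {0})" by simp
    then have "- (int -` W) - {0} \<noteq> {}" by (metis finite.emptyI)
    then obtain m where "m \<in> - (int -` W) - {0}" by blast
    then show thesis by (intro that[of m]) auto
  qed
  have "0 \<in> ?B" by (rule bar_boundaries_closed)
  then have "z m \<in> {z m + b | b. b \<in> ?B}" by force
  moreover have "{z m + b | b. b \<in> ?B} \<in> N" using N car z(1)[of m] by blast
  ultimately have "Poly_Mapping.keys (lin s (z m)) \<subseteq> W" unfolding N_def by blast
  then show False using z(2)[OF m(1)] m(2) by blast
qed

section \<open>Infinite dimension of the third rational homology\<close>

context uce_model begin

lemma H3_not_fin_dim: "\<not> vectorspace.fin_dim (class_ring :: rat ring) (group_homology E 3)"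
proof -
  obtain W where W: "\<And>g h k l. g \<in> carrier \<Delta> \<Longrightarrow> h \<in> carrier \<Delta> \<Longrightarrow> k \<in> carrier \<Delta> \<Longrightarrow> l \<in> carrier \<Delta> \<Longrightarrow>
      W h k l - W (g \<otimes>\<^sub>\<Delta> h) k l + W g (h \<otimes>\<^sub>\<Delta> k) l - W g h (k \<otimes>\<^sub>\<Delta> l) + W g h k = (0 :: laurent)"
    and W1: "\<And>a g h. a \<in> carrier G \<Longrightarrow> W (dd.i1 a) g h = 0"
    and W2: "\<And>n. W (dd.i2 (x1 [^]\<^sub>A (n::nat), \<one>\<^sub>A)) (dd.i2 (y1, \<one>\<^sub>A)) (dd.i1 (\<one>\<^sub>A, y2))
      - W (dd.i2 (x1 [^]\<^sub>A n, \<one>\<^sub>A)) (dd.i1 (\<one>\<^sub>A, y2)) (dd.i2 (y1, \<one>\<^sub>A)) = tpow (int n) - 1"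
    using cocycle_exists by blast
  define s where "s gs = W (\<pi> (gs ! 0)) (\<pi> (gs ! 1)) (\<pi> (gs ! 2))" for gs
  have s: "s [a, b, c] = W (\<pi> a) (\<pi> b) (\<pi> c)" for a b c by (simp add: s_def)
  note pc = hom_in_carrier[OF pi]
  have coc: "lin s (bar_boundary E c) = 0" if "c \<in> bar_chains E (Suc 3)" for c
    using that
  proof (induction rule: bar_chains_induct)
    case (add c d) then show ?case by (simp add: bar_boundary_add)
  next
    case (single gs a)
    then obtain g h k l where g: "gs = [g, h, k, l]" "g \<in> carrier E" "h \<in> carrier E" "k \<in> carrier E" "l \<in> carrier E"
      by (auto simp: length_Suc_conv numeral_3_eq_3)
    have sc: "scl a x - scl a y = scl a (x - y)" for x y :: laurent
      by (simp only: diff_eq_eq scl_simps(1)[symmetric] diff_add_cancel)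
    show ?case
      using W[OF pc[OF g(2)] pc[OF g(3)] pc[OF g(4)] pc[OF g(5)]] g
      by (simp add: bar_boundary_lists s hom_mult[OF pi] sc scl_simps(1)[symmetric] scl_simps(5))
  qed simp
  define V where "V = \<kappa>1 (\<one>\<^sub>A, y2)"
  define x where "x n = (x1 [^]\<^sub>A n, \<one>\<^sub>A)" for n :: nat
  define y where "y = (y1, \<one>\<^sub>A)"
  \<comment> \<open>A commutator in \<open>F\<close>, so \<tau> vanishes on it and its two images in
    E coincide.\<close>
  define u where "u n = (x1 [^]\<^sub>A n \<otimes>\<^sub>A y1 \<otimes>\<^sub>A inv\<^bsub>A\<^esub> (x1 [^]\<^sub>A n) \<otimes>\<^sub>A inv\<^bsub>A\<^esub> y1, \<one>\<^sub>A)" for n :: nat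
  have xF: "x1 [^]\<^sub>A n \<in> F" for n :: nat using F_pow[OF fox1D(1), of "int n"] by (simp add: int_pow_int)
  have uS: "u n \<in> S" "\<tau> (u n) = (0, 0, 0)" for n
    using xF[of n] fox1D(2) F_closed by (simp_all add: u_def S_iff \<tau>_def F_homs)
  have yS: "y \<in> S" and vS: "(\<one>\<^sub>A, y2) \<in> S" using s_in_S by (simp_all add: y_def s2_def s3_def)
  have G: "x n \<in> carrier G" "y \<in> carrier G" "u n \<in> carrier G" "(\<one>\<^sub>A, y2) \<in> carrier G" for n
    using FA[OF xF] SG[OF yS] SG[OF uS(1)] SG[OF vS] by (simp_all add: x_def)
  have rel: "u n \<otimes>\<^sub>G (y \<otimes>\<^sub>G x n) = x n \<otimes>\<^sub>G y" for n
    using FA[OF xF] FA[OF fox1D(2)] by (simp add: u_def x_def y_def A.m_assoc)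
  have com: "(\<one>\<^sub>A, y2) \<otimes>\<^sub>G p = p \<otimes>\<^sub>G (\<one>\<^sub>A, y2)" if "p \<in> {x n, y, u n}" for p n
    using that FA[OF xF[of n]] FA[OF fox1D(2)] FA[OF fox2D(2)] by (auto simp: x_def y_def u_def)
  have z0: "\<zeta> (0, 0, 0) = \<one>\<^sub>E0" using hom_one[OF iota_hom(3) group_Z3 ee.P.group_axioms] by simp
  have u12: "\<kappa>2 (u n) = \<kappa>1 (u n)" for n
    using iota_S[OF uS(1)[of n]] uS(2)[of n] iota_closed(1)[OF G(3)] by (simp add: \<kappa>1_def \<kappa>2_def z0)
  have zc: "k (\<zeta> z) \<in> carrier E" "k (\<zeta> z) \<otimes>\<^sub>E w = w \<otimes>\<^sub>E k (\<zeta> z)" if "w \<in> carrier E" for z w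
  proof -
    have "k (\<zeta> z \<otimes>\<^sub>E0 k' w) = k (k' w \<otimes>\<^sub>E0 \<zeta> z)"
      using ee.P.centralD(2)[OF central_zeta hom_in_carrier[OF k'(2) that]] by simp
    then show "k (\<zeta> z) \<otimes>\<^sub>E w = w \<otimes>\<^sub>E k (\<zeta> z)"
      using hom_mult[OF k_hom] iota_closed(3) hom_in_carrier[OF k'(2) that] k'(3)[OF that] by simp
  qed (rule hom_in_carrier[OF k_hom iota_closed(3)])
  have V2: "\<exists>z. \<kappa>2 (\<one>\<^sub>A, y2) = V \<otimes>\<^sub>E k (\<zeta> z)"
    using iota_S[OF vS] hom_mult[OF k_hom iota_closed(1)[OF G(4)] iota_closed(3)]
    by (intro exI[of _ "\<tau> (\<one>\<^sub>A, y2)"]) (simp add: V_def \<kappa>1_def \<kappa>2_def)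
  have Vc: "V \<in> carrier E" unfolding V_def by (rule hom_in_carrier[OF kappa_hom(1) G(4)])
  note kc = hom_in_carrier[OF kappa_hom(1)] hom_in_carrier[OF kappa_hom(2)]
  have com1: "V \<otimes>\<^sub>E \<kappa>1 p = \<kappa>1 p \<otimes>\<^sub>E V" if "p \<in> {x n, y, u n}" for p n
  proof -
    have "p \<in> carrier G" using that G by auto
    from hom_mult[OF kappa_hom(1) G(4) this] hom_mult[OF kappa_hom(1) this G(4)] show ?thesis
      unfolding V_def com[OF that] by simp
  qed
  \<comment> \<open>\<open>V\<close> differs from the second image of the same element only by a
    central factor, so commutation inside the second copy passes to \<open>V\<close>.\<close>
  have com2: "V \<otimes>\<^sub>E \<kappa>2 p = \<kappa>2 p \<otimes>\<^sub>E V" if p: "p \<in> {x n, y, u n}" for p n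
  proof -
    have pG: "p \<in> carrier G" using p G by auto
    obtain z where z: "\<kappa>2 (\<one>\<^sub>A, y2) = V \<otimes>\<^sub>E k (\<zeta> z)" using V2 by blast
    have "V \<otimes>\<^sub>E k (\<zeta> z) \<otimes>\<^sub>E \<kappa>2 p = \<kappa>2 p \<otimes>\<^sub>E (V \<otimes>\<^sub>E k (\<zeta> z))"
      using hom_mult[OF kappa_hom(2) G(4) pG] hom_mult[OF kappa_hom(2) pG G(4)] unfolding com[OF p] z by simp
    moreover have "V \<otimes>\<^sub>E k (\<zeta> z) \<otimes>\<^sub>E \<kappa>2 p = V \<otimes>\<^sub>E \<kappa>2 p \<otimes>\<^sub>E k (\<zeta> z)"
      using Vc kc(2)[OF pG] zc(1)[OF Vc] zc(2)[OF kc(2)[OF pG], of z] by (simp add: E.m_assoc)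
    ultimately show ?thesis
      using Vc kc(2)[OF pG] zc(1)[OF Vc, of z] by (simp add: E.m_assoc[symmetric] E.right_cancel)
  qed
  have rk: "\<kappa>1 (u n) \<otimes>\<^sub>E (\<kappa>1 y \<otimes>\<^sub>E \<kappa>1 (x n)) = \<kappa>1 (x n) \<otimes>\<^sub>E \<kappa>1 y"
    "\<kappa>2 (u n) \<otimes>\<^sub>E (\<kappa>2 y \<otimes>\<^sub>E \<kappa>2 (x n)) = \<kappa>2 (x n) \<otimes>\<^sub>E \<kappa>2 y" for n
    using rel[of n] G by (simp_all only: hom_mult[OF kappa_hom(1), symmetric] hom_mult[OF kappa_hom(2), symmetric] G.m_closed)
  define c where "c n = comm_shuffle E V (\<kappa>1 (u n)) (\<kappa>1 (x n)) (\<kappa>1 y) - comm_shuffle E V (\<kappa>2 (u n)) (\<kappa>2 (x n)) (\<kappa>2 y)" for n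
  have C: "V \<otimes>\<^sub>E \<kappa>1 (u n) = \<kappa>1 (u n) \<otimes>\<^sub>E V" "V \<otimes>\<^sub>E \<kappa>1 (x n) = \<kappa>1 (x n) \<otimes>\<^sub>E V" "V \<otimes>\<^sub>E \<kappa>1 y = \<kappa>1 y \<otimes>\<^sub>E V"
    "V \<otimes>\<^sub>E \<kappa>2 (u n) = \<kappa>2 (u n) \<otimes>\<^sub>E V" "V \<otimes>\<^sub>E \<kappa>2 (x n) = \<kappa>2 (x n) \<otimes>\<^sub>E V" "V \<otimes>\<^sub>E \<kappa>2 y = \<kappa>2 y \<otimes>\<^sub>E V" for n
    by (rule com1[of _ n] com2[of _ n]; blast)+
  note b1 = boundary_comm_shuffle[OF E Vc kc(1)[OF G(3)] kc(1)[OF G(1)] kc(1)[OF G(2)] C(1-3) rk(1)]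
  note b2 = boundary_comm_shuffle[OF E Vc kc(2)[OF G(3)] kc(2)[OF G(1)] kc(2)[OF G(2)] C(4-6) rk(2)]
  have cyc: "c n \<in> bar_cycles E 3" for n
    using bar_chains_closed(2)[OF b1(2)[of n] bar_chains_closed(3)[OF b2(2)[of n], of "- 1"]] b1(1)[of n] b2(1)[of n]
    by (simp add: c_def bar_cycles_def bar_boundary_minus u12 scl_simps del: One_nat_def)
  have pV: "\<pi> V = dd.i1 (\<one>\<^sub>A, y2)" unfolding V_def by (rule pi_kappa(1)[OF G(4)])
  have py: "\<pi> (\<kappa>2 y) = dd.i1 y" using pi_kappa(2)[OF G(2)] dd.i1_i2[OF yS] by simp
  have pu: "\<pi> (\<kappa>2 (u n)) = dd.i1 (u n)" for n using pi_kappa(1)[OF G(3)] u12 by simp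
  \<comment> \<open>The elements \<open>y\<close> and \<open>u n\<close> lie in \<open>S\<close>, so
    even their second images project to the first copy of \<open>G\<close> in \<Delta>. Only the two
    terms that start with \<open>\<kappa>2 (x n)\<close> survive.\<close>
  have T0: "s [a, g, h] = 0" if "\<pi> a = dd.i1 p" "p \<in> carrier G" for a g h p unfolding s that(1) by (rule W1[OF that(2)])
  have "lin s (c n) = s [\<kappa>2 (x n), \<kappa>2 y, V] - s [\<kappa>2 (x n), V, \<kappa>2 y]" for n
    unfolding c_def comm_shuffle_def shuffle_def
    by (simp add: T0[OF pV G(4)] T0[OF py G(2)] T0[OF pu G(3)] T0[OF pi_kappa(1)[OF G(1)] G(1)] T0[OF pi_kappa(1)[OF G(2)] G(2)] T0[OF pi_kappa(1)[OF G(3)] G(3)]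
        scl_simps del: carrier_DirProd)
  then have lc: "lin s (c n) = tpow (int n) - 1" for n
    using W2[of n, folded x_def y_def] by (simp only: s pV pi_kappa(2)[OF G(1)] pi_kappa(2)[OF G(2)])
  \<comment> \<open>For positive n the monomial t^n is not touched by the constant term; at n = 0
    the whole value would vanish.\<close>
  have "int n \<in> Poly_Mapping.keys (lin s (c n))" if "n > 0" for n
    using that by (simp add: lc in_keys_iff lookup_minus lookup_single lookup_one)
  with E coc cyc show ?thesis by (rule homology_not_fin_dim)
qed

end

theorem proposition6p5:
  fixes A :: "nat gword set monoid"
    and F :: "nat gword set set"
    and \<phi> :: "nat gword set \<times> nat gword set \<Rightarrow> int"
    and S :: "(nat gword set \<times> nat gword set) set"
    and \<Delta> :: "((nat gword set \<times> nat gword set) + (nat gword set \<times> nat gword set)) gword set monoid"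
    and E :: "'e monoid"
    and \<pi> :: "'e \<Rightarrow> ((nat gword set \<times> nat gword set) + (nat gword set \<times> nat gword set)) gword set"
  assumes "A = higman_group \<or> (\<exists>p\<ge>3. A = four_generator_group p)"
    and "subgroup F A" and "A\<lparr>carrier := F\<rparr> \<cong> free_group {..<2::nat}"
    and "\<phi> \<in> hom (A\<lparr>carrier := F\<rparr> \<times>\<times> A\<lparr>carrier := F\<rparr>) integer_group"
    and "(\<lambda>x. \<phi> (x, \<one>\<^bsub>A\<^esub>)) ` F = UNIV" and "(\<lambda>x. \<phi> (\<one>\<^bsub>A\<^esub>, x)) ` F = UNIV"
    and "S = kernel (A\<lparr>carrier := F\<rparr> \<times>\<times> A\<lparr>carrier := F\<rparr>) integer_group \<phi>"
    and "\<Delta> = double (A \<times>\<times> A) S"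
    and "infinite (UNIV :: 'u set)"
    and "universal_central_extension TYPE('u) E \<Delta> \<pi>"
  shows "torsion_free E \<and> finitely_presented E \<and> super_perfect E
    \<and> no_nontrivial_finite_quotients E
    \<and> \<not> vectorspace.fin_dim (class_ring :: rat ring) (group_homology E 3)"
proof -
  obtain q where Aq: "A = base q" "\<And>p. q = Some p \<Longrightarrow> p \<ge> 3"
  proof -
    have "\<exists>q. A = base q \<and> (\<forall>p. q = Some p \<longrightarrow> p \<ge> 3)"
      using assms(1)
    proof
      assume "A = higman_group"
      then show ?thesis by (intro exI[of _ None]) (simp add: base_def)
    next
      assume "\<exists>p\<ge>3. A = four_generator_group p"
      then obtain p where "p \<ge> 3" "A = four_generator_group p" by blast
      then show ?thesis by (intro exI[of _ "Some p"]) (simp add: base_def)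
    qed
    then show thesis using that by blast
  qed
  let ?K = "A\<lparr>carrier := F\<rparr>"
  have gA: "group A" unfolding Aq(1) by (rule group_base)
  then have K: "group ?K" by (rule group.subgroup_imp_group[OF _ assms(2)])
  \<comment> \<open>The restrictions of \<phi> to the two factors. As \<phi> is their sum, its
    kernel is the fibre product \<open>S\<close> of the locale.\<close>
  define f1 where "f1 x = \<phi> (x, \<one>\<^sub>A)" for x
  define f2 where "f2 x = \<phi> (\<one>\<^sub>A, x)" for x
  note inc = DirProd_inclusions[OF K K]
  have f: "f1 \<in> hom ?K integer_group" "f2 \<in> hom ?K integer_group"
    using hom_compose[OF inc(1) assms(4)] hom_compose[OF inc(2) assms(4)] by (simp_all add: f1_def[abs_def] f2_def[abs_def] comp_def)
  have surj: "f1 ` carrier ?K = UNIV" "f2 ` carrier ?K = UNIV" using assms(5,6) by (simp_all add: f1_def f2_def)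
  have free: "?K \<cong> F2" using assms(3) by simp
  obtain x1 y1 e1 d1 where fox1: "fox_data ?K f1 x1 y1 e1 d1" by (rule fox_data_exists[OF K free f(1) surj(1)])
  obtain x2 y2 e2 d2 where fox2: "fox_data ?K f2 x2 y2 e2 d2" by (rule fox_data_exists[OF K free f(2) surj(2)])
  interpret fibre q F f1 f2 x1 y1 x2 y2 e1 e2 d1 d2
    by (rule fibre.intro) (use Aq assms(2) fox1 fox2 in simp_all)
  have phi: "\<phi> (u, v) = f1 u + f2 v" if "u \<in> F" "v \<in> F" for u v
    using hom_mult[OF assms(4), of "(u, \<one>\<^sub>A)" "(\<one>\<^sub>A, v)"] that subgroup.one_closed[OF assms(2)] subgroup.mem_carrier[OF assms(2)]
    by (simp add: f1_def f2_def monoid.r_one[OF group.is_monoid[OF gA]] monoid.l_one[OF group.is_monoid[OF gA]])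
  have SS: "S = fibre.S F f1 f2" unfolding assms(7) S_def by (auto simp: kernel_def phi)
  have D: "\<Delta> = dd.P" by (simp only: assms(8) SS Aq(1) double_def)
  note uce = assms(10)[unfolded D]
  obtain k where k: "k \<in> iso E0 E" "\<And>x. x \<in> carrier E0 \<Longrightarrow> \<pi> (k x) = \<pi>0 x" by (rule uce_iso[OF assms(9) uce], rule that)
  have E: "group E" "\<pi> \<in> hom E dd.P" using uce by (auto simp: universal_central_extension_def central_extension_def epi_def)
  interpret uce_model q F f1 f2 x1 y1 x2 y2 e1 e2 d1 d2 E \<pi> k
    by (intro uce_model.intro uce_model_axioms.intro fibre_axioms E k)
  show ?thesis
    using torsion_free_E finitely_presented_E super_perfect_E no_finite_quotients_E H3_not_fin_dim by blast
qed

end
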